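(* Let $\psi$ be the characteristic exponent of a one-dimensional Lévy process without Gaussian component, and assume $$\frac{1}{\mathrm{Re}\,\psi(\xi)}=o(|\xi|^{-1})\quad\text{as }|\xi|\to\infty.$$ Let $a:[0,\infty)\times\mathbb R\to\mathbb R$ be measurable with $|a(t,x)|\le K$ for all $t,x$, for some constant $K>0$. Then for every $x_0\in\mathbb R$ there exists a (weak) solution of $$dX_t=dS_t+a(t,X_t)\,dt,\quad t\ge0,\quad X_0=x_0.$$
   Context: A process $(S,\mathbb F)$ with $S_0=0$ on a filtered complete probability space is a Lévy process with characteristic exponent $\psi$ if its paths are càdlàg and $\mathbf E(e^{i\xi(S_t-S_s)}\mid\mathcal F_s)=e^{-(t-s)\psi(\xi)}$ for all $t>s\ge0$, $\xi\in\mathbb R$, with $\psi$ continuous; $\psi(\xi)=ic\xi+\tfrac12Q\xi^2+\int(1-e^{i\xi z}+i\xi z\mathbf 1_{\{|z|<1\}})\nu(dz)$, and "no Gaussian component" means $Q=0$. A (weak) solution with initial value $x_0$ is a càdlàg process $(X,\mathbb F)$ on some filtered probability space $(\Omega,\mathcal F,\mathbf P)$ together with a Lévy process $(S,\mathbb F)$ with characteristic exponent $\psi$ such that $X_t=x_0+S_t+\int_0^ta(s,X_s)\,ds$ for all $t\ge0$, $\mathbf P$-a.s. *)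

theory Defs
  imports "HOL-Probability.Probability" "HOL-Library.Landau_Symbols"
begin

definition cadlag :: "(real \<Rightarrow> real) \<Rightarrow> bool" where
  "cadlag f \<longleftrightarrow> (\<forall>t\<ge>0. continuous (at_right t) f) \<and> (\<forall>t>0. \<exists>l. (f \<longlongrightarrow> l) (at_left t))"

definition levy_measure :: "real measure \<Rightarrow> bool" where
  "levy_measure \<nu> \<longleftrightarrow> sets \<nu> = sets borel \<and> emeasure \<nu> {0} = 0 \<and>
     (\<integral>\<^sup>+ z. ennreal (min 1 (z\<^sup>2)) \<partial>\<nu>) < \<infinity>"

definition levy_exponent_nogauss :: "real \<Rightarrow> real measure \<Rightarrow> real \<Rightarrow> complex" where
  "levy_exponent_nogauss c \<nu> \<xi> =
     \<i> * complex_of_real (c * \<xi>) +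
     (\<integral> z. (1 - exp (\<i> * complex_of_real (\<xi> * z)) +
              (if \<bar>z\<bar> < 1 then \<i> * complex_of_real (\<xi> * z) else 0)) \<partial>\<nu>)"

text \<open>(S,F) is a Levy process with characteristic exponent psi on the filtered complete
  probability space (M,F). The conditional characteristic function condition
  E(e^{i xi (S_t - S_s)} | F_s) = e^{-(t-s) psi(xi)} is written out via the defining
  property of conditional expectation (the right-hand side being a constant).\<close>
definition levy_process ::
  "'a measure \<Rightarrow> (real \<Rightarrow> 'a measure) \<Rightarrow> (real \<Rightarrow> 'a \<Rightarrow> real) \<Rightarrow> (real \<Rightarrow> complex) \<Rightarrow> bool" where
  "levy_process M F S \<psi> \<longleftrightarrow>
     prob_space M \<and> complete_measure M \<and>
     filtration (space M) F \<and> (\<forall>t. subalgebra M (F t)) \<and>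
     (\<forall>t\<ge>0. S t \<in> borel_measurable (F t)) \<and>
     (\<forall>\<omega>\<in>space M. S 0 \<omega> = 0 \<and> cadlag (\<lambda>t. S t \<omega>)) \<and>
     continuous_on UNIV \<psi> \<and>
     (\<forall>s t \<xi> A. 0 \<le> s \<longrightarrow> s < t \<longrightarrow> A \<in> sets (F s) \<longrightarrow>
        (\<integral>\<omega>. indicator A \<omega> * exp (\<i> * complex_of_real (\<xi> * (S t \<omega> - S s \<omega>))) \<partial>M)
          = complex_of_real (measure M A) * exp (- complex_of_real (t - s) * \<psi> \<xi>))"

definition weak_solution ::
  "'a measure \<Rightarrow> (real \<Rightarrow> 'a measure) \<Rightarrow> (real \<Rightarrow> 'a \<Rightarrow> real) \<Rightarrow> (real \<Rightarrow> 'a \<Rightarrow> real) \<Rightarrow>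
   (real \<Rightarrow> complex) \<Rightarrow> (real \<Rightarrow> real \<Rightarrow> real) \<Rightarrow> real \<Rightarrow> bool" where
  "weak_solution M F X S \<psi> a x0 \<longleftrightarrow>
     levy_process M F S \<psi> \<and>
     (\<forall>t\<ge>0. X t \<in> borel_measurable (F t)) \<and>
     (\<forall>\<omega>\<in>space M. cadlag (\<lambda>t. X t \<omega>)) \<and>
     (AE \<omega> in M. \<forall>t\<ge>0. X t \<omega> = x0 + S t \<omega> + (LBINT s=0..t. a s (X s \<omega>)))"

end

theory Submission
  imports Defs
begin

text \<open>
  Let \<open>X = x0 + S + A\<close> with \<open>A\<close> adapted and \<open>K\<close>-Lipschitz in time. Duhamel's formula for the characteristic function of
  \<open>X t\<close> and the growth of \<open>Re \<psi>\<close> beyond \<open>N * \<bar>\<xi>\<bar>\<close> bound the space-time \<open>L\<^sup>2\<close> norm of \<open>t\<close> times the density of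
  \<open>X t\<close> by a constant that depends on \<open>A\<close> only through \<open>K\<close>: the drift term is absorbed once \<open>N > 2 * K\<close>. This is a Krylov estimate,
  and it lets bounded drifts converging almost everywhere pass to the limit along convergent processes.

  It then suffices to approximate \<open>a\<close> almost everywhere by bounded drifts \<open>f\<^sub>n\<close> that are Lipschitz in space. In dimension
  one the noise is additive, so the solutions for \<open>max f\<^sub>m \<dots> f\<^sub>n\<close> are ordered like the drifts. They converge
  monotonically, first in \<open>n\<close> and then in \<open>m\<close>, on the given probability space, and the limit solves the equation
  with drift \<open>limsup f\<^sub>n = a\<close>.

  The Levy process itself is a sum of compensated compound Poisson processes over annuli \<open>E i\<close>, built from independent
  Poisson numbers of points. The annuli shrink so fast that Ottaviani's inequality and the Borel-Cantelli lemma give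
  uniform convergence on bounded time intervals.
\<close>

section \<open>Gaussian averages of characteristic functions\<close>

text \<open>The weighted transform \<open>h s \<xi> = E (b s * iexp (\<xi> * X s))\<close> in
  Duhamel's formula has no bound by the characteristic function of \<open>X s\<close> at a fixed
  \<open>\<xi>\<close>. A comparison holds only in mean square over \<open>\<xi>\<close>: with the
  weight \<open>b s\<close>, the law of \<open>X s\<close> becomes a signed measure dominated by
  \<open>K\<close> times that law. No density is known to exist at this stage, so Plancherel's
  identity is replaced by averages against \<open>std_normal_density (\<sigma> * \<xi>)\<close>.
  They are finite for every law, they keep the constant \<open>K^2\<close>, and the final bound does
  not depend on \<open>\<sigma>\<close>.

  The limit of a sequence of processes might charge the null set on which the drifts fail to
  converge. The bound is therefore tested on continuous functions of time and space, where Fatou's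
  lemma carries it to limits, and only afterwards extended to Borel functions.

  Almost everywhere convergence of drifts gives no order between them; finite maxima create one and
  stay Lipschitz.\<close>

lemma gauss_fourier:
  fixes s y :: real
  assumes "s > 0"
  shows "(CLBINT \<xi>. complex_of_real (std_normal_density (s * \<xi>)) * iexp (\<xi> * y)) =
    complex_of_real (exp (- (y / s)\<^sup>2 / 2) / s)"
proof -
  have "complex_of_real (exp (- (y / s)\<^sup>2 / 2)) = char std_normal_distribution (y / s)"
    by (simp add: char_std_normal_distribution)
  also have "\<dots> = (CLBINT x. std_normal_density x *\<^sub>R iexp (y / s * x))"
    unfolding char_def by (subst integral_density) auto
  also have "\<dots> = \<bar>s\<bar> *\<^sub>R (CLBINT x. std_normal_density (0 + s * x) *\<^sub>R iexp (y / s * (0 + s * x)))"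
    using assms by (intro lborel_integral_real_affine) auto
  also have "\<dots> = s *\<^sub>R (CLBINT \<xi>. complex_of_real (std_normal_density (s * \<xi>)) * iexp (\<xi> * y))"
    using assms by (auto simp: scaleR_conv_of_real mult.commute intro!: arg_cong2[where f="(*)"] Bochner_Integration.integral_cong)
  finally show ?thesis
    using assms by (simp add: scaleR_conv_of_real field_simps)
qed

lemma std_normal_density_scaled_integrable:
  assumes "s > 0"
  shows "integrable lborel (\<lambda>\<xi>. std_normal_density (s * \<xi>))"
proof -
  have "integrable lborel (\<lambda>x. std_normal_density (0 + s * x))"
    using assms by (intro lborel_integrable_real_affine) auto
  then show ?thesis by simp
qed

text \<open>The squared modulus is \<open>z * cnj z\<close>, and a product of two expectations is an
  expectation over two independent copies of \<open>(X, B)\<close>. In this form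
  \<open>\<xi>\<close> occurs in a single exponential and can be integrated out first.\<close>

lemma (in prob_space) norm_sq_weighted_char:
  fixes X B :: "'a \<Rightarrow> real"
  assumes [measurable]: "X \<in> borel_measurable M" "B \<in> borel_measurable M"
    and B: "\<And>\<omega>. \<omega> \<in> space M \<Longrightarrow> \<bar>B \<omega>\<bar> \<le> K"
  shows "complex_of_real ((cmod (CLINT \<omega>|M. B \<omega> * iexp (\<xi> * X \<omega>)))\<^sup>2) =
    (CLINT p|(M \<Otimes>\<^sub>M M). complex_of_real (B (fst p) * B (snd p)) * iexp (\<xi> * (X (fst p) - X (snd p))))"
proof -
  interpret P: pair_prob_space M M ..
  have i1: "integrable M (\<lambda>\<omega>. complex_of_real (B \<omega>) * iexp (\<xi> * X \<omega>))"
    by (rule integrable_const_bound[where B=K]) (auto simp: norm_mult B)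
  have i2: "integrable M (\<lambda>\<omega>. complex_of_real (B \<omega>) * iexp (- (\<xi> * X \<omega>)))"
    by (rule integrable_const_bound[where B=K]) (auto simp: norm_mult B)
  have K: "\<bar>K\<bar> = K" using B not_empty by fastforce
  have "complex_of_real ((cmod (CLINT \<omega>|M. B \<omega> * iexp (\<xi> * X \<omega>)))\<^sup>2)
    = (CLINT \<omega>|M. B \<omega> * iexp (\<xi> * X \<omega>)) * cnj (CLINT \<omega>|M. B \<omega> * iexp (\<xi> * X \<omega>))"
    by (rule complex_norm_square)
  also have "cnj (CLINT \<omega>|M. B \<omega> * iexp (\<xi> * X \<omega>)) = (CLINT \<omega>|M. B \<omega> * iexp (- (\<xi> * X \<omega>)))"
    by (subst Bochner_Integration.integral_cnj[symmetric]) (simp add: exp_cnj)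
  also have "(CLINT \<omega>|M. B \<omega> * iexp (\<xi> * X \<omega>)) * \<dots> =
     (CLINT \<omega>|M. (CLINT \<omega>'|M. (B \<omega> * iexp (\<xi> * X \<omega>)) * (B \<omega>' * iexp (- (\<xi> * X \<omega>')))))"
    by simp
  also have "\<dots> = (CLINT p|(M \<Otimes>\<^sub>M M). (B (fst p) * iexp (\<xi> * X (fst p))) * (B (snd p) * iexp (- (\<xi> * X (snd p)))))"
  proof -
    have "integrable (M \<Otimes>\<^sub>M M) (\<lambda>p. (B (fst p) * iexp (\<xi> * X (fst p))) * (B (snd p) * iexp (- (\<xi> * X (snd p)))))"
    proof (rule P.P.integrable_const_bound[where B="K*K"])
      show "AE p in M \<Otimes>\<^sub>M M. cmod ((B (fst p) * iexp (\<xi> * X (fst p))) * (B (snd p) * iexp (- (\<xi> * X (snd p))))) \<le> K * K"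
        using K by (intro AE_I2) (auto simp: norm_mult space_pair_measure intro!: mult_mono B)
    qed measurable
    from P.integral_fst'[OF this] show ?thesis by simp
  qed
  also have "\<dots> = (CLINT p|(M \<Otimes>\<^sub>M M). complex_of_real (B (fst p) * B (snd p)) * iexp (\<xi> * (X (fst p) - X (snd p))))"
    by (intro Bochner_Integration.integral_cong) (auto simp: algebra_simps exp_diff exp_add exp_minus divide_inverse)
  finally show ?thesis .
qed

text \<open>Fubini, with the inner integral over \<open>\<xi>\<close> evaluated by
  \<open>gauss_fourier\<close>. The kernel that remains is positive, so an inequality between
  weights on the right becomes an inequality between transforms on the left.\<close>

lemma (in prob_space) gauss_integral_weighted_char:
  fixes X B :: "'a \<Rightarrow> real"
  assumes [measurable]: "X \<in> borel_measurable M" "B \<in> borel_measurable M"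
    and B: "\<And>\<omega>. \<omega> \<in> space M \<Longrightarrow> \<bar>B \<omega>\<bar> \<le> K" and s: "s > 0"
  shows "(LBINT \<xi>. std_normal_density (s * \<xi>) * (cmod (CLINT \<omega>|M. B \<omega> * iexp (\<xi> * X \<omega>)))\<^sup>2) =
    (LINT p|(M \<Otimes>\<^sub>M M). B (fst p) * B (snd p) * (exp (- ((X (fst p) - X (snd p)) / s)\<^sup>2 / 2) / s))"
proof -
  interpret P: pair_prob_space M M ..
  interpret Q: pair_sigma_finite "lborel :: real measure" "M \<Otimes>\<^sub>M M" ..
  have K: "\<bar>K\<bar> = K" using B not_empty by fastforce
  note [measurable] = std_normal_density_scaled_integrable[OF s]
  let ?f = "\<lambda>\<xi> p. complex_of_real (std_normal_density (s * \<xi>)) * (complex_of_real (B (fst p) * B (snd p)) * iexp (\<xi> * (X (fst p) - X (snd p))))"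
  have int: "integrable (lborel \<Otimes>\<^sub>M (M \<Otimes>\<^sub>M M)) (case_prod ?f)"
  proof (rule Bochner_Integration.integrable_bound)
    show "integrable (lborel \<Otimes>\<^sub>M (M \<Otimes>\<^sub>M M)) (\<lambda>z. K * K * std_normal_density (s * fst z))"
    proof -
      have "integrable (lborel \<Otimes>\<^sub>M (M \<Otimes>\<^sub>M M)) (\<lambda>(x,y). (K * K) * std_normal_density (s * x))"
        using s by (intro Q.Fubini_integrable) (auto simp: P.P.prob_space std_normal_density_scaled_integrable abs_mult)
      then show ?thesis unfolding case_prod_beta' .
    qed
    show "AE z in lborel \<Otimes>\<^sub>M (M \<Otimes>\<^sub>M M). norm (case_prod ?f z) \<le> norm (K * K * std_normal_density (s * fst z))"
    proof (intro AE_I2)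
      fix z :: "real \<times> 'a \<times> 'a" assume z: "z \<in> space (lborel \<Otimes>\<^sub>M (M \<Otimes>\<^sub>M M))"
      obtain x a b where z': "z = (x, a, b)" "a \<in> space M" "b \<in> space M"
        using z by (cases z) (auto simp: space_pair_measure)
      have "\<bar>B a\<bar> * \<bar>B b\<bar> \<le> K * K" using z' K by (intro mult_mono B) auto
      then have "\<bar>B a\<bar> * \<bar>B b\<bar> * std_normal_density (s * x) \<le> K * K * std_normal_density (s * x)"
        by (rule mult_right_mono) simp
      then show "norm (case_prod ?f z) \<le> norm (K * K * std_normal_density (s * fst z))"
        using K by (simp add: z' norm_mult abs_mult ac_simps)
    qed
  qed measurable
  have "complex_of_real (LBINT \<xi>. std_normal_density (s * \<xi>) * (cmod (CLINT \<omega>|M. B \<omega> * iexp (\<xi> * X \<omega>)))\<^sup>2) =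
    (CLBINT \<xi>. complex_of_real (std_normal_density (s * \<xi>)) * complex_of_real ((cmod (CLINT \<omega>|M. B \<omega> * iexp (\<xi> * X \<omega>)))\<^sup>2))"
    by (simp flip: integral_complex_of_real)
  also have "\<dots> = (CLBINT \<xi>. (CLINT p|(M \<Otimes>\<^sub>M M). ?f \<xi> p))"
    by (subst norm_sq_weighted_char[where K=K]) (use B in auto)
  also have "\<dots> = (CLINT p|(M \<Otimes>\<^sub>M M). (CLBINT \<xi>. ?f \<xi> p))"
    by (rule Q.Fubini_integral[OF int, symmetric])
  also have "\<dots> = (CLINT p|(M \<Otimes>\<^sub>M M). complex_of_real (B (fst p) * B (snd p)) * complex_of_real (exp (- ((X (fst p) - X (snd p)) / s)\<^sup>2 / 2) / s))"
    unfolding gauss_fourier[OF s, symmetric] Bochner_Integration.integral_mult_right_zero[symmetric]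
    by (simp only: mult.left_commute)
  also have "\<dots> = complex_of_real (LINT p|(M \<Otimes>\<^sub>M M). B (fst p) * B (snd p) * (exp (- ((X (fst p) - X (snd p)) / s)\<^sup>2 / 2) / s))"
    by (simp only: of_real_mult[symmetric] integral_complex_of_real)
  finally show ?thesis by (simp only: of_real_eq_iff)
qed

text \<open>The Gaussian weight has a nonnegative Fourier transform, so a bounded weight \<open>B\<close> can be
  pulled out of the square of the characteristic function.\<close>
lemma (in prob_space) gauss_weighted_char_le:
  fixes X B :: "'a \<Rightarrow> real"
  assumes [measurable]: "X \<in> borel_measurable M" "B \<in> borel_measurable M"
    and B: "\<And>\<omega>. \<omega> \<in> space M \<Longrightarrow> \<bar>B \<omega>\<bar> \<le> K" and s: "s > 0"
  shows "(LBINT \<xi>. std_normal_density (s * \<xi>) * (cmod (CLINT \<omega>|M. B \<omega> * iexp (\<xi> * X \<omega>)))\<^sup>2) \<le>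
    K\<^sup>2 * (LBINT \<xi>. std_normal_density (s * \<xi>) * (cmod (CLINT \<omega>|M. iexp (\<xi> * X \<omega>)))\<^sup>2)"
proof -
  interpret P: pair_prob_space M M ..
  have K: "\<bar>K\<bar> = K" using B not_empty by fastforce
  let ?e = "\<lambda>p. exp (- ((X (fst p) - X (snd p)) / s)\<^sup>2 / 2) / s"
  have e: "\<bar>?e p\<bar> \<le> 1 / s" "0 \<le> ?e p" for p using s by (auto simp: abs_mult divide_right_mono)
  have "(LBINT \<xi>. std_normal_density (s * \<xi>) * (cmod (CLINT \<omega>|M. B \<omega> * iexp (\<xi> * X \<omega>)))\<^sup>2)
     = (LINT p|(M \<Otimes>\<^sub>M M). B (fst p) * B (snd p) * ?e p)"
    by (rule gauss_integral_weighted_char) (use B s in auto)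
  also have "\<dots> \<le> (LINT p|(M \<Otimes>\<^sub>M M). K\<^sup>2 * ?e p)"
  proof (rule integral_mono)
    show "integrable (M \<Otimes>\<^sub>M M) (\<lambda>p. B (fst p) * B (snd p) * ?e p)"
      by (rule P.P.integrable_const_bound[where B="K * K * (1/s)"], intro AE_I2)
         (use K e in \<open>auto simp: space_pair_measure abs_mult simp del: times_divide_eq_right abs_divide intro!: mult_mono B\<close>, measurable)
    show "integrable (M \<Otimes>\<^sub>M M) (\<lambda>p. K\<^sup>2 * ?e p)"
      by (rule P.P.integrable_const_bound[where B="K\<^sup>2 * (1/s)"], intro AE_I2)
         (use K e in \<open>auto simp: space_pair_measure abs_mult simp del: times_divide_eq_right abs_divide intro!: mult_left_mono\<close>, measurable)
    fix p assume p: "p \<in> space (M \<Otimes>\<^sub>M M)"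
    have "B (fst p) * B (snd p) \<le> \<bar>B (fst p)\<bar> * \<bar>B (snd p)\<bar>" by (metis abs_ge_self abs_mult)
    also have "\<dots> \<le> K * K" using p K by (intro mult_mono B) (auto simp: space_pair_measure)
    finally show "B (fst p) * B (snd p) * ?e p \<le> K\<^sup>2 * ?e p"
      using e by (intro mult_right_mono) (auto simp: power2_eq_square)
  qed
  \<comment> \<open>The factor \<open>1 * 1\<close> casts the integrand as the case
    \<open>B = 1\<close> of \<open>gauss_integral_weighted_char\<close>, which is then read
    backwards.\<close>
  also have "\<dots> = K\<^sup>2 * (LINT p|(M \<Otimes>\<^sub>M M). 1 * 1 * ?e p)" by simp
  also have "(LINT p|(M \<Otimes>\<^sub>M M). 1 * 1 * ?e p) =
    (LBINT \<xi>. std_normal_density (s * \<xi>) * (cmod (CLINT \<omega>|M. complex_of_real 1 * iexp (\<xi> * X \<omega>)))\<^sup>2)"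
    by (rule gauss_integral_weighted_char[where K=1, symmetric]) (use s in auto)
  finally show ?thesis by simp
qed

section \<open>Integrals over time and the chain rule\<close>

lemma iexp_diff_le: "cmod (iexp x - iexp y) \<le> \<bar>x - y\<bar>"
proof -
  have "iexp x - iexp y = iexp y * (iexp (x - y) - 1)"
    by (simp add: algebra_simps exp_diff exp_add exp_minus divide_inverse)
  then have "cmod (iexp x - iexp y) = cmod (iexp (x - y) - 1)"
    by (simp add: norm_mult)
  also have "\<dots> \<le> \<bar>x - y\<bar>"
    using iexp_approx1[of "x - y" 0] by simp
  finally show ?thesis .
qed

lemma iexp_diff_linear_le: "cmod (iexp x - iexp y - \<i> * (x - y) * iexp y) \<le> (x - y)\<^sup>2 / 2"
proof -
  have "iexp x - iexp y - \<i> * (x - y) * iexp y = iexp y * (iexp (x - y) - 1 - \<i> * (x - y))"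
    by (simp add: algebra_simps exp_diff exp_add exp_minus divide_inverse)
  then have "cmod (iexp x - iexp y - \<i> * (x - y) * iexp y) = cmod (iexp (x - y) - 1 - \<i> * (x - y))"
    by (simp add: norm_mult)
  also have "\<dots> \<le> (x - y)\<^sup>2 / 2"
    using iexp_approx1[of "x - y" 1] by (simp add: algebra_simps power2_eq_square)
  finally show ?thesis .
qed

lemma bounded_set_integrable:
  fixes f :: "real \<Rightarrow> 'b::{banach, second_countable_topology}"
  assumes [measurable]: "f \<in> borel_measurable borel" "S \<in> sets borel" and "S \<subseteq> {s..t}" "\<And>r. r \<in> S \<Longrightarrow> norm (f r) \<le> C"
  shows "set_integrable lborel S f"
proof -
  have "emeasure lborel S \<le> emeasure lborel {s..t}"
    by (rule emeasure_mono) (use assms in auto)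
  then have fin: "emeasure lborel S < \<infinity>"
    by (simp add: emeasure_lborel_Icc_eq split: if_splits) (meson ennreal_less_top order_le_less_trans)
  have "integrable lborel (\<lambda>x. indicator S x *\<^sub>R \<bar>C\<bar>)"
    using fin by (auto intro!: integrable_scaleR_left integrable_real_indicator)
  then show ?thesis
    unfolding set_integrable_def
    by (rule Bochner_Integration.integrable_bound)
       (use assms in \<open>auto simp: indicator_def intro: order_trans[OF _ abs_ge_self]\<close>)
qed

lemma bounded_set_integral_norm_le:
  fixes f :: "real \<Rightarrow> 'b::{banach, second_countable_topology}"
  assumes [measurable]: "f \<in> borel_measurable borel" and st: "s \<le> t" and b: "\<And>r. r \<in> {s<..t} \<Longrightarrow> norm (f r) \<le> C"
  shows "norm (LINT r:{s<..t}|lborel. f r) \<le> C * (t - s)"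
proof -
  have 1: "set_integrable lborel {s<..t} f"
    using assms by (intro bounded_set_integrable[of _ _ s t C]) auto
  have "norm (LINT r:{s<..t}|lborel. f r) \<le> (LINT r:{s<..t}|lborel. norm (f r))"
    by (rule set_integral_norm_bound[OF 1])
  also have "\<dots> \<le> (LINT r:{s<..t}|lborel. C)"
    using 1 b by (intro set_integral_mono bounded_set_integrable[of _ _ s t "\<bar>C\<bar>"]) (auto simp: set_integrable_norm intro: order_trans[OF _ abs_ge_self])
  also have "\<dots> = C * (t - s)"
    using st by (simp add: set_integral_const mult.commute)
  finally show ?thesis .
qed

lemma set_integral_Icc_diff:
  fixes f :: "real \<Rightarrow> 'b::{banach, second_countable_topology}"
  assumes [measurable]: "f \<in> borel_measurable borel" and "0 \<le> s" "s \<le> t"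
    and b: "\<And>r. 0 \<le> r \<Longrightarrow> r \<le> t \<Longrightarrow> norm (f r) \<le> C"
  shows "(LINT r:{0..t}|lborel. f r) - (LINT r:{0..s}|lborel. f r) = (LINT r:{s<..t}|lborel. f r)"
proof -
  have "{0..t} = {0..s} \<union> {s<..t}" "{0..s} \<inter> {s<..t} = {}" using assms by auto
  then have "(LINT r:{0..t}|lborel. f r) = (LINT r:{0..s}|lborel. f r) + (LINT r:{s<..t}|lborel. f r)"
    using assms
    by (auto intro!: set_integral_Un bounded_set_integrable[of _ _ 0 t C])
  then show ?thesis by simp
qed

lemma set_integral_Icc_lipschitz:
  fixes f :: "real \<Rightarrow> 'b::{banach, second_countable_topology}"
  assumes [measurable]: "f \<in> borel_measurable borel" and "0 \<le> s" "0 \<le> t"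
    and b: "\<And>r. 0 \<le> r \<Longrightarrow> norm (f r) \<le> C"
  shows "norm ((LINT r:{0..t}|lborel. f r) - (LINT r:{0..s}|lborel. f r)) \<le> C * \<bar>t - s\<bar>"
proof -
  have *: "norm ((LINT r:{0..t}|lborel. f r) - (LINT r:{0..s}|lborel. f r)) \<le> C * (t - s)"
    if "0 \<le> s" "s \<le> t" for s t
    using that by (subst set_integral_Icc_diff[where C=C]) (auto intro!: b bounded_set_integral_norm_le)
  from *[of s t] *[of t s] show ?thesis using assms
    by (cases "s \<le> t") (auto simp: norm_minus_commute)
qed

text \<open>The difference quotients are at most \<open>\<bar>C\<bar> * \<bar>y - x\<bar>\<close>,
  so \<open>G\<close> has derivative zero at every point of the interval. This identifies two
  functions whose increments agree to first order although neither is known to be differentiable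
  everywhere.\<close>

lemma quadratic_increment_constant:
  fixes G :: "real \<Rightarrow> 'b::real_normed_vector"
  assumes "0 \<le> T" and G: "\<And>s t. 0 \<le> s \<Longrightarrow> s \<le> t \<Longrightarrow> t \<le> T \<Longrightarrow> norm (G t - G s) \<le> C * (t - s)\<^sup>2"
  shows "G T = G 0"
proof -
  have "(G has_vector_derivative 0) (at x within {0..T})" if x: "x \<in> {0..T}" for x
  proof -
    have le: "norm (G y - G x) \<le> \<bar>C\<bar> * \<bar>y - x\<bar>\<^sup>2" if "y \<in> {0..T}" for y
    proof -
      have "norm (G y - G x) \<le> C * (y - x)\<^sup>2"
        using G[of x y] G[of y x] x that by (cases "x \<le> y") (auto simp: norm_minus_commute power2_commute)
      also have "\<dots> \<le> \<bar>C\<bar> * \<bar>y - x\<bar>\<^sup>2" by (auto intro: mult_right_mono)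
      finally show ?thesis .
    qed
    have "((\<lambda>y. (G y - G x) /\<^sub>R \<bar>y - x\<bar>) \<longlongrightarrow> 0) (at x within {0..T})"
    proof (rule tendsto_0_le[where K=1])
      show "((\<lambda>y. \<bar>C\<bar> * \<bar>y - x\<bar>) \<longlongrightarrow> 0) (at x within {0..T})"
        by (auto intro!: tendsto_eq_intros)
      show "\<forall>\<^sub>F y in at x within {0..T}. norm ((G y - G x) /\<^sub>R \<bar>y - x\<bar>) \<le> norm (\<bar>C\<bar> * \<bar>y - x\<bar>) * 1"
        unfolding eventually_at
      proof (intro exI[of _ 1] conjI ballI impI)
        fix y assume y: "y \<in> {0..T}" "y \<noteq> x \<and> dist y x < 1"
        have "norm (G y - G x) / \<bar>y - x\<bar> \<le> \<bar>C\<bar> * \<bar>y - x\<bar>"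
          using le[OF y(1)] y(2) by (simp add: divide_le_eq power2_eq_square mult.assoc)
        then show "norm ((G y - G x) /\<^sub>R \<bar>y - x\<bar>) \<le> norm (\<bar>C\<bar> * \<bar>y - x\<bar>) * 1"
          by (simp add: divide_inverse mult.commute)
      qed simp
    qed
    then show ?thesis
      unfolding has_vector_derivative_def has_derivative_within
      by (auto simp: divide_inverse algebra_simps)
  qed
  then obtain c where "\<And>x. x \<in> {0..T} \<Longrightarrow> G x = c"
    using has_vector_derivative_zero_constant[of "{0..T}" G] by auto
  then show ?thesis using assms by auto
qed

text \<open>The chain rule for an indefinite integral of a merely measurable function: both sides have
  increments that agree up to a quadratic error.\<close>
lemma iexp_indefinite_integral:
  fixes b :: "real \<Rightarrow> real" and \<xi> :: real
  assumes b[measurable]: "b \<in> borel_measurable borel" and K: "\<And>r. 0 \<le> r \<Longrightarrow> \<bar>b r\<bar> \<le> K" and t: "0 \<le> t"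
  defines "A \<equiv> \<lambda>t. (LINT r:{0..t}|lborel. b r)"
  assumes A[measurable]: "A \<in> borel_measurable borel"
  shows "iexp (\<xi> * A t) = 1 + (CLINT r:{0..t}|lborel. \<i> * \<xi> * b r * iexp (\<xi> * A r))"
proof -
  let ?f = "\<lambda>r. \<i> * \<xi> * b r * iexp (\<xi> * A r)"
  define G where "G t = iexp (\<xi> * A t) - (CLINT r:{0..t}|lborel. ?f r)" for t
  have K0: "0 \<le> K" using K[of 0] by simp
  have fb: "norm (?f r) \<le> \<bar>\<xi>\<bar> * K" if "0 \<le> r" for r
    using K[OF that] by (auto simp: norm_mult intro: mult_left_mono)
  have Alip: "\<bar>A r - A s\<bar> \<le> K * (r - s)" if "0 \<le> s" "s \<le> r" for s r
    using set_integral_Icc_lipschitz[of b s r K] that K by (auto simp: A_def)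
  have "G t = G 0"
  proof (rule quadratic_increment_constant[OF t])
    fix s r assume sr: "0 \<le> s" "s \<le> r" "r \<le> t"
    have 1: "(CLINT u:{0..r}|lborel. ?f u) - (CLINT u:{0..s}|lborel. ?f u) = (CLINT u:{s<..r}|lborel. ?f u)"
      using sr by (intro set_integral_Icc_diff[where C="\<bar>\<xi>\<bar> * K"] fb) auto
    have Ars: "A r - A s = (LINT u:{s<..r}|lborel. b u)"
      unfolding A_def using sr K by (intro set_integral_Icc_diff[where C=K]) auto
    have 2: "(CLINT u:{s<..r}|lborel. \<i> * \<xi> * b u * iexp (\<xi> * A s)) = \<i> * \<xi> * (A r - A s) * iexp (\<xi> * A s)"
    proof -
      have "(CLINT u:{s<..r}|lborel. \<i> * \<xi> * b u * iexp (\<xi> * A s)) =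
        (CLINT u:{s<..r}|lborel. (\<i> * \<xi> * iexp (\<xi> * A s)) * complex_of_real (b u))"
        by (simp add: ac_simps)
      also have "\<dots> = (\<i> * \<xi> * iexp (\<xi> * A s)) * (CLINT u:{s<..r}|lborel. complex_of_real (b u))"
        by (rule set_integral_mult_right)
      also have "(CLINT u:{s<..r}|lborel. complex_of_real (b u)) = complex_of_real (A r - A s)"
        unfolding Ars by (rule set_integral_complex_of_real)
      finally show ?thesis by (simp only: ac_simps)
    qed
    have i1: "set_integrable lborel {s<..r} ?f"
      using sr fb by (intro bounded_set_integrable[of _ _ s r "\<bar>\<xi>\<bar> * K"]) auto
    have i2: "set_integrable lborel {s<..r} (\<lambda>u. \<i> * \<xi> * b u * iexp (\<xi> * A s))"
      using sr K by (intro bounded_set_integrable[of _ _ s r "\<bar>\<xi>\<bar> * K"]) (auto simp: norm_mult intro!: mult_left_mono)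
    have "G r - G s = (iexp (\<xi> * A r) - iexp (\<xi> * A s) - \<i> * (\<xi> * A r - \<xi> * A s) * iexp (\<xi> * A s)) -
       ((CLINT u:{s<..r}|lborel. ?f u) - \<i> * \<xi> * (A r - A s) * iexp (\<xi> * A s))"
      unfolding G_def 1[symmetric] by (simp add: algebra_simps)
    also have "\<dots> = (iexp (\<xi> * A r) - iexp (\<xi> * A s) - \<i> * (\<xi> * A r - \<xi> * A s) * iexp (\<xi> * A s)) -
       (CLINT u:{s<..r}|lborel. ?f u - \<i> * \<xi> * b u * iexp (\<xi> * A s))"
      by (subst set_integral_diff(2)[OF i1 i2]) (simp only: 2)
    also have "norm \<dots> \<le> (\<xi> * A r - \<xi> * A s)\<^sup>2 / 2 + (\<bar>\<xi>\<bar> * K * (\<bar>\<xi>\<bar> * K * (r - s))) * (r - s)"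
    proof (rule norm_triangle_le_diff, rule add_mono)
      show "cmod (iexp (\<xi> * A r) - iexp (\<xi> * A s) - \<i> * (\<xi> * A r - \<xi> * A s) * iexp (\<xi> * A s)) \<le> (\<xi> * A r - \<xi> * A s)\<^sup>2 / 2"
        using iexp_diff_linear_le[of "\<xi> * A r" "\<xi> * A s"] by simp
      show "cmod (CLINT u:{s<..r}|lborel. ?f u - \<i> * \<xi> * b u * iexp (\<xi> * A s)) \<le> (\<bar>\<xi>\<bar> * K * (\<bar>\<xi>\<bar> * K * (r - s))) * (r - s)"
      proof (rule bounded_set_integral_norm_le)
        fix u assume u: "u \<in> {s<..r}"
        have "cmod (?f u - \<i> * \<xi> * b u * iexp (\<xi> * A s)) = \<bar>\<xi>\<bar> * \<bar>b u\<bar> * cmod (iexp (\<xi> * A u) - iexp (\<xi> * A s))"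
          unfolding right_diff_distrib[symmetric] by (simp add: norm_mult)
        also have "cmod (iexp (\<xi> * A u) - iexp (\<xi> * A s)) \<le> \<bar>\<xi> * A u - \<xi> * A s\<bar>"
          by (rule iexp_diff_le)
        also have "\<dots> = \<bar>\<xi>\<bar> * \<bar>A u - A s\<bar>"
          unfolding right_diff_distrib[symmetric] by (simp add: abs_mult)
        also have "\<dots> \<le> \<bar>\<xi>\<bar> * (K * (r - s))"
          using Alip[of s u] u sr K0 by (intro mult_left_mono order_trans[OF Alip[of s u]]) auto
        finally have "cmod (?f u - \<i> * \<xi> * b u * iexp (\<xi> * A s)) \<le> \<bar>\<xi>\<bar> * \<bar>b u\<bar> * (\<bar>\<xi>\<bar> * (K * (r - s)))"
          by (simp add: mult_left_mono)
        also have "\<dots> \<le> \<bar>\<xi>\<bar> * K * (\<bar>\<xi>\<bar> * (K * (r - s)))"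
          using sr u K0 by (intro mult_right_mono mult_left_mono K) auto
        finally show "cmod (?f u - \<i> * \<xi> * b u * iexp (\<xi> * A s)) \<le> \<bar>\<xi>\<bar> * K * (\<bar>\<xi>\<bar> * K * (r - s))"
          by (simp only: mult.assoc)
      qed (use sr in auto)
    qed
    also have "(\<xi> * A r - \<xi> * A s)\<^sup>2 / 2 \<le> (\<bar>\<xi>\<bar> * K * (r - s))\<^sup>2"
    proof -
      have "\<bar>\<xi> * A r - \<xi> * A s\<bar> \<le> \<bar>\<bar>\<xi>\<bar> * K * (r - s)\<bar>"
        using Alip[of s r] sr K0 unfolding right_diff_distrib[symmetric] abs_mult
        by (auto simp: mult.assoc intro: mult_left_mono)
      then have "(\<xi> * A r - \<xi> * A s)\<^sup>2 \<le> (\<bar>\<xi>\<bar> * K * (r - s))\<^sup>2"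
        by (simp only: abs_le_square_iff)
      then show ?thesis by (smt (verit) zero_le_power2 field_sum_of_halves)
    qed
    finally show "norm (G r - G s) \<le> (2 * (\<bar>\<xi>\<bar> * K)\<^sup>2) * (r - s)\<^sup>2"
      by (simp add: power2_eq_square algebra_simps)
  qed
  moreover have "G 0 = 1"
  proof -
    have "A 0 = 0" "(CLINT r:{0..0}|lborel. ?f r) = 0"
      using set_integral_Icc_lipschitz[of b 0 0 K] fb
      by (auto simp: A_def set_lebesgue_integral_def intro!: integral_eq_zero_AE AE_I'[of "{0}"] simp: indicator_def split: if_splits)
    then show ?thesis by (simp add: G_def)
  qed
  ultimately show ?thesis by (simp add: G_def algebra_simps)
qed

section \<open>Processes driven by a Levy process\<close>

text \<open>Time ranges over all reals, with \<open>S\<close> equal to 0 up to time 0. Adaptedness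
  and right continuity then hold at every real time and can be passed around without a sign
  condition.\<close>

locale levy_driver = prob_space P for P :: "'a measure" +
  fixes F :: "real \<Rightarrow> 'a measure" and S :: "real \<Rightarrow> 'a \<Rightarrow> real" and \<psi> :: "real \<Rightarrow> complex"
  assumes filt: "filtration (space P) F"
    and subalg: "\<And>t. subalgebra P (F t)"
    and S_adapted: "\<And>t. S t \<in> borel_measurable (F t)"
    and S_right: "\<And>\<omega> t. \<omega> \<in> space P \<Longrightarrow> continuous (at_right t) (\<lambda>t. S t \<omega>)"
    and S_nonpos: "\<And>\<omega> t. t \<le> 0 \<Longrightarrow> S t \<omega> = 0"
    and psi_cont: "continuous_on UNIV \<psi>"
    and S_incr: "\<And>s t \<xi> A. 0 \<le> s \<Longrightarrow> s < t \<Longrightarrow> A \<in> sets (F s) \<Longrightarrow>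
        (CLINT \<omega>|P. indicator A \<omega> * iexp (\<xi> * (S t \<omega> - S s \<omega>)))
          = complex_of_real (measure P A) * exp (- complex_of_real (t - s) * \<psi> \<xi>)"
begin

lemma adapted_measurable [measurable_dest]:
  "f \<in> measurable (F t) N \<Longrightarrow> f \<in> measurable P N"
  using measurable_from_subalg[OF subalg] .

lemma adapted_mono:
  assumes "s \<le> t" "f \<in> measurable (F s) N" shows "f \<in> measurable (F t) N"
proof -
  interpret filtration "space P" F by (rule filt)
  show ?thesis using assms sets_F_mono[of s t] space_F by (auto simp: measurable_def)
qed

lemma S_measurable [measurable]: "S t \<in> borel_measurable P"
  using S_adapted by (rule adapted_measurable)

lemma space_F: "space (F t) = space P"
  using subalg[of t] by (simp add: subalgebra_def)

text \<open>Independence of the increment from \<open>F s\<close>, extended from indicators to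
  bounded weights by linearity and dominated convergence. Duhamel's formula uses it for the weight
  \<open>b s * iexp (\<xi> * X s)\<close>.\<close>

lemma increment_char_weighted:
  fixes H :: "'a \<Rightarrow> complex"
  assumes st: "0 \<le> s" "s \<le> t" and H: "H \<in> borel_measurable (F s)"
    and B: "\<And>\<omega>. \<omega> \<in> space P \<Longrightarrow> cmod (H \<omega>) \<le> C"
  shows "(CLINT \<omega>|P. H \<omega> * iexp (\<xi> * (S t \<omega> - S s \<omega>))) =
    (CLINT \<omega>|P. H \<omega>) * exp (- complex_of_real (t - s) * \<psi> \<xi>)"
proof (cases "s = t")
  case True then show ?thesis by simp
next
  case False
  with st have "s < t" by simp
  let ?e = "\<lambda>\<omega>. iexp (\<xi> * (S t \<omega> - S s \<omega>))"
  have [measurable]: "?e \<in> borel_measurable P" by measurable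
  have "integrable P H"
    using H B by (intro integrable_const_bound[where B=C]) auto
  \<comment> \<open>Induction over the restricted measure builds \<open>H\<close> from indicators of
    sets in \<open>F s\<close>, exactly those to which \<open>S_incr\<close> applies.\<close>
  then have "integrable (restr_to_subalg P (F s)) H"
    by (rule integrable_in_subalg[OF subalg H])
  then show ?thesis
  proof (induction rule: integrable_induct)
    case (base A c)
    then have A: "A \<in> sets (F s)" by (simp add: sets_restr_to_subalg[OF subalg])
    then have [measurable]: "A \<in> sets P" using subalg by (auto simp: subalgebra_def)
    have "(CLINT \<omega>|P. indicator A \<omega> *\<^sub>R c * ?e \<omega>) = c * (CLINT \<omega>|P. indicator A \<omega> * ?e \<omega>)"
      unfolding Bochner_Integration.integral_mult_right_zero[symmetric]
      by (intro Bochner_Integration.integral_cong refl) (simp split: split_indicator)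
    also have "\<dots> = c * (complex_of_real (measure P A) * exp (- complex_of_real (t - s) * \<psi> \<xi>))"
      by (subst S_incr[OF st(1) \<open>s < t\<close> A]) simp
    also have "\<dots> = (CLINT \<omega>|P. indicator A \<omega> *\<^sub>R c) * exp (- complex_of_real (t - s) * \<psi> \<xi>)"
      by (simp add: scaleR_conv_of_real emeasure_eq_measure)
    finally show ?case by simp
  next
    case (add f g)
    have [simp]: "integrable P f" "integrable P g"
      using add by (auto intro: integrable_from_subalg[OF subalg])
    have "integrable P (\<lambda>\<omega>. h \<omega> * ?e \<omega>)" if h: "integrable P h" for h
    proof (rule Bochner_Integration.integrable_bound[OF h])
      show "(\<lambda>\<omega>. h \<omega> * ?e \<omega>) \<in> borel_measurable P"
        using h by measurable
    qed (simp add: norm_mult)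
    from this[of f] this[of g] have "integrable P (\<lambda>\<omega>. f \<omega> * ?e \<omega>)" "integrable P (\<lambda>\<omega>. g \<omega> * ?e \<omega>)" by auto
    then show ?case using add by (simp add: distrib_right)
  next
    case (lim f u)
    have [simp]: "integrable P f" "\<And>i. integrable P (u i)"
      using lim by (auto intro: integrable_from_subalg[OF subalg])
    have [measurable]: "f \<in> borel_measurable P" "\<And>i. u i \<in> borel_measurable P"
      by (auto intro!: borel_measurable_integrable)
    have conv: "\<And>\<omega>. \<omega> \<in> space P \<Longrightarrow> (\<lambda>i. u i \<omega>) \<longlonglongrightarrow> f \<omega>" and le: "\<And>i \<omega>. \<omega> \<in> space P \<Longrightarrow> cmod (u i \<omega>) \<le> 2 * cmod (f \<omega>)"
      using lim by (auto simp: space_restr_to_subalg)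
    have 1: "(\<lambda>i. CLINT \<omega>|P. u i \<omega> * ?e \<omega>) \<longlonglongrightarrow> (CLINT \<omega>|P. f \<omega> * ?e \<omega>)"
      by (rule integral_dominated_convergence[where w="\<lambda>\<omega>. 2 * cmod (f \<omega>)"])
         (auto intro!: tendsto_intros conv le simp: norm_mult)
    have 2: "(\<lambda>i. (CLINT \<omega>|P. u i \<omega>) * exp (- complex_of_real (t - s) * \<psi> \<xi>)) \<longlonglongrightarrow> (CLINT \<omega>|P. f \<omega>) * exp (- complex_of_real (t - s) * \<psi> \<xi>)"
      by (intro tendsto_mult tendsto_const integral_dominated_convergence[where w="\<lambda>\<omega>. 2 * cmod (f \<omega>)"])
         (auto intro!: tendsto_intros conv le)
    show ?case
      using LIMSEQ_unique[OF 1] 2 lim by simp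
  qed
qed

lemma char_S:
  assumes "0 \<le> t"
  shows "(CLINT \<omega>|P. iexp (\<xi> * S t \<omega>)) = exp (- complex_of_real t * \<psi> \<xi>)"
  using increment_char_weighted[of 0 t "\<lambda>_. 1" 1 \<xi>] assms by (simp add: S_nonpos prob_space)

text \<open>Duhamel's formula for the perturbation of \<open>S\<close> by a drift. The chain rule is
  applied to \<open>iexp (\<xi> * A t)\<close> alone, while \<open>S t\<close> stays in the other
  factor and is split as \<open>S s + (S t - S s)\<close>: what is known at time \<open>s\<close>
  combines to \<open>b s * iexp (\<xi> * X s)\<close>, and the increment contributes
  \<open>exp (- (t - s) * \<psi> \<xi>)\<close>. Thus no stochastic calculus for \<open>S\<close>
  enters.\<close>

lemma char_drifted:
  fixes b :: "real \<Rightarrow> 'a \<Rightarrow> real" and x0 :: real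
  assumes b[measurable]: "(\<lambda>p. b (fst p) (snd p)) \<in> borel_measurable (borel \<Otimes>\<^sub>M P)"
    and b_adapted: "\<And>t. b t \<in> borel_measurable (F t)"
    and bK: "\<And>t \<omega>. 0 \<le> t \<Longrightarrow> \<omega> \<in> space P \<Longrightarrow> \<bar>b t \<omega>\<bar> \<le> K"
    and A: "\<And>t \<omega>. \<omega> \<in> space P \<Longrightarrow> A t \<omega> = (LINT s:{0..t}|lborel. b s \<omega>)"
    and A_meas[measurable]: "(\<lambda>p. A (fst p) (snd p)) \<in> borel_measurable (borel \<Otimes>\<^sub>M P)"
    and A_adapted: "\<And>t. A t \<in> borel_measurable (F t)"
    and X: "\<And>t \<omega>. \<omega> \<in> space P \<Longrightarrow> X t \<omega> = x0 + S t \<omega> + A t \<omega>"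
    and t: "0 \<le> t"
  shows "(CLINT \<omega>|P. iexp (\<xi> * X t \<omega>)) = iexp (\<xi> * x0) * exp (- complex_of_real t * \<psi> \<xi>) +
    (CLINT s:{0..t}|lborel. \<i> * \<xi> * (CLINT \<omega>|P. b s \<omega> * iexp (\<xi> * X s \<omega>)) * exp (- complex_of_real (t - s) * \<psi> \<xi>))"
proof -
  interpret pair_sigma_finite lborel P ..
  have K: "0 \<le> K" using bK[of 0] not_empty by fastforce
  let ?g = "\<lambda>s \<omega>. \<i> * \<xi> * b s \<omega> * iexp (\<xi> * A s \<omega>) * iexp (\<xi> * (x0 + S t \<omega>))"
  have path: "iexp (\<xi> * X t \<omega>) = iexp (\<xi> * (x0 + S t \<omega>)) + (CLBINT s. indicator {0..t} s *\<^sub>R ?g s \<omega>)"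
    if \<omega>[measurable]: "\<omega> \<in> space P" for \<omega>
  proof -
    have [measurable]: "(\<lambda>s. b s \<omega>) \<in> borel_measurable borel"
      using measurable_compose[OF measurable_Pair2'[OF \<omega>] b] by simp
    have [measurable]: "(\<lambda>s. A s \<omega>) \<in> borel_measurable borel"
      using measurable_compose[OF measurable_Pair2'[OF \<omega>] A_meas] by simp
    have 1: "iexp (\<xi> * A t \<omega>) = 1 + (CLINT r:{0..t}|lborel. \<i> * \<xi> * b r \<omega> * iexp (\<xi> * A r \<omega>))"
      unfolding A[OF \<omega>]
      by (rule iexp_indefinite_integral[where K=K]) (use bK \<omega> t A[OF \<omega>] in \<open>auto simp flip: A\<close>)
    have "iexp (\<xi> * X t \<omega>) = iexp (\<xi> * A t \<omega>) * iexp (\<xi> * (x0 + S t \<omega>))"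
      by (simp add: X[OF \<omega>] algebra_simps exp_add)
    also have "\<dots> = iexp (\<xi> * (x0 + S t \<omega>)) + (CLINT r:{0..t}|lborel. \<i> * \<xi> * b r \<omega> * iexp (\<xi> * A r \<omega>)) * iexp (\<xi> * (x0 + S t \<omega>))"
      unfolding 1 by (simp add: algebra_simps)
    also have "(CLINT r:{0..t}|lborel. \<i> * \<xi> * b r \<omega> * iexp (\<xi> * A r \<omega>)) * iexp (\<xi> * (x0 + S t \<omega>)) = (CLBINT s. indicator {0..t} s *\<^sub>R ?g s \<omega>)"
      unfolding set_lebesgue_integral_def
      by (subst Bochner_Integration.integral_mult_left_zero[symmetric]) (simp only: mult_scaleR_left)
    finally show ?thesis .
  qed
  have int: "integrable (lborel \<Otimes>\<^sub>M P) (\<lambda>(s,\<omega>). indicator {0..t} s *\<^sub>R ?g s \<omega>)"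
  proof (rule Bochner_Integration.integrable_bound)
    show "integrable (lborel \<Otimes>\<^sub>M P) (\<lambda>p. indicator {0..t} (fst p) *\<^sub>R (\<bar>\<xi>\<bar> * K))"
    proof -
      have "emeasure (lborel \<Otimes>\<^sub>M P) ({0..t} \<times> space P) = emeasure lborel {0..t} * emeasure P (space P)"
        by (rule sigma_finite_measure.emeasure_pair_measure_Times[OF prob_space_imp_sigma_finite[OF prob_space_axioms]]) auto
      then have "emeasure (lborel \<Otimes>\<^sub>M P) ({0..t} \<times> space P) < \<infinity>"
        using t by (simp add: emeasure_space_1)
      then have "integrable (lborel \<Otimes>\<^sub>M P) (\<lambda>p. indicator ({0..t} \<times> space P) p *\<^sub>R (\<bar>\<xi>\<bar> * K))"
        by (intro integrable_scaleR_left integrable_real_indicator) auto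
      then show ?thesis
        by (rule Bochner_Integration.integrable_cong[THEN iffD1, rotated -1]) (auto simp: indicator_def space_pair_measure)
    qed
    show "AE p in lborel \<Otimes>\<^sub>M P. norm (case p of (s,\<omega>) \<Rightarrow> indicator {0..t} s *\<^sub>R ?g s \<omega>) \<le> norm (indicator {0..t} (fst p) *\<^sub>R (\<bar>\<xi>\<bar> * K))"
      using bK K by (intro AE_I2) (auto simp: indicator_def space_pair_measure norm_mult intro!: mult_left_mono)
    have "S t \<in> borel_measurable P" by simp
    then show "(\<lambda>(s, \<omega>). indicator {0..t} s *\<^sub>R ?g s \<omega>) \<in> borel_measurable (lborel \<Otimes>\<^sub>M P)"
      unfolding case_prod_beta' by measurable
  qed
  have inner: "(CLINT \<omega>|P. ?g s \<omega>) = \<i> * \<xi> * (CLINT \<omega>|P. b s \<omega> * iexp (\<xi> * X s \<omega>)) * exp (- complex_of_real (t - s) * \<psi> \<xi>)"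
    if s: "0 \<le> s" "s \<le> t" for s
  proof -
    note [measurable] = b_adapted A_adapted S_adapted
    have "(CLINT \<omega>|P. ?g s \<omega>) = (CLINT \<omega>|P. (\<i> * \<xi> * (b s \<omega> * iexp (\<xi> * X s \<omega>))) * iexp (\<xi> * (S t \<omega> - S s \<omega>)))"
      by (intro Bochner_Integration.integral_cong) (auto simp: X algebra_simps exp_add exp_diff)
    also have "\<dots> = (CLINT \<omega>|P. \<i> * \<xi> * (b s \<omega> * iexp (\<xi> * X s \<omega>))) * exp (- complex_of_real (t - s) * \<psi> \<xi>)"
    proof (rule increment_char_weighted[where C="\<bar>\<xi>\<bar> * K"])
      have "(\<lambda>\<omega>. \<i> * \<xi> * (b s \<omega> * iexp (\<xi> * (x0 + S s \<omega> + A s \<omega>)))) \<in> borel_measurable (F s)"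
        by measurable
      then show "(\<lambda>\<omega>. \<i> * \<xi> * (b s \<omega> * iexp (\<xi> * X s \<omega>))) \<in> borel_measurable (F s)"
        by (rule measurable_cong[THEN iffD1, rotated]) (simp add: X space_F)
    qed (use s bK K in \<open>auto simp: norm_mult intro!: mult_left_mono\<close>)
    finally show ?thesis by simp
  qed
  have "(CLINT \<omega>|P. iexp (\<xi> * X t \<omega>)) = (CLINT \<omega>|P. iexp (\<xi> * (x0 + S t \<omega>)) + (CLBINT s. indicator {0..t} s *\<^sub>R ?g s \<omega>))"
    by (intro Bochner_Integration.integral_cong path) auto
  also have "\<dots> = (CLINT \<omega>|P. iexp (\<xi> * (x0 + S t \<omega>))) + (CLINT \<omega>|P. (CLBINT s. indicator {0..t} s *\<^sub>R ?g s \<omega>))"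
  proof (rule Bochner_Integration.integral_add)
    show "integrable P (\<lambda>\<omega>. iexp (\<xi> * (x0 + S t \<omega>)))"
      by (rule integrable_const_bound[where B=1]) auto
    show "integrable P (\<lambda>\<omega>. (CLBINT s. indicator {0..t} s *\<^sub>R ?g s \<omega>))"
      using integrable_snd[OF int] by simp
  qed
  also have "(CLINT \<omega>|P. iexp (\<xi> * (x0 + S t \<omega>))) = iexp (\<xi> * x0) * exp (- complex_of_real t * \<psi> \<xi>)"
    by (subst char_S[OF t, symmetric], subst Bochner_Integration.integral_mult_right_zero[symmetric])
       (simp add: algebra_simps exp_add)
  also have "(CLINT \<omega>|P. (CLBINT s. indicator {0..t} s *\<^sub>R ?g s \<omega>)) = (CLBINT s. (CLINT \<omega>|P. indicator {0..t} s *\<^sub>R ?g s \<omega>))"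
    by (rule Fubini_integral[OF int])
  also have "\<dots> = (CLINT s:{0..t}|lborel. \<i> * \<xi> * (CLINT \<omega>|P. b s \<omega> * iexp (\<xi> * X s \<omega>)) * exp (- complex_of_real (t - s) * \<psi> \<xi>))"
    unfolding set_lebesgue_integral_def
  proof (intro Bochner_Integration.integral_cong refl)
    fix s show "(CLINT \<omega>|P. indicator {0..t} s *\<^sub>R ?g s \<omega>) = indicator {0..t} s *\<^sub>R
        (\<i> * \<xi> * (CLINT \<omega>|P. b s \<omega> * iexp (\<xi> * X s \<omega>)) * exp (- complex_of_real (t - s) * \<psi> \<xi>))"
      using inner[of s] by (cases "s \<in> {0..t}") simp_all
  qed
  finally show ?thesis .
qed

end

section \<open>Convolution with a one-sided exponential kernel\<close>

text \<open>Extended by 0 to negative arguments, so that integrals over \<open>{0..t}\<close> become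
  convolutions on the whole line; values in \<open>ennreal\<close> make Tonelli's theorem available
  without integrability checks.\<close>

definition exp_kernel :: "real \<Rightarrow> real \<Rightarrow> ennreal" where
  "exp_kernel R r = ennreal (indicator {0..} r * exp (- (r * R)))"

lemma exp_kernel_measurable [measurable]: "exp_kernel R \<in> borel_measurable borel"
  unfolding exp_kernel_def by measurable

lemma nn_integral_exp_kernel:
  assumes "R > 0"
  shows "(\<integral>\<^sup>+ r. exp_kernel R r \<partial>lborel) = ennreal (1 / R)"
proof -
  interpret prob_space "density lborel (exponential_density R)"
    using assms by (rule prob_space_exponential_density)
  have "1 = emeasure (density lborel (exponential_density R)) UNIV"
    using emeasure_space_1 by simp
  also have "\<dots> = (\<integral>\<^sup>+ r. ennreal R * exp_kernel R r \<partial>lborel)"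
    using assms by (subst emeasure_density)
      (auto intro!: nn_integral_cong simp: exp_kernel_def exponential_density_def indicator_def ennreal_mult')
  also have "\<dots> = ennreal R * (\<integral>\<^sup>+ r. exp_kernel R r \<partial>lborel)"
    by (rule nn_integral_cmult) simp
  finally have "ennreal (1 / R) = ennreal (1 / R) * (ennreal R * (\<integral>\<^sup>+ r. exp_kernel R r \<partial>lborel))"
    by simp
  also have "\<dots> = (\<integral>\<^sup>+ r. exp_kernel R r \<partial>lborel)"
    using assms by (simp add: mult.assoc[symmetric] ennreal_mult[symmetric])
  finally show ?thesis by simp
qed

lemma nn_integral_exp_kernel_reflect:
  assumes "R > 0"
  shows "(\<integral>\<^sup>+ s. exp_kernel R (t - s) \<partial>lborel) = ennreal (1 / R)"
proof -
  have "(\<integral>\<^sup>+ r. exp_kernel R r \<partial>lborel) = ennreal \<bar>-1\<bar> * (\<integral>\<^sup>+ s. exp_kernel R (t + (-1) * s) \<partial>lborel)"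
    by (rule nn_integral_real_affine) auto
  then show ?thesis using nn_integral_exp_kernel[OF assms] by simp
qed

lemma nn_integral_exp_kernel_shift:
  assumes "R > 0"
  shows "(\<integral>\<^sup>+ t. exp_kernel R (t - s) \<partial>lborel) = ennreal (1 / R)"
proof -
  have "(\<integral>\<^sup>+ r. exp_kernel R r \<partial>lborel) = ennreal \<bar>1\<bar> * (\<integral>\<^sup>+ t. exp_kernel R (- s + 1 * t) \<partial>lborel)"
    by (rule nn_integral_real_affine) auto
  then show ?thesis using nn_integral_exp_kernel[OF assms] by simp
qed

text \<open>Cauchy-Schwarz after writing the kernel as the square of
  \<open>exp_kernel (R / 2)\<close>. One factor integrates to the total mass \<open>1 / R\<close>,
  the other stays with \<open>w\<close>.\<close>

lemma exp_kernel_sq_convolution_le: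
  fixes w :: "real \<Rightarrow> ennreal"
  assumes [measurable]: "w \<in> borel_measurable borel" and R: "R > 0"
  shows "(\<integral>\<^sup>+ s. exp_kernel R (t - s) * (indicator {0..} s * w s) \<partial>lborel)\<^sup>2 \<le>
    ennreal (1 / R) * (\<integral>\<^sup>+ s. exp_kernel R (t - s) * (indicator {0..} s * (w s)\<^sup>2) \<partial>lborel)"
proof -
  have sq: "exp_kernel R r = exp_kernel (R / 2) r * exp_kernel (R / 2) r" for r
    by (auto simp: exp_kernel_def indicator_def ennreal_mult[symmetric] exp_add[symmetric])
  have "(\<integral>\<^sup>+ s. exp_kernel R (t - s) * (indicator {0..} s * w s) \<partial>lborel)\<^sup>2 =
     (\<integral>\<^sup>+ s. exp_kernel (R/2) (t - s) * (exp_kernel (R/2) (t - s) * (indicator {0..} s * w s)) \<partial>lborel)\<^sup>2"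
    by (simp add: sq mult.assoc)
  also have "\<dots> \<le> (\<integral>\<^sup>+ s. (exp_kernel (R/2) (t - s))\<^sup>2 \<partial>lborel) * (\<integral>\<^sup>+ s. (exp_kernel (R/2) (t - s) * (indicator {0..} s * w s))\<^sup>2 \<partial>lborel)"
    by (rule Cauchy_Schwarz_nn_integral) measurable
  also have "(\<integral>\<^sup>+ s. (exp_kernel (R/2) (t - s))\<^sup>2 \<partial>lborel) = ennreal (1 / R)"
    using nn_integral_exp_kernel_reflect[OF R] by (simp add: sq power2_eq_square)
  also have "(\<integral>\<^sup>+ s. (exp_kernel (R/2) (t - s) * (indicator {0..} s * w s))\<^sup>2 \<partial>lborel) =
     (\<integral>\<^sup>+ s. exp_kernel R (t - s) * (indicator {0..} s * (w s)\<^sup>2) \<partial>lborel)"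
    by (intro nn_integral_cong) (simp add: sq power2_eq_square indicator_def mult_ac)
  finally show ?thesis .
qed

text \<open>Young's inequality: convolution with a kernel of mass \<open>1 / R\<close> has norm at
  most \<open>1 / R\<close> on square integrable functions. Since the kernel is causal, both sides
  may be restricted to \<open>{0..T}\<close>.\<close>

lemma exp_kernel_convolution_L2:
  fixes w :: "real \<Rightarrow> ennreal"
  assumes [measurable]: "w \<in> borel_measurable borel" and R: "R > 0"
  shows "(\<integral>\<^sup>+ t. indicator {0..T} t * (\<integral>\<^sup>+ s. exp_kernel R (t - s) * (indicator {0..} s * w s) \<partial>lborel)\<^sup>2 \<partial>lborel) \<le>
    ennreal (1 / R\<^sup>2) * (\<integral>\<^sup>+ s. indicator {0..T} s * (w s)\<^sup>2 \<partial>lborel)"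
proof -
  have "(\<integral>\<^sup>+ t. indicator {0..T} t * (\<integral>\<^sup>+ s. exp_kernel R (t - s) * (indicator {0..} s * w s) \<partial>lborel)\<^sup>2 \<partial>lborel) \<le>
    (\<integral>\<^sup>+ t. indicator {0..T} t * (ennreal (1 / R) * (\<integral>\<^sup>+ s. exp_kernel R (t - s) * (indicator {0..} s * (w s)\<^sup>2) \<partial>lborel)) \<partial>lborel)"
    by (intro nn_integral_mono mult_left_mono exp_kernel_sq_convolution_le) (use R in auto)
  also have "\<dots> = (\<integral>\<^sup>+ t. (\<integral>\<^sup>+ s. ennreal (1 / R) * (indicator {0..T} t * exp_kernel R (t - s) * (indicator {0..} s * (w s)\<^sup>2)) \<partial>lborel) \<partial>lborel)"
    by (simp add: nn_integral_cmult[symmetric] mult_ac)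
  \<comment> \<open>The indicator moves from \<open>t\<close> to \<open>s\<close>: the kernel
    vanishes unless \<open>s \<le> t\<close>, hence \<open>t \<le> T\<close> forces
    \<open>s \<le> T\<close>.\<close>
  also have "\<dots> \<le> (\<integral>\<^sup>+ t. (\<integral>\<^sup>+ s. ennreal (1 / R) * (exp_kernel R (t - s) * (indicator {0..T} s * (w s)\<^sup>2)) \<partial>lborel) \<partial>lborel)"
    by (intro nn_integral_mono mult_left_mono) (auto simp: indicator_def exp_kernel_def)
  also have "\<dots> = (\<integral>\<^sup>+ s. (\<integral>\<^sup>+ t. ennreal (1 / R) * (exp_kernel R (t - s) * (indicator {0..T} s * (w s)\<^sup>2)) \<partial>lborel) \<partial>lborel)"
    by (rule lborel_pair.Fubini') measurable
  also have "\<dots> = (\<integral>\<^sup>+ s. ennreal (1 / R) * (ennreal (1 / R) * (indicator {0..T} s * (w s)\<^sup>2)) \<partial>lborel)"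
    by (simp add: nn_integral_cmult nn_integral_multc nn_integral_exp_kernel_shift[OF R])
  also have "\<dots> = ennreal (1 / R\<^sup>2) * (\<integral>\<^sup>+ s. indicator {0..T} s * (w s)\<^sup>2 \<partial>lborel)"
    using R by (subst nn_integral_cmult[symmetric]) (auto simp: mult.assoc[symmetric] ennreal_mult[symmetric] power2_eq_square)
  finally show ?thesis .
qed

lemma exp_set_integral_eq_nn:
  fixes v :: "real \<Rightarrow> real"
  assumes [measurable]: "v \<in> borel_measurable borel" and v: "\<And>s. 0 \<le> s \<Longrightarrow> s \<le> t \<Longrightarrow> 0 \<le> v s \<and> v s \<le> K"
    and R: "R > 0"
  shows "ennreal (LINT s:{0..t}|lborel. exp (- ((t - s) * R)) * v s) =
    (\<integral>\<^sup>+ s. exp_kernel R (t - s) * (indicator {0..} s * ennreal (v s)) \<partial>lborel)"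
proof -
  have "set_integrable lborel {0..t} (\<lambda>s. exp (- ((t - s) * R)) * v s)"
  proof (rule bounded_set_integrable)
    fix s assume s: "s \<in> {0..t}"
    have "exp (- ((t - s) * R)) * v s \<le> 1 * K"
      using s R v[of s] by (intro mult_mono) auto
    then show "norm (exp (- ((t - s) * R)) * v s) \<le> K"
      using v[of s] s by (simp add: abs_mult)
  qed auto
  then have "integrable lborel (\<lambda>s. indicator {0..t} s *\<^sub>R (exp (- ((t - s) * R)) * v s))"
    by (simp add: set_integrable_def)
  then have "ennreal (LINT s:{0..t}|lborel. exp (- ((t - s) * R)) * v s) =
     (\<integral>\<^sup>+ s. ennreal (indicator {0..t} s *\<^sub>R (exp (- ((t - s) * R)) * v s)) \<partial>lborel)"
    unfolding set_lebesgue_integral_def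
    using v by (intro nn_integral_eq_integral[symmetric] AE_I2) (auto simp: indicator_def)
  also have "\<dots> = (\<integral>\<^sup>+ s. exp_kernel R (t - s) * (indicator {0..} s * ennreal (v s)) \<partial>lborel)"
    using v by (intro nn_integral_cong) (auto simp: indicator_def exp_kernel_def ennreal_mult)
  finally show ?thesis .
qed

lemma exp_set_integral_le:
  fixes R t :: real
  assumes "R > 0"
  shows "(LINT s:{0..t}|lborel. exp (- ((t - s) * R))) \<le> 1 / R"
proof -
  have "ennreal (LINT s:{0..t}|lborel. exp (- ((t - s) * R)) * 1) = (\<integral>\<^sup>+ s. exp_kernel R (t - s) * (indicator {0..} s * ennreal 1) \<partial>lborel)"
    by (rule exp_set_integral_eq_nn[where K=1]) (use assms in auto)
  also have "\<dots> \<le> (\<integral>\<^sup>+ s. exp_kernel R (t - s) \<partial>lborel)"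
    by (intro nn_integral_mono) (auto simp: indicator_def)
  also have "\<dots> = ennreal (1 / R)" by (rule nn_integral_exp_kernel_reflect[OF assms])
  finally show ?thesis using assms by (simp add: ennreal_le_iff)
qed

lemma mult_exp_le: "(y::real) * exp (- y) \<le> 1"
proof -
  have "y \<le> exp y" using exp_ge_add_one_self[of y] by linarith
  then show ?thesis by (simp add: exp_minus field_simps)
qed

text \<open>Half of the exponent pays for the factor \<open>r\<close>, by
  \<open>y * exp (- y) \<le> 1\<close> at \<open>y = r * R / 2\<close>.\<close>

lemma mult_exp_le_half:
  fixes R r :: real
  assumes "R > 0" shows "r * exp (- (r * R)) \<le> 2 / R * exp (- (r * (R / 2)))"
proof -
  have "(r * R / 2) * exp (- (r * R / 2)) \<le> 1" by (rule mult_exp_le)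
  then have "(r * R / 2) * exp (- (r * R / 2)) * exp (- (r * R / 2)) \<le> 1 * exp (- (r * R / 2))"
    by (rule mult_right_mono) simp
  also have "(r * R / 2) * exp (- (r * R / 2)) * exp (- (r * R / 2)) = (r * R / 2) * exp (- (r * R))"
    by (simp add: mult.assoc exp_add[symmetric])
  finally show ?thesis using assms by (simp add: field_simps)
qed

text \<open>To be read with \<open>x = \<bar>\<xi>\<bar>\<close>,
  \<open>R = Re (\<psi> \<xi>)\<close>, \<open>u\<close> the modulus of the characteristic function
  and \<open>v\<close> that of the weighted one. The factor \<open>t\<close> is written as
  \<open>(t - s) + s\<close> under the integral. The part with \<open>t - s\<close> is tamed by the
  kernel and the crude bound \<open>v \<le> K\<close>, and is of order \<open>1 / x\<close>. The
  part with \<open>s\<close> is the convolution of \<open>s * v s\<close>; its norm carries the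
  factor \<open>x / R \<le> 1 / N\<close>, which is what can be made small.\<close>

lemma duhamel_weighted_L2:
  fixes u v :: "real \<Rightarrow> real"
  assumes [measurable]: "v \<in> borel_measurable borel" "u \<in> borel_measurable borel"
    and v: "\<And>s. 0 \<le> s \<Longrightarrow> 0 \<le> v s \<and> v s \<le> K"
    and u0: "\<And>s. 0 \<le> s \<Longrightarrow> 0 \<le> u s"
    and u: "\<And>t. 0 \<le> t \<Longrightarrow> t \<le> T \<Longrightarrow> u t \<le> exp (- (t * R)) + x * (LINT s:{0..t}|lborel. exp (- ((t - s) * R)) * v s)"
    and x: "0 < x" and N: "0 < N" "N * x \<le> R" and T: "0 \<le> T"
  shows "(\<integral>\<^sup>+ t. indicator {0..T} t * ennreal ((t * u t)\<^sup>2) \<partial>lborel) \<le>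
    ennreal (2 * T * (1 / N + 4 * K / N\<^sup>2)\<^sup>2 / x\<^sup>2) + ennreal (2 / N\<^sup>2) * (\<integral>\<^sup>+ s. indicator {0..T} s * ennreal ((s * v s)\<^sup>2) \<partial>lborel)"
proof -
  \<comment> \<open>\<open>1 / N\<close> comes from the initial term,
    \<open>t * exp (- (t * R)) \<le> 1 / R\<close>. The summand \<open>4 * K / N^2\<close> comes
    from the part with \<open>t - s\<close>: a factor \<open>2 / R\<close> from
    \<open>mult_exp_le_half\<close> and another \<open>2 / R\<close> from integrating the kernel of
    rate \<open>R / 2\<close>.\<close>
  define C where "C = 1 / N + 4 * K / N\<^sup>2"
  have R: "R > 0" using x N by (meson less_le_trans mult_pos_pos)
  have K: "0 \<le> K" using v[of 0] by linarith
  have C: "0 \<le> C" using N K by (simp add: C_def)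
  define W where "W t = (LINT s:{0..t}|lborel. exp (- ((t - s) * R)) * (s * v s))" for t
  have W_nn: "ennreal (W t) = (\<integral>\<^sup>+ s. exp_kernel R (t - s) * (indicator {0..} s * ennreal (s * v s)) \<partial>lborel)" if "0 \<le> t" for t
    unfolding W_def
  proof (rule exp_set_integral_eq_nn[OF _ _ R, where K="t * K"])
    show "0 \<le> s * v s \<and> s * v s \<le> t * K" if "0 \<le> s" "s \<le> t" for s
      using that v[of s] by (auto intro!: mult_mono)
  qed measurable
  have W0: "0 \<le> W t" for t
    unfolding W_def set_lebesgue_integral_def by (intro Bochner_Integration.integral_nonneg) (use v in \<open>auto simp: indicator_def\<close>)
  have pt: "t * u t \<le> C / x + x * W t" if t: "0 \<le> t" "t \<le> T" for t
  proof -
    have e: "0 \<le> exp (- ((t - s) * R)) * v s \<and> exp (- ((t - s) * R)) * v s \<le> K" if "s \<in> {0..t}" for s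
    proof -
      have "exp (- ((t - s) * R)) * v s \<le> 1 * K"
        using that v[of s] R by (intro mult_mono) auto
      then show ?thesis using v[of s] that by auto
    qed
    have i1: "set_integrable lborel {0..t} (\<lambda>s. exp (- ((t - s) * R)) * (s * v s))"
    proof (rule bounded_set_integrable[of _ _ 0 t "t * K"])
      fix s assume s: "s \<in> {0..t}"
      have "s * (exp (- ((t - s) * R)) * v s) \<le> t * K"
        using e[OF s] s by (intro mult_mono) auto
      then show "norm (exp (- ((t - s) * R)) * (s * v s)) \<le> t * K" using e[OF s] v[of s] s by (simp add: abs_mult mult_ac)
    qed auto
    have i2: "set_integrable lborel {0..t} (\<lambda>s. (t - s) * exp (- ((t - s) * R)) * v s)"
    proof (rule bounded_set_integrable[of _ _ 0 t "t * K"])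
      fix s assume s: "s \<in> {0..t}"
      have "(t - s) * (exp (- ((t - s) * R)) * v s) \<le> t * K"
        using e[OF s] s by (intro mult_mono) auto
      then show "norm ((t - s) * exp (- ((t - s) * R)) * v s) \<le> t * K" using e[OF s] v[of s] s by (simp add: abs_mult mult_ac)
    qed auto
    have i3: "set_integrable lborel {0..t} (\<lambda>s. (2 * K / R) * exp (- ((t - s) * (R / 2))))"
      using R K by (intro bounded_set_integrable[of _ _ 0 t "2 * K / R"]) (auto simp: abs_mult divide_right_mono mult_left_le)
    have "t * u t \<le> t * (exp (- (t * R)) + x * (LINT s:{0..t}|lborel. exp (- ((t - s) * R)) * v s))"
      using t u by (intro mult_left_mono) auto
    also have "\<dots> = t * exp (- (t * R)) + x * (LINT s:{0..t}|lborel. t * (exp (- ((t - s) * R)) * v s))"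
      by (simp add: algebra_simps)
    also have "(LINT s:{0..t}|lborel. t * (exp (- ((t - s) * R)) * v s)) =
       (LINT s:{0..t}|lborel. (t - s) * exp (- ((t - s) * R)) * v s) + W t"
      unfolding W_def by (subst set_integral_add(2)[OF i2 i1, symmetric]) (simp add: algebra_simps)
    also have "(LINT s:{0..t}|lborel. (t - s) * exp (- ((t - s) * R)) * v s) \<le> (LINT s:{0..t}|lborel. (2 * K / R) * exp (- ((t - s) * (R / 2))))"
    proof (rule set_integral_mono[OF i2 i3])
      fix s assume s: "s \<in> {0..t}"
      have "(t - s) * exp (- ((t - s) * R)) * v s \<le> (2 / R * exp (- ((t - s) * (R / 2)))) * K"
        using s v[of s] R by (intro mult_mono mult_exp_le_half) auto
      then show "(t - s) * exp (- ((t - s) * R)) * v s \<le> (2 * K / R) * exp (- ((t - s) * (R / 2)))"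
        by (simp add: algebra_simps)
    qed
    also have "(LINT s:{0..t}|lborel. (2 * K / R) * exp (- ((t - s) * (R / 2)))) = (2 * K / R) * (LINT s:{0..t}|lborel. exp (- ((t - s) * (R / 2))))"
      by (rule set_integral_mult_right)
    also have "\<dots> \<le> (2 * K / R) * (1 / (R / 2))"
      using R K by (intro mult_left_mono exp_set_integral_le) auto
    also have "t * exp (- (t * R)) \<le> 1 / R"
      using mult_exp_le[of "t * R"] R by (simp add: field_simps)
    finally have 1: "t * u t \<le> 1 / R + x * (2 * K / R * (1 / (R / 2)) + W t)"
      using x by (simp add: mult_left_mono)
    have "1 / R \<le> 1 / (N * x)" using N x R by (intro divide_left_mono) auto
    moreover have "x * (4 * K / (R * R)) \<le> x * (4 * K / ((N * x) * (N * x)))"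
      using N x R K by (intro mult_left_mono divide_left_mono mult_mono) auto
    ultimately have "1 / R + x * (2 * K / R * (1 / (R / 2))) \<le> 1 / (N * x) + x * (4 * K / ((N * x) * (N * x)))"
      by simp
    also have "\<dots> = C / x" using N x by (simp add: C_def field_simps power2_eq_square)
    finally show ?thesis using 1 by (simp add: algebra_simps)
  qed
  have sq: "(t * u t)\<^sup>2 \<le> 2 * C\<^sup>2 / x\<^sup>2 + 2 * x\<^sup>2 * (W t)\<^sup>2" if t: "0 \<le> t" "t \<le> T" for t
  proof -
    have "(t * u t)\<^sup>2 \<le> (C / x + x * W t)\<^sup>2"
      using pt[OF t] u0[of t] t by (intro power_mono) auto
    also have "\<dots> \<le> 2 * (C / x)\<^sup>2 + 2 * (x * W t)\<^sup>2"
      using sum_squares_bound[of "C / x" "x * W t"] by (simp add: power2_sum)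
    finally show ?thesis by (simp add: power_divide power_mult_distrib)
  qed
  have "(\<integral>\<^sup>+ t. indicator {0..T} t * ennreal ((t * u t)\<^sup>2) \<partial>lborel) \<le>
     (\<integral>\<^sup>+ t. ennreal (2 * C\<^sup>2 / x\<^sup>2) * indicator {0..T} t + ennreal (2 * x\<^sup>2) * (indicator {0..T} t * (\<integral>\<^sup>+ s. exp_kernel R (t - s) * (indicator {0..} s * ennreal (s * v s)) \<partial>lborel)\<^sup>2) \<partial>lborel)"
  proof (rule nn_integral_mono)
    fix t :: real
    show "indicator {0..T} t * ennreal ((t * u t)\<^sup>2) \<le> ennreal (2 * C\<^sup>2 / x\<^sup>2) * indicator {0..T} t + ennreal (2 * x\<^sup>2) * (indicator {0..T} t * (\<integral>\<^sup>+ s. exp_kernel R (t - s) * (indicator {0..} s * ennreal (s * v s)) \<partial>lborel)\<^sup>2)"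
    proof (cases "t \<in> {0..T}")
      case True
      then have "ennreal ((t * u t)\<^sup>2) \<le> ennreal (2 * C\<^sup>2 / x\<^sup>2 + 2 * x\<^sup>2 * (W t)\<^sup>2)"
        by (intro ennreal_leI sq) auto
      also have "\<dots> = ennreal (2 * C\<^sup>2 / x\<^sup>2) + ennreal (2 * x\<^sup>2) * (ennreal (W t))\<^sup>2"
        using W0[of t] by (simp add: ennreal_plus ennreal_mult ennreal_power)
      finally show ?thesis using True by (simp add: W_nn)
    qed simp
  qed
  also have "\<dots> = ennreal (2 * C\<^sup>2 / x\<^sup>2) * ennreal T + ennreal (2 * x\<^sup>2) * (\<integral>\<^sup>+ t. indicator {0..T} t * (\<integral>\<^sup>+ s. exp_kernel R (t - s) * (indicator {0..} s * ennreal (s * v s)) \<partial>lborel)\<^sup>2 \<partial>lborel)"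
    using T by (simp add: nn_integral_add nn_integral_cmult)
  also have "\<dots> \<le> ennreal (2 * C\<^sup>2 / x\<^sup>2) * ennreal T + ennreal (2 * x\<^sup>2) * (ennreal (1 / R\<^sup>2) * (\<integral>\<^sup>+ s. indicator {0..T} s * (ennreal (s * v s))\<^sup>2 \<partial>lborel))"
    using R by (intro add_left_mono mult_left_mono exp_kernel_convolution_L2) auto
  also have "(\<integral>\<^sup>+ s. indicator {0..T} s * (ennreal (s * v s))\<^sup>2 \<partial>lborel) = (\<integral>\<^sup>+ s. indicator {0..T} s * ennreal ((s * v s)\<^sup>2) \<partial>lborel)"
    using v by (intro nn_integral_cong) (auto simp: indicator_def ennreal_power)
  also have "ennreal (2 * x\<^sup>2) * (ennreal (1 / R\<^sup>2) * (\<integral>\<^sup>+ s. indicator {0..T} s * ennreal ((s * v s)\<^sup>2) \<partial>lborel)) =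
     ennreal (2 * x\<^sup>2 / R\<^sup>2) * (\<integral>\<^sup>+ s. indicator {0..T} s * ennreal ((s * v s)\<^sup>2) \<partial>lborel)"
    by (simp add: mult.assoc[symmetric] ennreal_mult[symmetric])
  also have "\<dots> \<le> ennreal (2 / N\<^sup>2) * (\<integral>\<^sup>+ s. indicator {0..T} s * ennreal ((s * v s)\<^sup>2) \<partial>lborel)"
  proof (intro mult_right_mono ennreal_leI)
    have "(N * x)\<^sup>2 \<le> R\<^sup>2" using N x by (intro power_mono) auto
    then show "2 * x\<^sup>2 / R\<^sup>2 \<le> 2 / N\<^sup>2" using N R by (simp add: field_simps power_mult_distrib)
  qed simp
  also have "ennreal (2 * C\<^sup>2 / x\<^sup>2) * ennreal T = ennreal (2 * T * C\<^sup>2 / x\<^sup>2)"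
    using T by (simp add: ennreal_mult[symmetric] mult_ac)
  finally show ?thesis by (simp add: C_def add_left_mono)
qed

section \<open>The occupation bound\<close>

text \<open>In this shape a jointly measurable process can be registered as a measurability rule,
  which then applies under arbitrary substitutions for time and sample point.\<close>

lemma measurable_joint_comp:
  assumes "(\<lambda>p. X (fst p) (snd p)) \<in> measurable (M \<Otimes>\<^sub>M N) L" "f \<in> measurable Q M" "g \<in> measurable Q N"
  shows "(\<lambda>x. X (f x) (g x)) \<in> measurable Q L"
  using measurable_compose[OF measurable_Pair[OF assms(2,3)] assms(1)] by simp

text \<open>Evaluated at the next grid point to the right, capped at \<open>T\<close>, the process
  is measurable and involves values up to time \<open>T\<close> only; right continuity gives the
  limit. The cap allows \<open>G = F T\<close>, which is progressive measurability.\<close>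

lemma right_continuous_stopped_measurable:
  fixes X :: "real \<Rightarrow> 'a \<Rightarrow> real"
  assumes X: "\<And>t. t \<le> T \<Longrightarrow> X t \<in> borel_measurable G"
    and right: "\<And>t \<omega>. \<omega> \<in> space G \<Longrightarrow> continuous (at_right t) (\<lambda>t. X t \<omega>)"
  shows "(\<lambda>p. X (min T (fst p)) (snd p)) \<in> borel_measurable (borel \<Otimes>\<^sub>M G)"
proof (rule borel_measurable_LIMSEQ_metric)
  let ?d = "\<lambda>n t. (real_of_int \<lfloor>real (Suc n) * t\<rfloor> + 1) / real (Suc n)"
  fix n
  show "(\<lambda>p. X (min T (?d n (fst p))) (snd p)) \<in> borel_measurable (borel \<Otimes>\<^sub>M G)"
  proof (rule measurable_compose_countable[where g="\<lambda>p. \<lfloor>real (Suc n) * fst p\<rfloor>" and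
      f="\<lambda>k p. X (min T ((real_of_int k + 1) / real (Suc n))) (snd p)"])
    fix k :: int
    have "X (min T ((real_of_int k + 1) / real (Suc n))) \<in> borel_measurable G"
      by (rule X) simp
    then show "(\<lambda>p. X (min T ((real_of_int k + 1) / real (Suc n))) (snd p)) \<in> borel_measurable (borel \<Otimes>\<^sub>M G)"
      by measurable
  qed measurable
next
  let ?d = "\<lambda>n t. (real_of_int \<lfloor>real (Suc n) * t\<rfloor> + 1) / real (Suc n)"
  fix p :: "real \<times> 'a" assume "p \<in> space (borel \<Otimes>\<^sub>M G)"
  then obtain t \<omega> where p: "p = (t, \<omega>)" "\<omega> \<in> space G" by (cases p) (auto simp: space_pair_measure)
  \<comment> \<open>The \<open>+ 1\<close> keeps the grid point strictly to the right of
    \<open>t\<close>, also when \<open>t\<close> itself lies on the grid, as convergence along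
    \<open>at_right\<close> demands.\<close>
  have gt: "t < ?d n t" for n
    by (simp add: pos_less_divide_eq mult.commute)
  have le: "?d n t \<le> t + 1 / real (Suc n)" for n
  proof -
    have "?d n t \<le> (real (Suc n) * t + 1) / real (Suc n)"
      by (intro divide_right_mono add_right_mono of_int_floor_le) simp
    also have "\<dots> = t + 1 / real (Suc n)"
      by (simp add: add_divide_distrib del: of_nat_Suc)
    finally show ?thesis .
  qed
  have lim: "(\<lambda>n. ?d n t) \<longlonglongrightarrow> t"
  proof (rule tendsto_sandwich[where f="\<lambda>_. t" and h="\<lambda>n. t + 1 / real (Suc n)"])
    show "(\<lambda>n. t + 1 / real (Suc n)) \<longlonglongrightarrow> t"
      using tendsto_add[OF tendsto_const LIMSEQ_inverse_real_of_nat, of t] by (simp add: inverse_eq_divide)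
  qed (intro always_eventually allI less_imp_le[OF gt] le tendsto_const)+
  show "(\<lambda>n. X (min T (?d n (fst p))) (snd p)) \<longlonglongrightarrow> X (min T (fst p)) (snd p)"
  proof (cases "t < T")
    case True
    have "filterlim (\<lambda>n. ?d n t) (at_right t) sequentially"
      unfolding filterlim_at using lim gt gt[THEN less_imp_neq, symmetric]
      by (simp del: of_nat_Suc)
    moreover have "((\<lambda>t. X t \<omega>) \<longlongrightarrow> X t \<omega>) (at_right t)"
      using right[OF p(2), of t] by (simp add: continuous_within)
    ultimately have "(\<lambda>n. X (?d n t) \<omega>) \<longlonglongrightarrow> X t \<omega>"
      using filterlim_compose by blast
    moreover have "\<forall>\<^sub>F n in sequentially. ?d n t < T"
      using order_tendstoD(2)[OF lim True] .
    then have "\<forall>\<^sub>F n in sequentially. X (?d n t) \<omega> = X (min T (?d n t)) \<omega>"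
      by eventually_elim (auto simp: min_def)
    ultimately show ?thesis
      using True p by (auto simp: min_absorb2 elim: Lim_transform_eventually)
  next
    case False
    then have "min T (?d n t) = T" for n using gt[of n] by simp
    then show ?thesis using False p by simp
  qed
qed

lemma right_continuous_measurable:
  fixes X :: "real \<Rightarrow> 'a \<Rightarrow> real"
  assumes X: "\<And>t. X t \<in> borel_measurable G"
    and right: "\<And>t \<omega>. \<omega> \<in> space G \<Longrightarrow> continuous (at_right t) (\<lambda>t. X t \<omega>)"
  shows "(\<lambda>p. X (fst p) (snd p)) \<in> borel_measurable (borel \<Otimes>\<^sub>M G)"
proof (rule borel_measurable_LIMSEQ_metric)
  show "(\<lambda>p. X (min (real n) (fst p)) (snd p)) \<in> borel_measurable (borel \<Otimes>\<^sub>M G)" for n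
    by (rule right_continuous_stopped_measurable[OF X right])
  fix p :: "real \<times> 'a"
  have "\<forall>\<^sub>F n in sequentially. fst p \<le> real n"
    using eventually_ge_at_top[of "nat \<lceil>fst p\<rceil>"] by eventually_elim linarith
  then have "\<forall>\<^sub>F n in sequentially. X (min (real n) (fst p)) (snd p) = X (fst p) (snd p)"
    by eventually_elim (simp add: min_absorb2)
  then show "(\<lambda>n. X (min (real n) (fst p)) (snd p)) \<longlonglongrightarrow> X (fst p) (snd p)"
    by (rule tendsto_eventually)
qed

lemma nn_integral_inverse_square_tail:
  assumes "\<rho> > 0"
  shows "(\<integral>\<^sup>+ \<xi>. indicator {x. \<rho> \<le> \<bar>x\<bar>} \<xi> * ennreal (1 / \<xi>\<^sup>2) \<partial>lborel) \<le> ennreal (2 / \<rho>)"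
proof -
  have 1: "(\<integral>\<^sup>+ \<xi>. ennreal (1 / \<xi>\<^sup>2) * indicator {\<rho>..} \<xi> \<partial>lborel) = ennreal (0 - (- 1 / \<rho>))"
  proof (rule nn_integral_FTC_atLeast)
    show "((\<lambda>x::real. - 1 / x) \<longlongrightarrow> 0) at_top"
      by (rule tendsto_divide_0[OF tendsto_const]) (simp add: filterlim_at_top_imp_at_infinity filterlim_ident)
    fix x assume "\<rho> \<le> x"
    then show "((\<lambda>x. - 1 / x) has_real_derivative 1 / x\<^sup>2) (at x)"
      using assms by (auto intro!: derivative_eq_intros simp: power2_eq_square)
  qed auto
  have 2: "(\<integral>\<^sup>+ \<xi>. ennreal (1 / \<xi>\<^sup>2) * indicator {\<rho>..} (- \<xi>) \<partial>lborel) = (\<integral>\<^sup>+ \<xi>. ennreal (1 / \<xi>\<^sup>2) * indicator {\<rho>..} \<xi> \<partial>lborel)"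
    by (subst nn_integral_real_affine[where c="-1" and t=0 and f="\<lambda>\<xi>. ennreal (1 / \<xi>\<^sup>2) * indicator {\<rho>..} \<xi>"]) auto
  have "(\<integral>\<^sup>+ \<xi>. indicator {x. \<rho> \<le> \<bar>x\<bar>} \<xi> * ennreal (1 / \<xi>\<^sup>2) \<partial>lborel) \<le>
     (\<integral>\<^sup>+ \<xi>. ennreal (1 / \<xi>\<^sup>2) * indicator {\<rho>..} \<xi> + ennreal (1 / \<xi>\<^sup>2) * indicator {\<rho>..} (- \<xi>) \<partial>lborel)"
    by (intro nn_integral_mono) (auto simp: indicator_def abs_real_def split: if_splits)
  also have "\<dots> = ennreal (1 / \<rho>) + ennreal (1 / \<rho>)"
    using 1 2 by (subst nn_integral_add) auto
  also have "\<dots> = ennreal (2 / \<rho>)" using assms by (simp flip: ennreal_plus)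
  finally show ?thesis .
qed

context levy_driver
begin

text \<open>The drift rate \<open>b\<close> and its integral \<open>A\<close> are bound
  existentially, because the occupation estimate has to be uniform over all of them and may see the
  rate only through its bound \<open>K\<close>.\<close>

definition drifted :: "real \<Rightarrow> real \<Rightarrow> (real \<Rightarrow> 'a \<Rightarrow> real) \<Rightarrow> bool" where
  "drifted K x0 X \<longleftrightarrow> (\<exists>b A.
     (\<lambda>p. b (fst p) (snd p)) \<in> borel_measurable (borel \<Otimes>\<^sub>M P) \<and> (\<forall>t. b t \<in> borel_measurable (F t)) \<and>
     (\<forall>t\<ge>0. \<forall>\<omega>\<in>space P. \<bar>b t \<omega>\<bar> \<le> K) \<and>
     (\<forall>t. \<forall>\<omega>\<in>space P. A t \<omega> = (LINT s:{0..t}|lborel. b s \<omega>)) \<and>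
     (\<lambda>p. A (fst p) (snd p)) \<in> borel_measurable (borel \<Otimes>\<^sub>M P) \<and> (\<forall>t. A t \<in> borel_measurable (F t)) \<and>
     (\<forall>t. \<forall>\<omega>\<in>space P. X t \<omega> = x0 + S t \<omega> + A t \<omega>))"

lemma S_joint_measurable [measurable]: "(\<lambda>p. S (fst p) (snd p)) \<in> borel_measurable (borel \<Otimes>\<^sub>M P)"
  by (rule right_continuous_measurable) (auto intro: S_right)

lemma drifted_joint_measurable:
  assumes "drifted K x0 X"
  shows "(\<lambda>p. X (fst p) (snd p)) \<in> borel_measurable (borel \<Otimes>\<^sub>M P)"
proof -
  obtain A where [measurable]: "(\<lambda>p. A (fst p) (snd p)) \<in> borel_measurable (borel \<Otimes>\<^sub>M P)"
    and X: "\<And>t \<omega>. \<omega> \<in> space P \<Longrightarrow> X t \<omega> = x0 + S t \<omega> + A t \<omega>"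
    using assms unfolding drifted_def by blast
  have "(\<lambda>p. x0 + S (fst p) (snd p) + A (fst p) (snd p)) \<in> borel_measurable (borel \<Otimes>\<^sub>M P)" by measurable
  then show ?thesis
    by (rule measurable_cong[THEN iffD1, rotated]) (auto simp: X space_pair_measure)
qed

end

locale smoothing_levy_driver = levy_driver +
  assumes growth: "\<And>N. \<exists>\<rho>. \<forall>\<xi>. \<rho> \<le> \<bar>\<xi>\<bar> \<longrightarrow> N * \<bar>\<xi>\<bar> \<le> Re (\<psi> \<xi>)"
begin

text \<open>The weight \<open>t\<close> makes the initial term \<open>exp (- t * \<psi> \<xi>)\<close> square integrable near \<open>t = 0\<close>. In Duhamel's formula
  the drift contributes at most a fraction \<open>2 * K\<^sup>2 / N\<^sup>2\<close> of the left-hand side, and the growth of \<open>Re \<psi>\<close> permits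
  \<open>N > 2 * K\<close>, so this term is absorbed; by the Gaussian factor the left-hand side is finite to begin with.\<close>
lemma char_drifted_L2:
  fixes K T :: real
  assumes K: "K > 0" and T: "T \<ge> 0"
  shows "\<exists>C\<ge>0. \<forall>x0 X \<sigma>. drifted K x0 X \<longrightarrow> 0 < \<sigma> \<longrightarrow>
    (\<integral>\<^sup>+ t. indicator {0..T} t * (\<integral>\<^sup>+ \<xi>. ennreal (std_normal_density (\<sigma> * \<xi>) * (t * cmod (CLINT \<omega>|P. iexp (\<xi> * X t \<omega>)))\<^sup>2) \<partial>lborel) \<partial>lborel) \<le> ennreal C"
proof -
  define N where "N = 2 * K + 1"
  have N: "N > 0" using K by (simp add: N_def)
  obtain \<rho>' where "\<forall>\<xi>. \<rho>' \<le> \<bar>\<xi>\<bar> \<longrightarrow> N * \<bar>\<xi>\<bar> \<le> Re (\<psi> \<xi>)" using growth by blast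
  define \<rho> where "\<rho> = max 1 \<rho>'"
  have \<rho>: "\<rho> > 0" "\<And>\<xi>. \<rho> \<le> \<bar>\<xi>\<bar> \<Longrightarrow> N * \<bar>\<xi>\<bar> \<le> Re (\<psi> \<xi>)"
    using \<open>\<forall>\<xi>. \<rho>' \<le> \<bar>\<xi>\<bar> \<longrightarrow> N * \<bar>\<xi>\<bar> \<le> Re (\<psi> \<xi>)\<close> by (auto simp: \<rho>_def)
  define D where "D = 2 * T * (1 / N + 4 * K / N\<^sup>2)\<^sup>2"
  have D: "0 \<le> D" using T by (simp add: D_def)
  \<comment> \<open>Frequencies below \<open>\<rho>\<close>, where \<open>Re (\<psi> \<xi>)\<close>
    is not under control, contribute at most \<open>T ^ 3\<close> each on a set of length
    \<open>2 * \<rho>\<close>. Above \<open>\<rho>\<close> the term \<open>D / \<xi>^2\<close>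
    integrates to at most \<open>D * (2 / \<rho>)\<close>.\<close>
  define C where "C = T ^ 3 * (2 * \<rho>) + D * (2 / \<rho>)"
  have C: "0 \<le> C" using T D \<rho> by (simp add: C_def)
  show ?thesis
  proof (intro exI[of _ "2 * C"] conjI allI impI)
    show "0 \<le> 2 * C" using C by simp
    fix x0 X and \<sigma> :: real
    assume drift: "drifted K x0 X" and \<sigma>: "0 < \<sigma>"
    obtain b A where b[measurable]: "(\<lambda>p. b (fst p) (snd p)) \<in> borel_measurable (borel \<Otimes>\<^sub>M P)"
      and ba: "\<And>t. b t \<in> borel_measurable (F t)"
      and bK: "\<And>t \<omega>. 0 \<le> t \<Longrightarrow> \<omega> \<in> space P \<Longrightarrow> \<bar>b t \<omega>\<bar> \<le> K"
      and A: "\<And>t \<omega>. \<omega> \<in> space P \<Longrightarrow> A t \<omega> = (LINT s:{0..t}|lborel. b s \<omega>)"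
      and Am: "(\<lambda>p. A (fst p) (snd p)) \<in> borel_measurable (borel \<Otimes>\<^sub>M P)"
      and Aa: "\<And>t. A t \<in> borel_measurable (F t)"
      and X: "\<And>t \<omega>. \<omega> \<in> space P \<Longrightarrow> X t \<omega> = x0 + S t \<omega> + A t \<omega>"
      using drift unfolding drifted_def by blast
    note X_joint = drifted_joint_measurable[OF drift]
    note [measurable (raw)] = measurable_joint_comp[OF X_joint] measurable_joint_comp[OF b]
    have [measurable]: "X t \<in> borel_measurable P" for t
      using measurable_compose[OF measurable_Pair1' X_joint, of t] by simp
    have [measurable]: "b t \<in> borel_measurable P" for t
      using ba by (rule adapted_measurable)
    define \<phi> where "\<phi> t \<xi> = (CLINT \<omega>|P. iexp (\<xi> * X t \<omega>))" for t \<xi>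
    define h where "h t \<xi> = (CLINT \<omega>|P. b t \<omega> * iexp (\<xi> * X t \<omega>))" for t \<xi>
    have \<phi>_meas: "(\<lambda>p. \<phi> (fst p) (snd p)) \<in> borel_measurable (borel \<Otimes>\<^sub>M borel)"
      unfolding \<phi>_def
      by (rule borel_measurable_lebesgue_integral) measurable
    note [measurable (raw)] = measurable_joint_comp[OF \<phi>_meas]
    have h_meas: "(\<lambda>p. h (fst p) (snd p)) \<in> borel_measurable (borel \<Otimes>\<^sub>M borel)"
      unfolding h_def
      by (rule borel_measurable_lebesgue_integral) measurable
    note [measurable (raw)] = measurable_joint_comp[OF h_meas]
    have \<phi>1: "cmod (\<phi> t \<xi>) \<le> 1" for t \<xi>
    proof -
      have "cmod (\<phi> t \<xi>) \<le> (LINT \<omega>|P. cmod (iexp (\<xi> * X t \<omega>)))"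
        unfolding \<phi>_def by (rule integral_norm_bound)
      also have "\<dots> = 1" by (simp add: prob_space)
      finally show ?thesis .
    qed
    have hK: "cmod (h t \<xi>) \<le> K" if t: "0 \<le> t" for t \<xi>
    proof -
      have "cmod (h t \<xi>) \<le> (LINT \<omega>|P. cmod (b t \<omega> * iexp (\<xi> * X t \<omega>)))"
        unfolding h_def by (rule integral_norm_bound)
      also have "\<dots> \<le> (LINT \<omega>|P. K)"
      proof (rule integral_mono)
        show "integrable P (\<lambda>\<omega>. cmod (b t \<omega> * iexp (\<xi> * X t \<omega>)))"
          by (rule integrable_const_bound[where B=K]) (use bK t in \<open>auto simp: norm_mult\<close>)
      qed (use bK t in \<open>auto simp: norm_mult\<close>)
      also have "\<dots> = K" by (simp add: prob_space)
      finally show ?thesis .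
    qed
    let ?\<gamma> = "\<lambda>\<xi>. std_normal_density (\<sigma> * \<xi>)"
    have \<gamma>1: "?\<gamma> \<xi> \<le> 1" for \<xi>
    proof -
      have "1 \<le> sqrt (2 * pi)" using pi_gt3 by simp
      then have "1 / sqrt (2 * pi) * exp (- (\<sigma> * \<xi>)\<^sup>2 / 2) \<le> 1 * 1"
        by (intro mult_mono) auto
      then show ?thesis by (simp add: std_normal_density_def)
    qed
    define G where "G \<xi> = (\<integral>\<^sup>+ t. indicator {0..T} t * ennreal ((t * cmod (\<phi> t \<xi>))\<^sup>2) \<partial>lborel)" for \<xi>
    define H where "H \<xi> = (\<integral>\<^sup>+ t. indicator {0..T} t * ennreal ((t * cmod (h t \<xi>))\<^sup>2) \<partial>lborel)" for \<xi>
    have [measurable]: "G \<in> borel_measurable borel" "H \<in> borel_measurable borel"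
      unfolding G_def H_def by measurable
    have G_small: "G \<xi> \<le> ennreal (T ^ 3)" for \<xi>
    proof -
      have "G \<xi> \<le> (\<integral>\<^sup>+ t. ennreal (T\<^sup>2) * indicator {0..T} t \<partial>lborel)"
        unfolding G_def
      proof (rule nn_integral_mono)
        fix t :: real
        show "indicator {0..T} t * ennreal ((t * cmod (\<phi> t \<xi>))\<^sup>2) \<le> ennreal (T\<^sup>2) * indicator {0..T} t"
        proof (cases "t \<in> {0..T}")
          case True
          then have "t * cmod (\<phi> t \<xi>) \<le> T * 1" by (intro mult_mono \<phi>1) auto
          with True show ?thesis by (auto intro!: ennreal_leI power_mono)
        qed simp
      qed
      also have "\<dots> = ennreal (T ^ 3)"
        using T by (simp add: nn_integral_cmult ennreal_mult[symmetric] power3_eq_cube power2_eq_square)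
      finally show ?thesis .
    qed
    have G_large: "G \<xi> \<le> ennreal (D / \<xi>\<^sup>2) + ennreal (2 / N\<^sup>2) * H \<xi>" if \<xi>: "\<rho> \<le> \<bar>\<xi>\<bar>" for \<xi>
    proof -
      have "G \<xi> \<le> ennreal (2 * T * (1 / N + 4 * K / N\<^sup>2)\<^sup>2 / \<bar>\<xi>\<bar>\<^sup>2) + ennreal (2 / N\<^sup>2) * H \<xi>"
        unfolding G_def H_def
      proof (rule duhamel_weighted_L2[where R="Re (\<psi> \<xi>)"])
        fix t assume t: "0 \<le> t" "t \<le> T"
        let ?R = "Re (\<psi> \<xi>)"
        have i: "set_integrable lborel {0..t} (\<lambda>s. \<i> * \<xi> * h s \<xi> * exp (- complex_of_real (t - s) * \<psi> \<xi>))"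
        proof (rule bounded_set_integrable[of _ _ 0 t "\<bar>\<xi>\<bar> * K * 1"])
          fix s assume s: "s \<in> {0..t}"
          have "0 \<le> ?R" using \<rho> \<xi> N by (meson abs_ge_zero dual_order.trans mult_nonneg_nonneg less_imp_le)
          then have "cmod (exp (- complex_of_real (t - s) * \<psi> \<xi>)) \<le> 1" using s by (auto simp: mult_nonpos_nonneg)
          then show "norm (\<i> * \<xi> * h s \<xi> * exp (- complex_of_real (t - s) * \<psi> \<xi>)) \<le> \<bar>\<xi>\<bar> * K * 1"
            unfolding norm_mult using hK[of s \<xi>] s K by (intro mult_mono) auto
        qed auto
        have "\<phi> t \<xi> = iexp (\<xi> * x0) * exp (- complex_of_real t * \<psi> \<xi>) +
            (CLINT s:{0..t}|lborel. \<i> * \<xi> * h s \<xi> * exp (- complex_of_real (t - s) * \<psi> \<xi>))"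
          unfolding \<phi>_def h_def
          by (rule char_drifted[OF b ba bK A Am Aa X t(1)])
        then have "cmod (\<phi> t \<xi>) \<le> cmod (iexp (\<xi> * x0) * exp (- complex_of_real t * \<psi> \<xi>)) +
            cmod (CLINT s:{0..t}|lborel. \<i> * \<xi> * h s \<xi> * exp (- complex_of_real (t - s) * \<psi> \<xi>))"
          by (simp only: norm_triangle_ineq)
        also have "cmod (iexp (\<xi> * x0) * exp (- complex_of_real t * \<psi> \<xi>)) = exp (- (t * ?R))"
          by (simp add: norm_mult)
        also have "cmod (CLINT s:{0..t}|lborel. \<i> * \<xi> * h s \<xi> * exp (- complex_of_real (t - s) * \<psi> \<xi>))
            \<le> (LINT s:{0..t}|lborel. cmod (\<i> * \<xi> * h s \<xi> * exp (- complex_of_real (t - s) * \<psi> \<xi>)))"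
          by (rule set_integral_norm_bound[OF i])
        also have "\<dots> = (LINT s:{0..t}|lborel. \<bar>\<xi>\<bar> * (exp (- ((t - s) * ?R)) * cmod (h s \<xi>)))"
          by (simp add: norm_mult algebra_simps)
        also have "\<dots> = \<bar>\<xi>\<bar> * (LINT s:{0..t}|lborel. exp (- ((t - s) * ?R)) * cmod (h s \<xi>))"
          by (rule set_integral_mult_right)
        finally show "cmod (\<phi> t \<xi>) \<le> exp (- (t * ?R)) + \<bar>\<xi>\<bar> * (LINT s:{0..t}|lborel. exp (- ((t - s) * ?R)) * cmod (h s \<xi>))"
          by simp
      qed (use \<xi> \<rho> N T hK in auto)
      then show ?thesis by (simp add: D_def)
    qed
    \<comment> \<open>The bound of \<open>h\<close> by \<open>K\<close> times \<open>\<phi>\<close>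
      is available only at fixed time and after Gaussian averaging over \<open>\<xi>\<close>. Hence
      the integrals are interchanged, the bound is applied for each \<open>t\<close>, and the order
      is restored.\<close>
    have HG: "(\<integral>\<^sup>+ \<xi>. ennreal (?\<gamma> \<xi>) * H \<xi> \<partial>lborel) \<le> ennreal (K\<^sup>2) * (\<integral>\<^sup>+ \<xi>. ennreal (?\<gamma> \<xi>) * G \<xi> \<partial>lborel)"
    proof -
      have swap: "(\<integral>\<^sup>+ \<xi>. ennreal (?\<gamma> \<xi>) * (\<integral>\<^sup>+ t. indicator {0..T} t * ennreal ((t * cmod (f t \<xi>))\<^sup>2) \<partial>lborel) \<partial>lborel) =
        (\<integral>\<^sup>+ t. indicator {0..T} t * (ennreal (t\<^sup>2) * (\<integral>\<^sup>+ \<xi>. ennreal (?\<gamma> \<xi> * (cmod (f t \<xi>))\<^sup>2) \<partial>lborel)) \<partial>lborel)"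
        if f: "(\<lambda>p. f (fst p) (snd p)) \<in> borel_measurable (borel \<Otimes>\<^sub>M borel)" for f :: "real \<Rightarrow> real \<Rightarrow> complex"
      proof -
        note [measurable (raw)] = measurable_joint_comp[OF f]
        have "(\<integral>\<^sup>+ \<xi>. ennreal (?\<gamma> \<xi>) * (\<integral>\<^sup>+ t. indicator {0..T} t * ennreal ((t * cmod (f t \<xi>))\<^sup>2) \<partial>lborel) \<partial>lborel) =
          (\<integral>\<^sup>+ \<xi>. (\<integral>\<^sup>+ t. indicator {0..T} t * (ennreal (t\<^sup>2) * ennreal (?\<gamma> \<xi> * (cmod (f t \<xi>))\<^sup>2)) \<partial>lborel) \<partial>lborel)"
          by (simp add: nn_integral_cmult[symmetric] power_mult_distrib ennreal_mult mult_ac)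
        also have "\<dots> = (\<integral>\<^sup>+ t. (\<integral>\<^sup>+ \<xi>. indicator {0..T} t * (ennreal (t\<^sup>2) * ennreal (?\<gamma> \<xi> * (cmod (f t \<xi>))\<^sup>2)) \<partial>lborel) \<partial>lborel)"
          by (rule lborel_pair.Fubini') measurable
        finally show ?thesis by (simp add: nn_integral_cmult)
      qed
      have int: "integrable lborel (\<lambda>\<xi>. ?\<gamma> \<xi> * (cmod (f \<xi>))\<^sup>2)"
        if [measurable]: "f \<in> borel_measurable borel" and f: "\<And>\<xi>. cmod (f \<xi>) \<le> L" for f :: "real \<Rightarrow> complex" and L
      proof (rule Bochner_Integration.integrable_bound)
        show "integrable lborel (\<lambda>\<xi>. L\<^sup>2 * ?\<gamma> \<xi>)"
          using std_normal_density_scaled_integrable[OF \<sigma>] by simp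
        show "AE \<xi> in lborel. norm (?\<gamma> \<xi> * (cmod (f \<xi>))\<^sup>2) \<le> norm (L\<^sup>2 * ?\<gamma> \<xi>)"
        proof (rule AE_I2)
          fix \<xi> :: real
          have "(cmod (f \<xi>))\<^sup>2 \<le> L\<^sup>2" using f[of \<xi>] by (intro power_mono) auto
          then show "norm (?\<gamma> \<xi> * (cmod (f \<xi>))\<^sup>2) \<le> norm (L\<^sup>2 * ?\<gamma> \<xi>)"
            by (simp add: abs_mult mult.commute[of "L\<^sup>2"] mult_left_mono)
        qed
      qed measurable
      have [measurable]: "\<phi> t \<in> borel_measurable borel" "h t \<in> borel_measurable borel" for t
        using measurable_compose[OF measurable_Pair1' \<phi>_meas, of t] measurable_compose[OF measurable_Pair1' h_meas, of t] by auto
      have key: "(\<integral>\<^sup>+ \<xi>. ennreal (?\<gamma> \<xi> * (cmod (h t \<xi>))\<^sup>2) \<partial>lborel) \<le> ennreal (K\<^sup>2) * (\<integral>\<^sup>+ \<xi>. ennreal (?\<gamma> \<xi> * (cmod (\<phi> t \<xi>))\<^sup>2) \<partial>lborel)"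
        if t: "0 \<le> t" for t
      proof -
        have "(\<integral>\<^sup>+ \<xi>. ennreal (?\<gamma> \<xi> * (cmod (h t \<xi>))\<^sup>2) \<partial>lborel) = ennreal (LBINT \<xi>. ?\<gamma> \<xi> * (cmod (h t \<xi>))\<^sup>2)"
          by (rule nn_integral_eq_integral[OF int[of _ K]]) (use hK t in auto)
        also have "\<dots> \<le> ennreal (K\<^sup>2 * (LBINT \<xi>. ?\<gamma> \<xi> * (cmod (\<phi> t \<xi>))\<^sup>2))"
          unfolding h_def \<phi>_def
          by (intro ennreal_leI gauss_weighted_char_le \<sigma> bK t) auto
        also have "\<dots> = ennreal (K\<^sup>2) * ennreal (LBINT \<xi>. ?\<gamma> \<xi> * (cmod (\<phi> t \<xi>))\<^sup>2)"
          by (rule ennreal_mult') simp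
        also have "ennreal (LBINT \<xi>. ?\<gamma> \<xi> * (cmod (\<phi> t \<xi>))\<^sup>2) = (\<integral>\<^sup>+ \<xi>. ennreal (?\<gamma> \<xi> * (cmod (\<phi> t \<xi>))\<^sup>2) \<partial>lborel)"
          by (rule nn_integral_eq_integral[OF int[of _ 1], symmetric]) (use \<phi>1 in auto)
        finally show ?thesis .
      qed
      have "(\<integral>\<^sup>+ \<xi>. ennreal (?\<gamma> \<xi>) * H \<xi> \<partial>lborel) =
        (\<integral>\<^sup>+ t. indicator {0..T} t * (ennreal (t\<^sup>2) * (\<integral>\<^sup>+ \<xi>. ennreal (?\<gamma> \<xi> * (cmod (h t \<xi>))\<^sup>2) \<partial>lborel)) \<partial>lborel)"
        unfolding H_def by (rule swap) measurable
      also have "\<dots> \<le> (\<integral>\<^sup>+ t. indicator {0..T} t * (ennreal (t\<^sup>2) * (ennreal (K\<^sup>2) * (\<integral>\<^sup>+ \<xi>. ennreal (?\<gamma> \<xi> * (cmod (\<phi> t \<xi>))\<^sup>2) \<partial>lborel))) \<partial>lborel)"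
        by (intro nn_integral_mono) (auto simp: indicator_def intro!: mult_left_mono key)
      also have "\<dots> = ennreal (K\<^sup>2) * (\<integral>\<^sup>+ t. indicator {0..T} t * (ennreal (t\<^sup>2) * (\<integral>\<^sup>+ \<xi>. ennreal (?\<gamma> \<xi> * (cmod (\<phi> t \<xi>))\<^sup>2) \<partial>lborel)) \<partial>lborel)"
        by (subst nn_integral_cmult[symmetric]) (auto simp: mult_ac)
      also have "(\<integral>\<^sup>+ t. indicator {0..T} t * (ennreal (t\<^sup>2) * (\<integral>\<^sup>+ \<xi>. ennreal (?\<gamma> \<xi> * (cmod (\<phi> t \<xi>))\<^sup>2) \<partial>lborel)) \<partial>lborel) =
        (\<integral>\<^sup>+ \<xi>. ennreal (?\<gamma> \<xi>) * G \<xi> \<partial>lborel)"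
        unfolding G_def by (rule swap[symmetric]) measurable
      finally show ?thesis .
    qed
    define J where "J = (\<integral>\<^sup>+ \<xi>. ennreal (?\<gamma> \<xi>) * G \<xi> \<partial>lborel)"
    have J_fin: "J < \<infinity>"
    proof -
      have "J \<le> (\<integral>\<^sup>+ \<xi>. ennreal (?\<gamma> \<xi>) * ennreal (T ^ 3) \<partial>lborel)"
        unfolding J_def by (intro nn_integral_mono mult_left_mono G_small) auto
      also have "\<dots> = (\<integral>\<^sup>+ \<xi>. ennreal (?\<gamma> \<xi>) \<partial>lborel) * ennreal (T ^ 3)"
        by (rule nn_integral_multc) measurable
      also have "(\<integral>\<^sup>+ \<xi>. ennreal (?\<gamma> \<xi>) \<partial>lborel) = ennreal (LBINT \<xi>. ?\<gamma> \<xi>)"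
        by (rule nn_integral_eq_integral[OF std_normal_density_scaled_integrable[OF \<sigma>]]) auto
      finally show ?thesis by (simp add: ennreal_mult_less_top less_top le_less_trans)
    qed
    have "J \<le> (\<integral>\<^sup>+ \<xi>. (ennreal (T ^ 3) * indicator {-\<rho>..\<rho>} \<xi> + ennreal D * (indicator {x. \<rho> \<le> \<bar>x\<bar>} \<xi> * ennreal (1 / \<xi>\<^sup>2))) + ennreal (2 / N\<^sup>2) * (ennreal (?\<gamma> \<xi>) * H \<xi>) \<partial>lborel)"
      unfolding J_def
    proof (rule nn_integral_mono)
      fix \<xi> :: real
      have le1: "ennreal (?\<gamma> \<xi>) * c \<le> c" for c :: ennreal
        using mult_right_mono[of "ennreal (?\<gamma> \<xi>)" 1 c] \<gamma>1[of \<xi>] by (simp add: ennreal_le_1)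
      show "ennreal (?\<gamma> \<xi>) * G \<xi> \<le> (ennreal (T ^ 3) * indicator {-\<rho>..\<rho>} \<xi> + ennreal D * (indicator {x. \<rho> \<le> \<bar>x\<bar>} \<xi> * ennreal (1 / \<xi>\<^sup>2))) + ennreal (2 / N\<^sup>2) * (ennreal (?\<gamma> \<xi>) * H \<xi>)"
      proof (cases "\<rho> \<le> \<bar>\<xi>\<bar>")
        case True
        have "ennreal (?\<gamma> \<xi>) * G \<xi> \<le> ennreal (?\<gamma> \<xi>) * (ennreal (D / \<xi>\<^sup>2) + ennreal (2 / N\<^sup>2) * H \<xi>)"
          by (intro mult_left_mono G_large True) auto
        also have "\<dots> = ennreal (?\<gamma> \<xi>) * ennreal (D / \<xi>\<^sup>2) + ennreal (2 / N\<^sup>2) * (ennreal (?\<gamma> \<xi>) * H \<xi>)"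
          by (simp add: distrib_left mult_ac)
        also have "\<dots> \<le> ennreal (D / \<xi>\<^sup>2) + ennreal (2 / N\<^sup>2) * (ennreal (?\<gamma> \<xi>) * H \<xi>)"
          by (intro add_right_mono le1)
        also have "ennreal (D / \<xi>\<^sup>2) = ennreal D * (indicator {x. \<rho> \<le> \<bar>x\<bar>} \<xi> * ennreal (1 / \<xi>\<^sup>2))"
          using True D by (simp add: ennreal_mult[symmetric])
        finally show ?thesis by (rule order_trans) (auto intro!: add_right_mono)
      next
        case False
        then have "\<xi> \<in> {-\<rho>..\<rho>}" by auto
        have "ennreal (?\<gamma> \<xi>) * G \<xi> \<le> G \<xi>" by (rule le1)
        also have "\<dots> \<le> ennreal (T ^ 3) * indicator {-\<rho>..\<rho>} \<xi>" using G_small[of \<xi>] \<open>\<xi> \<in> {-\<rho>..\<rho>}\<close> by simp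
        finally show ?thesis by (rule order_trans) (simp add: add.assoc)
      qed
    qed
    also have "\<dots> = (ennreal (T ^ 3) * ennreal (2 * \<rho>) + ennreal D * (\<integral>\<^sup>+ \<xi>. indicator {x. \<rho> \<le> \<bar>x\<bar>} \<xi> * ennreal (1 / \<xi>\<^sup>2) \<partial>lborel)) + ennreal (2 / N\<^sup>2) * (\<integral>\<^sup>+ \<xi>. ennreal (?\<gamma> \<xi>) * H \<xi> \<partial>lborel)"
      using \<rho>(1) by (simp add: nn_integral_add nn_integral_cmult)
    also have "\<dots> \<le> (ennreal (T ^ 3) * ennreal (2 * \<rho>) + ennreal D * ennreal (2 / \<rho>)) + ennreal (2 / N\<^sup>2) * (ennreal (K\<^sup>2) * J)"
      unfolding J_def by (intro add_mono mult_left_mono HG nn_integral_inverse_square_tail \<rho>) auto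
    also have "ennreal (T ^ 3) * ennreal (2 * \<rho>) + ennreal D * ennreal (2 / \<rho>) = ennreal C"
      unfolding C_def using T D \<rho>(1) by (simp add: ennreal_mult[symmetric] ennreal_plus[symmetric] del: ennreal_plus)
    finally have J1: "J \<le> ennreal C + ennreal (2 / N\<^sup>2) * (ennreal (K\<^sup>2) * J)" .
    obtain j where j: "J = ennreal j" "0 \<le> j" using J_fin by (cases J) auto
    have "ennreal j \<le> ennreal (C + 2 / N\<^sup>2 * (K\<^sup>2 * j))"
      using J1 j C by (simp add: ennreal_mult[symmetric] ennreal_plus[symmetric] del: ennreal_plus)
    then have "j \<le> C + 2 / N\<^sup>2 * (K\<^sup>2 * j)"
      using C j by (subst (asm) ennreal_le_iff) auto
    also have "2 / N\<^sup>2 * (K\<^sup>2 * j) \<le> 1 / 2 * j"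
    proof -
      have "(2 * K)\<^sup>2 \<le> N\<^sup>2" using K by (intro power_mono) (auto simp: N_def)
      then have "2 / N\<^sup>2 * K\<^sup>2 \<le> 1 / 2" using N by (simp add: field_simps)
      then show ?thesis using j(2) mult_right_mono[of "2 / N\<^sup>2 * K\<^sup>2" "1/2" j] by (simp add: mult.assoc)
    qed
    finally have "J \<le> ennreal (2 * C)" using j by (auto intro!: ennreal_leI)
    moreover have "(\<integral>\<^sup>+ t. indicator {0..T} t * (\<integral>\<^sup>+ \<xi>. ennreal (std_normal_density (\<sigma> * \<xi>) * (t * cmod (CLINT \<omega>|P. iexp (\<xi> * X t \<omega>)))\<^sup>2) \<partial>lborel) \<partial>lborel) = J"
    proof -
      have "(\<integral>\<^sup>+ t. indicator {0..T} t * (\<integral>\<^sup>+ \<xi>. ennreal (?\<gamma> \<xi> * (t * cmod (\<phi> t \<xi>))\<^sup>2) \<partial>lborel) \<partial>lborel) =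
        (\<integral>\<^sup>+ t. (\<integral>\<^sup>+ \<xi>. indicator {0..T} t * ennreal (?\<gamma> \<xi> * (t * cmod (\<phi> t \<xi>))\<^sup>2) \<partial>lborel) \<partial>lborel)"
        by (simp add: nn_integral_cmult)
      also have "\<dots> = (\<integral>\<^sup>+ \<xi>. (\<integral>\<^sup>+ t. indicator {0..T} t * ennreal (?\<gamma> \<xi> * (t * cmod (\<phi> t \<xi>))\<^sup>2) \<partial>lborel) \<partial>lborel)"
        by (rule lborel_pair.Fubini') measurable
      also have "\<dots> = J"
        unfolding J_def G_def by (simp add: nn_integral_cmult[symmetric] ennreal_mult mult_ac)
      finally show ?thesis by (simp add: \<phi>_def)
    qed
    ultimately show "(\<integral>\<^sup>+ t. indicator {0..T} t * (\<integral>\<^sup>+ \<xi>. ennreal (std_normal_density (\<sigma> * \<xi>) * (t * cmod (CLINT \<omega>|P. iexp (\<xi> * X t \<omega>)))\<^sup>2) \<partial>lborel) \<partial>lborel) \<le> ennreal (2 * C)"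
      by simp
  qed
qed

end

section \<open>Occupation bounds for continuous test functions\<close>

lemma nn_integral_Fatou_le:
  fixes u :: "nat \<Rightarrow> 'a \<Rightarrow> ennreal"
  assumes [measurable]: "\<And>n. u n \<in> borel_measurable M"
    and lim: "AE x in M. (\<lambda>n. u n x) \<longlonglongrightarrow> v x"
    and le: "\<And>n. (\<integral>\<^sup>+ x. u n x \<partial>M) \<le> C"
  shows "(\<integral>\<^sup>+ x. v x \<partial>M) \<le> C"
proof -
  have "(\<integral>\<^sup>+ x. v x \<partial>M) = (\<integral>\<^sup>+ x. liminf (\<lambda>n. u n x) \<partial>M)"
    using lim by (intro nn_integral_cong_AE) (auto simp: lim_imp_Liminf)
  also have "\<dots> \<le> liminf (\<lambda>n. (\<integral>\<^sup>+ x. u n x \<partial>M))"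
    by (rule nn_integral_liminf) measurable
  also have "\<dots> \<le> C" by (rule Liminf_le) (auto simp: le)
  finally show ?thesis .
qed

text \<open>A linear substitute for Cauchy-Schwarz: with \<open>\<alpha>\<close> left free, no
  square roots of possibly infinite integrals appear, and the inequality holds for
  \<open>b = top\<close> as well.\<close>

lemma ennreal_AM_GM:
  fixes b :: ennreal
  assumes \<alpha>: "0 < \<alpha>" and a: "0 \<le> a"
  shows "ennreal a * b \<le> ennreal \<alpha> * ennreal (a\<^sup>2) + ennreal (1 / \<alpha>) * b\<^sup>2"
proof (cases b)
  case (real r)
  have "0 \<le> (sqrt \<alpha> * a - r / sqrt \<alpha>)\<^sup>2" by simp
  then have "2 * (a * r) \<le> \<alpha> * a\<^sup>2 + 1 / \<alpha> * r\<^sup>2"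
    using \<alpha> by (simp add: power2_diff power_mult_distrib power_divide)
  then have "a * r \<le> \<alpha> * a\<^sup>2 + 1 / \<alpha> * r\<^sup>2"
    using a real mult_nonneg_nonneg[of a r] by linarith
  then have "ennreal (a * r) \<le> ennreal (\<alpha> * a\<^sup>2 + 1 / \<alpha> * r\<^sup>2)" by (rule ennreal_leI)
  also have "\<dots> = ennreal \<alpha> * ennreal (a\<^sup>2) + ennreal (1 / \<alpha>) * (ennreal r)\<^sup>2"
    using real \<alpha> by (subst ennreal_plus) (auto simp del: times_divide_eq_left simp: ennreal_mult ennreal_power)
  finally show ?thesis
    using real a by (simp add: ennreal_mult)
next
  case top
  then show ?thesis using \<alpha> by (simp add: ennreal_mult_top power2_eq_square ennreal_top_mult)
qed

lemma continuous_pair_comp_measurable: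
  fixes g :: "'b::second_countable_topology \<times> 'c::second_countable_topology \<Rightarrow> 'd::topological_space"
  assumes "continuous_on UNIV g" "f \<in> borel_measurable N" "h \<in> borel_measurable N"
  shows "(\<lambda>x. g (f x, h x)) \<in> borel_measurable N"
  using measurable_compose[OF borel_measurable_Pair[OF assms(2,3)] borel_measurable_continuous_onI[OF assms(1)]] .

text \<open>Plancherel for the law of \<open>X\<close> smoothed by a centred Gaussian of standard
  deviation \<open>\<sigma>\<close>. Its squared norm is an expectation over two independent copies,
  in which two Gaussians convolve to one of standard deviation
  \<open>sqrt (\<sigma>^2 + \<sigma>^2)\<close>; this is the kernel of
  \<open>gauss_integral_weighted_char\<close>, except for a factor \<open>1 / sqrt (2 * pi)\<close>
  that is estimated by 1.\<close>

lemma (in prob_space) mollified_density_L2: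
  fixes X :: "'a \<Rightarrow> real"
  assumes [measurable]: "X \<in> borel_measurable M" and \<sigma>: "0 < \<sigma>"
  shows "(\<integral>\<^sup>+ x. (\<integral>\<^sup>+ \<omega>. ennreal (normal_density 0 \<sigma> (x - X \<omega>)) \<partial>M)\<^sup>2 \<partial>lborel) \<le>
    (\<integral>\<^sup>+ \<xi>. ennreal (std_normal_density (sqrt (\<sigma>\<^sup>2 + \<sigma>\<^sup>2) * \<xi>) * (cmod (CLINT \<omega>|M. iexp (\<xi> * X \<omega>)))\<^sup>2) \<partial>lborel)"
proof -
  interpret P: pair_prob_space M M ..
  interpret Q: pair_sigma_finite "lborel :: real measure" M ..
  interpret Q2: pair_sigma_finite "lborel :: real measure" "M \<Otimes>\<^sub>M M" ..
  define s where "s = sqrt (\<sigma>\<^sup>2 + \<sigma>\<^sup>2)"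
  have s: "0 < s" using \<sigma> by (simp add: s_def)
  let ?n = "\<lambda>y. ennreal (normal_density 0 \<sigma> y)"
  have conv: "(\<integral>\<^sup>+ x. ?n (x - a) * ?n (x - b) \<partial>lborel) = ennreal (normal_density 0 s (a - b))" for a b :: real
  proof -
    have "(\<integral>\<^sup>+ x. ?n (x - a) * ?n (x - b) \<partial>lborel) = (\<integral>\<^sup>+ y. ?n ((b + 1 * y) - a) * ?n ((b + 1 * y) - b) \<partial>lborel)"
      by (subst nn_integral_real_affine[where c=1 and t=b]) auto
    also have "\<dots> = (\<integral>\<^sup>+ y. ennreal (normal_density 0 \<sigma> ((a - b) - y) * normal_density 0 \<sigma> y) \<partial>lborel)"
    proof (intro nn_integral_cong)
      fix y
      have "normal_density 0 \<sigma> (b + 1 * y - a) = normal_density 0 \<sigma> (a - b - y)"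
        by (simp add: normal_density_def power2_commute[of "b + y"] algebra_simps)
      then show "?n (b + 1 * y - a) * ?n (b + 1 * y - b) = ennreal (normal_density 0 \<sigma> (a - b - y) * normal_density 0 \<sigma> y)"
        by (simp add: ennreal_mult)
    qed
    also have "\<dots> = ennreal (normal_density 0 s (a - b))"
      using fun_cong[OF conv_normal_density_zero_mean[OF \<sigma> \<sigma>], of "a - b"] by (simp add: s_def)
    finally show ?thesis .
  qed
  have "(\<integral>\<^sup>+ x. (\<integral>\<^sup>+ \<omega>. ?n (x - X \<omega>) \<partial>M)\<^sup>2 \<partial>lborel) =
    (\<integral>\<^sup>+ x. (\<integral>\<^sup>+ \<omega>. (\<integral>\<^sup>+ \<omega>'. ?n (x - X \<omega>) * ?n (x - X \<omega>') \<partial>M) \<partial>M) \<partial>lborel)"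
    by (simp add: power2_eq_square nn_integral_cmult nn_integral_multc)
  also have "\<dots> = (\<integral>\<^sup>+ x. (\<integral>\<^sup>+ p. ?n (x - X (fst p)) * ?n (x - X (snd p)) \<partial>(M \<Otimes>\<^sub>M M)) \<partial>lborel)"
    by (intro nn_integral_cong) (subst sigma_finite_measure.nn_integral_fst[OF prob_space_imp_sigma_finite[OF prob_space_axioms], symmetric], auto)
  also have "\<dots> = (\<integral>\<^sup>+ p. (\<integral>\<^sup>+ x. ?n (x - X (fst p)) * ?n (x - X (snd p)) \<partial>lborel) \<partial>(M \<Otimes>\<^sub>M M))"
    by (rule Q2.Fubini'[symmetric]) measurable
  also have "\<dots> = (\<integral>\<^sup>+ p. ennreal (normal_density 0 s (X (fst p) - X (snd p))) \<partial>(M \<Otimes>\<^sub>M M))"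
    by (simp add: conv)
  also have "\<dots> \<le> (\<integral>\<^sup>+ p. ennreal (1 * 1 * (exp (- ((X (fst p) - X (snd p)) / s)\<^sup>2 / 2) / s)) \<partial>(M \<Otimes>\<^sub>M M))"
  proof (intro nn_integral_mono ennreal_leI)
    fix p
    have "1 \<le> sqrt (2 * pi)" using pi_gt3 by simp
    then have "1 * s \<le> sqrt (2 * pi) * s" using s by (intro mult_right_mono) auto
    then have "1 / (sqrt (2 * pi) * s) \<le> 1 / s" using s by (intro divide_left_mono) auto
    then have "1 / (sqrt (2 * pi) * s) * exp (- ((X (fst p) - X (snd p)) / s)\<^sup>2 / 2) \<le> 1 / s * exp (- ((X (fst p) - X (snd p)) / s)\<^sup>2 / 2)"
      by (rule mult_right_mono) simp
    moreover have "sqrt (2 * pi * s\<^sup>2) = sqrt (2 * pi) * s" using s by (simp add: real_sqrt_mult)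
    ultimately show "normal_density 0 s (X (fst p) - X (snd p)) \<le> 1 * 1 * (exp (- ((X (fst p) - X (snd p)) / s)\<^sup>2 / 2) / s)"
      by (simp add: normal_density_def power_divide mult.commute[of 2 "s\<^sup>2"])
  qed
  also have "\<dots> = ennreal (LINT p|(M \<Otimes>\<^sub>M M). 1 * 1 * (exp (- ((X (fst p) - X (snd p)) / s)\<^sup>2 / 2) / s))"
  proof (rule nn_integral_eq_integral)
    show "integrable (M \<Otimes>\<^sub>M M) (\<lambda>p. 1 * 1 * (exp (- ((X (fst p) - X (snd p)) / s)\<^sup>2 / 2) / s))"
      by (rule P.P.integrable_const_bound[where B="1 / s"]) (use s in \<open>auto simp: divide_right_mono\<close>)
  qed (use s in auto)
  also have "(LINT p|(M \<Otimes>\<^sub>M M). 1 * 1 * (exp (- ((X (fst p) - X (snd p)) / s)\<^sup>2 / 2) / s)) =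
    (LBINT \<xi>. std_normal_density (s * \<xi>) * (cmod (CLINT \<omega>|M. complex_of_real 1 * iexp (\<xi> * X \<omega>)))\<^sup>2)"
    by (rule gauss_integral_weighted_char[where K=1, symmetric]) (use s in auto)
  \<comment> \<open>An inequality covers both cases: the Bochner integral of a non-integrable
    function is 0 by convention.\<close>
  also have "ennreal \<dots> \<le> (\<integral>\<^sup>+ \<xi>. ennreal (std_normal_density (s * \<xi>) * (cmod (CLINT \<omega>|M. complex_of_real 1 * iexp (\<xi> * X \<omega>)))\<^sup>2) \<partial>lborel)"
  proof (cases "integrable lborel (\<lambda>\<xi>. std_normal_density (s * \<xi>) * (cmod (CLINT \<omega>|M. complex_of_real 1 * iexp (\<xi> * X \<omega>)))\<^sup>2)")
    case True
    then show ?thesis by (subst nn_integral_eq_integral) auto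
  next
    case False
    then show ?thesis by (simp add: not_integrable_integral_eq)
  qed
  finally show ?thesis by (simp add: s_def)
qed

context levy_driver
begin

text \<open>Optimised over \<open>\<alpha>\<close>, the right-hand side is \<open>2 * sqrt C\<close> times the \<open>L\<^sup>2\<close> norm of \<open>g\<close> on \<open>{0..T} \<times> UNIV\<close>.\<close>
definition occupation_bound :: "(real \<Rightarrow> 'a \<Rightarrow> real) \<Rightarrow> real \<Rightarrow> real \<Rightarrow> bool" where
  "occupation_bound X T C \<longleftrightarrow> (\<forall>g \<alpha>. continuous_on UNIV g \<longrightarrow> (\<forall>z. 0 \<le> g z) \<longrightarrow> 0 < \<alpha> \<longrightarrow>
    (\<integral>\<^sup>+ p. indicator {0..T} (fst p) * ennreal (fst p * g (fst p, X (fst p) (snd p))) \<partial>(lborel \<Otimes>\<^sub>M P)) \<le>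
    ennreal \<alpha> * (\<integral>\<^sup>+ z. indicator {0..T} (fst z) * ennreal ((g z)\<^sup>2) \<partial>lborel) + ennreal (C / \<alpha>))"

text \<open>Fatou's lemma. Continuity of \<open>g\<close> makes \<open>g (t, X n t)\<close> converge
  at every point, which is the reason for testing the bound on continuous functions.\<close>

lemma occupation_bound_limit:
  assumes X: "\<And>n. (\<lambda>p. X n (fst p) (snd p)) \<in> borel_measurable (borel \<Otimes>\<^sub>M P)"
    and lim: "\<And>t \<omega>. \<omega> \<in> space P \<Longrightarrow> (\<lambda>n. X n t \<omega>) \<longlonglongrightarrow> Y t \<omega>"
    and bd: "\<And>n. occupation_bound (X n) T C"
  shows "occupation_bound Y T C"
  unfolding occupation_bound_def
proof (intro allI impI)
  fix g :: "real \<times> real \<Rightarrow> real" and \<alpha> :: real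
  assume g: "continuous_on UNIV g" "\<forall>z. 0 \<le> g z" and \<alpha>: "0 < \<alpha>"
  note [measurable (raw)] = measurable_joint_comp[OF X] continuous_pair_comp_measurable[OF g(1)]
  show "(\<integral>\<^sup>+ p. indicator {0..T} (fst p) * ennreal (fst p * g (fst p, Y (fst p) (snd p))) \<partial>(lborel \<Otimes>\<^sub>M P)) \<le>
    ennreal \<alpha> * (\<integral>\<^sup>+ z. indicator {0..T} (fst z) * ennreal ((g z)\<^sup>2) \<partial>lborel) + ennreal (C / \<alpha>)"
  proof (rule nn_integral_Fatou_le)
    fix n
    show "(\<lambda>p. indicator {0..T} (fst p) * ennreal (fst p * g (fst p, X n (fst p) (snd p)))) \<in> borel_measurable (lborel \<Otimes>\<^sub>M P)"
      by measurable
    show "(\<integral>\<^sup>+ p. indicator {0..T} (fst p) * ennreal (fst p * g (fst p, X n (fst p) (snd p))) \<partial>(lborel \<Otimes>\<^sub>M P)) \<le>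
      ennreal \<alpha> * (\<integral>\<^sup>+ z. indicator {0..T} (fst z) * ennreal ((g z)\<^sup>2) \<partial>lborel) + ennreal (C / \<alpha>)"
      using bd[of n] g \<alpha> by (auto simp: occupation_bound_def)
  next
    show "AE p in lborel \<Otimes>\<^sub>M P. (\<lambda>n. indicator {0..T} (fst p) * ennreal (fst p * g (fst p, X n (fst p) (snd p)))) \<longlonglongrightarrow>
      indicator {0..T} (fst p) * ennreal (fst p * g (fst p, Y (fst p) (snd p)))"
    proof (rule AE_I2)
      fix p :: "real \<times> 'a" assume "p \<in> space (lborel \<Otimes>\<^sub>M P)"
      then have p: "snd p \<in> space P" by (auto simp: space_pair_measure)
      have "(\<lambda>n. g (fst p, X n (fst p) (snd p))) \<longlonglongrightarrow> g (fst p, Y (fst p) (snd p))"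
        using g(1) by (intro continuous_on_tendsto_compose[of UNIV g] tendsto_Pair tendsto_const lim p) auto
      then have "(\<lambda>n. ennreal (fst p * g (fst p, X n (fst p) (snd p)))) \<longlonglongrightarrow> ennreal (fst p * g (fst p, Y (fst p) (snd p)))"
        by (intro tendsto_ennrealI tendsto_mult tendsto_const)
      then show "(\<lambda>n. indicator {0..T} (fst p) * ennreal (fst p * g (fst p, X n (fst p) (snd p)))) \<longlonglongrightarrow>
        indicator {0..T} (fst p) * ennreal (fst p * g (fst p, Y (fst p) (snd p)))"
        by (cases "fst p \<in> {0..T}") auto
    qed
  qed
qed

end

context smoothing_levy_driver
begin

text \<open>Perturb \<open>X t\<close> by an independent Gaussian of size \<open>\<sigma> n\<close>.
  The perturbed variable has a density \<open>q\<close>, so \<open>ennreal_AM_GM\<close> separates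
  \<open>g\<close> from \<open>t * q\<close>, and \<open>mollified_density_L2\<close> bounds the
  norm of \<open>t * q\<close> by \<open>char_drifted_L2\<close> with a constant uniform in
  \<open>\<sigma> n\<close>. Fatou's lemma then removes the perturbation.\<close>

lemma drifted_occupation_bound:
  assumes K: "K > 0" and T: "T \<ge> 0"
  shows "\<exists>C\<ge>0. \<forall>x0 X. drifted K x0 X \<longrightarrow> occupation_bound X T C"
proof -
  obtain C where C: "C \<ge> 0" and CL2: "\<And>x0 X \<sigma>. drifted K x0 X \<Longrightarrow> 0 < \<sigma> \<Longrightarrow>
    (\<integral>\<^sup>+ t. indicator {0..T} t * (\<integral>\<^sup>+ \<xi>. ennreal (std_normal_density (\<sigma> * \<xi>) * (t * cmod (CLINT \<omega>|P. iexp (\<xi> * X t \<omega>)))\<^sup>2) \<partial>lborel) \<partial>lborel) \<le> ennreal C"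
    using char_drifted_L2[OF assms] by blast
  have "occupation_bound X T C" if drift: "drifted K x0 X" for x0 X
    unfolding occupation_bound_def
  proof (intro allI impI)
    fix g :: "real \<times> real \<Rightarrow> real" and \<alpha> :: real
    assume g: "continuous_on UNIV g" "\<forall>z. 0 \<le> g z" and \<alpha>: "0 < \<alpha>"
    interpret Q: pair_sigma_finite "lborel :: real measure" P ..
    note X_joint = drifted_joint_measurable[OF drift]
    note [measurable (raw)] = measurable_joint_comp[OF X_joint] continuous_pair_comp_measurable[OF g(1)]
    have [measurable]: "g \<in> borel_measurable borel" by (rule borel_measurable_continuous_onI[OF g(1)])
    then have [measurable]: "g \<in> borel_measurable (borel \<Otimes>\<^sub>M borel)" by (simp add: borel_prod)
    have [measurable]: "X t \<in> borel_measurable P" for t by measurable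
    define \<sigma> where "\<sigma> n = 1 / real (Suc n)" for n
    have \<sigma>: "0 < \<sigma> n" for n by (simp add: \<sigma>_def)
    have \<sigma>0: "\<sigma> \<longlonglongrightarrow> 0"
      using LIMSEQ_inverse_real_of_nat by (simp add: \<sigma>_def[abs_def] inverse_eq_divide)
    define u where "u n p = (\<integral>\<^sup>+ y. ennreal (fst p * g (fst p, X (fst p) (snd p) + \<sigma> n * y)) * ennreal (std_normal_density y) \<partial>lborel)"
      for n and p :: "real \<times> 'a"
    have u_meas[measurable]: "u n \<in> borel_measurable (borel \<Otimes>\<^sub>M P)" for n
      unfolding u_def by measurable
    define R where "R = ennreal \<alpha> * (\<integral>\<^sup>+ z. indicator {0..T} (fst z) * ennreal ((g z)\<^sup>2) \<partial>lborel) + ennreal (C / \<alpha>)"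
    have u_le: "(\<integral>\<^sup>+ p. indicator {0..T} (fst p) * u n p \<partial>(lborel \<Otimes>\<^sub>M P)) \<le> R" for n
    proof -
      define q where "q t x = (\<integral>\<^sup>+ \<omega>. ennreal (normal_density 0 (\<sigma> n) (x - X t \<omega>)) \<partial>P)" for t x
      have q_meas: "(\<lambda>z. q (fst z) (snd z)) \<in> borel_measurable (borel \<Otimes>\<^sub>M borel)"
        unfolding q_def by measurable
      note [measurable (raw)] = measurable_joint_comp[OF q_meas]
      \<comment> \<open>The substitution \<open>x = X t \<omega> + \<sigma> n * y\<close> turns the
        smeared test function into the test function integrated against the smoothed law.\<close>
      have inner: "(\<integral>\<^sup>+ \<omega>. u n (t, \<omega>) \<partial>P) = (\<integral>\<^sup>+ x. ennreal (t * g (t, x)) * q t x \<partial>lborel)" for t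
      proof -
        have "u n (t, \<omega>) = (\<integral>\<^sup>+ x. ennreal (t * g (t, x)) * ennreal (normal_density 0 (\<sigma> n) (x - X t \<omega>)) \<partial>lborel)" for \<omega>
        proof -
          have "(\<integral>\<^sup>+ x. ennreal (t * g (t, x)) * ennreal (normal_density 0 (\<sigma> n) (x - X t \<omega>)) \<partial>lborel) =
            ennreal \<bar>\<sigma> n\<bar> * (\<integral>\<^sup>+ y. ennreal (t * g (t, X t \<omega> + \<sigma> n * y)) * ennreal (normal_density 0 (\<sigma> n) ((X t \<omega> + \<sigma> n * y) - X t \<omega>)) \<partial>lborel)"
            using \<sigma>[of n] by (intro nn_integral_real_affine) auto
          also have "\<dots> = (\<integral>\<^sup>+ y. ennreal (t * g (t, X t \<omega> + \<sigma> n * y)) * (ennreal \<bar>\<sigma> n\<bar> * ennreal (normal_density 0 (\<sigma> n) (\<sigma> n * y))) \<partial>lborel)"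
            by (subst nn_integral_cmult[symmetric]) (auto simp: mult_ac)
          also have "\<dots> = u n (t, \<omega>)"
          proof -
            have "ennreal \<bar>\<sigma> n\<bar> * ennreal (normal_density 0 (\<sigma> n) (\<sigma> n * y)) = ennreal (std_normal_density y)" for y
              using \<sigma>[of n] by (subst ennreal_mult[symmetric])
                (auto simp: normal_density_def real_sqrt_mult power_mult_distrib)
            then show ?thesis by (simp only: u_def fst_conv snd_conv)
          qed
          finally show ?thesis by (simp add: u_def)
        qed
        then have "(\<integral>\<^sup>+ \<omega>. u n (t, \<omega>) \<partial>P) = (\<integral>\<^sup>+ \<omega>. (\<integral>\<^sup>+ x. ennreal (t * g (t, x)) * ennreal (normal_density 0 (\<sigma> n) (x - X t \<omega>)) \<partial>lborel) \<partial>P)"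
          by simp
        also have "\<dots> = (\<integral>\<^sup>+ x. (\<integral>\<^sup>+ \<omega>. ennreal (t * g (t, x)) * ennreal (normal_density 0 (\<sigma> n) (x - X t \<omega>)) \<partial>P) \<partial>lborel)"
          by (rule Q.Fubini') measurable
        also have "\<dots> = (\<integral>\<^sup>+ x. ennreal (t * g (t, x)) * q t x \<partial>lborel)"
          unfolding q_def by (intro nn_integral_cong nn_integral_cmult) measurable
        finally show ?thesis .
      qed
      have "(\<integral>\<^sup>+ p. indicator {0..T} (fst p) * u n p \<partial>(lborel \<Otimes>\<^sub>M P)) = (\<integral>\<^sup>+ t. (\<integral>\<^sup>+ \<omega>. indicator {0..T} t * u n (t, \<omega>) \<partial>P) \<partial>lborel)"
        by (subst sigma_finite_measure.nn_integral_fst[OF prob_space_imp_sigma_finite[OF prob_space_axioms], symmetric]) auto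
      also have "\<dots> = (\<integral>\<^sup>+ t. indicator {0..T} t * (\<integral>\<^sup>+ x. ennreal (t * g (t, x)) * q t x \<partial>lborel) \<partial>lborel)"
        by (intro nn_integral_cong) (subst nn_integral_cmult, auto simp: inner)
      also have "\<dots> \<le> (\<integral>\<^sup>+ t. indicator {0..T} t * (\<integral>\<^sup>+ x. ennreal \<alpha> * ennreal ((g (t, x))\<^sup>2) + ennreal (1 / \<alpha>) * (ennreal (t\<^sup>2) * (q t x)\<^sup>2) \<partial>lborel) \<partial>lborel)"
      proof (intro nn_integral_mono)
        fix t :: real
        show "indicator {0..T} t * (\<integral>\<^sup>+ x. ennreal (t * g (t, x)) * q t x \<partial>lborel) \<le>
          indicator {0..T} t * (\<integral>\<^sup>+ x. ennreal \<alpha> * ennreal ((g (t, x))\<^sup>2) + ennreal (1 / \<alpha>) * (ennreal (t\<^sup>2) * (q t x)\<^sup>2) \<partial>lborel)"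
        proof (cases "t \<in> {0..T}")
          case True
          have "ennreal (t * g (t, x)) * q t x \<le> ennreal \<alpha> * ennreal ((g (t, x))\<^sup>2) + ennreal (1 / \<alpha>) * (ennreal (t\<^sup>2) * (q t x)\<^sup>2)" for x
          proof -
            have "ennreal (t * g (t, x)) * q t x = ennreal (g (t, x)) * (ennreal t * q t x)"
              using True g(2) by (simp add: ennreal_mult mult_ac)
            also have "\<dots> \<le> ennreal \<alpha> * ennreal ((g (t, x))\<^sup>2) + ennreal (1 / \<alpha>) * (ennreal t * q t x)\<^sup>2"
              by (rule ennreal_AM_GM[OF \<alpha>]) (use g(2) in auto)
            also have "(ennreal t * q t x)\<^sup>2 = ennreal (t\<^sup>2) * (q t x)\<^sup>2"
              using True by (simp add: power_mult_distrib ennreal_power)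
            finally show ?thesis .
          qed
          then show ?thesis by (intro mult_left_mono nn_integral_mono) auto
        qed simp
      qed
      also have "\<dots> = (\<integral>\<^sup>+ t. ennreal \<alpha> * (indicator {0..T} t * (\<integral>\<^sup>+ x. ennreal ((g (t, x))\<^sup>2) \<partial>lborel)) +
         ennreal (1 / \<alpha>) * (indicator {0..T} t * (ennreal (t\<^sup>2) * (\<integral>\<^sup>+ x. (q t x)\<^sup>2 \<partial>lborel))) \<partial>lborel)"
        by (simp add: nn_integral_add nn_integral_cmult distrib_left mult_ac)
      also have "\<dots> = ennreal \<alpha> * (\<integral>\<^sup>+ t. indicator {0..T} t * (\<integral>\<^sup>+ x. ennreal ((g (t, x))\<^sup>2) \<partial>lborel) \<partial>lborel) +
         ennreal (1 / \<alpha>) * (\<integral>\<^sup>+ t. indicator {0..T} t * (ennreal (t\<^sup>2) * (\<integral>\<^sup>+ x. (q t x)\<^sup>2 \<partial>lborel)) \<partial>lborel)"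
        by (simp add: nn_integral_add nn_integral_cmult)
      also have "(\<integral>\<^sup>+ t. indicator {0..T} t * (\<integral>\<^sup>+ x. ennreal ((g (t, x))\<^sup>2) \<partial>lborel) \<partial>lborel) =
         (\<integral>\<^sup>+ z. indicator {0..T} (fst z) * ennreal ((g z)\<^sup>2) \<partial>lborel)"
        unfolding lborel_prod[symmetric]
        by (subst lborel.nn_integral_fst[symmetric]) (auto simp: nn_integral_cmult)
      also have "(\<integral>\<^sup>+ t. indicator {0..T} t * (ennreal (t\<^sup>2) * (\<integral>\<^sup>+ x. (q t x)\<^sup>2 \<partial>lborel)) \<partial>lborel) \<le>
         (\<integral>\<^sup>+ t. indicator {0..T} t * (\<integral>\<^sup>+ \<xi>. ennreal (std_normal_density (sqrt ((\<sigma> n)\<^sup>2 + (\<sigma> n)\<^sup>2) * \<xi>) * (t * cmod (CLINT \<omega>|P. iexp (\<xi> * X t \<omega>)))\<^sup>2) \<partial>lborel) \<partial>lborel)"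
      proof (intro nn_integral_mono mult_left_mono)
        fix t :: real
        have "ennreal (t\<^sup>2) * (\<integral>\<^sup>+ x. (q t x)\<^sup>2 \<partial>lborel) \<le> ennreal (t\<^sup>2) *
          (\<integral>\<^sup>+ \<xi>. ennreal (std_normal_density (sqrt ((\<sigma> n)\<^sup>2 + (\<sigma> n)\<^sup>2) * \<xi>) * (cmod (CLINT \<omega>|P. iexp (\<xi> * X t \<omega>)))\<^sup>2) \<partial>lborel)"
          unfolding q_def by (intro mult_left_mono mollified_density_L2 \<sigma>) auto
        also have "\<dots> = (\<integral>\<^sup>+ \<xi>. ennreal (t\<^sup>2) * ennreal (std_normal_density (sqrt ((\<sigma> n)\<^sup>2 + (\<sigma> n)\<^sup>2) * \<xi>) * (cmod (CLINT \<omega>|P. iexp (\<xi> * X t \<omega>)))\<^sup>2) \<partial>lborel)"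
          by (rule nn_integral_cmult[symmetric]) measurable
        also have "\<dots> = (\<integral>\<^sup>+ \<xi>. ennreal (std_normal_density (sqrt ((\<sigma> n)\<^sup>2 + (\<sigma> n)\<^sup>2) * \<xi>) * (t * cmod (CLINT \<omega>|P. iexp (\<xi> * X t \<omega>)))\<^sup>2) \<partial>lborel)"
          by (intro nn_integral_cong) (simp add: ennreal_mult[symmetric] power_mult_distrib mult_ac)
        finally show "ennreal (t\<^sup>2) * (\<integral>\<^sup>+ x. (q t x)\<^sup>2 \<partial>lborel) \<le>
          (\<integral>\<^sup>+ \<xi>. ennreal (std_normal_density (sqrt ((\<sigma> n)\<^sup>2 + (\<sigma> n)\<^sup>2) * \<xi>) * (t * cmod (CLINT \<omega>|P. iexp (\<xi> * X t \<omega>)))\<^sup>2) \<partial>lborel)" .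
      qed simp
      also have "\<dots> \<le> ennreal C"
        by (rule CL2[OF drift]) (use \<sigma>[of n] in simp)
      also have "ennreal (1 / \<alpha>) * ennreal C = ennreal (C / \<alpha>)"
        using \<alpha> C by (simp add: ennreal_mult[symmetric])
      finally show ?thesis by (simp add: R_def add_left_mono mult_left_mono)
    qed
    have point: "ennreal (fst p * g (fst p, X (fst p) (snd p))) \<le> liminf (\<lambda>n. u n p)" if "0 \<le> fst p" for p :: "real \<times> 'a"
    proof -
      have "ennreal (fst p * g (fst p, X (fst p) (snd p))) = ennreal (fst p * g (fst p, X (fst p) (snd p))) * (\<integral>\<^sup>+ y. ennreal (std_normal_density y) \<partial>lborel)"
        by (subst nn_integral_eq_integral) auto
      also have "\<dots> = (\<integral>\<^sup>+ y. ennreal (fst p * g (fst p, X (fst p) (snd p))) * ennreal (std_normal_density y) \<partial>lborel)"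
        by (rule nn_integral_cmult[symmetric]) measurable
      also have "\<dots> = (\<integral>\<^sup>+ y. liminf (\<lambda>n. ennreal (fst p * g (fst p, X (fst p) (snd p) + \<sigma> n * y)) * ennreal (std_normal_density y)) \<partial>lborel)"
      proof (intro nn_integral_cong lim_imp_Liminf[symmetric])
        fix y :: real
        have "(\<lambda>n. X (fst p) (snd p) + \<sigma> n * y) \<longlonglongrightarrow> X (fst p) (snd p) + 0 * y"
          by (intro tendsto_intros \<sigma>0)
        then have "(\<lambda>n. g (fst p, X (fst p) (snd p) + \<sigma> n * y)) \<longlonglongrightarrow> g (fst p, X (fst p) (snd p))"
          using g(1) by (intro continuous_on_tendsto_compose[of UNIV g] tendsto_Pair tendsto_const) auto
        then have "(\<lambda>n. ennreal (fst p * g (fst p, X (fst p) (snd p) + \<sigma> n * y) * std_normal_density y)) \<longlonglongrightarrow> ennreal (fst p * g (fst p, X (fst p) (snd p)) * std_normal_density y)"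
          by (intro tendsto_ennrealI tendsto_mult tendsto_const)
        then show "(\<lambda>n. ennreal (fst p * g (fst p, X (fst p) (snd p) + \<sigma> n * y)) * ennreal (std_normal_density y)) \<longlonglongrightarrow> ennreal (fst p * g (fst p, X (fst p) (snd p))) * ennreal (std_normal_density y)"
          using g(2) that by (simp add: ennreal_mult[symmetric])
      qed simp
      also have "\<dots> \<le> liminf (\<lambda>n. u n p)"
        unfolding u_def by (rule nn_integral_liminf) measurable
      finally show ?thesis .
    qed
    have "(\<integral>\<^sup>+ p. indicator {0..T} (fst p) * ennreal (fst p * g (fst p, X (fst p) (snd p))) \<partial>(lborel \<Otimes>\<^sub>M P)) \<le>
      (\<integral>\<^sup>+ p. liminf (\<lambda>n. indicator {0..T} (fst p) * u n p) \<partial>(lborel \<Otimes>\<^sub>M P))"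
    proof (rule nn_integral_mono)
      fix p :: "real \<times> 'a"
      show "indicator {0..T} (fst p) * ennreal (fst p * g (fst p, X (fst p) (snd p))) \<le> liminf (\<lambda>n. indicator {0..T} (fst p) * u n p)"
        using point[of p] by (cases "fst p \<in> {0..T}") auto
    qed
    also have "\<dots> \<le> liminf (\<lambda>n. (\<integral>\<^sup>+ p. indicator {0..T} (fst p) * u n p \<partial>(lborel \<Otimes>\<^sub>M P)))"
      by (rule nn_integral_liminf) measurable
    also have "\<dots> \<le> R"
      by (rule Liminf_le) (auto simp: u_le)
    finally show "(\<integral>\<^sup>+ p. indicator {0..T} (fst p) * ennreal (fst p * g (fst p, X (fst p) (snd p))) \<partial>(lborel \<Otimes>\<^sub>M P)) \<le>
      ennreal \<alpha> * (\<integral>\<^sup>+ z. indicator {0..T} (fst z) * ennreal ((g z)\<^sup>2) \<partial>lborel) + ennreal (C / \<alpha>)"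
      by (simp add: R_def)
  qed
  with C show ?thesis by blast
qed

end

section \<open>From continuous to Borel test functions\<close>

text \<open>Outer regularity encloses \<open>N\<close> in an open set \<open>U\<close> of Lebesgue
  measure below \<open>e\<close>, and the indicator of \<open>U\<close> is a limit of continuous
  functions below it. So \<open>\<mu>\<close> gives \<open>U\<close> at most
  \<open>\<alpha> * e + C / \<alpha>\<close>, where \<open>e\<close> may be chosen after
  \<open>\<alpha>\<close>.\<close>

lemma L2_dominated_null_set:
  fixes \<mu> \<kappa> :: "'b::euclidean_space measure"
  assumes sets[measurable_cong]: "sets \<mu> = sets borel" "sets \<kappa> = sets borel"
    and le: "\<And>B. emeasure \<kappa> B \<le> emeasure lborel B"
    and dom: "\<And>g \<alpha>. continuous_on UNIV g \<Longrightarrow> (\<And>z. 0 \<le> g z) \<Longrightarrow> 0 < \<alpha> \<Longrightarrow>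
      (\<integral>\<^sup>+ z. ennreal (g z) \<partial>\<mu>) \<le> ennreal \<alpha> * (\<integral>\<^sup>+ z. ennreal ((g z)\<^sup>2) \<partial>\<kappa>) + ennreal (C / \<alpha>)"
    and N: "N \<in> null_sets lborel" and C: "0 \<le> C"
  shows "N \<in> null_sets \<mu>"
proof -
  have [measurable]: "N \<in> sets borel" using N by auto
  have bound: "emeasure \<mu> N \<le> ennreal (\<alpha> * e + C / \<alpha>)" if \<alpha>: "0 < \<alpha>" and e: "0 < e" for \<alpha> e
  proof -
    obtain U where U: "open U" "N \<subseteq> U" "emeasure lborel (U - N) < e"
      using outer_regular_lborel[OF \<open>N \<in> sets borel\<close> e] by blast
    have [measurable]: "U \<in> sets borel" using U by auto
    have Ue: "emeasure lborel U < e"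
      using U(3) emeasure_Diff_null_set[OF N, of U] by simp
    \<comment> \<open>\<open>infdist\<close> to the empty set is 0 by convention; the functions
      \<open>g m\<close> below would vanish identically for \<open>U = UNIV\<close>.\<close>
    have "U \<noteq> UNIV" using Ue by auto
    then have ne: "- U \<noteq> {}" by auto
    define g where "g m z = min 1 (real m * infdist z (- U))" for m z
    have g: "continuous_on UNIV (g m)" "0 \<le> g m z" "g m z \<le> indicator U z" for m z
      unfolding g_def by (auto intro!: continuous_intros simp: infdist_nonneg indicator_def)
    have [measurable]: "g m \<in> borel_measurable borel" for m
      by (rule borel_measurable_continuous_onI[OF g(1)])
    have "emeasure \<mu> U = (\<integral>\<^sup>+ z. indicator U z \<partial>\<mu>)" by simp
    also have "\<dots> \<le> ennreal (\<alpha> * e + C / \<alpha>)"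
    proof (rule nn_integral_Fatou_le)
      show "(\<lambda>z. ennreal (g m z)) \<in> borel_measurable \<mu>" for m by measurable
      show "AE z in \<mu>. (\<lambda>m. ennreal (g m z)) \<longlonglongrightarrow> indicator U z"
      proof (rule AE_I2)
        fix z
        show "(\<lambda>m. ennreal (g m z)) \<longlonglongrightarrow> indicator U z"
        proof (cases "z \<in> U")
          case True
          then have pos: "0 < infdist z (- U)"
            using infdist_pos_not_in_closed[of "- U" z] U(1) ne by auto
          have "\<forall>\<^sub>F m in sequentially. g m z = 1"
            using eventually_ge_at_top[of "nat \<lceil>1 / infdist z (- U)\<rceil>"]
          proof eventually_elim
            case (elim m)
            then have "1 / infdist z (- U) \<le> real m" by linarith
            then show ?case using pos by (auto simp: g_def field_simps min_def)
          qed
          then have "\<forall>\<^sub>F m in sequentially. ennreal (g m z) = indicator U z"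
            by eventually_elim (use True in simp)
          then show ?thesis by (rule tendsto_eventually)
        next
          case False
          then have "g m z = 0" for m using g(2,3)[of m z] by (simp add: indicator_def)
          then show ?thesis using False by simp
        qed
      qed
      fix m
      have "(\<integral>\<^sup>+ z. ennreal (g m z) \<partial>\<mu>) \<le> ennreal \<alpha> * (\<integral>\<^sup>+ z. ennreal ((g m z)\<^sup>2) \<partial>\<kappa>) + ennreal (C / \<alpha>)"
        by (intro dom g \<alpha>)
      also have "(\<integral>\<^sup>+ z. ennreal ((g m z)\<^sup>2) \<partial>\<kappa>) \<le> (\<integral>\<^sup>+ z. indicator U z \<partial>\<kappa>)"
      proof (rule nn_integral_mono)
        fix z
        have "(g m z)\<^sup>2 \<le> (indicator U z)\<^sup>2" using g(2,3)[of m z] by (intro power_mono)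
        then have "ennreal ((g m z)\<^sup>2) \<le> ennreal (indicator U z)"
          by (intro ennreal_leI) (cases "z \<in> U"; simp)
        then show "ennreal ((g m z)\<^sup>2) \<le> indicator U z" by (simp add: ennreal_indicator)
      qed
      also have "\<dots> \<le> ennreal e"
        using Ue le[of U] by simp
      finally have "(\<integral>\<^sup>+ z. ennreal (g m z) \<partial>\<mu>) \<le> ennreal \<alpha> * ennreal e + ennreal (C / \<alpha>)"
        by (simp add: add_right_mono mult_left_mono)
      then show "(\<integral>\<^sup>+ z. ennreal (g m z) \<partial>\<mu>) \<le> ennreal (\<alpha> * e + C / \<alpha>)"
        using \<alpha> e C by (simp add: ennreal_mult ennreal_plus)
    qed
    finally show ?thesis using emeasure_mono[of N U \<mu>] U(2) by (simp add: sets)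
  qed
  have "emeasure \<mu> N \<le> ennreal 0"
  proof (rule tendsto_lowerbound)
    \<comment> \<open>The choice is \<open>\<alpha> = Suc n\<close> and
      \<open>e = (1 / Suc n)^2\<close>, so that both summands are of order \<open>1 / n\<close>. In
      the code \<open>e\<close> is written as a squared quotient.\<close>
    show "(\<lambda>n. ennreal (real (Suc n) * (1 / real (Suc n))\<^sup>2 + C / real (Suc n))) \<longlonglongrightarrow> ennreal 0"
    proof (rule tendsto_ennrealI)
      have "(\<lambda>n. (1 + C) * inverse (real (Suc n))) \<longlonglongrightarrow> (1 + C) * 0"
        by (intro tendsto_intros LIMSEQ_inverse_real_of_nat)
      moreover have "real (Suc n) * (1 / real (Suc n))\<^sup>2 + C / real (Suc n) = (1 + C) * inverse (real (Suc n))" for n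
        by (simp add: power2_eq_square divide_inverse distrib_right del: of_nat_Suc)
      ultimately show "(\<lambda>n. real (Suc n) * (1 / real (Suc n))\<^sup>2 + C / real (Suc n)) \<longlonglongrightarrow> 0"
        by simp
    qed
    show "\<forall>\<^sub>F n in sequentially. emeasure \<mu> N \<le> ennreal (real (Suc n) * (1 / real (Suc n))\<^sup>2 + C / real (Suc n))"
      by (intro always_eventually allI bound) auto
  qed simp
  then show ?thesis by (simp add: null_sets_def sets)
qed

text \<open>Measurability in the sense of \<open>measurable_on\<close> is by definition an almost
  everywhere limit of continuous functions. Clamping to \<open>[c, d]\<close> preserves continuity
  and the limit.\<close>

lemma borel_AE_limit_continuous:
  fixes f :: "'b::euclidean_space \<Rightarrow> real"
  assumes [measurable]: "f \<in> borel_measurable borel" and f: "\<And>z. c \<le> f z \<and> f z \<le> d"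
  shows "\<exists>g. (\<forall>n. continuous_on UNIV (g n)) \<and> (\<forall>n z. c \<le> g n z \<and> g n z \<le> (d::real)) \<and>
    (AE z in lborel. (\<lambda>n. g n z) \<longlonglongrightarrow> f z)"
proof -
  have "f \<in> borel_measurable lebesgue" using assms(1) by (simp add: measurable_completion)
  then have "f measurable_on UNIV"
    using measurable_on_iff_borel_measurable[of UNIV f] by simp
  then obtain N g where N: "negligible N" and g: "\<And>n. continuous_on UNIV (g n)"
    and lim: "\<And>z. z \<notin> N \<Longrightarrow> (\<lambda>n. g n z) \<longlonglongrightarrow> f z"
    unfolding measurable_on_def by auto
  have cd: "c \<le> d" using f[of undefined] by linarith
  have "N \<in> null_sets lebesgue" using N by (simp add: negligible_iff_null_sets)
  then have "AE z in lebesgue. z \<notin> N" by (rule AE_not_in)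
  then have "AE z in lborel. z \<notin> N" by (simp add: AE_completion_iff)
  then have "AE z in lborel. (\<lambda>n. max c (min d (g n z))) \<longlonglongrightarrow> f z"
  proof eventually_elim
    case (elim z)
    have "(\<lambda>n. max c (min d (g n z))) \<longlonglongrightarrow> max c (min d (f z))"
      by (intro tendsto_intros lim elim)
    then show ?case using f[of z] by (simp add: min_absorb2 max_absorb2)
  qed
  moreover have "continuous_on UNIV (\<lambda>z. max c (min d (g n z)))" for n
    by (intro continuous_intros g)
  ultimately show ?thesis using cd
    by (intro exI[of _ "\<lambda>n z. max c (min d (g n z))"]) auto
qed

text \<open>Continuous approximations that converge Lebesgue almost everywhere also converge
  \<open>\<mu>\<close>-almost everywhere, because \<open>\<mu>\<close> does not charge null sets.
  The weight \<open>w\<close> has finite \<open>\<kappa>\<close>-integral and supplies the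
  dominating function for a bounded \<open>f\<close>; since \<open>0 \<le> w \<le> 1\<close>, one of
  the two factors \<open>w\<close> produced by squaring is estimated by 1.\<close>

lemma L2_dominated_borel:
  fixes \<mu> \<kappa> :: "'b::euclidean_space measure" and w f :: "'b \<Rightarrow> real"
  assumes sets[measurable_cong]: "sets \<mu> = sets borel" "sets \<kappa> = sets borel"
    and le: "\<And>B. emeasure \<kappa> B \<le> emeasure lborel B"
    and dom: "\<And>g \<alpha>. continuous_on UNIV g \<Longrightarrow> (\<And>z. 0 \<le> g z) \<Longrightarrow> 0 < \<alpha> \<Longrightarrow>
      (\<integral>\<^sup>+ z. ennreal (g z) \<partial>\<mu>) \<le> ennreal \<alpha> * (\<integral>\<^sup>+ z. ennreal ((g z)\<^sup>2) \<partial>\<kappa>) + ennreal (C / \<alpha>)"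
    and C: "0 \<le> C" and \<alpha>: "0 < \<alpha>"
    and w: "continuous_on UNIV w" "\<And>z. 0 \<le> w z" "\<And>z. w z \<le> 1" and w_fin: "(\<integral>\<^sup>+ z. ennreal (w z) \<partial>\<kappa>) < \<infinity>"
    and f[measurable]: "f \<in> borel_measurable borel" "\<And>z. 0 \<le> f z" "\<And>z. f z \<le> B"
  shows "(\<integral>\<^sup>+ z. ennreal (w z * f z) \<partial>\<mu>) \<le> ennreal \<alpha> * (\<integral>\<^sup>+ z. ennreal (w z * (f z)\<^sup>2) \<partial>\<kappa>) + ennreal (C / \<alpha>)"
proof -
  obtain g where g: "\<And>n. continuous_on UNIV (g n)" "\<And>n z. 0 \<le> g n z" "\<And>n z. g n z \<le> B"
    and lim: "AE z in lborel. (\<lambda>n. g n z) \<longlonglongrightarrow> f z"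
    using borel_AE_limit_continuous[OF f(1), of 0 B] f(2,3) by blast
  have [measurable]: "g n \<in> borel_measurable borel" "w \<in> borel_measurable borel" for n
    using borel_measurable_continuous_onI g(1) w(1) by auto
  obtain N where N: "N \<in> null_sets lborel" "\<And>z. z \<notin> N \<Longrightarrow> (\<lambda>n. g n z) \<longlonglongrightarrow> f z"
    using lim by (auto elim!: AE_E3)
  have "N \<in> null_sets \<mu>"
    by (rule L2_dominated_null_set[OF sets le dom N(1) C])
  then have AE_\<mu>: "AE z in \<mu>. (\<lambda>n. g n z) \<longlonglongrightarrow> f z"
    by (rule AE_I') (use N(2) in auto)
  have "N \<in> null_sets \<kappa>"
    using N(1) le[of N] by (auto simp: null_sets_def sets)
  then have AE_\<kappa>: "AE z in \<kappa>. (\<lambda>n. g n z) \<longlonglongrightarrow> f z"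
    by (rule AE_I') (use N(2) in auto)
  let ?R = "\<lambda>h. ennreal \<alpha> * (\<integral>\<^sup>+ z. ennreal (w z * (h z)\<^sup>2) \<partial>\<kappa>) + ennreal (C / \<alpha>)"
  have 1: "(\<integral>\<^sup>+ z. ennreal (w z * g n z) \<partial>\<mu>) \<le> ?R (g n)" for n
  proof -
    have "(\<integral>\<^sup>+ z. ennreal (w z * g n z) \<partial>\<mu>) \<le> ennreal \<alpha> * (\<integral>\<^sup>+ z. ennreal ((w z * g n z)\<^sup>2) \<partial>\<kappa>) + ennreal (C / \<alpha>)"
      by (intro dom \<alpha> continuous_intros g w mult_nonneg_nonneg)
    also have "\<dots> \<le> ?R (g n)"
    proof (intro add_right_mono mult_left_mono nn_integral_mono ennreal_leI)
      fix z
      have "w z * w z \<le> 1 * w z" using w by (intro mult_right_mono) auto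
      then show "(w z * g n z)\<^sup>2 \<le> w z * (g n z)\<^sup>2"
        by (simp add: power_mult_distrib power2_eq_square[of "w z"] mult_right_mono)
    qed simp
    finally show ?thesis .
  qed
  have 2: "(\<lambda>n. \<integral>\<^sup>+ z. ennreal (w z * (g n z)\<^sup>2) \<partial>\<kappa>) \<longlonglongrightarrow> (\<integral>\<^sup>+ z. ennreal (w z * (f z)\<^sup>2) \<partial>\<kappa>)"
  proof (rule nn_integral_dominated_convergence[where w="\<lambda>z. ennreal (B\<^sup>2) * ennreal (w z)"])
    show "AE z in \<kappa>. ennreal (w z * (g n z)\<^sup>2) \<le> ennreal (B\<^sup>2) * ennreal (w z)" for n
    proof (rule AE_I2)
      fix z
      have "(g n z)\<^sup>2 \<le> B\<^sup>2" using g by (intro power_mono)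
      then show "ennreal (w z * (g n z)\<^sup>2) \<le> ennreal (B\<^sup>2) * ennreal (w z)"
        using w by (subst ennreal_mult[symmetric]) (auto simp: mult.commute[of "w z"] intro!: ennreal_leI mult_right_mono)
    qed
    show "(\<integral>\<^sup>+ z. ennreal (B\<^sup>2) * ennreal (w z) \<partial>\<kappa>) < \<infinity>"
      using w_fin by (simp add: nn_integral_cmult ennreal_mult_less_top)
    show "AE z in \<kappa>. (\<lambda>n. ennreal (w z * (g n z)\<^sup>2)) \<longlonglongrightarrow> ennreal (w z * (f z)\<^sup>2)"
      using AE_\<kappa> by eventually_elim (intro tendsto_ennrealI tendsto_intros)
  qed measurable
  have "(\<integral>\<^sup>+ z. ennreal (w z * f z) \<partial>\<mu>) = (\<integral>\<^sup>+ z. liminf (\<lambda>n. ennreal (w z * g n z)) \<partial>\<mu>)"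
  proof (rule nn_integral_cong_AE)
    show "AE z in \<mu>. ennreal (w z * f z) = liminf (\<lambda>n. ennreal (w z * g n z))"
      using AE_\<mu> by eventually_elim (intro lim_imp_Liminf[symmetric] tendsto_ennrealI tendsto_intros, auto)
  qed
  also have "\<dots> \<le> liminf (\<lambda>n. \<integral>\<^sup>+ z. ennreal (w z * g n z) \<partial>\<mu>)"
    by (rule nn_integral_liminf) measurable
  also have "\<dots> \<le> liminf (\<lambda>n. ?R (g n))"
    by (intro Liminf_mono always_eventually allI 1)
  also have "\<dots> = ?R f"
  proof (rule lim_imp_Liminf)
    show "(\<lambda>n. ?R (g n)) \<longlonglongrightarrow> ?R f"
      by (intro tendsto_add tendsto_const ennreal_tendsto_cmult 2) auto
  qed simp
  finally show ?thesis .
qed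

context levy_driver
begin

text \<open>The preceding lemma with \<open>\<mu>\<close> the occupation measure of the path in time
  and space, carrying the density \<open>t\<close>, and \<open>\<kappa>\<close> Lebesgue measure on
  the strip \<open>{0..T} \<times> UNIV\<close>. The Gaussian in the space variable is the weight
  that makes bounded functions square integrable there.\<close>

lemma occupation_bound_borel:
  fixes f :: "real \<Rightarrow> real \<Rightarrow> real"
  assumes X: "(\<lambda>p. X (fst p) (snd p)) \<in> borel_measurable (borel \<Otimes>\<^sub>M P)"
    and bd: "occupation_bound X T C" and C: "0 \<le> C" and \<alpha>: "0 < \<alpha>" and T: "0 \<le> T"
    and f: "(\<lambda>z. f (fst z) (snd z)) \<in> borel_measurable borel" "\<And>t x. 0 \<le> f t x" "\<And>t x. f t x \<le> B"
  shows "(\<integral>\<^sup>+ p. indicator {0..T} (fst p) * ennreal (fst p * (std_normal_density (X (fst p) (snd p)) * f (fst p) (X (fst p) (snd p)))) \<partial>(lborel \<Otimes>\<^sub>M P)) \<le>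
    ennreal \<alpha> * (\<integral>\<^sup>+ z. indicator {0..T} (fst z) * ennreal (std_normal_density (snd z) * (f (fst z) (snd z))\<^sup>2) \<partial>lborel) + ennreal (C / \<alpha>)"
proof -
  have f_prod: "(\<lambda>z. f (fst z) (snd z)) \<in> borel_measurable (borel \<Otimes>\<^sub>M borel)"
    using f(1) by (simp add: borel_prod)
  note [measurable (raw)] = measurable_joint_comp[OF X] measurable_joint_comp[OF f_prod]
  note [measurable] = f(1)
  define d where "d p = indicator {0..T} (fst p) * ennreal (fst p)" for p :: "real \<times> 'a"
  define \<mu> where "\<mu> = distr (density (lborel \<Otimes>\<^sub>M P) d) borel (\<lambda>p. (fst p, X (fst p) (snd p)))"
  have [measurable]: "d \<in> borel_measurable (lborel \<Otimes>\<^sub>M P)" unfolding d_def by measurable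
  have [measurable]: "(\<lambda>p. (fst p, X (fst p) (snd p))) \<in> borel_measurable (lborel \<Otimes>\<^sub>M P)"
    unfolding borel_prod[symmetric] by measurable
  have [measurable]: "(\<lambda>z::real \<times> real. indicator {0..T} (fst z) :: ennreal) \<in> borel_measurable borel"
    unfolding borel_prod[symmetric] by measurable
  define \<kappa> where "\<kappa> = density (lborel :: (real \<times> real) measure) (\<lambda>z. indicator {0..T} (fst z))"
  have \<mu>_int: "(\<integral>\<^sup>+ z. ennreal (g z) \<partial>\<mu>) = (\<integral>\<^sup>+ p. indicator {0..T} (fst p) * ennreal (fst p * g (fst p, X (fst p) (snd p))) \<partial>(lborel \<Otimes>\<^sub>M P))"
    if [measurable]: "g \<in> borel_measurable borel" for g
  proof -
    have "(\<integral>\<^sup>+ z. ennreal (g z) \<partial>\<mu>) = (\<integral>\<^sup>+ p. d p * ennreal (g (fst p, X (fst p) (snd p))) \<partial>(lborel \<Otimes>\<^sub>M P))"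
      unfolding \<mu>_def by (subst nn_integral_distr) (auto simp: nn_integral_density)
    also have "\<dots> = (\<integral>\<^sup>+ p. indicator {0..T} (fst p) * ennreal (fst p * g (fst p, X (fst p) (snd p))) \<partial>(lborel \<Otimes>\<^sub>M P))"
      by (intro nn_integral_cong) (auto simp: d_def indicator_def ennreal_mult')
    finally show ?thesis .
  qed
  have \<kappa>_int: "(\<integral>\<^sup>+ z. h z \<partial>\<kappa>) = (\<integral>\<^sup>+ z. indicator {0..T} (fst z) * h z \<partial>lborel)"
    if [measurable]: "h \<in> borel_measurable borel" for h :: "real \<times> real \<Rightarrow> ennreal"
    unfolding \<kappa>_def by (rule nn_integral_density) measurable
  let ?w = "\<lambda>z::real \<times> real. std_normal_density (snd z)"
  have [measurable]: "?w \<in> borel_measurable borel"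
    unfolding borel_prod[symmetric] by measurable
  have "(\<integral>\<^sup>+ z. ennreal (?w z * f (fst z) (snd z)) \<partial>\<mu>) \<le>
    ennreal \<alpha> * (\<integral>\<^sup>+ z. ennreal (?w z * (f (fst z) (snd z))\<^sup>2) \<partial>\<kappa>) + ennreal (C / \<alpha>)"
  proof (rule L2_dominated_borel[OF _ _ _ _ C \<alpha>, where B=B])
    show "emeasure \<kappa> B \<le> emeasure lborel B" for B
    proof (cases "B \<in> sets borel")
      case True
      then have "emeasure \<kappa> B = (\<integral>\<^sup>+ z. indicator {0..T} (fst z) * indicator B z \<partial>lborel)"
        unfolding \<kappa>_def by (subst emeasure_density) auto
      also have "\<dots> \<le> (\<integral>\<^sup>+ z. indicator B z \<partial>lborel)"
        by (intro nn_integral_mono) (auto simp: indicator_def)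
      finally show ?thesis using True by simp
    qed (simp add: emeasure_notin_sets \<kappa>_def)
    fix g :: "real \<times> real \<Rightarrow> real" and \<alpha> :: real
    assume g: "continuous_on UNIV g" "\<And>z. 0 \<le> g z" "0 < \<alpha>"
    then have [measurable]: "g \<in> borel_measurable borel" by (auto intro: borel_measurable_continuous_onI)
    show "(\<integral>\<^sup>+ z. ennreal (g z) \<partial>\<mu>) \<le> ennreal \<alpha> * (\<integral>\<^sup>+ z. ennreal ((g z)\<^sup>2) \<partial>\<kappa>) + ennreal (C / \<alpha>)"
      using bd g unfolding occupation_bound_def by (simp add: \<mu>_int \<kappa>_int)
  next
    show "continuous_on UNIV ?w"
      unfolding std_normal_density_def by (intro continuous_intros) auto
    show "?w z \<le> 1" for z
    proof -
      have "1 \<le> sqrt (2 * pi)" using pi_gt3 by simp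
      then have "1 / sqrt (2 * pi) * exp (- (snd z)\<^sup>2 / 2) \<le> 1 * 1"
        by (intro mult_mono) auto
      then show ?thesis by (simp add: std_normal_density_def)
    qed
    have "(\<integral>\<^sup>+ z. ennreal (?w z) \<partial>\<kappa>) = (\<integral>\<^sup>+ z. indicator {0..T} (fst z) * ennreal (?w z) \<partial>(lborel \<Otimes>\<^sub>M lborel))"
      by (subst \<kappa>_int) (auto simp: lborel_prod)
    also have "\<dots> = (\<integral>\<^sup>+ t. (\<integral>\<^sup>+ x. indicator {0..T} t * ennreal (std_normal_density x) \<partial>lborel) \<partial>lborel)"
      by (subst lborel.nn_integral_fst[symmetric]) auto
    also have "\<dots> = (\<integral>\<^sup>+ t. indicator {0..T} t * (\<integral>\<^sup>+ x. ennreal (std_normal_density x) \<partial>lborel) \<partial>lborel)"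
      by (simp add: nn_integral_cmult)
    also have "(\<integral>\<^sup>+ x. ennreal (std_normal_density x) \<partial>lborel) = 1"
      by (subst nn_integral_eq_integral) auto
    finally show "(\<integral>\<^sup>+ z. ennreal (?w z) \<partial>\<kappa>) < \<infinity>" using T by simp
  qed (auto simp: \<mu>_def \<kappa>_def f)
  then show ?thesis
    by (simp add: \<mu>_int \<kappa>_int)
qed

end

section \<open>Lipschitz drifts and comparison\<close>

text \<open>Gronwall's argument by iteration. The index \<open>j\<close> lets one statement serve
  two purposes: increments of Picard iterates, and, with \<open>v\<close> constant in
  \<open>j\<close>, a function that satisfies a Volterra inequality with itself.\<close>

lemma iterated_volterra_bound:
  fixes v :: "nat \<Rightarrow> real \<Rightarrow> real"
  assumes meas[measurable]: "\<And>j. v j \<in> borel_measurable borel"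
    and v0: "\<And>j t. 0 \<le> t \<Longrightarrow> t \<le> T \<Longrightarrow> 0 \<le> v j t"
    and base: "\<And>t. 0 \<le> t \<Longrightarrow> t \<le> T \<Longrightarrow> v 0 t \<le> M"
    and step: "\<And>j t. 0 \<le> t \<Longrightarrow> t \<le> T \<Longrightarrow> v (Suc j) t \<le> L * (LINT s:{0..t}|lborel. v j s)"
    and L: "0 \<le> L" and M: "0 \<le> M" and t: "0 \<le> t" "t \<le> T"
  shows "v j t \<le> M * (L * t) ^ j / fact j"
  using t
proof (induction j arbitrary: t)
  case 0
  then show ?case using base by simp
next
  case (Suc j)
  have i: "set_integrable lborel {0..t} (\<lambda>s. M * (L * s) ^ j / fact j)"
    unfolding set_integrable_def by (rule borel_integrable_compact) (auto intro!: continuous_intros)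
  have "v (Suc j) t \<le> L * (LINT s:{0..t}|lborel. v j s)" by (rule step[OF Suc.prems])
  also have "\<dots> \<le> L * (LINT s:{0..t}|lborel. M * (L * s) ^ j / fact j)"
  proof (intro mult_left_mono set_integral_mono i L)
    show "set_integrable lborel {0..t} (v j)"
    proof (rule bounded_set_integrable[of _ _ 0 t "M * (L * t) ^ j / fact j"])
      fix r assume r: "r \<in> {0..t}"
      have "v j r \<le> M * (L * r) ^ j / fact j" using r Suc by auto
      also have "\<dots> \<le> M * (L * t) ^ j / fact j"
        using r L M by (intro divide_right_mono mult_left_mono power_mono) (auto intro!: mult_nonneg_nonneg)
      finally show "norm (v j r) \<le> M * (L * t) ^ j / fact j" using v0[of r j] r Suc.prems by simp
    qed auto
    show "v j r \<le> M * (L * r) ^ j / fact j" if "r \<in> {0..t}" for r using that Suc by auto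
  qed
  also have "(LINT s:{0..t}|lborel. M * (L * s) ^ j / fact j) = (M * L ^ j / fact j) * (LINT s|lborel. s ^ j * indicator {0..t} s)"
    unfolding set_lebesgue_integral_def
    by (subst Bochner_Integration.integral_mult_right_zero[symmetric]) (simp add: power_mult_distrib mult_ac)
  also have "(LINT s|lborel. s ^ j * indicator {0..t} s) = t ^ Suc j / Suc j"
    using Suc.prems by (subst integral_power) auto
  also have "L * ((M * L ^ j / fact j) * (t ^ Suc j / Suc j)) = M * (L * t) ^ Suc j / fact (Suc j)"
    by (simp add: power_mult_distrib mult_ac)
  finally show ?case .
qed

text \<open>Covers negative times as well: there \<open>{0..t}\<close> is empty and the integral is
  0, as at time 0.\<close>

lemma set_integral_Icc_abs_diff:
  fixes b :: "real \<Rightarrow> real"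
  assumes [measurable]: "b \<in> borel_measurable borel" and b: "\<And>r. 0 \<le> r \<Longrightarrow> \<bar>b r\<bar> \<le> K"
  shows "\<bar>(LINT r:{0..t}|lborel. b r) - (LINT r:{0..s}|lborel. b r)\<bar> \<le> K * \<bar>t - s\<bar>"
proof -
  have K: "0 \<le> K" using b[of 0] by simp
  have eq: "(LINT r:{0..t}|lborel. b r) = (LINT r:{0..max 0 t}|lborel. b r)" for t
  proof (cases "0 \<le> t")
    case False
    have "norm (LINT r:{0..0}|lborel. b r) \<le> 0"
      unfolding set_lebesgue_integral_def
      by (intro eq_refl) (simp, intro integral_eq_zero_AE AE_I'[of "{0}"], auto simp: indicator_def split: if_splits)
    with False show ?thesis by (simp add: max_def set_lebesgue_integral_def)
  qed (simp add: max_absorb2)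
  have "\<bar>(LINT r:{0..t}|lborel. b r) - (LINT r:{0..s}|lborel. b r)\<bar> \<le> K * \<bar>max 0 t - max 0 s\<bar>"
    unfolding eq[of t] eq[of s]
    using set_integral_Icc_lipschitz[of b "max 0 s" "max 0 t" K] b by auto
  also have "\<dots> \<le> K * \<bar>t - s\<bar>" using K by (intro mult_left_mono) auto
  finally show ?thesis .
qed

text \<open>At a time where \<open>A > A'\<close>, integrate the difference of the drifts from the last time before it at which
  \<open>A \<le> A'\<close>.\<close>
lemma drift_comparison:
  fixes f f' :: "real \<Rightarrow> real \<Rightarrow> real" and w A A' :: "real \<Rightarrow> real"
  assumes meas[measurable]: "(\<lambda>s. f s (w s + A s)) \<in> borel_measurable borel" "(\<lambda>s. f' s (w s + A' s)) \<in> borel_measurable borel"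
    and bd: "\<And>t x. 0 \<le> t \<Longrightarrow> \<bar>f t x\<bar> \<le> K" "\<And>t x. 0 \<le> t \<Longrightarrow> \<bar>f' t x\<bar> \<le> K"
    and lip: "\<And>t x y. 0 \<le> t \<Longrightarrow> \<bar>f t x - f t y\<bar> \<le> L * \<bar>x - y\<bar>" and L: "0 \<le> L"
    and le: "\<And>t x. 0 \<le> t \<Longrightarrow> f t x \<le> f' t x"
    and A: "\<And>t. A t = (LINT s:{0..t}|lborel. f s (w s + A s))"
    and A': "\<And>t. A' t = (LINT s:{0..t}|lborel. f' s (w s + A' s))"
    and t: "0 \<le> t"
  shows "A t \<le> A' t"
proof -
  have lipA: "\<bar>A r - A s\<bar> \<le> K * \<bar>r - s\<bar>" for r s
    by (subst A, subst A, rule set_integral_Icc_abs_diff) (use bd in auto)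
  have lipA': "\<bar>A' r - A' s\<bar> \<le> K * \<bar>r - s\<bar>" for r s
    by (subst A', subst A', rule set_integral_Icc_abs_diff) (use bd in auto)
  have K: "0 \<le> K" using bd(1)[of 0] by (meson abs_ge_zero order_refl order_trans)
  have contA: "continuous_on UNIV h" if "\<And>r s. \<bar>h r - h s\<bar> \<le> K * \<bar>r - s\<bar>" for h :: "real \<Rightarrow> real"
    by (rule lipschitz_on_continuous_on[of K], rule lipschitz_onI) (use that K in \<open>auto simp: dist_real_def\<close>)
  have cA: "continuous_on UNIV A" and cA': "continuous_on UNIV A'"
    by (rule contA, rule lipA) (rule contA, rule lipA')
  have zero: "(LINT s:{0..0}|lborel. h s) = 0" for h :: "real \<Rightarrow> real"
    unfolding set_lebesgue_integral_def
    by (intro integral_eq_zero_AE AE_I'[of "{0}"]) (auto simp: indicator_def split: if_splits)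
  have A0: "A 0 = 0" "A' 0 = 0" using zero A[of 0] A'[of 0] by auto
  define u where "u r = max 0 (A r - A' r)" for r
  have cu: "continuous_on UNIV u" unfolding u_def by (intro continuous_intros cA cA')
  then have [measurable]: "u \<in> borel_measurable borel" by (rule borel_measurable_continuous_onI)
  have u_le: "u r \<le> 2 * K * r" if "0 \<le> r" for r
    using lipA[of r 0] lipA'[of r 0] that A0 K by (auto simp: u_def)
  have volterra: "u r \<le> L * (LINT s:{0..r}|lborel. u s)" if r: "0 \<le> r" for r
  proof (cases "A r \<le> A' r")
    case True
    then have "u r = 0" by (simp add: u_def)
    moreover have "0 \<le> (LINT s:{0..r}|lborel. u s)"
      unfolding set_lebesgue_integral_def by (intro Bochner_Integration.integral_nonneg) (simp add: u_def)
    ultimately show ?thesis using L by simp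
  next
    case False
    define Z where "Z = {s \<in> {0..r}. A s - A' s \<le> 0}"
    have "closed Z"
    proof -
      have "Z = {0..r} \<inter> (\<lambda>s. A s - A' s) -` {..0}" by (auto simp: Z_def)
      moreover have "closed ((\<lambda>s. A s - A' s) -` {..0})"
        by (intro closed_vimage continuous_on_diff cA cA') auto
      ultimately show ?thesis by auto
    qed
    moreover have "Z \<noteq> {}" using r A0 by (auto simp: Z_def)
    moreover have "bdd_above Z" by (auto simp: Z_def intro: bdd_aboveI[of _ r])
    ultimately have SZ: "Sup Z \<in> Z" by (intro closed_contains_Sup)
    define s0 where "s0 = Sup Z"
    have s0: "0 \<le> s0" "s0 \<le> r" "A s0 \<le> A' s0" using SZ by (auto simp: Z_def s0_def)
    have gt: "A' s < A s" if "s \<in> {s0<..r}" for s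
    proof (rule ccontr)
      assume "\<not> A' s < A s"
      then have "s \<in> Z" using that s0 by (auto simp: Z_def)
      then have "s \<le> s0" unfolding s0_def using \<open>bdd_above Z\<close> by (rule cSup_upper)
      then show False using that by simp
    qed
    have i1: "set_integrable lborel {s0<..r} (\<lambda>s. f s (w s + A s))" "set_integrable lborel {s0<..r} (\<lambda>s. f' s (w s + A' s))"
      using s0 bd by (auto intro!: bounded_set_integrable[of _ _ 0 r K])
    have iu: "set_integrable lborel S u" if "S \<subseteq> {0..r}" "S \<in> sets borel" for S
    proof (rule bounded_set_integrable[OF _ that(2,1), of _ "2 * K * r"])
      fix s assume "s \<in> S"
      then have s: "0 \<le> s" "s \<le> r" using that by auto
      have "u s \<le> 2 * K * s" using u_le s by simp
      also have "\<dots> \<le> 2 * K * r" using s K by (intro mult_left_mono) auto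
      finally show "norm (u s) \<le> 2 * K * r" by (simp add: u_def)
    qed simp
    have "u r = (A r - A' r)" using False by (simp add: u_def)
    also have "\<dots> \<le> (A r - A s0) - (A' r - A' s0)" using s0 by simp
    also have "A r - A s0 = (LINT s:{s0<..r}|lborel. f s (w s + A s))"
      unfolding A[of r] A[of s0] using s0 bd by (intro set_integral_Icc_diff[where C=K]) auto
    also have "A' r - A' s0 = (LINT s:{s0<..r}|lborel. f' s (w s + A' s))"
      unfolding A'[of r] A'[of s0] using s0 bd by (intro set_integral_Icc_diff[where C=K]) auto
    also have "(LINT s:{s0<..r}|lborel. f s (w s + A s)) - (LINT s:{s0<..r}|lborel. f' s (w s + A' s)) =
       (LINT s:{s0<..r}|lborel. f s (w s + A s) - f' s (w s + A' s))"
      by (rule set_integral_diff(2)[OF i1, symmetric])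
    also have "\<dots> \<le> (LINT s:{s0<..r}|lborel. L * u s)"
    proof (rule set_integral_mono)
      show "set_integrable lborel {s0<..r} (\<lambda>s. L * u s)"
        using s0 by (intro set_integrable_mult_right impI iu) auto
      fix s assume s: "s \<in> {s0<..r}"
      then have s': "0 \<le> s" using s0 by auto
      \<comment> \<open>Replacing \<open>f'\<close> by \<open>f\<close> at the same argument leaves
        a difference of values of \<open>f\<close> alone, so the Lipschitz bound is asked of the
        smaller drift only.\<close>
      have "f s (w s + A s) - f' s (w s + A' s) \<le> f s (w s + A s) - f s (w s + A' s)"
        using le[OF s'] by simp
      also have "\<dots> \<le> L * \<bar>(w s + A s) - (w s + A' s)\<bar>" using lip[OF s', of "w s + A s" "w s + A' s"] by linarith
      also have "\<dots> = L * u s" using gt[OF s] by (simp add: u_def)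
      finally show "f s (w s + A s) - f' s (w s + A' s) \<le> L * u s" .
    qed (intro set_integral_diff i1)
    also have "\<dots> = L * (LINT s:{s0<..r}|lborel. u s)" by (rule set_integral_mult_right)
    also have "\<dots> \<le> L * (LINT s:{0..r}|lborel. u s)"
    proof (intro mult_left_mono L)
      have "{s0<..r} \<subseteq> {0..r}" using s0 by auto
      then have "integrable lborel (\<lambda>s. indicator {s0<..r} s *\<^sub>R u s)" "integrable lborel (\<lambda>s. indicator {0..r} s *\<^sub>R u s)"
        using iu[of "{s0<..r}"] iu[of "{0..r}"] by (simp_all add: set_integrable_def)
      then show "(LINT s:{s0<..r}|lborel. u s) \<le> (LINT s:{0..r}|lborel. u s)"
        unfolding set_lebesgue_integral_def using s0
        by (intro integral_mono) (auto simp: indicator_def u_def)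
    qed
    finally show ?thesis .
  qed
  \<comment> \<open>\<open>u\<close> satisfies a Volterra inequality with itself, so the iterated
    bound holds for every \<open>j\<close>; the factorial drives it to 0.\<close>
  have bound: "u t \<le> 2 * K * t * (L * t) ^ j / fact j" for j
  proof (rule iterated_volterra_bound[where v="\<lambda>_. u" and T=t])
    show "u r \<le> 2 * K * t" if "0 \<le> r" "r \<le> t" for r
      using u_le[OF that(1)] mult_left_mono[OF that(2), of "2 * K"] K by linarith
  qed (use L K t volterra in \<open>auto simp: u_def\<close>)
  have "(\<lambda>j. 2 * K * t * (L * t) ^ j / fact j) \<longlonglongrightarrow> 2 * K * t * 0"
    using tendsto_mult[OF tendsto_const summable_LIMSEQ_zero[OF summable_exp[of "L * t"]], of "2 * K * t"]
    by (simp add: field_simps)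
  then have "u t \<le> 2 * K * t * 0"
    by (rule tendsto_lowerbound) (auto simp: bound)
  then show ?thesis by (simp add: u_def)
qed

context levy_driver
begin

text \<open>Adaptedness is the delicate point. On \<open>{0..t}\<close> the integrand agrees with
  the one built from \<open>Y\<close> stopped at \<open>t\<close>, which is jointly measurable with
  respect to \<open>F t\<close>.\<close>

lemma integral_process:
  fixes f :: "real \<Rightarrow> real \<Rightarrow> real"
  assumes f: "(\<lambda>z. f (fst z) (snd z)) \<in> borel_measurable (borel \<Otimes>\<^sub>M borel)"
    and bd: "\<And>t x. 0 \<le> t \<Longrightarrow> \<bar>f t x\<bar> \<le> K"
    and Y: "\<And>t. Y t \<in> borel_measurable (F t)"
    and right: "\<And>t \<omega>. \<omega> \<in> space P \<Longrightarrow> continuous (at_right t) (\<lambda>t. Y t \<omega>)"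
  defines "A \<equiv> \<lambda>t \<omega>. (LINT s:{0..t}|lborel. f s (Y s \<omega>))"
  shows "\<And>t. A t \<in> borel_measurable (F t)"
    and "\<And>\<omega> t. \<omega> \<in> space P \<Longrightarrow> isCont (\<lambda>t. A t \<omega>) t"
    and "\<And>\<omega> s t. \<omega> \<in> space P \<Longrightarrow> \<bar>A t \<omega> - A s \<omega>\<bar> \<le> K * \<bar>t - s\<bar>"
    and "\<And>\<omega>. \<omega> \<in> space P \<Longrightarrow> (\<lambda>s. f s (Y s \<omega>)) \<in> borel_measurable borel"
proof -
  note [measurable (raw)] = measurable_joint_comp[OF f]
  show "A t \<in> borel_measurable (F t)" for t
  proof -
    have "(\<lambda>p. Y (min t (fst p)) (snd p)) \<in> borel_measurable (borel \<Otimes>\<^sub>M F t)"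
      by (rule right_continuous_stopped_measurable) (use right in \<open>auto simp: space_F intro: adapted_mono[OF _ Y]\<close>)
    note [measurable (raw)] = measurable_joint_comp[OF this]
    have "(\<lambda>\<omega>. LINT s|lborel. indicator {0..t} s *\<^sub>R f s (Y (min t s) \<omega>)) \<in> borel_measurable (F t)"
      by measurable
    also have "(\<lambda>\<omega>. LINT s|lborel. indicator {0..t} s *\<^sub>R f s (Y (min t s) \<omega>)) = A t"
      unfolding A_def set_lebesgue_integral_def
      by (intro ext Bochner_Integration.integral_cong refl) (auto simp: indicator_def min_absorb2)
    finally show ?thesis .
  qed
  have "(\<lambda>p. Y (fst p) (snd p)) \<in> borel_measurable (borel \<Otimes>\<^sub>M P)"
    by (rule right_continuous_measurable) (use Y right in auto)
  note Ym = measurable_joint_comp[OF this]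
  show meas: "(\<lambda>s. f s (Y s \<omega>)) \<in> borel_measurable borel" if "\<omega> \<in> space P" for \<omega>
  proof -
    have [measurable]: "(\<lambda>s. Y s \<omega>) \<in> borel_measurable borel"
      by (rule Ym) (use that in auto)
    show ?thesis by measurable
  qed
  show lip: "\<bar>A t \<omega> - A s \<omega>\<bar> \<le> K * \<bar>t - s\<bar>" if "\<omega> \<in> space P" for \<omega> s t
    unfolding A_def by (rule set_integral_Icc_abs_diff[OF meas[OF that] bd])
  show "isCont (\<lambda>t. A t \<omega>) t" if "\<omega> \<in> space P" for \<omega> t
  proof -
    have K: "0 \<le> K" using bd[of 0] by (meson abs_ge_zero order_refl order_trans)
    have "continuous_on UNIV (\<lambda>t. A t \<omega>)"
      by (rule lipschitz_on_continuous_on[of K], rule lipschitz_onI) (use lip[OF that] K in \<open>auto simp: dist_real_def\<close>)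
    then show ?thesis by (simp add: continuous_on_eq_continuous_at)
  qed
qed

text \<open>Picard iteration for each sample point: the noise is additive, so
  \<open>A = X - x0 - S\<close> solves an ordinary integral equation with \<open>S\<close> as a
  parameter. Convergence holds for every sample point and every time, hence the limit is adapted and
  the equation holds without an exceptional set.\<close>

lemma lipschitz_drift_solution:
  fixes f :: "real \<Rightarrow> real \<Rightarrow> real"
  assumes f: "(\<lambda>z. f (fst z) (snd z)) \<in> borel_measurable (borel \<Otimes>\<^sub>M borel)"
    and bd: "\<And>t x. \<bar>f t x\<bar> \<le> K"
    and lip: "\<And>t x y. \<bar>f t x - f t y\<bar> \<le> L * \<bar>x - y\<bar>" and L: "0 \<le> L"
  shows "\<exists>X. (\<forall>t. X t \<in> borel_measurable (F t)) \<and>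
    (\<forall>\<omega>\<in>space P. \<forall>t. continuous (at_right t) (\<lambda>t. X t \<omega>)) \<and>
    (\<forall>\<omega>\<in>space P. \<forall>t. X t \<omega> = x0 + S t \<omega> + (LINT s:{0..t}|lborel. f s (X s \<omega>)))"
proof -
  have K: "0 \<le> K" using bd[of 0] by (meson abs_ge_zero order_trans)
  define Aj where "Aj j = ((\<lambda>A t \<omega>. LINT s:{0..t}|lborel. f s (x0 + S s \<omega> + A s \<omega>)) ^^ j) (\<lambda>_ _. 0)" for j
  have Aj_0: "Aj 0 = (\<lambda>_ _. 0)" by (simp add: Aj_def)
  have Aj_Suc: "Aj (Suc j) = (\<lambda>t \<omega>. LINT s:{0..t}|lborel. f s (x0 + S s \<omega> + Aj j s \<omega>))" for j by (simp add: Aj_def)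
  have props: "(\<forall>t. Aj j t \<in> borel_measurable (F t)) \<and> (\<forall>\<omega>\<in>space P. \<forall>t. isCont (\<lambda>t. Aj j t \<omega>) t)" for j
  proof (induction j)
    case 0 then show ?case by (simp add: Aj_0)
  next
    case (Suc j)
    have "(\<lambda>\<omega>. x0 + S t \<omega> + Aj j t \<omega>) \<in> borel_measurable (F t)" for t
      using Suc S_adapted[of t] by (intro borel_measurable_add) auto
    moreover have "continuous (at_right t) (\<lambda>t. x0 + S t \<omega> + Aj j t \<omega>)" if "\<omega> \<in> space P" for t \<omega>
      using Suc that by (intro continuous_intros S_right) (auto intro: continuous_at_imp_continuous_at_within)
    ultimately show ?case
      unfolding Aj_Suc using integral_process(1,2)[OF f bd, of "\<lambda>t \<omega>. x0 + S t \<omega> + Aj j t \<omega>"] by blast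
  qed
  have right: "continuous (at_right t) (\<lambda>t. x0 + S t \<omega> + Aj j t \<omega>)" if "\<omega> \<in> space P" for t \<omega> j
    using props that by (intro continuous_intros S_right) (auto intro: continuous_at_imp_continuous_at_within)
  have adap: "(\<lambda>\<omega>. x0 + S t \<omega> + Aj j t \<omega>) \<in> borel_measurable (F t)" for t j
    using props S_adapted[of t] by (intro borel_measurable_add) auto
  have ip3: "\<bar>Aj (Suc j) t \<omega> - Aj (Suc j) s \<omega>\<bar> \<le> K * \<bar>t - s\<bar>" if "\<omega> \<in> space P" for j s t \<omega>
    unfolding Aj_Suc by (rule integral_process(3)[OF f bd adap right that])
  have ip4: "(\<lambda>s. f s (x0 + S s \<omega> + Aj j s \<omega>)) \<in> borel_measurable borel" if "\<omega> \<in> space P" for j \<omega>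
    by (rule integral_process(4)[OF f bd adap right that])
  have Aj_cont[measurable]: "(\<lambda>t. Aj j t \<omega>) \<in> borel_measurable borel" if "\<omega> \<in> space P" for j \<omega>
    using props that by (intro borel_measurable_continuous_onI) (simp add: continuous_on_eq_continuous_at)
  have incr: "\<bar>Aj (Suc j) t \<omega> - Aj j t \<omega>\<bar> \<le> K * T * (L * t) ^ j / fact j"
    if \<omega>: "\<omega> \<in> space P" and t: "0 \<le> t" "t \<le> T" for j t \<omega> T
  proof (rule iterated_volterra_bound[where v="\<lambda>j t. \<bar>Aj (Suc j) t \<omega> - Aj j t \<omega>\<bar>" and T=T])
    show "(\<lambda>t. \<bar>Aj (Suc j) t \<omega> - Aj j t \<omega>\<bar>) \<in> borel_measurable borel" for j
      using Aj_cont[OF \<omega>, of "Suc j"] Aj_cont[OF \<omega>, of j] by measurable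
    show "\<bar>Aj (Suc 0) t \<omega> - Aj 0 t \<omega>\<bar> \<le> K * T" if "0 \<le> t" "t \<le> T" for t
    proof -
      have "\<bar>Aj (Suc 0) t \<omega> - Aj (Suc 0) 0 \<omega>\<bar> \<le> K * \<bar>t - 0\<bar>"
        by (rule ip3[OF \<omega>])
      moreover have "Aj (Suc 0) 0 \<omega> = 0"
        unfolding Aj_Suc set_lebesgue_integral_def
        by (intro integral_eq_zero_AE AE_I'[of "{0}"]) (auto simp: indicator_def split: if_splits)
      moreover have "K * t \<le> K * T" using that K by (intro mult_left_mono) auto
      ultimately show ?thesis using that by (simp add: Aj_0)
    qed
    fix j t assume t: "0 \<le> t" "t \<le> T"
    let ?g = "\<lambda>j s. f s (x0 + S s \<omega> + Aj j s \<omega>)"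
    have i: "set_integrable lborel {0..t} (?g j)" for j
      by (rule bounded_set_integrable[of _ _ 0 t K]) (use bd ip4[OF \<omega>] in auto)
    have iA: "set_integrable lborel {0..t} (\<lambda>s. \<bar>Aj (Suc j) s \<omega> - Aj j s \<omega>\<bar>)"
      unfolding set_integrable_def
      by (rule borel_integrable_compact)
         (use props \<omega> in \<open>auto intro!: continuous_intros continuous_at_imp_continuous_on\<close>)
    have "\<bar>Aj (Suc (Suc j)) t \<omega> - Aj (Suc j) t \<omega>\<bar> = \<bar>LINT s:{0..t}|lborel. ?g (Suc j) s - ?g j s\<bar>"
      by (subst set_integral_diff(2)[OF i i]) (simp add: Aj_Suc)
    also have "\<dots> \<le> (LINT s:{0..t}|lborel. \<bar>?g (Suc j) s - ?g j s\<bar>)"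
      using set_integral_norm_bound[OF set_integral_diff(1)[OF i[of "Suc j"] i[of j]]] by simp
    also have "\<dots> \<le> (LINT s:{0..t}|lborel. L * \<bar>Aj (Suc j) s \<omega> - Aj j s \<omega>\<bar>)"
    proof (rule set_integral_mono)
      show "set_integrable lborel {0..t} (\<lambda>s. \<bar>?g (Suc j) s - ?g j s\<bar>)"
        using set_integrable_norm[OF set_integral_diff(1)[OF i[of "Suc j"] i[of j]]] by simp
      show "set_integrable lborel {0..t} (\<lambda>s. L * \<bar>Aj (Suc j) s \<omega> - Aj j s \<omega>\<bar>)"
        using iA by (intro set_integrable_mult_right impI)
      show "\<bar>?g (Suc j) s - ?g j s\<bar> \<le> L * \<bar>Aj (Suc j) s \<omega> - Aj j s \<omega>\<bar>" for s
        using lip[of s "x0 + S s \<omega> + Aj (Suc j) s \<omega>" "x0 + S s \<omega> + Aj j s \<omega>"] by simp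
    qed
    also have "\<dots> = L * (LINT s:{0..t}|lborel. \<bar>Aj (Suc j) s \<omega> - Aj j s \<omega>\<bar>)" by (rule set_integral_mult_right)
    finally show "\<bar>Aj (Suc (Suc j)) t \<omega> - Aj (Suc j) t \<omega>\<bar> \<le> L * (LINT s:{0..t}|lborel. \<bar>Aj (Suc j) s \<omega> - Aj j s \<omega>\<bar>)" .
  qed (use L K t in auto)
  define A where "A t \<omega> = lim (\<lambda>j. Aj j t \<omega>)" for t \<omega>
  have lim: "(\<lambda>j. Aj j t \<omega>) \<longlonglongrightarrow> A t \<omega>" if \<omega>: "\<omega> \<in> space P" for t \<omega>
  proof (cases "0 \<le> t")
    case True
    have "summable (\<lambda>j. Aj (Suc j) t \<omega> - Aj j t \<omega>)"
    proof (rule summable_comparison_test'[where N=0])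
      show "summable (\<lambda>j. K * t * (L * t) ^ j / fact j)"
        using summable_mult[OF summable_exp[of "L * t"], of "K * t"] by (simp add: field_simps)
      show "norm (Aj (Suc j) t \<omega> - Aj j t \<omega>) \<le> K * t * (L * t) ^ j / fact j" for j
        using incr[OF \<omega> True order_refl, of j] by simp
    qed
    then have "(\<lambda>n. \<Sum>j<n. Aj (Suc j) t \<omega> - Aj j t \<omega>) \<longlonglongrightarrow> (\<Sum>j. Aj (Suc j) t \<omega> - Aj j t \<omega>)"
      by (rule summable_LIMSEQ)
    then have "convergent (\<lambda>j. Aj j t \<omega>)"
      unfolding sum_lessThan_telescope[of "\<lambda>j. Aj j t \<omega>"] by (auto simp: Aj_0 convergent_def)
    then show ?thesis by (simp add: A_def convergent_LIMSEQ_iff)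
  next
    case False
    then have "Aj j t \<omega> = 0" for j
      by (cases j) (auto simp: Aj_0 Aj_Suc set_lebesgue_integral_def)
    then have "(\<lambda>j. Aj j t \<omega>) \<longlonglongrightarrow> 0" by simp
    then show ?thesis by (simp add: A_def limI)
  qed
  have A_adapted: "A t \<in> borel_measurable (F t)" for t
    by (rule borel_measurable_LIMSEQ_metric[where f="\<lambda>j. Aj j t"]) (use props lim in \<open>auto simp: space_F\<close>)
  have A_eq: "A t \<omega> = (LINT s:{0..t}|lborel. f s (x0 + S s \<omega> + A s \<omega>))" if \<omega>: "\<omega> \<in> space P" for t \<omega>
  proof (rule LIMSEQ_unique)
    show "(\<lambda>j. Aj (Suc j) t \<omega>) \<longlonglongrightarrow> A t \<omega>" by (rule LIMSEQ_Suc[OF lim[OF \<omega>]])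
    have conv: "(\<lambda>j. f s (x0 + S s \<omega> + Aj j s \<omega>)) \<longlonglongrightarrow> f s (x0 + S s \<omega> + A s \<omega>)" for s
    proof (rule metric_tendsto_imp_tendsto)
      show "(\<lambda>j. L * Aj j s \<omega>) \<longlonglongrightarrow> L * A s \<omega>" by (intro tendsto_intros lim \<omega>)
      show "\<forall>\<^sub>F j in sequentially. dist (f s (x0 + S s \<omega> + Aj j s \<omega>)) (f s (x0 + S s \<omega> + A s \<omega>)) \<le> dist (L * Aj j s \<omega>) (L * A s \<omega>)"
      proof (rule always_eventually, rule allI)
        fix j
        have "\<bar>f s (x0 + S s \<omega> + Aj j s \<omega>) - f s (x0 + S s \<omega> + A s \<omega>)\<bar> \<le> L * \<bar>Aj j s \<omega> - A s \<omega>\<bar>"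
          using lip[of s "x0 + S s \<omega> + Aj j s \<omega>" "x0 + S s \<omega> + A s \<omega>"] by simp
        also have "\<dots> = \<bar>L * Aj j s \<omega> - L * A s \<omega>\<bar>"
          unfolding right_diff_distrib[symmetric] using L by (simp add: abs_mult)
        finally show "dist (f s (x0 + S s \<omega> + Aj j s \<omega>)) (f s (x0 + S s \<omega> + A s \<omega>)) \<le> dist (L * Aj j s \<omega>) (L * A s \<omega>)"
          by (simp add: dist_real_def)
      qed
    qed
    show "(\<lambda>j. Aj (Suc j) t \<omega>) \<longlonglongrightarrow> (LINT s:{0..t}|lborel. f s (x0 + S s \<omega> + A s \<omega>))"
      unfolding Aj_Suc set_lebesgue_integral_def
    proof (rule integral_dominated_convergence[where w="\<lambda>s. indicator {0..t} s *\<^sub>R K"])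
      have "set_integrable lborel {0..t} (\<lambda>s. K)"
        by (rule bounded_set_integrable[of _ _ 0 t K]) (use K in auto)
      then show "integrable lborel (\<lambda>s. indicator {0..t} s *\<^sub>R K)" by (simp add: set_integrable_def)
      have [measurable]: "(\<lambda>s. f s (x0 + S s \<omega> + Aj j s \<omega>)) \<in> borel_measurable borel" for j by (rule ip4[OF \<omega>])
      show "(\<lambda>s. indicator {0..t} s *\<^sub>R f s (x0 + S s \<omega> + Aj j s \<omega>)) \<in> borel_measurable lborel" for j by measurable
      have "(\<lambda>s. f s (x0 + S s \<omega> + A s \<omega>)) \<in> borel_measurable borel"
        by (rule borel_measurable_LIMSEQ_metric[OF _ conv]) simp
      then show "(\<lambda>s. indicator {0..t} s *\<^sub>R f s (x0 + S s \<omega> + A s \<omega>)) \<in> borel_measurable lborel" by measurable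
    qed (auto simp: indicator_def bd intro!: AE_I2 conv)
  qed
  define X where "X t \<omega> = x0 + S t \<omega> + A t \<omega>" for t \<omega>
  have A_lip: "\<bar>A t \<omega> - A s \<omega>\<bar> \<le> K * \<bar>t - s\<bar>" if \<omega>: "\<omega> \<in> space P" for s t \<omega>
  proof (rule tendsto_upperbound)
    show "(\<lambda>j. \<bar>Aj (Suc j) t \<omega> - Aj (Suc j) s \<omega>\<bar>) \<longlonglongrightarrow> \<bar>A t \<omega> - A s \<omega>\<bar>"
      by (intro tendsto_intros LIMSEQ_Suc[OF lim] \<omega>)
    show "\<forall>\<^sub>F j in sequentially. \<bar>Aj (Suc j) t \<omega> - Aj (Suc j) s \<omega>\<bar> \<le> K * \<bar>t - s\<bar>"
      by (intro always_eventually allI ip3 \<omega>)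
  qed simp
  have A_cont: "continuous (at_right t) (\<lambda>t. A t \<omega>)" if \<omega>: "\<omega> \<in> space P" for t \<omega>
  proof -
    have "continuous_on UNIV (\<lambda>t. A t \<omega>)"
      by (rule lipschitz_on_continuous_on[of K], rule lipschitz_onI) (use A_lip[OF \<omega>] K in \<open>auto simp: dist_real_def\<close>)
    then show ?thesis by (auto simp: continuous_on_eq_continuous_at intro: continuous_at_imp_continuous_at_within)
  qed
  show ?thesis
  proof (intro exI[of _ X] conjI allI ballI)
    show "X t \<in> borel_measurable (F t)" for t
      unfolding X_def using A_adapted[of t] S_adapted[of t] by (intro borel_measurable_add) auto
    show "continuous (at_right t) (\<lambda>t. X t \<omega>)" if "\<omega> \<in> space P" for \<omega> t
      unfolding X_def using that by (intro continuous_intros S_right A_cont)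
    show "X t \<omega> = x0 + S t \<omega> + (LINT s:{0..t}|lborel. f s (X s \<omega>))" if "\<omega> \<in> space P" for \<omega> t
      unfolding X_def using A_eq[OF that, of t] by simp
  qed
qed

end

section \<open>Lipschitz approximation of measurable drifts\<close>

text \<open>Induction on the structure of the polynomial. A product of Lipschitz functions is
  Lipschitz where both factors are bounded, which confines the claim to a ball.\<close>

lemma real_polynomial_lipschitz_on_cball:
  fixes p :: "'b::euclidean_space \<Rightarrow> real"
  assumes "real_polynomial_function p"
  shows "\<exists>L\<ge>0. \<forall>x\<in>cball 0 r. \<forall>y\<in>cball 0 r. \<bar>p x - p y\<bar> \<le> L * norm (x - y)"
  using assms
proof induction
  case (linear f)
  then interpret bounded_linear f .
  obtain L where L: "\<And>x. norm (f x) \<le> norm x * L" "0 \<le> L" using nonneg_bounded by blast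
  show ?case
  proof (intro exI[of _ L] conjI ballI L(2))
    fix x y show "\<bar>f x - f y\<bar> \<le> L * norm (x - y)"
      using L(1)[of "x - y"] by (simp add: diff mult.commute)
  qed
next
  case (const c)
  then show ?case by (intro exI[of _ 0]) auto
next
  case (add f g)
  then obtain L1 L2 where L: "L1 \<ge> 0" "L2 \<ge> 0"
    "\<And>x y. x \<in> cball 0 r \<Longrightarrow> y \<in> cball 0 r \<Longrightarrow> \<bar>f x - f y\<bar> \<le> L1 * norm (x - y)"
    "\<And>x y. x \<in> cball 0 r \<Longrightarrow> y \<in> cball 0 r \<Longrightarrow> \<bar>g x - g y\<bar> \<le> L2 * norm (x - y)" by blast
  show ?case
  proof (intro exI[of _ "L1 + L2"] conjI ballI)
    fix x y :: 'b assume "x \<in> cball 0 r" "y \<in> cball 0 r"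
    then show "\<bar>f x + g x - (f y + g y)\<bar> \<le> (L1 + L2) * norm (x - y)"
      using L(3)[of x y] L(4)[of x y] by (simp add: distrib_right)
  qed (use L in simp)
next
  case (mult f g)
  then obtain L1 L2 where L: "L1 \<ge> 0" "L2 \<ge> 0"
    "\<And>x y. x \<in> cball 0 r \<Longrightarrow> y \<in> cball 0 r \<Longrightarrow> \<bar>f x - f y\<bar> \<le> L1 * norm (x - y)"
    "\<And>x y. x \<in> cball 0 r \<Longrightarrow> y \<in> cball 0 r \<Longrightarrow> \<bar>g x - g y\<bar> \<le> L2 * norm (x - y)" by blast
  have cont: "continuous_on (cball 0 r) f" "continuous_on (cball 0 r) g"
    using mult continuous_on_polymonial_function by (auto simp: real_polynomial_function_eq)
  obtain B1 where B1: "\<forall>x\<in>cball 0 r. \<bar>f x\<bar> \<le> B1"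
    using compact_imp_bounded[OF compact_continuous_image[OF cont(1) compact_cball]] by (auto simp: bounded_iff)
  obtain B2 where B2: "\<forall>x\<in>cball 0 r. \<bar>g x\<bar> \<le> B2"
    using compact_imp_bounded[OF compact_continuous_image[OF cont(2) compact_cball]] by (auto simp: bounded_iff)
  show ?case
  proof (intro exI[of _ "\<bar>B1\<bar> * L2 + \<bar>B2\<bar> * L1"] conjI ballI)
    fix x y :: 'b assume xy: "x \<in> cball 0 r" "y \<in> cball 0 r"
    have "\<bar>f x * g x - f y * g y\<bar> = \<bar>f x * (g x - g y) + g y * (f x - f y)\<bar>" by (simp add: algebra_simps)
    also have "\<dots> \<le> \<bar>f x\<bar> * \<bar>g x - g y\<bar> + \<bar>g y\<bar> * \<bar>f x - f y\<bar>"
      using abs_triangle_ineq[of "f x * (g x - g y)" "g y * (f x - f y)"] by (simp only: abs_mult)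
    also have "\<dots> \<le> \<bar>B1\<bar> * (L2 * norm (x - y)) + \<bar>B2\<bar> * (L1 * norm (x - y))"
      using xy bspec[OF B1 xy(1)] bspec[OF B2 xy(2)] L by (intro add_mono mult_mono) auto
    finally show "\<bar>f x * g x - f y * g y\<bar> \<le> (\<bar>B1\<bar> * L2 + \<bar>B2\<bar> * L1) * norm (x - y)" by (simp add: algebra_simps)
  qed (use L in simp)
qed

text \<open>Clamping the argument to a square makes a polynomial approximation globally Lipschitz.\<close>
lemma lipschitz_approximation:
  fixes g :: "real \<times> real \<Rightarrow> real"
  assumes g: "continuous_on UNIV g" "\<And>z. \<bar>g z\<bar> \<le> K"
  shows "\<exists>f L. (\<lambda>z. f (fst z) (snd z)) \<in> borel_measurable borel \<and> 0 \<le> L \<and> (\<forall>t x. \<bar>f t x\<bar> \<le> K) \<and>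
    (\<forall>t x y. \<bar>f t x - f t y\<bar> \<le> (L::real) * \<bar>x - y\<bar>) \<and>
    (\<forall>t x. \<bar>t\<bar> \<le> real n \<longrightarrow> \<bar>x\<bar> \<le> real n \<longrightarrow> \<bar>f t x - g (t, x)\<bar> \<le> 1 / real (Suc n))"
proof -
  define cl where "cl x = max (- real n) (min (real n) x)" for x :: real
  have cl: "\<bar>cl x\<bar> \<le> real n" "\<bar>cl x - cl y\<bar> \<le> \<bar>x - y\<bar>" for x y by (auto simp: cl_def)
  have cl_id: "cl x = x" if "\<bar>x\<bar> \<le> real n" for x using that by (auto simp: cl_def)
  have cl_cont: "continuous_on UNIV cl" unfolding cl_def by (intro continuous_intros)
  \<comment> \<open>Large enough for the clamped square, since the norm of a pair is at most the sum
    of the norms of its components.\<close>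
  define r where "r = 2 * real n"
  have ball: "(cl t, cl x) \<in> cball 0 r" for t x
    using norm_Pair_le[of "cl t" "cl x"] cl(1)[of t] cl(1)[of x] by (simp add: r_def)
  obtain p where p: "real_polynomial_function p" "\<And>z. z \<in> cball 0 r \<Longrightarrow> \<bar>g z - p z\<bar> < 1 / real (Suc n)"
    using Stone_Weierstrass_real_polynomial_function[OF compact_cball continuous_on_subset[OF g(1)], of 0 r "1 / real (Suc n)"]
    by auto
  obtain L where L: "0 \<le> L" "\<And>x y. x \<in> cball 0 r \<Longrightarrow> y \<in> cball 0 r \<Longrightarrow> \<bar>p x - p y\<bar> \<le> L * norm (x - y)"
    using real_polynomial_lipschitz_on_cball[OF p(1), of r] by blast
  have K: "0 \<le> K" using g(2)[of undefined] by linarith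
  define f where "f t x = max (- K) (min K (p (cl t, cl x)))" for t x
  have p_cont: "continuous_on UNIV p"
    using p(1) continuous_on_polymonial_function by (auto simp: real_polynomial_function_eq)
  have "continuous_on UNIV (\<lambda>z. f (fst z) (snd z))"
    unfolding f_def
    by (intro continuous_intros continuous_on_compose2[OF p_cont] continuous_on_compose2[OF cl_cont]) auto
  then have "(\<lambda>z. f (fst z) (snd z)) \<in> borel_measurable borel"
    by (rule borel_measurable_continuous_onI)
  moreover have "\<bar>f t x\<bar> \<le> K" for t x using K by (auto simp: f_def)
  moreover have "\<bar>f t x - f t y\<bar> \<le> L * \<bar>x - y\<bar>" for t x y
  proof -
    have "\<bar>f t x - f t y\<bar> \<le> \<bar>p (cl t, cl x) - p (cl t, cl y)\<bar>" by (auto simp: f_def)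
    also have "\<dots> \<le> L * norm ((cl t, cl x) - (cl t, cl y))" by (intro L ball)
    also have "\<dots> \<le> L * \<bar>x - y\<bar>" using L(1) cl(2)[of x y] by (intro mult_left_mono) (auto simp: norm_Pair)
    finally show ?thesis .
  qed
  moreover have "\<bar>f t x - g (t, x)\<bar> \<le> 1 / real (Suc n)" if "\<bar>t\<bar> \<le> real n" "\<bar>x\<bar> \<le> real n" for t x
  proof -
    have "\<bar>f t x - g (t, x)\<bar> \<le> \<bar>p (cl t, cl x) - g (t, x)\<bar>"
      using g(2)[of "(t, x)"] by (auto simp: f_def)
    also have "\<dots> \<le> 1 / real (Suc n)"
      using p(2)[OF ball, of t x] that by (simp add: cl_id abs_minus_commute del: of_nat_Suc)
    finally show ?thesis .
  qed
  ultimately show ?thesis using L(1) by blast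
qed

text \<open>Diagonal choice: \<open>f n\<close> is within \<open>1 / Suc n\<close> of a continuous
  \<open>g n\<close> on the square of half-width \<open>n\<close>, and every point eventually lies
  in these squares. The Lipschitz constants may grow with \<open>n\<close>.\<close>

lemma lipschitz_AE_approximation:
  fixes a :: "real \<Rightarrow> real \<Rightarrow> real"
  assumes a: "(\<lambda>z. a (fst z) (snd z)) \<in> borel_measurable borel" "\<And>t x. \<bar>a t x\<bar> \<le> K"
  shows "\<exists>f L. (\<forall>n. (\<lambda>z. f n (fst z) (snd z)) \<in> borel_measurable borel) \<and> (\<forall>n. 0 \<le> L n) \<and> (\<forall>n t x. \<bar>f n t x\<bar> \<le> K) \<and>
    (\<forall>n t x y. \<bar>f n t x - f n t y\<bar> \<le> (L n :: real) * \<bar>x - y\<bar>) \<and>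
    (AE z in lborel. (\<lambda>n. f n (fst z) (snd z)) \<longlonglongrightarrow> a (fst z) (snd z))"
proof -
  obtain g where g: "\<And>n. continuous_on UNIV (g n)" "\<And>n z. - K \<le> g n z \<and> g n z \<le> K"
    and lim: "AE z in lborel. (\<lambda>n. g n z) \<longlonglongrightarrow> a (fst z) (snd z)"
    using borel_AE_limit_continuous[OF a(1), of "- K" K] a(2) by (auto simp: abs_le_iff minus_le_iff)
  have "\<forall>n. \<exists>f L. (\<lambda>z. f (fst z) (snd z)) \<in> borel_measurable borel \<and> 0 \<le> L \<and> (\<forall>t x. \<bar>f t x\<bar> \<le> K) \<and>
    (\<forall>t x y. \<bar>f t x - f t y\<bar> \<le> (L::real) * \<bar>x - y\<bar>) \<and>
    (\<forall>t x. \<bar>t\<bar> \<le> real n \<longrightarrow> \<bar>x\<bar> \<le> real n \<longrightarrow> \<bar>f t x - g n (t, x)\<bar> \<le> 1 / real (Suc n))"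
    using g by (intro allI lipschitz_approximation) (auto simp: abs_le_iff minus_le_iff)
  from choice[OF this] obtain f where "\<forall>n. \<exists>L. (\<lambda>z. f n (fst z) (snd z)) \<in> borel_measurable borel \<and> 0 \<le> L \<and> (\<forall>t x. \<bar>f n t x\<bar> \<le> K) \<and>
    (\<forall>t x y. \<bar>f n t x - f n t y\<bar> \<le> (L::real) * \<bar>x - y\<bar>) \<and>
    (\<forall>t x. \<bar>t\<bar> \<le> real n \<longrightarrow> \<bar>x\<bar> \<le> real n \<longrightarrow> \<bar>f n t x - g n (t, x)\<bar> \<le> 1 / real (Suc n))" by blast
  from choice[OF this] obtain L where
    f: "\<forall>n. (\<lambda>z. f n (fst z) (snd z)) \<in> borel_measurable borel \<and> 0 \<le> L n \<and> (\<forall>t x. \<bar>f n t x\<bar> \<le> K) \<and>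
      (\<forall>t x y. \<bar>f n t x - f n t y\<bar> \<le> (L n::real) * \<bar>x - y\<bar>) \<and>
      (\<forall>t x. \<bar>t\<bar> \<le> real n \<longrightarrow> \<bar>x\<bar> \<le> real n \<longrightarrow> \<bar>f n t x - g n (t, x)\<bar> \<le> 1 / real (Suc n))" by blast
  have "AE z in lborel. (\<lambda>n. f n (fst z) (snd z)) \<longlonglongrightarrow> a (fst z) (snd z)"
    using lim
  proof eventually_elim
    case (elim z)
    obtain t x where z: "z = (t, x)" by (cases z)
    have "(\<lambda>n. f n t x - g n (t, x)) \<longlonglongrightarrow> 0"
    proof (rule Lim_null_comparison)
      show "(\<lambda>n. 1 / real (Suc n)) \<longlonglongrightarrow> 0" using LIMSEQ_inverse_real_of_nat by (simp add: inverse_eq_divide)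
      show "\<forall>\<^sub>F n in sequentially. norm (f n t x - g n (t, x)) \<le> 1 / real (Suc n)"
        using eventually_ge_at_top[of "nat \<lceil>max \<bar>t\<bar> \<bar>x\<bar>\<rceil>"]
      proof eventually_elim
        case (elim n)
        then have "max \<bar>t\<bar> \<bar>x\<bar> \<le> real n" by linarith
        then show ?case using f by simp
      qed
    qed
    from tendsto_add[OF this elim] show ?case by (simp add: z)
  qed
  with f show ?thesis by blast
qed

context levy_driver
begin

text \<open>Adapted processes whose distance from the driver is a \<open>K\<close>-Lipschitz path started in \<open>x0\<close>;
  unlike \<open>drifted\<close> this is visibly closed under pointwise limits.\<close>
definition lipschitz_drifted :: "real \<Rightarrow> real \<Rightarrow> (real \<Rightarrow> 'a \<Rightarrow> real) \<Rightarrow> bool" where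
  "lipschitz_drifted K x0 X \<longleftrightarrow> (\<forall>t. X t \<in> borel_measurable (F t)) \<and>
    (\<forall>\<omega>\<in>space P. X 0 \<omega> = x0 \<and> (\<forall>s t. \<bar>(X t \<omega> - S t \<omega>) - (X s \<omega> - S s \<omega>)\<bar> \<le> K * \<bar>t - s\<bar>))"

lemma lipschitz_drifted_limit:
  assumes "\<And>n. lipschitz_drifted K x0 (X n)"
    and lim: "\<And>t \<omega>. \<omega> \<in> space P \<Longrightarrow> (\<lambda>n. X n t \<omega>) \<longlonglongrightarrow> Y t \<omega>"
  shows "lipschitz_drifted K x0 Y"
proof -
  have X: "\<And>n t. X n t \<in> borel_measurable (F t)" "\<And>n \<omega>. \<omega> \<in> space P \<Longrightarrow> X n 0 \<omega> = x0"
    "\<And>n \<omega> s t. \<omega> \<in> space P \<Longrightarrow> \<bar>(X n t \<omega> - S t \<omega>) - (X n s \<omega> - S s \<omega>)\<bar> \<le> K * \<bar>t - s\<bar>"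
    using assms(1) by (auto simp: lipschitz_drifted_def)
  show ?thesis
    unfolding lipschitz_drifted_def
  proof (intro conjI allI ballI)
    show "Y t \<in> borel_measurable (F t)" for t
      by (rule borel_measurable_LIMSEQ_metric[OF X(1)]) (use lim in \<open>auto simp: space_F\<close>)
    fix \<omega> assume \<omega>: "\<omega> \<in> space P"
    show "Y 0 \<omega> = x0" using lim[OF \<omega>, of 0] X(2)[OF \<omega>] by (simp add: LIMSEQ_const_iff)
    show "\<bar>(Y t \<omega> - S t \<omega>) - (Y s \<omega> - S s \<omega>)\<bar> \<le> K * \<bar>t - s\<bar>" for s t
    proof (rule tendsto_upperbound)
      show "(\<lambda>n. \<bar>(X n t \<omega> - S t \<omega>) - (X n s \<omega> - S s \<omega>)\<bar>) \<longlonglongrightarrow> \<bar>(Y t \<omega> - S t \<omega>) - (Y s \<omega> - S s \<omega>)\<bar>"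
        by (intro tendsto_intros lim \<omega>)
    qed (auto simp: X \<omega>)
  qed
qed

lemma lipschitz_drifted_cont:
  assumes "lipschitz_drifted K x0 X" "\<omega> \<in> space P"
  shows "isCont (\<lambda>t. X t \<omega> - S t \<omega>) t"
proof -
  have lip: "\<bar>(X t \<omega> - S t \<omega>) - (X s \<omega> - S s \<omega>)\<bar> \<le> K * \<bar>t - s\<bar>" for s t
    using assms by (auto simp: lipschitz_drifted_def)
  have "0 \<le> K * \<bar>1 - 0\<bar>" using lip[of 1 0] by (meson abs_ge_zero order_trans)
  then have "continuous_on UNIV (\<lambda>t. X t \<omega> - S t \<omega>)"
    by (intro lipschitz_on_continuous_on[of K] lipschitz_onI) (use lip in \<open>auto simp: dist_real_def\<close>)
  then show ?thesis by (simp add: continuous_on_eq_continuous_at)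
qed

lemma lipschitz_drifted_right:
  assumes "lipschitz_drifted K x0 X" "\<omega> \<in> space P"
  shows "continuous (at_right t) (\<lambda>t. X t \<omega>)"
  using continuous_add[OF continuous_at_imp_continuous_at_within[OF lipschitz_drifted_cont[OF assms]] S_right[OF assms(2)]]
  by simp

lemma lipschitz_drifted_joint_measurable:
  assumes "lipschitz_drifted K x0 X"
  shows "(\<lambda>p. X (fst p) (snd p)) \<in> borel_measurable (borel \<Otimes>\<^sub>M P)"
  by (rule right_continuous_measurable)
     (use assms lipschitz_drifted_right[OF assms] in \<open>auto simp: lipschitz_drifted_def intro: adapted_measurable\<close>)

lemma lipschitz_drifted_bound:
  assumes "lipschitz_drifted K x0 X" "\<omega> \<in> space P" "0 \<le> t"
  shows "\<bar>X t \<omega>\<bar> \<le> \<bar>x0\<bar> + K * t + \<bar>S t \<omega>\<bar>"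
proof -
  have *: "X 0 \<omega> = x0 \<and> (\<forall>s t. \<bar>(X t \<omega> - S t \<omega>) - (X s \<omega> - S s \<omega>)\<bar> \<le> K * \<bar>t - s\<bar>)"
    using assms(1,2) unfolding lipschitz_drifted_def by blast
  have "\<bar>(X t \<omega> - S t \<omega>) - (X 0 \<omega> - S 0 \<omega>)\<bar> \<le> K * \<bar>t - 0\<bar>" "X 0 \<omega> = x0"
    using * by (fast, fast)
  moreover have "S 0 \<omega> = 0" by (simp add: S_nonpos)
  ultimately show ?thesis using assms(3) by auto
qed

lemma std_normal_density_antimono:
  "\<bar>x\<bar> \<le> y \<Longrightarrow> std_normal_density y \<le> std_normal_density x"
  by (auto simp: std_normal_density_def abs_le_square_iff[symmetric] intro!: divide_right_mono)


end

section \<open>Bounded measurable drifts\<close>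

context levy_driver
begin

text \<open>The weight \<open>wt\<close> is dominated by the Gaussian density at every process \<open>X n\<close> and at \<open>Y\<close> at once, because all of
  them stay within \<open>\<bar>x0\<bar> + K * t + \<bar>S t \<omega>\<bar>\<close>.\<close>
lemma drift_limit:
  fixes b :: "nat \<Rightarrow> real \<Rightarrow> real \<Rightarrow> real" and c :: "real \<Rightarrow> real \<Rightarrow> real"
  assumes X: "\<And>n. lipschitz_drifted K x0 (X n)"
    and lim: "\<And>t \<omega>. \<omega> \<in> space P \<Longrightarrow> (\<lambda>n. X n t \<omega>) \<longlonglongrightarrow> Y t \<omega>"
    and occ: "\<And>T. 0 \<le> T \<Longrightarrow> \<exists>C\<ge>0. \<forall>n. occupation_bound (X n) T C"
    and b: "\<And>n. (\<lambda>z. b n (fst z) (snd z)) \<in> borel_measurable borel" "\<And>n t x. \<bar>b n t x\<bar> \<le> K"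
    and c: "(\<lambda>z. c (fst z) (snd z)) \<in> borel_measurable borel" "\<And>t x. \<bar>c t x\<bar> \<le> K"
    and bc: "AE z in lborel. (\<lambda>n. b n (fst z) (snd z)) \<longlonglongrightarrow> c (fst z) (snd z)"
    and eq: "\<And>n. AE \<omega> in P. \<forall>t\<ge>0. X n t \<omega> = x0 + S t \<omega> + (LINT s:{0..t}|lborel. b n s (X n s \<omega>))"
  shows "AE \<omega> in P. \<forall>t\<ge>0. Y t \<omega> = x0 + S t \<omega> + (LINT s:{0..t}|lborel. c s (Y s \<omega>))"
proof -
  interpret Q: pair_sigma_finite "lborel :: real measure" P ..
  have K: "0 \<le> K" using b(2)[of 0 0 0] by linarith
  have Yl: "lipschitz_drifted K x0 Y" by (rule lipschitz_drifted_limit[OF X lim])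
  note Xm = lipschitz_drifted_joint_measurable[OF X] and Ym = lipschitz_drifted_joint_measurable[OF Yl]
  have bm: "(\<lambda>z. b n (fst z) (snd z)) \<in> borel_measurable (borel \<Otimes>\<^sub>M borel)" for n using b(1)[of n] by (simp add: borel_prod)
  have cm: "(\<lambda>z. c (fst z) (snd z)) \<in> borel_measurable (borel \<Otimes>\<^sub>M borel)" using c(1) by (simp add: borel_prod)
  note [measurable (raw)] = measurable_joint_comp[OF Xm] measurable_joint_comp[OF Ym] measurable_joint_comp[OF S_joint_measurable]
    measurable_joint_comp[OF bm] measurable_joint_comp[OF cm]
  have [measurable]: "fst \<in> borel_measurable (borel :: (real \<times> real) measure)" "snd \<in> borel_measurable (borel :: (real \<times> real) measure)"
    unfolding borel_prod[symmetric] by measurable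
  have "AE \<omega> in P. \<forall>t\<in>{0..T}. Y t \<omega> = x0 + S t \<omega> + (LINT s:{0..t}|lborel. c s (Y s \<omega>))" if T: "0 \<le> T" for T
  proof -
    obtain C where C: "0 \<le> C" and occX: "\<And>n. occupation_bound (X n) T C" using occ[OF T] by blast
    have occY: "occupation_bound Y T C" by (rule occupation_bound_limit[OF Xm lim occX])
    define wt where "wt p = std_normal_density (\<bar>x0\<bar> + K * fst p + \<bar>S (fst p) (snd p)\<bar>)" for p :: "real \<times> 'a"
    define d where "d p = indicator {0..T} (fst p) * ennreal (fst p * wt p)" for p :: "real \<times> 'a"
    have [measurable]: "wt \<in> borel_measurable (borel \<Otimes>\<^sub>M P)" unfolding wt_def by measurable
    have [measurable]: "d \<in> borel_measurable (lborel \<Otimes>\<^sub>M P)" unfolding d_def by measurable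
    have wt: "0 < wt p" "wt p \<le> 1" for p
    proof -
      show "0 < wt p" by (simp add: wt_def normal_density_pos)
      have "1 \<le> sqrt (2 * pi)" using pi_gt3 by simp
      then have "1 / sqrt (2 * pi) * exp (- (\<bar>x0\<bar> + K * fst p + \<bar>S (fst p) (snd p)\<bar>)\<^sup>2 / 2) \<le> 1 * 1"
        by (intro mult_mono) auto
      then show "wt p \<le> 1" by (simp add: wt_def std_normal_density_def)
    qed
    define m where "m = density (lborel \<Otimes>\<^sub>M P) d"
    have m_int: "(\<integral>\<^sup>+ p. h p \<partial>m) = (\<integral>\<^sup>+ p. d p * h p \<partial>(lborel \<Otimes>\<^sub>M P))" if [measurable]: "h \<in> borel_measurable (lborel \<Otimes>\<^sub>M P)" for h
      unfolding m_def by (rule nn_integral_density) measurable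
    have d_fin: "(\<integral>\<^sup>+ p. d p \<partial>(lborel \<Otimes>\<^sub>M P)) < \<infinity>"
    proof -
      have "(\<integral>\<^sup>+ p. d p \<partial>(lborel \<Otimes>\<^sub>M P)) \<le> (\<integral>\<^sup>+ p. indicator {0..T} (fst p) * ennreal T \<partial>(lborel \<Otimes>\<^sub>M P))"
      proof (intro nn_integral_mono)
        fix p :: "real \<times> 'a"
        show "d p \<le> indicator {0..T} (fst p) * ennreal T"
        proof (cases "fst p \<in> {0..T}")
          case True
          then have "fst p * wt p \<le> T * 1" using wt[of p] by (intro mult_mono) auto
          then show ?thesis using True by (simp add: d_def ennreal_leI)
        qed (simp add: d_def)
      qed
      also have "\<dots> = (\<integral>\<^sup>+ t. (\<integral>\<^sup>+ \<omega>. indicator {0..T} t * ennreal T \<partial>P) \<partial>lborel)"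
        by (subst sigma_finite_measure.nn_integral_fst[OF prob_space_imp_sigma_finite[OF prob_space_axioms], symmetric]) auto
      also have "\<dots> = ennreal T * ennreal T" using T by (simp add: emeasure_space_1 nn_integral_multc)
      finally show ?thesis by (simp add: le_less_trans ennreal_mult_less_top)
    qed
    \<comment> \<open>The squared norm on the right of \<open>occupation_bound_borel\<close>. Its
      Gaussian factor makes it finite for bounded \<open>h\<close> and lets it pass to almost
      everywhere limits.\<close>
    define I where "I h = (\<integral>\<^sup>+ z. indicator {0..T} (fst z) * ennreal (std_normal_density (snd z) * (h (fst z) (snd z))\<^sup>2) \<partial>lborel)" for h :: "real \<Rightarrow> real \<Rightarrow> real"
    have key: "(\<integral>\<^sup>+ p. d p * ennreal (h (fst p) (Z (fst p) (snd p))) \<partial>(lborel \<Otimes>\<^sub>M P)) \<le> ennreal \<alpha> * I h + ennreal (C / \<alpha>)"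
      if Z: "lipschitz_drifted K x0 Z" "occupation_bound Z T C" and h: "(\<lambda>z. h (fst z) (snd z)) \<in> borel_measurable borel" "\<And>t x. 0 \<le> h t x" "\<And>t x. h t x \<le> 2 * K" and \<alpha>: "0 < \<alpha>" for Z h \<alpha>
    proof -
      have "(\<integral>\<^sup>+ p. d p * ennreal (h (fst p) (Z (fst p) (snd p))) \<partial>(lborel \<Otimes>\<^sub>M P)) \<le>
        (\<integral>\<^sup>+ p. indicator {0..T} (fst p) * ennreal (fst p * (std_normal_density (Z (fst p) (snd p)) * h (fst p) (Z (fst p) (snd p)))) \<partial>(lborel \<Otimes>\<^sub>M P))"
      proof (rule nn_integral_mono)
        fix p :: "real \<times> 'a" assume "p \<in> space (lborel \<Otimes>\<^sub>M P)"
        then have p: "snd p \<in> space P" by (auto simp: space_pair_measure)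
        show "d p * ennreal (h (fst p) (Z (fst p) (snd p))) \<le> indicator {0..T} (fst p) * ennreal (fst p * (std_normal_density (Z (fst p) (snd p)) * h (fst p) (Z (fst p) (snd p))))"
        proof (cases "fst p \<in> {0..T}")
          case True
          then have "wt p \<le> std_normal_density (Z (fst p) (snd p))"
            unfolding wt_def by (intro std_normal_density_antimono lipschitz_drifted_bound Z p) auto
          then have "fst p * (wt p * h (fst p) (Z (fst p) (snd p))) \<le> fst p * (std_normal_density (Z (fst p) (snd p)) * h (fst p) (Z (fst p) (snd p)))"
            using True h(2) by (intro mult_left_mono mult_right_mono) auto
          then show ?thesis using True h(2) wt[of p] by (simp add: d_def ennreal_mult[symmetric] ennreal_leI mult.assoc)
        qed (simp add: d_def)
      qed
      also have "\<dots> \<le> ennreal \<alpha> * I h + ennreal (C / \<alpha>)"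
        unfolding I_def by (rule occupation_bound_borel[OF lipschitz_drifted_joint_measurable[OF Z(1)] Z(2) C \<alpha> T h])
      finally show ?thesis .
    qed
    have I_conv: "(\<lambda>n. I (\<lambda>t x. \<bar>h n t x - k t x\<bar>)) \<longlonglongrightarrow> I (\<lambda>t x. \<bar>l t x - k t x\<bar>)"
      if [measurable]: "\<And>n. (\<lambda>z. h n (fst z) (snd z)) \<in> borel_measurable borel" "(\<lambda>z. k (fst z) (snd z)) \<in> borel_measurable borel" "(\<lambda>z. l (fst z) (snd z)) \<in> borel_measurable borel"
      and bds: "\<And>n t x. \<bar>h n t x\<bar> \<le> K" "\<And>t x. \<bar>k t x\<bar> \<le> K" and hl: "AE z in lborel. (\<lambda>n. h n (fst z) (snd z)) \<longlonglongrightarrow> l (fst z) (snd z)"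
      for h :: "nat \<Rightarrow> real \<Rightarrow> real \<Rightarrow> real" and k l
      unfolding I_def
    proof (rule nn_integral_dominated_convergence[where w="\<lambda>z. ennreal ((2 * K)\<^sup>2) * (indicator {0..T} (fst z) * ennreal (std_normal_density (snd z)))"])
      show "AE z in lborel. indicator {0..T} (fst z) * ennreal (std_normal_density (snd z) * \<bar>h n (fst z) (snd z) - k (fst z) (snd z)\<bar>\<^sup>2) \<le>
        ennreal ((2 * K)\<^sup>2) * (indicator {0..T} (fst z) * ennreal (std_normal_density (snd z)))" for n
      proof (rule AE_I2)
        fix z :: "real \<times> real"
        have "\<bar>h n (fst z) (snd z) - k (fst z) (snd z)\<bar> \<le> 2 * K" using bds(1)[of n "fst z" "snd z"] bds(2)[of "fst z" "snd z"] by linarith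
        then have "\<bar>h n (fst z) (snd z) - k (fst z) (snd z)\<bar>\<^sup>2 \<le> (2 * K)\<^sup>2" by (intro power_mono) auto
        then have "std_normal_density (snd z) * \<bar>h n (fst z) (snd z) - k (fst z) (snd z)\<bar>\<^sup>2 \<le> std_normal_density (snd z) * (2 * K)\<^sup>2"
          by (rule mult_left_mono) simp
        then have "ennreal (std_normal_density (snd z) * \<bar>h n (fst z) (snd z) - k (fst z) (snd z)\<bar>\<^sup>2) \<le> ennreal (std_normal_density (snd z)) * ennreal ((2 * K)\<^sup>2)"
          by (subst ennreal_mult[symmetric]) (auto intro: ennreal_leI)
        then show "indicator {0..T} (fst z) * ennreal (std_normal_density (snd z) * \<bar>h n (fst z) (snd z) - k (fst z) (snd z)\<bar>\<^sup>2) \<le>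
        ennreal ((2 * K)\<^sup>2) * (indicator {0..T} (fst z) * ennreal (std_normal_density (snd z)))"
          by (cases "fst z \<in> {0..T}") (auto simp: mult.commute)
      qed
      have "(\<integral>\<^sup>+ z. indicator {0..T} (fst z) * ennreal (std_normal_density (snd z)) \<partial>lborel) = (\<integral>\<^sup>+ t. (\<integral>\<^sup>+ x. indicator {0..T} t * ennreal (std_normal_density x) \<partial>lborel) \<partial>lborel)"
        unfolding lborel_prod[symmetric] by (subst lborel.nn_integral_fst[symmetric]) auto
      also have "\<dots> = (\<integral>\<^sup>+ t. indicator {0..T} t * (\<integral>\<^sup>+ x. ennreal (std_normal_density x) \<partial>lborel) \<partial>lborel)"
        by (simp add: nn_integral_cmult)
      also have "(\<integral>\<^sup>+ x. ennreal (std_normal_density x) \<partial>lborel) = 1"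
        by (subst nn_integral_eq_integral) auto
      finally show "(\<integral>\<^sup>+ z. ennreal ((2 * K)\<^sup>2) * (indicator {0..T} (fst z) * ennreal (std_normal_density (snd z))) \<partial>lborel) < \<infinity>"
        using T by (simp add: nn_integral_cmult ennreal_mult_less_top)
      show "AE z in lborel. (\<lambda>n. indicator {0..T} (fst z) * ennreal (std_normal_density (snd z) * \<bar>h n (fst z) (snd z) - k (fst z) (snd z)\<bar>\<^sup>2))
        \<longlonglongrightarrow> indicator {0..T} (fst z) * ennreal (std_normal_density (snd z) * \<bar>l (fst z) (snd z) - k (fst z) (snd z)\<bar>\<^sup>2)"
        using hl
      proof eventually_elim
        case (elim z)
        then have "(\<lambda>n. ennreal (std_normal_density (snd z) * \<bar>h n (fst z) (snd z) - k (fst z) (snd z)\<bar>\<^sup>2))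
          \<longlonglongrightarrow> ennreal (std_normal_density (snd z) * \<bar>l (fst z) (snd z) - k (fst z) (snd z)\<bar>\<^sup>2)"
          by (intro tendsto_ennrealI tendsto_intros)
        then show ?case by (cases "fst z \<in> {0..T}") auto
      qed
    qed measurable
    define u where "u n p = b n (fst p) (X n (fst p) (snd p)) - c (fst p) (Y (fst p) (snd p))" for n and p :: "real \<times> 'a"
    have u_meas[measurable]: "u n \<in> borel_measurable (lborel \<Otimes>\<^sub>M P)" for n unfolding u_def by measurable
    have u_bd: "\<bar>u n p\<bar> \<le> 2 * K" for n p
      using b(2)[of n "fst p" "X n (fst p) (snd p)"] c(2)[of "fst p" "Y (fst p) (snd p)"] unfolding u_def by linarith
    define E where "E n = (\<integral>\<^sup>+ p. d p * ennreal \<bar>u n p\<bar> \<partial>(lborel \<Otimes>\<^sub>M P))" for n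
    \<comment> \<open>For a merely measurable \<open>c\<close>, convergence of \<open>X n\<close> to
      \<open>Y\<close> says nothing about \<open>c\<close> along \<open>X n\<close>. Continuous
      functions \<open>g k\<close> that approximate \<open>c\<close> almost everywhere are therefore
      interposed.\<close>
    obtain g where g: "\<And>k. continuous_on UNIV (g k)" "\<And>k z. - K \<le> g k z \<and> g k z \<le> K"
      and glim: "AE z in lborel. (\<lambda>k. g k z) \<longlonglongrightarrow> c (fst z) (snd z)"
      using borel_AE_limit_continuous[OF c(1), of "- K" K] c(2) by (auto simp: abs_le_iff minus_le_iff)
    have gK: "\<bar>g k z\<bar> \<le> K" for k z using g(2)[of k z] by auto
    have gm[measurable]: "g k \<in> borel_measurable borel" for k by (rule borel_measurable_continuous_onI[OF g(1)])
    have gc: "\<bar>g k z - c (fst z) (snd z)\<bar> \<le> 2 * K" for k z using gK[of k z] c(2)[of "fst z" "snd z"] by linarith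
    \<comment> \<open>The triangle inequality goes from \<open>b n\<close> to \<open>g k\<close>
      along \<open>X n\<close>, from \<open>X n\<close> to \<open>Y\<close> inside
      \<open>g k\<close>, and from \<open>g k\<close> to \<open>c\<close> along \<open>Y\<close>.
      The outer terms fall under the occupation bounds, the middle one tends to 0 by continuity of
      \<open>g k\<close>. First \<open>n\<close> tends to infinity, then \<open>k\<close>; the terms
      \<open>C / \<alpha>\<close> remain.\<close>
    have Elim: "limsup E \<le> ennreal (2 * C / \<alpha>)" if \<alpha>: "0 < \<alpha>" for \<alpha>
    proof -
      have bound: "limsup E \<le> (ennreal \<alpha> * I (\<lambda>t x. \<bar>c t x - g k (t, x)\<bar>) + ennreal (C / \<alpha>)) + 0 + (ennreal \<alpha> * I (\<lambda>t x. \<bar>g k (t, x) - c t x\<bar>) + ennreal (C / \<alpha>))" for k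
      proof -
        define A2 where "A2 n = (\<integral>\<^sup>+ p. d p * ennreal \<bar>g k (fst p, X n (fst p) (snd p)) - g k (fst p, Y (fst p) (snd p))\<bar> \<partial>(lborel \<Otimes>\<^sub>M P))" for n
        note [measurable (raw)] = continuous_pair_comp_measurable[OF g(1)]
        let ?B = "\<lambda>n. (ennreal \<alpha> * I (\<lambda>t x. \<bar>b n t x - g k (t, x)\<bar>) + ennreal (C / \<alpha>)) + A2 n + (ennreal \<alpha> * I (\<lambda>t x. \<bar>g k (t, x) - c t x\<bar>) + ennreal (C / \<alpha>))"
        have "E n \<le> ?B n" for n
        proof -
          have "E n \<le> (\<integral>\<^sup>+ p. (d p * ennreal \<bar>b n (fst p) (X n (fst p) (snd p)) - g k (fst p, X n (fst p) (snd p))\<bar> +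
              d p * ennreal \<bar>g k (fst p, X n (fst p) (snd p)) - g k (fst p, Y (fst p) (snd p))\<bar>) +
              d p * ennreal \<bar>g k (fst p, Y (fst p) (snd p)) - c (fst p) (Y (fst p) (snd p))\<bar> \<partial>(lborel \<Otimes>\<^sub>M P))"
            unfolding E_def
          proof (rule nn_integral_mono)
            fix p
            have "\<bar>u n p\<bar> \<le> (\<bar>b n (fst p) (X n (fst p) (snd p)) - g k (fst p, X n (fst p) (snd p))\<bar> +
              \<bar>g k (fst p, X n (fst p) (snd p)) - g k (fst p, Y (fst p) (snd p))\<bar>) + \<bar>g k (fst p, Y (fst p) (snd p)) - c (fst p) (Y (fst p) (snd p))\<bar>"
              unfolding u_def by linarith
            from ennreal_leI[OF this] have "ennreal \<bar>u n p\<bar> \<le> (ennreal \<bar>b n (fst p) (X n (fst p) (snd p)) - g k (fst p, X n (fst p) (snd p))\<bar> +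
              ennreal \<bar>g k (fst p, X n (fst p) (snd p)) - g k (fst p, Y (fst p) (snd p))\<bar>) + ennreal \<bar>g k (fst p, Y (fst p) (snd p)) - c (fst p) (Y (fst p) (snd p))\<bar>"
              by (simp only: ennreal_plus abs_ge_zero add_nonneg_nonneg)
            from mult_left_mono[OF this, of "d p"]
            show "d p * ennreal \<bar>u n p\<bar> \<le> (d p * ennreal \<bar>b n (fst p) (X n (fst p) (snd p)) - g k (fst p, X n (fst p) (snd p))\<bar> +
              d p * ennreal \<bar>g k (fst p, X n (fst p) (snd p)) - g k (fst p, Y (fst p) (snd p))\<bar>) + d p * ennreal \<bar>g k (fst p, Y (fst p) (snd p)) - c (fst p) (Y (fst p) (snd p))\<bar>"
              by (simp only: distrib_left zero_le)
          qed
          also have "\<dots> = (\<integral>\<^sup>+ p. d p * ennreal \<bar>b n (fst p) (X n (fst p) (snd p)) - g k (fst p, X n (fst p) (snd p))\<bar> \<partial>(lborel \<Otimes>\<^sub>M P)) + A2 n +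
             (\<integral>\<^sup>+ p. d p * ennreal \<bar>g k (fst p, Y (fst p) (snd p)) - c (fst p) (Y (fst p) (snd p))\<bar> \<partial>(lborel \<Otimes>\<^sub>M P))"
            unfolding A2_def by (simp add: nn_integral_add)
          also have "\<dots> \<le> ?B n"
          proof (intro add_mono order_refl)
            show "(\<integral>\<^sup>+ p. d p * ennreal \<bar>b n (fst p) (X n (fst p) (snd p)) - g k (fst p, X n (fst p) (snd p))\<bar> \<partial>(lborel \<Otimes>\<^sub>M P)) \<le> ennreal \<alpha> * I (\<lambda>t x. \<bar>b n t x - g k (t, x)\<bar>) + ennreal (C / \<alpha>)"
            proof (rule key[of "X n" "\<lambda>t x. \<bar>b n t x - g k (t, x)\<bar>" \<alpha>, OF X occX _ _ _ \<alpha>])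
              show "(\<lambda>z. \<bar>b n (fst z) (snd z) - g k (fst z, snd z)\<bar>) \<in> borel_measurable borel" using b(1)[of n] by simp
              show "\<bar>b n t x - g k (t, x)\<bar> \<le> 2 * K" for t x using b(2)[of n t x] gK[of k "(t, x)"] by linarith
            qed simp
            show "(\<integral>\<^sup>+ p. d p * ennreal \<bar>g k (fst p, Y (fst p) (snd p)) - c (fst p) (Y (fst p) (snd p))\<bar> \<partial>(lborel \<Otimes>\<^sub>M P)) \<le> ennreal \<alpha> * I (\<lambda>t x. \<bar>g k (t, x) - c t x\<bar>) + ennreal (C / \<alpha>)"
            proof (rule key[of Y "\<lambda>t x. \<bar>g k (t, x) - c t x\<bar>" \<alpha>, OF Yl occY _ _ _ \<alpha>])
              show "(\<lambda>z. \<bar>g k (fst z, snd z) - c (fst z) (snd z)\<bar>) \<in> borel_measurable borel" using c(1) by simp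
              show "\<bar>g k (t, x) - c t x\<bar> \<le> 2 * K" for t x using gc[of k "(t, x)"] by simp
            qed simp
          qed
          finally show ?thesis .
        qed
        then have "limsup E \<le> limsup ?B" by (intro Limsup_mono always_eventually allI)
        also have "limsup ?B = (ennreal \<alpha> * I (\<lambda>t x. \<bar>c t x - g k (t, x)\<bar>) + ennreal (C / \<alpha>)) + 0 + (ennreal \<alpha> * I (\<lambda>t x. \<bar>g k (t, x) - c t x\<bar>) + ennreal (C / \<alpha>))"
        proof (rule lim_imp_Limsup)
          have "(\<lambda>n. I (\<lambda>t x. \<bar>b n t x - g k (t, x)\<bar>)) \<longlonglongrightarrow> I (\<lambda>t x. \<bar>c t x - g k (t, x)\<bar>)"
            by (rule I_conv[OF b(1) _ c(1) b(2) gK bc]) simp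
          moreover have "A2 \<longlonglongrightarrow> (\<integral>\<^sup>+ p. 0 \<partial>((lborel :: real measure) \<Otimes>\<^sub>M P))"
            unfolding A2_def
          proof (rule nn_integral_dominated_convergence[where w="\<lambda>p. ennreal (2 * K) * d p"])
            show "AE p in lborel \<Otimes>\<^sub>M P. d p * ennreal \<bar>g k (fst p, X n (fst p) (snd p)) - g k (fst p, Y (fst p) (snd p))\<bar> \<le> ennreal (2 * K) * d p" for n
            proof (rule AE_I2)
              fix p :: "real \<times> 'a"
              have "\<bar>g k (fst p, X n (fst p) (snd p)) - g k (fst p, Y (fst p) (snd p))\<bar> \<le> 2 * K"
                using gK[of k "(fst p, X n (fst p) (snd p))"] gK[of k "(fst p, Y (fst p) (snd p))"] by linarith
              then show "d p * ennreal \<bar>g k (fst p, X n (fst p) (snd p)) - g k (fst p, Y (fst p) (snd p))\<bar> \<le> ennreal (2 * K) * d p"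
                unfolding mult.commute[of "ennreal (2 * K)"] by (intro mult_left_mono ennreal_leI) auto
            qed
            show "(\<integral>\<^sup>+ p. ennreal (2 * K) * d p \<partial>(lborel \<Otimes>\<^sub>M P)) < \<infinity>"
              using d_fin by (simp add: nn_integral_cmult ennreal_mult_less_top)
            show "AE p in lborel \<Otimes>\<^sub>M P. (\<lambda>n. d p * ennreal \<bar>g k (fst p, X n (fst p) (snd p)) - g k (fst p, Y (fst p) (snd p))\<bar>) \<longlonglongrightarrow> 0"
            proof (rule AE_I2)
              fix p :: "real \<times> 'a" assume "p \<in> space (lborel \<Otimes>\<^sub>M P)"
              then have p: "snd p \<in> space P" by (auto simp: space_pair_measure)
              have "(\<lambda>n. g k (fst p, X n (fst p) (snd p))) \<longlonglongrightarrow> g k (fst p, Y (fst p) (snd p))"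
                using g(1)[of k] by (intro continuous_on_tendsto_compose[of UNIV "g k"] tendsto_Pair tendsto_const lim p) auto
              then have "(\<lambda>n. \<bar>g k (fst p, X n (fst p) (snd p)) - g k (fst p, Y (fst p) (snd p))\<bar>) \<longlonglongrightarrow> \<bar>g k (fst p, Y (fst p) (snd p)) - g k (fst p, Y (fst p) (snd p))\<bar>"
                by (intro tendsto_intros)
              then have "(\<lambda>n. ennreal \<bar>g k (fst p, X n (fst p) (snd p)) - g k (fst p, Y (fst p) (snd p))\<bar>) \<longlonglongrightarrow> ennreal 0"
                by (intro tendsto_ennrealI) simp
              then have "(\<lambda>n. d p * ennreal \<bar>g k (fst p, X n (fst p) (snd p)) - g k (fst p, Y (fst p) (snd p))\<bar>) \<longlonglongrightarrow> d p * ennreal 0"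
                by (intro ennreal_tendsto_cmult) (auto simp: d_def indicator_def)
              then show "(\<lambda>n. d p * ennreal \<bar>g k (fst p, X n (fst p) (snd p)) - g k (fst p, Y (fst p) (snd p))\<bar>) \<longlonglongrightarrow> 0" by simp
            qed
          qed measurable
          ultimately show "?B \<longlonglongrightarrow> (ennreal \<alpha> * I (\<lambda>t x. \<bar>c t x - g k (t, x)\<bar>) + ennreal (C / \<alpha>)) + 0 + (ennreal \<alpha> * I (\<lambda>t x. \<bar>g k (t, x) - c t x\<bar>) + ennreal (C / \<alpha>))"
            by (intro tendsto_add tendsto_const ennreal_tendsto_cmult) auto
        qed simp
        finally show ?thesis .
      qed
      have "limsup E \<le> (ennreal \<alpha> * I (\<lambda>t x. \<bar>c t x - c t x\<bar>) + ennreal (C / \<alpha>)) + 0 + (ennreal \<alpha> * I (\<lambda>t x. \<bar>c t x - c t x\<bar>) + ennreal (C / \<alpha>))"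
      proof (rule tendsto_lowerbound)
        have "(\<lambda>k. I (\<lambda>t x. \<bar>g k (t, x) - c t x\<bar>)) \<longlonglongrightarrow> I (\<lambda>t x. \<bar>c t x - c t x\<bar>)"
          by (rule I_conv[OF _ c(1) c(1) _ c(2)]) (use gK glim in auto)
        then show "(\<lambda>k. (ennreal \<alpha> * I (\<lambda>t x. \<bar>c t x - g k (t, x)\<bar>) + ennreal (C / \<alpha>)) + 0 + (ennreal \<alpha> * I (\<lambda>t x. \<bar>g k (t, x) - c t x\<bar>) + ennreal (C / \<alpha>)))
          \<longlonglongrightarrow> (ennreal \<alpha> * I (\<lambda>t x. \<bar>c t x - c t x\<bar>) + ennreal (C / \<alpha>)) + 0 + (ennreal \<alpha> * I (\<lambda>t x. \<bar>c t x - c t x\<bar>) + ennreal (C / \<alpha>))"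
          unfolding abs_minus_commute[of "c _ _" "g _ _"]
          by (intro tendsto_add tendsto_const ennreal_tendsto_cmult) auto
      qed (use bound in auto)
      also have "I (\<lambda>t x. \<bar>c t x - c t x\<bar>) = 0" by (simp add: I_def)
      finally show ?thesis using C \<alpha> by (simp add: ennreal_plus[symmetric] del: ennreal_plus)
    qed
    \<comment> \<open>The squared norms, which carry the factor \<open>\<alpha>\<close>, are already
      gone, so \<open>\<alpha>\<close> may now tend to infinity.\<close>
    have "limsup E \<le> ennreal 0"
    proof (rule tendsto_lowerbound)
      have "(\<lambda>n. 2 * C * inverse (real (Suc n))) \<longlonglongrightarrow> 2 * C * 0"
        by (intro tendsto_intros LIMSEQ_inverse_real_of_nat)
      then show "(\<lambda>n. ennreal (2 * C / real (Suc n))) \<longlonglongrightarrow> ennreal 0"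
        by (intro tendsto_ennrealI) (simp add: divide_inverse)
      show "\<forall>\<^sub>F n in sequentially. limsup E \<le> ennreal (2 * C / real (Suc n))"
        by (intro always_eventually allI Elim) simp
    qed simp
    then have E0: "E \<longlonglongrightarrow> 0"
      by (intro tendsto_0_if_Limsup_eq_0_ennreal) simp
    have "finite_measure m"
    proof (rule finite_measureI)
      have "emeasure m (space m) = (\<integral>\<^sup>+ p. 1 \<partial>m)" by simp
      also have "\<dots> = (\<integral>\<^sup>+ p. d p \<partial>(lborel \<Otimes>\<^sub>M P))" by (subst m_int) auto
      finally show "emeasure m (space m) \<noteq> \<infinity>" using d_fin by simp
    qed
    then interpret m: finite_measure m .
    have sets_m[measurable_cong]: "sets m = sets (lborel \<Otimes>\<^sub>M P)" by (simp add: m_def)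
    \<comment> \<open>Convergence in mean yields almost everywhere convergence along a subsequence.
      That is enough, because the left-hand sides \<open>X n t \<omega>\<close> converge along the
      whole sequence.\<close>
    have "\<exists>r::nat \<Rightarrow> nat. strict_mono r \<and> (AE p in m. (\<lambda>n. u (r n) p) \<longlonglongrightarrow> 0)"
    proof (rule tendsto_L1_AE_subseq)
      show "integrable m (u n)" for n
        by (rule m.integrable_const_bound[where B="2 * K"]) (use u_bd in auto)
      have "(\<lambda>n. enn2real (E n)) \<longlonglongrightarrow> enn2real 0"
        using E0 by (intro tendsto_enn2real) simp_all
      moreover have "enn2real (E n) = (LINT p|m. norm (u n p))" for n
        by (subst integral_eq_nn_integral) (auto simp: E_def m_int)
      ultimately show "(\<lambda>n. LINT p|m. norm (u n p)) \<longlonglongrightarrow> 0" by simp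
    qed
    then obtain r :: "nat \<Rightarrow> nat" where r: "strict_mono r" "AE p in m. (\<lambda>n. u (r n) p) \<longlonglongrightarrow> 0" by blast
    have "AE p in lborel \<Otimes>\<^sub>M P. 0 < d p \<longrightarrow> (\<lambda>n. u (r n) p) \<longlonglongrightarrow> 0"
      using r(2) unfolding m_def by (subst (asm) AE_density) auto
    then obtain N where N: "N \<in> null_sets (lborel \<Otimes>\<^sub>M P)"
      "\<And>p. p \<in> space (lborel \<Otimes>\<^sub>M P) - N \<Longrightarrow> 0 < d p \<longrightarrow> (\<lambda>n. u (r n) p) \<longlonglongrightarrow> 0"
      by (auto elim!: AE_E3)
    have [measurable]: "N \<in> sets (lborel \<Otimes>\<^sub>M P)" using N(1) by auto
    have "AE p in lborel \<Otimes>\<^sub>M P. p \<notin> N" by (rule AE_not_in[OF N(1)])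
    then have "AE t in lborel. AE \<omega> in P. (t, \<omega>) \<notin> N"
      using Q.AE_pair by fast
    then have "AE \<omega> in P. AE t in lborel. (t, \<omega>) \<notin> N"
      by (subst (asm) Q.AE_commute) measurable
    moreover have "AE \<omega> in P. \<forall>n. \<forall>t\<ge>0. X n t \<omega> = x0 + S t \<omega> + (LINT s:{0..t}|lborel. b n s (X n s \<omega>))"
      using eq by (simp add: AE_all_countable)
    ultimately show ?thesis
      using AE_space
    proof eventually_elim
      case (elim \<omega>)
      note \<omega>[measurable] = elim(3)
      have [measurable]: "(\<lambda>s. b n s (X n s \<omega>)) \<in> borel_measurable borel" "(\<lambda>s. c s (Y s \<omega>)) \<in> borel_measurable borel" for n
        by measurable
      \<comment> \<open>The density \<open>d\<close> is positive on the strip except at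
        \<open>s = 0\<close>, where the factor \<open>s\<close> makes it vanish; this single time is
        discarded.\<close>
      have pt: "AE s in lborel. s \<in> {0..T} \<longrightarrow> (\<lambda>n. b (r n) s (X (r n) s \<omega>)) \<longlonglongrightarrow> c s (Y s \<omega>)"
        using elim(1) AE_lborel_singleton[of 0]
      proof eventually_elim
        case (elim s)
        show ?case
        proof
          assume s: "s \<in> {0..T}"
          have "0 < d (s, \<omega>)" using s elim(2) wt(1)[of "(s, \<omega>)"] by (auto simp: d_def)
          then have "(\<lambda>n. u (r n) (s, \<omega>)) \<longlonglongrightarrow> 0"
            using N(2)[of "(s, \<omega>)"] elim(1) \<omega> by (auto simp: space_pair_measure)
          then have "(\<lambda>n. u (r n) (s, \<omega>) + c s (Y s \<omega>)) \<longlonglongrightarrow> 0 + c s (Y s \<omega>)"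
            by (intro tendsto_intros)
          then show "(\<lambda>n. b (r n) s (X (r n) s \<omega>)) \<longlonglongrightarrow> c s (Y s \<omega>)" by (simp add: u_def)
        qed
      qed
      show ?case
      proof
        fix t assume t: "t \<in> {0..T}"
        have "(\<lambda>n. LINT s:{0..t}|lborel. b (r n) s (X (r n) s \<omega>)) \<longlonglongrightarrow> (LINT s:{0..t}|lborel. c s (Y s \<omega>))"
          unfolding set_lebesgue_integral_def
        proof (rule integral_dominated_convergence[where w="\<lambda>s. indicator {0..t} s *\<^sub>R K"])
          have "set_integrable lborel {0..t} (\<lambda>s. K)"
            by (rule bounded_set_integrable[of _ _ 0 t K]) (use K in auto)
          then show "integrable lborel (\<lambda>s. indicator {0..t} s *\<^sub>R K)" by (simp add: set_integrable_def)
          show "AE s in lborel. (\<lambda>n. indicator {0..t} s *\<^sub>R b (r n) s (X (r n) s \<omega>)) \<longlonglongrightarrow> indicator {0..t} s *\<^sub>R c s (Y s \<omega>)"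
            using pt by eventually_elim (use t in \<open>auto simp: indicator_def\<close>)
        qed (auto simp: indicator_def b intro!: AE_I2)
        then have "(\<lambda>n. x0 + S t \<omega> + (LINT s:{0..t}|lborel. b (r n) s (X (r n) s \<omega>))) \<longlonglongrightarrow> x0 + S t \<omega> + (LINT s:{0..t}|lborel. c s (Y s \<omega>))"
          by (intro tendsto_intros)
        moreover have "(\<lambda>n. x0 + S t \<omega> + (LINT s:{0..t}|lborel. b (r n) s (X (r n) s \<omega>))) = (\<lambda>n. X (r n) t \<omega>)"
          using elim(2) t by auto
        moreover have "(\<lambda>n. X (r n) t \<omega>) \<longlonglongrightarrow> Y t \<omega>"
          using LIMSEQ_subseq_LIMSEQ[OF lim[OF \<omega>] r(1)] by (simp add: o_def)
        ultimately show "Y t \<omega> = x0 + S t \<omega> + (LINT s:{0..t}|lborel. c s (Y s \<omega>))"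
          using LIMSEQ_unique by auto
      qed
    qed
  qed
  \<comment> \<open>The exceptional set found above depends on \<open>T\<close>. Integer horizons
    leave only countably many of them.\<close>
  then have "AE \<omega> in P. \<forall>N::nat. \<forall>t\<in>{0..real N}. Y t \<omega> = x0 + S t \<omega> + (LINT s:{0..t}|lborel. c s (Y s \<omega>))"
    by (simp add: AE_all_countable)
  then show ?thesis
  proof eventually_elim
    case (elim \<omega>)
    show ?case
    proof (intro allI impI)
      fix t :: real assume "0 \<le> t"
      then have "t \<in> {0..real (nat \<lceil>t\<rceil>)}" by (auto simp: real_nat_ceiling_ge)
      with elim show "Y t \<omega> = x0 + S t \<omega> + (LINT s:{0..t}|lborel. c s (Y s \<omega>))" by blast
    qed
  qed
qed

end

context levy_driver
begin

text \<open>Both descriptions of a solution: \<open>drifted\<close> exhibits the drift rate for the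
  occupation estimate, \<open>lipschitz_drifted\<close> is the one that survives limits.\<close>

lemma solution_drifted:
  fixes f :: "real \<Rightarrow> real \<Rightarrow> real"
  assumes f: "(\<lambda>z. f (fst z) (snd z)) \<in> borel_measurable (borel \<Otimes>\<^sub>M borel)"
    and bd: "\<And>t x. \<bar>f t x\<bar> \<le> K"
    and X: "\<And>t. X t \<in> borel_measurable (F t)"
    and right: "\<And>\<omega> t. \<omega> \<in> space P \<Longrightarrow> continuous (at_right t) (\<lambda>t. X t \<omega>)"
    and eq: "\<And>\<omega> t. \<omega> \<in> space P \<Longrightarrow> X t \<omega> = x0 + S t \<omega> + (LINT s:{0..t}|lborel. f s (X s \<omega>))"
  shows "drifted K x0 X" "lipschitz_drifted K x0 X"
proof -
  note ip = integral_process[OF f bd X right]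
  have Xm: "(\<lambda>p. X (fst p) (snd p)) \<in> borel_measurable (borel \<Otimes>\<^sub>M P)"
    by (rule right_continuous_measurable) (use X right in auto)
  note [measurable (raw)] = measurable_joint_comp[OF f] measurable_joint_comp[OF Xm]
  show "drifted K x0 X"
    unfolding drifted_def
  proof (intro exI conjI allI ballI impI)
    show "(\<lambda>p. f (fst p) (X (fst p) (snd p))) \<in> borel_measurable (borel \<Otimes>\<^sub>M P)" by measurable
    show "(\<lambda>\<omega>. f t (X t \<omega>)) \<in> borel_measurable (F t)" for t
      using X[of t] by measurable
    show "(\<lambda>p. LINT s:{0..fst p}|lborel. f s (X s (snd p))) \<in> borel_measurable (borel \<Otimes>\<^sub>M P)"
    proof (rule right_continuous_measurable[where X="\<lambda>t \<omega>. LINT s:{0..t}|lborel. f s (X s \<omega>)"])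
      show "(\<lambda>\<omega>. LINT s:{0..t}|lborel. f s (X s \<omega>)) \<in> borel_measurable P" for t
        by (rule adapted_measurable[OF ip(1)])
      show "continuous (at_right t) (\<lambda>t. LINT s:{0..t}|lborel. f s (X s \<omega>))" if "\<omega> \<in> space P" for \<omega> t
        by (rule continuous_at_imp_continuous_at_within[OF integral_process(2)[OF f bd X right that]])
    qed
    show "(\<lambda>\<omega>. LINT s:{0..t}|lborel. f s (X s \<omega>)) \<in> borel_measurable (F t)" for t
      by (rule ip(1))
    show "X t \<omega> = x0 + S t \<omega> + (LINT s:{0..t}|lborel. f s (X s \<omega>))" if "\<omega> \<in> space P" for t \<omega>
      by (rule eq[OF that])
  qed (simp_all add: bd)
  show "lipschitz_drifted K x0 X"
    unfolding lipschitz_drifted_def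
  proof (intro conjI allI ballI X)
    fix \<omega> assume \<omega>: "\<omega> \<in> space P"
    have "(LINT s:{0..0}|lborel. f s (X s \<omega>)) = 0"
      unfolding set_lebesgue_integral_def
      by (intro integral_eq_zero_AE AE_I'[of "{0}"]) (auto simp: indicator_def split: if_splits)
    then show "X 0 \<omega> = x0" using eq[OF \<omega>, of 0] by (simp add: S_nonpos)
    fix s t
    have "\<bar>(LINT s:{0..t}|lborel. f s (X s \<omega>)) - (LINT r:{0..s}|lborel. f r (X r \<omega>))\<bar> \<le> K * \<bar>t - s\<bar>"
      by (rule integral_process(3)[OF f bd X right \<omega>])
    then show "\<bar>(X t \<omega> - S t \<omega>) - (X s \<omega> - S s \<omega>)\<bar> \<le> K * \<bar>t - s\<bar>"
      by (subst eq[OF \<omega>, of t], subst eq[OF \<omega>, of s]) simp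
  qed
qed

text \<open>Subtracting the common noise \<open>x0 + S\<close> from both solutions leaves two drift
  integrals with the same parameter path \<open>w\<close>, to which the deterministic comparison
  applies.\<close>

lemma solution_mono:
  fixes f f' :: "real \<Rightarrow> real \<Rightarrow> real"
  assumes f: "(\<lambda>z. f (fst z) (snd z)) \<in> borel_measurable (borel \<Otimes>\<^sub>M borel)" "\<And>t x. \<bar>f t x\<bar> \<le> K"
    and f': "(\<lambda>z. f' (fst z) (snd z)) \<in> borel_measurable (borel \<Otimes>\<^sub>M borel)" "\<And>t x. \<bar>f' t x\<bar> \<le> K"
    and lip: "\<And>t x y. \<bar>f t x - f t y\<bar> \<le> L * \<bar>x - y\<bar>" "0 \<le> L"
    and le: "\<And>t x. f t x \<le> f' t x"
    and X: "lipschitz_drifted K x0 X" "lipschitz_drifted K x0 X'"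
    and eq: "\<And>\<omega> t. \<omega> \<in> space P \<Longrightarrow> X t \<omega> = x0 + S t \<omega> + (LINT s:{0..t}|lborel. f s (X s \<omega>))"
      "\<And>\<omega> t. \<omega> \<in> space P \<Longrightarrow> X' t \<omega> = x0 + S t \<omega> + (LINT s:{0..t}|lborel. f' s (X' s \<omega>))"
    and \<omega>: "\<omega> \<in> space P"
  shows "X t \<omega> \<le> X' t \<omega>"
proof (cases "0 \<le> t")
  case True
  note Xm = lipschitz_drifted_joint_measurable[OF X(1)] lipschitz_drifted_joint_measurable[OF X(2)]
  note [measurable (raw)] = measurable_joint_comp[OF f(1)] measurable_joint_comp[OF f'(1)] measurable_joint_comp[OF Xm(1)] measurable_joint_comp[OF Xm(2)]
  note [measurable] = \<omega>
  have "X t \<omega> - (x0 + S t \<omega>) \<le> X' t \<omega> - (x0 + S t \<omega>)"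
  proof (rule drift_comparison[where f=f and f'=f' and w="\<lambda>t. x0 + S t \<omega>" and K=K and L=L and A="\<lambda>t. X t \<omega> - (x0 + S t \<omega>)" and A'="\<lambda>t. X' t \<omega> - (x0 + S t \<omega>)"])
    show "(\<lambda>s. f s (x0 + S s \<omega> + (X s \<omega> - (x0 + S s \<omega>)))) \<in> borel_measurable borel"
      "(\<lambda>s. f' s (x0 + S s \<omega> + (X' s \<omega> - (x0 + S s \<omega>)))) \<in> borel_measurable borel"
      unfolding add_diff_cancel_left' add_diff_eq by measurable
    show "X t \<omega> - (x0 + S t \<omega>) = (LINT s:{0..t}|lborel. f s (x0 + S s \<omega> + (X s \<omega> - (x0 + S s \<omega>))))" for t
      using eq(1)[OF \<omega>, of t] by simp
    show "X' t \<omega> - (x0 + S t \<omega>) = (LINT s:{0..t}|lborel. f' s (x0 + S s \<omega> + (X' s \<omega> - (x0 + S s \<omega>))))" for t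
      using eq(2)[OF \<omega>, of t] by simp
  qed (use f f' lip le True in auto)
  then show ?thesis by simp
next
  case False
  then show ?thesis using eq[OF \<omega>, of t] by (simp add: set_lebesgue_integral_def)
qed

end

text \<open>With comparison for Lipschitz drifts, the solutions for the drifts \<open>max f\<^sub>m \<dots> f\<^sub>n\<close> increase in \<open>n\<close> and
  their limits decrease in \<open>m\<close>; so no compactness argument is needed and the solution is adapted to
  the given driver.\<close>
theorem (in smoothing_levy_driver) strong_solution:
  fixes a :: "real \<Rightarrow> real \<Rightarrow> real"
  assumes a: "(\<lambda>z. a (fst z) (snd z)) \<in> borel_measurable borel" "\<And>t x. \<bar>a t x\<bar> \<le> K" and K: "0 < K"
  shows "\<exists>X. lipschitz_drifted K x0 X \<and>
    (AE \<omega> in P. \<forall>t\<ge>0. X t \<omega> = x0 + S t \<omega> + (LINT s:{0..t}|lborel. a s (X s \<omega>)))"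
proof -
  obtain f L where f: "\<And>n. (\<lambda>z. f n (fst z) (snd z)) \<in> borel_measurable borel" and L: "\<And>n. 0 \<le> (L n :: real)"
    and fK: "\<And>n t x. \<bar>f n t x\<bar> \<le> K" and fL: "\<And>n t x y. \<bar>f n t x - f n t y\<bar> \<le> L n * \<bar>x - y\<bar>"
    and fa: "AE z in lborel. (\<lambda>n. f n (fst z) (snd z)) \<longlonglongrightarrow> a (fst z) (snd z)"
    using lipschitz_AE_approximation[OF a] by blast
  \<comment> \<open>The maximum of \<open>f m\<close>, ..., \<open>f (m + j)\<close>. It increases
    in \<open>j\<close>, and its limit \<open>G m\<close> is the supremum over all indices from
    \<open>m\<close> on.\<close>
  define h where "h m j t x = rec_nat (f m t x) (\<lambda>i r. max r (f (m + Suc i) t x)) j" for m j t x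
  have h0: "h m 0 t x = f m t x" and hS: "h m (Suc j) t x = max (h m j t x) (f (m + Suc j) t x)" for m j t x
    by (simp_all add: h_def)
  have hm: "(\<lambda>z. h m j (fst z) (snd z)) \<in> borel_measurable borel" for m j
    by (induction j) (simp add: h0 f, simp only: hS, intro borel_measurable_max f)
  have hm': "(\<lambda>z. h m j (fst z) (snd z)) \<in> borel_measurable (borel \<Otimes>\<^sub>M borel)" for m j
    using hm by (simp add: borel_prod)
  have hK: "\<bar>h m j t x\<bar> \<le> K" for m j t x
  proof (induction j)
    case 0 show ?case by (simp add: h0 fK)
  next
    case (Suc j) then show ?case using fK[of "m + Suc j" t x] unfolding hS by (auto simp: max_def)
  qed
  \<comment> \<open>A crude constant for a maximum. It may diverge with \<open>j\<close>: it serves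
    only the existence and the ordering of the approximations, while the estimates taken to the
    limit depend on \<open>K\<close>.\<close>
  have hL: "0 \<le> (\<Sum>i\<le>j. L (m + i)) \<and> \<bar>h m j t x - h m j t y\<bar> \<le> (\<Sum>i\<le>j. L (m + i)) * \<bar>x - y\<bar>" for m j t x y
  proof (induction j)
    case 0 show ?case by (simp add: h0 fL L)
  next
    case (Suc j)
    let ?A = "(\<Sum>i\<le>j. L (m + i)) * \<bar>x - y\<bar>" and ?B = "L (m + Suc j) * \<bar>x - y\<bar>"
    have nn: "0 \<le> ?A" "0 \<le> ?B" using Suc L by auto
    have 1: "\<bar>h m j t x - h m j t y\<bar> \<le> ?A" using Suc by simp
    have 2: "\<bar>f (m + Suc j) t x - f (m + Suc j) t y\<bar> \<le> ?B" by (rule fL)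
    have "\<bar>max p q - max p' q'\<bar> \<le> \<bar>p - p'\<bar> + \<bar>q - q'\<bar>" for p q p' q' :: real
      by (cases "p \<le> q"; cases "p' \<le> q'"; simp add: max_def)
    from this[of "h m j t x" "f (m + Suc j) t x" "h m j t y" "f (m + Suc j) t y"]
    have "\<bar>h m (Suc j) t x - h m (Suc j) t y\<bar> \<le> ?A + ?B"
      using 1 2 unfolding hS by linarith
    then show ?case using Suc L[of "m + Suc j"] by (simp add: distrib_right)
  qed
  have h_inc: "h m j t x \<le> h m (Suc j) t x" for m j t x by (simp add: hS)
  \<comment> \<open>The block starting at \<open>m\<close> contains the block starting at
    \<open>Suc m\<close> with the same last index. This makes the limits \<open>Y m\<close> decrease
    in \<open>m\<close>.\<close>
  have h_shift: "h (Suc m) j t x \<le> h m (Suc j) t x" for m j t x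
  proof (induction j)
    case 0 show ?case by (simp add: h0 hS)
  next
    case (Suc j) then show ?case by (subst hS, subst hS) auto
  qed
  define sol where "sol m j X \<longleftrightarrow> (\<forall>t. X t \<in> borel_measurable (F t)) \<and>
    (\<forall>\<omega>\<in>space P. \<forall>t. continuous (at_right t) (\<lambda>t. X t \<omega>)) \<and>
    (\<forall>\<omega>\<in>space P. \<forall>t. X t \<omega> = x0 + S t \<omega> + (LINT s:{0..t}|lborel. h m j s (X s \<omega>)))" for m j X
  define X where "X m j = (SOME X. sol m j X)" for m j
  have "\<exists>X. sol m j X" for m j
    unfolding sol_def
    by (rule lipschitz_drift_solution[where L="\<Sum>i\<le>j. L (m + i)", OF hm' hK]) (use hL in auto)
  then have sol: "sol m j (X m j)" for m j unfolding X_def by (rule someI_ex)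
  have X: "\<And>m j t. X m j t \<in> borel_measurable (F t)"
    "\<And>m j \<omega> t. \<omega> \<in> space P \<Longrightarrow> continuous (at_right t) (\<lambda>t. X m j t \<omega>)"
    using sol unfolding sol_def by blast+
  have Xeq: "X m j t \<omega> = x0 + S t \<omega> + (LINT s:{0..t}|lborel. h m j s (X m j s \<omega>))" if "\<omega> \<in> space P" for m j \<omega> t
    using sol[of m j] that unfolding sol_def by blast
  have Xd: "drifted K x0 (X m j)" and Xl: "lipschitz_drifted K x0 (X m j)" for m j
    using solution_drifted[OF hm' hK X(1) X(2) Xeq] by auto
  have X_mono: "X m j t \<omega> \<le> X m' j' t \<omega>" if "\<And>t x. h m j t x \<le> h m' j' t x" "\<omega> \<in> space P" for m j m' j' t \<omega>
    by (rule solution_mono[where L="\<Sum>i\<le>j. L (m + i)", OF hm' hK hm' hK _ _ that(1) Xl Xl Xeq Xeq that(2)])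
       (use hL in auto)
  have X_bd: "\<bar>X m j t \<omega> - S t \<omega> - x0\<bar> \<le> K * \<bar>t\<bar>" if "\<omega> \<in> space P" for m j t \<omega>
  proof -
    have *: "X m j 0 \<omega> = x0 \<and> (\<forall>s t. \<bar>(X m j t \<omega> - S t \<omega>) - (X m j s \<omega> - S s \<omega>)\<bar> \<le> K * \<bar>t - s\<bar>)"
      using Xl[of m j] that unfolding lipschitz_drifted_def by blast
    then have "\<bar>(X m j t \<omega> - S t \<omega>) - (X m j 0 \<omega> - S 0 \<omega>)\<bar> \<le> K * \<bar>t - 0\<bar>" by fast
    then show ?thesis using * by (simp add: S_nonpos)
  qed
  have X_le: "X m j t \<omega> \<le> x0 + S t \<omega> + K * \<bar>t\<bar>" and X_ge: "x0 + S t \<omega> - K * \<bar>t\<bar> \<le> X m j t \<omega>" if "\<omega> \<in> space P" for m j t \<omega>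
    using X_bd[OF that, of m j t] by linarith+
  define Y where "Y m t \<omega> = lim (\<lambda>j. X m j t \<omega>)" for m t \<omega>
  have Xlim: "(\<lambda>j. X m j t \<omega>) \<longlonglongrightarrow> Y m t \<omega>" if \<omega>: "\<omega> \<in> space P" for m t \<omega>
  proof -
    have "incseq (\<lambda>j. X m j t \<omega>)"
      by (intro incseq_SucI X_mono h_inc \<omega>)
    then obtain l where "(\<lambda>j. X m j t \<omega>) \<longlonglongrightarrow> l"
      using X_le[OF \<omega>]
      by - (rule incseq_convergent[of "\<lambda>j. X m j t \<omega>" "x0 + S t \<omega> + K * \<bar>t\<bar>"], auto)
    then show ?thesis by (simp add: Y_def limI)
  qed
  have Y_dec: "Y (Suc m) t \<omega> \<le> Y m t \<omega>" if \<omega>: "\<omega> \<in> space P" for m t \<omega>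
    by (rule LIMSEQ_le[OF Xlim[OF \<omega>] LIMSEQ_Suc[OF Xlim[OF \<omega>]]]) (auto intro!: X_mono h_shift \<omega>)
  define Z where "Z t \<omega> = lim (\<lambda>m. Y m t \<omega>)" for t \<omega>
  have Ylim: "(\<lambda>m. Y m t \<omega>) \<longlonglongrightarrow> Z t \<omega>" if \<omega>: "\<omega> \<in> space P" for t \<omega>
  proof -
    have "decseq (\<lambda>m. Y m t \<omega>)" by (intro decseq_SucI Y_dec \<omega>)
    moreover have "x0 + S t \<omega> - K * \<bar>t\<bar> \<le> Y m t \<omega>" for m
      by (rule LIMSEQ_le_const[OF Xlim[OF \<omega>]]) (use X_ge[OF \<omega>] in auto)
    ultimately obtain l where "(\<lambda>m. Y m t \<omega>) \<longlonglongrightarrow> l"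
      by - (rule decseq_convergent[of "\<lambda>m. Y m t \<omega>" "x0 + S t \<omega> - K * \<bar>t\<bar>"], auto)
    then show ?thesis by (simp add: Z_def limI)
  qed
  define G where "G m t x = lim (\<lambda>j. h m j t x)" for m t x
  have Glim: "(\<lambda>j. h m j t x) \<longlonglongrightarrow> G m t x" for m t x
  proof -
    have "h m j t x \<le> K" for j using hK[of m j t x] by linarith
    moreover have "incseq (\<lambda>j. h m j t x)" by (intro incseq_SucI h_inc)
    ultimately obtain l where "(\<lambda>j. h m j t x) \<longlonglongrightarrow> l"
      by - (rule incseq_convergent[of "\<lambda>j. h m j t x" K], auto)
    then show ?thesis by (simp add: G_def limI)
  qed
  have Gm: "(\<lambda>z. G m (fst z) (snd z)) \<in> borel_measurable borel" for m
    by (rule borel_measurable_LIMSEQ_metric[OF hm Glim])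
  have GK: "\<bar>G m t x\<bar> \<le> K" for m t x
    by (rule LIMSEQ_le_const2[OF tendsto_rabs[OF Glim]]) (use hK in auto)
  \<comment> \<open>Where \<open>f n\<close> converges to \<open>a\<close>, the suprema over tails
    converge as well: once all \<open>f n\<close> with \<open>n \<ge> m\<close> are within
    \<open>e / 2\<close> of \<open>a\<close>, so are their maxima and the limit
    \<open>G m\<close>.\<close>
  have Ga: "AE z in lborel. (\<lambda>m. G m (fst z) (snd z)) \<longlonglongrightarrow> a (fst z) (snd z)"
    using fa
  proof eventually_elim
    case (elim z)
    obtain t x where z: "z = (t, x)" by (cases z)
    show ?case
      unfolding z fst_conv snd_conv
    proof (rule LIMSEQ_I)
      fix e :: real assume e: "0 < e"
      obtain N where N: "\<And>n. N \<le> n \<Longrightarrow> \<bar>f n t x - a t x\<bar> < e / 2"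
        using LIMSEQ_D[OF elim, of "e / 2"] e by (auto simp: z)
      have "norm (G m t x - a t x) < e" if m: "N \<le> m" for m
      proof -
        have "\<bar>h m j t x - a t x\<bar> \<le> e / 2" for j
        proof (induction j)
          case 0 then show ?case using N[OF m] by (simp add: h0)
        next
          case (Suc j) then show ?case using N[of "m + Suc j"] m by (auto simp: hS max_def)
        qed
        then have "\<bar>G m t x - a t x\<bar> \<le> e / 2"
          by (intro LIMSEQ_le_const2[OF tendsto_rabs[OF tendsto_diff[OF Glim tendsto_const]]]) auto
        then show ?thesis using e by simp
      qed
      then show "\<exists>no. \<forall>n\<ge>no. norm (G n t x - a t x) < e" by blast
    qed
  qed
  have occX: "\<exists>C\<ge>0. \<forall>m j. occupation_bound (X m j) T C" if T: "0 \<le> T" for T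
  proof -
    obtain C where C: "0 \<le> C" "\<And>x0 X. drifted K x0 X \<Longrightarrow> occupation_bound X T C"
      using drifted_occupation_bound[OF K T] by blast
    then show ?thesis using Xd by (intro exI[of _ C]) auto
  qed
  \<comment> \<open>The drift \<open>G m\<close> of \<open>Y m\<close> need not be Lipschitz, and
    \<open>Y m\<close> satisfies its equation only almost surely. The occupation bound is inherited
    from \<open>X m j\<close> instead, which permits the second passage to the limit.\<close>
  have occY: "\<exists>C\<ge>0. \<forall>m. occupation_bound (Y m) T C" if T: "0 \<le> T" for T
  proof -
    obtain C where C: "C \<ge> 0" "\<And>m j. occupation_bound (X m j) T C" using occX[OF T] by blast
    have "occupation_bound (Y m) T C" for m
      by (rule occupation_bound_limit[OF lipschitz_drifted_joint_measurable[OF Xl] Xlim C(2)])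
    with C(1) show ?thesis by blast
  qed
  have Yl: "lipschitz_drifted K x0 (Y m)" for m
    by (rule lipschitz_drifted_limit[OF Xl Xlim])
  have Yeq: "AE \<omega> in P. \<forall>t\<ge>0. Y m t \<omega> = x0 + S t \<omega> + (LINT s:{0..t}|lborel. G m s (Y m s \<omega>))" for m
  proof (rule drift_limit[where X="X m" and b="h m" and K=K])
    show "\<exists>C\<ge>0. \<forall>n. occupation_bound (X m n) T C" if "0 \<le> T" for T using occX[OF that] by blast
    show "AE z in lborel. (\<lambda>n. h m n (fst z) (snd z)) \<longlonglongrightarrow> G m (fst z) (snd z)" by (simp add: Glim)
    show "AE \<omega> in P. \<forall>t\<ge>0. X m n t \<omega> = x0 + S t \<omega> + (LINT s:{0..t}|lborel. h m n s (X m n s \<omega>))" for n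
      by (rule AE_I2) (intro allI impI Xeq)
  qed (fact Xl Xlim hm hK Gm GK)+
  have "AE \<omega> in P. \<forall>t\<ge>0. Z t \<omega> = x0 + S t \<omega> + (LINT s:{0..t}|lborel. a s (Z s \<omega>))"
    by (rule drift_limit[OF Yl Ylim occY Gm GK a Ga Yeq])
  moreover have "lipschitz_drifted K x0 Z" by (rule lipschitz_drifted_limit[OF Yl Ylim])
  ultimately show ?thesis by blast
qed

section \<open>Independent increments and maximal inequality\<close>

text \<open>The left half-plane is convex, contains 0, and the derivative of \<open>exp\<close> has
  modulus at most 1 there.\<close>

lemma norm_exp_minus_one_le:
  fixes w :: complex
  assumes "Re w \<le> 0"
  shows "cmod (exp w - 1) \<le> cmod w"
proof -
  have "cmod (exp w - exp 0) \<le> 1 * cmod (w - 0)"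
  proof (rule field_differentiable_bound[where S="{z. Re z \<le> 0}" and f'=exp])
    show "convex {z. Re z \<le> 0}" by (rule convex_halfspace_Re_le)
    show "(exp has_field_derivative exp z) (at z within {z. Re z \<le> 0})" for z :: complex
      by (intro DERIV_exp has_field_derivative_at_within)
  qed (use assms in auto)
  then show ?thesis by simp
qed

context prob_space
begin

lemma integrable_bounded_complex:
  fixes R :: "'a \<Rightarrow> complex"
  assumes "R \<in> borel_measurable M" "\<And>\<omega>. \<omega> \<in> space M \<Longrightarrow> cmod (R \<omega>) \<le> C"
  shows "integrable M R"
  using assms by (intro integrable_const_bound[where B=C]) auto

text \<open>A bounded weight whose Fourier transform along \<open>Z\<close> vanishes integrates to zero over all events
  \<open>Z \<in> B\<close>: compare the laws of \<open>Z\<close> under \<open>M\<close> and under the density \<open>1 + R / c\<close>.\<close>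
lemma fourier_zero_real:
  fixes R Z :: "'a \<Rightarrow> real"
  assumes [measurable]: "R \<in> borel_measurable M" "Z \<in> borel_measurable M" and B[measurable]: "B \<in> sets borel"
    and bd: "\<And>\<omega>. \<omega> \<in> space M \<Longrightarrow> \<bar>R \<omega>\<bar> \<le> C"
    and zero: "\<And>u. (CLINT \<omega>|M. iexp (u * Z \<omega>) * complex_of_real (R \<omega>)) = 0"
  shows "(LINT \<omega>|M. indicator B (Z \<omega>) * R \<omega>) = 0"
proof -
  define c where "c = \<bar>C\<bar> + 1"
  have c: "0 < c" by (simp add: c_def)
  define w where "w \<omega> = (if \<omega> \<in> space M then 1 + R \<omega> / c else 1)" for \<omega>
  have w0: "0 \<le> w \<omega>" for \<omega>
  proof (cases "\<omega> \<in> space M")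
    case True
    then have "- c \<le> R \<omega>" using bd[of \<omega>] by (auto simp: c_def)
    then show ?thesis using c True by (simp add: w_def field_simps)
  qed (simp add: w_def)
  have [measurable]: "w \<in> borel_measurable M" unfolding w_def by measurable
  have iR: "integrable M R" by (rule integrable_const_bound[where B=C]) (use bd in auto)
  have ER: "(LINT \<omega>|M. R \<omega>) = 0" using zero[of 0] by simp
  have iw: "integrable M w"
    by (rule Bochner_Integration.integrable_cong[THEN iffD2, of _ _ _ "\<lambda>\<omega>. 1 + R \<omega> / c"]) (use iR in \<open>auto simp: w_def\<close>)
  have Ew: "(LINT \<omega>|M. w \<omega>) = 1"
    by (subst Bochner_Integration.integral_cong[where g="\<lambda>\<omega>. 1 + R \<omega> / c"]) (use iR ER in \<open>auto simp: w_def prob_space\<close>)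
  define Q where "Q = density M (\<lambda>\<omega>. ennreal (w \<omega>))"
  have Q: "prob_space Q"
  proof (rule prob_spaceI)
    have "emeasure Q (space Q) = (\<integral>\<^sup>+ \<omega>. ennreal (w \<omega>) \<partial>M)"
      unfolding Q_def by (subst emeasure_density) (auto intro!: nn_integral_cong)
    also have "\<dots> = 1" using iw w0 Ew by (subst nn_integral_eq_integral) auto
    finally show "emeasure Q (space Q) = 1" .
  qed
  have [measurable]: "Z \<in> borel_measurable Q" by (simp add: Q_def)
  have "distr Q borel Z = distr M borel Z"
  proof (rule Levy_uniqueness)
    show "real_distribution (distr Q borel Z)" using prob_space.real_distribution_distr[OF Q] by simp
    show "real_distribution (distr M borel Z)" by (rule real_distribution_distr) simp
    show "char (distr Q borel Z) = char (distr M borel Z)"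
    proof
      fix u
      have i1: "integrable M (\<lambda>\<omega>. iexp (u * Z \<omega>))" by (rule integrable_bounded_complex[where C=1]) auto
      have i2: "integrable M (\<lambda>\<omega>. iexp (u * Z \<omega>) * complex_of_real (R \<omega>))"
        by (rule integrable_bounded_complex[where C=C]) (use bd in \<open>auto simp: norm_mult\<close>)
      have "char (distr Q borel Z) u = (CLINT \<omega>|Q. iexp (u * Z \<omega>))"
        unfolding char_def by (subst integral_distr) auto
      also have "\<dots> = (CLINT \<omega>|M. w \<omega> *\<^sub>R iexp (u * Z \<omega>))"
        unfolding Q_def using w0 by (subst integral_density) auto
      also have "\<dots> = (CLINT \<omega>|M. iexp (u * Z \<omega>) + (iexp (u * Z \<omega>) * complex_of_real (R \<omega>)) / c)"
        by (intro Bochner_Integration.integral_cong) (auto simp: w_def scaleR_conv_of_real algebra_simps)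
      also have "\<dots> = (CLINT \<omega>|M. iexp (u * Z \<omega>))"
        using i1 i2 zero[of u] by simp
      also have "\<dots> = char (distr M borel Z) u"
        unfolding char_def by (subst integral_distr) auto
      finally show "char (distr Q borel Z) u = char (distr M borel Z) u" .
    qed
  qed
  moreover have "(LINT \<omega>|Q. indicator B (Z \<omega>)) = (LINT x|distr Q borel Z. (indicator B x :: real))"
    by (rule integral_distr[symmetric]) measurable
  moreover have "(LINT \<omega>|M. indicator B (Z \<omega>)) = (LINT x|distr M borel Z. (indicator B x :: real))"
    by (rule integral_distr[symmetric]) measurable
  ultimately have "(LINT \<omega>|Q. indicator B (Z \<omega>)) = (LINT \<omega>|M. (indicator B (Z \<omega>) :: real))"
    by simp
  moreover have "(LINT \<omega>|Q. (indicator B (Z \<omega>) :: real)) = (LINT \<omega>|M. indicator B (Z \<omega>) + (indicator B (Z \<omega>) * R \<omega>) / c)"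
  proof -
    have "(LINT \<omega>|Q. (indicator B (Z \<omega>) :: real)) = (LINT \<omega>|M. w \<omega> *\<^sub>R indicator B (Z \<omega>))"
      unfolding Q_def using w0 by (subst integral_density) auto
    also have "\<dots> = (LINT \<omega>|M. indicator B (Z \<omega>) + (indicator B (Z \<omega>) * R \<omega>) / c)"
      by (intro Bochner_Integration.integral_cong) (auto simp: w_def algebra_simps)
    finally show ?thesis .
  qed
  moreover have "integrable M (\<lambda>\<omega>. indicator B (Z \<omega>) :: real)"
    by (rule integrable_const_bound[where B=1]) (auto simp: indicator_def)
  moreover have "integrable M (\<lambda>\<omega>. indicator B (Z \<omega>) * R \<omega>)"
  proof (rule integrable_const_bound[where B="\<bar>C\<bar>"], rule AE_I2)
    show "norm (indicator B (Z \<omega>) * R \<omega>) \<le> \<bar>C\<bar>" if "\<omega> \<in> space M" for \<omega>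
      using bd[OF that] by (auto simp: indicator_def)
  qed measurable
  ultimately show ?thesis using c by simp
qed

text \<open>Reduction to the real and imaginary parts of \<open>R\<close>. Both inherit a vanishing
  transform, because conjugating \<open>R\<close> amounts to reflecting \<open>u\<close> to
  \<open>- u\<close>.\<close>

lemma fourier_zero:
  fixes R :: "'a \<Rightarrow> complex" and Z :: "'a \<Rightarrow> real"
  assumes [measurable]: "R \<in> borel_measurable M" "Z \<in> borel_measurable M" "B \<in> sets borel"
    and bd: "\<And>\<omega>. \<omega> \<in> space M \<Longrightarrow> cmod (R \<omega>) \<le> C"
    and zero: "\<And>u. (CLINT \<omega>|M. iexp (u * Z \<omega>) * R \<omega>) = 0"
  shows "(CLINT \<omega>|M. indicator B (Z \<omega>) * R \<omega>) = 0"
proof -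
  have "cnj \<in> borel_measurable borel"
    by (intro borel_measurable_continuous_onI continuous_intros)
  then have [measurable]: "(\<lambda>\<omega>. cnj (R \<omega>)) \<in> borel_measurable M" by measurable
  have i: "integrable M (\<lambda>\<omega>. iexp (u * Z \<omega>) * R \<omega>)" for u
    by (rule integrable_bounded_complex[where C=C]) (use bd in \<open>auto simp: norm_mult\<close>)
  have zero_cnj: "(CLINT \<omega>|M. iexp (u * Z \<omega>) * cnj (R \<omega>)) = 0" for u
  proof -
    have "(CLINT \<omega>|M. iexp (u * Z \<omega>) * cnj (R \<omega>)) = (CLINT \<omega>|M. cnj (iexp ((- u) * Z \<omega>) * R \<omega>))"
      by (simp add: exp_cnj)
    also have "\<dots> = cnj (CLINT \<omega>|M. iexp ((- u) * Z \<omega>) * R \<omega>)"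
      by (rule Bochner_Integration.integral_cnj)
    finally show ?thesis using zero[of "- u"] by simp
  qed
  have i_cnj: "integrable M (\<lambda>\<omega>. iexp (u * Z \<omega>) * cnj (R \<omega>))" for u
    by (rule integrable_bounded_complex[where C=C]) (use bd in \<open>auto simp: norm_mult\<close>)
  have Re0: "(LINT \<omega>|M. indicator B (Z \<omega>) * Re (R \<omega>)) = 0"
  proof (rule fourier_zero_real[where C=C])
    fix u
    have "(CLINT \<omega>|M. iexp (u * Z \<omega>) * complex_of_real (Re (R \<omega>))) =
      (CLINT \<omega>|M. (iexp (u * Z \<omega>) * R \<omega> + iexp (u * Z \<omega>) * cnj (R \<omega>)) / 2)"
      by (intro Bochner_Integration.integral_cong refl) (simp add: distrib_left[symmetric] complex_add_cnj)
    also have "\<dots> = 0" using i[of u] i_cnj[of u] zero[of u] zero_cnj[of u] by simp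
    finally show "(CLINT \<omega>|M. iexp (u * Z \<omega>) * complex_of_real (Re (R \<omega>))) = 0" .
  qed (use bd abs_Re_le_cmod order_trans in \<open>auto, blast\<close>)
  have Im0: "(LINT \<omega>|M. indicator B (Z \<omega>) * Im (R \<omega>)) = 0"
  proof (rule fourier_zero_real[where C=C])
    fix u
    have "(CLINT \<omega>|M. iexp (u * Z \<omega>) * complex_of_real (Im (R \<omega>))) =
      (CLINT \<omega>|M. (iexp (u * Z \<omega>) * R \<omega> - iexp (u * Z \<omega>) * cnj (R \<omega>)) / (2 * \<i>))"
    proof (intro Bochner_Integration.integral_cong refl)
      fix \<omega>
      have "complex_of_real (Im (R \<omega>)) = (R \<omega> - cnj (R \<omega>)) / (2 * \<i>)" by (simp add: complex_eq_iff)
      then show "iexp (u * Z \<omega>) * complex_of_real (Im (R \<omega>)) = (iexp (u * Z \<omega>) * R \<omega> - iexp (u * Z \<omega>) * cnj (R \<omega>)) / (2 * \<i>)"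
        by (simp only: times_divide_eq_right right_diff_distrib)
    qed
    also have "\<dots> = 0" using i[of u] i_cnj[of u] zero[of u] zero_cnj[of u] by simp
    finally show "(CLINT \<omega>|M. iexp (u * Z \<omega>) * complex_of_real (Im (R \<omega>))) = 0" .
  qed (use bd abs_Im_le_cmod order_trans in \<open>auto, blast\<close>)
  have int: "integrable M (\<lambda>\<omega>. indicator B (Z \<omega>) * R \<omega>)"
  proof (rule integrable_bounded_complex[where C="\<bar>C\<bar>"])
    show "cmod (indicator B (Z \<omega>) * R \<omega>) \<le> \<bar>C\<bar>" if "\<omega> \<in> space M" for \<omega>
      using bd[OF that] by (auto simp: indicator_def)
  qed measurable
  have "Re (CLINT \<omega>|M. indicator B (Z \<omega>) * R \<omega>) = (LINT \<omega>|M. Re (indicator B (Z \<omega>) * R \<omega>))"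
    using integral_Re[OF int] by simp
  also have "\<dots> = 0" unfolding Re0[symmetric] by (intro Bochner_Integration.integral_cong) (auto simp: indicator_def)
  finally have 1: "Re (CLINT \<omega>|M. indicator B (Z \<omega>) * R \<omega>) = 0" .
  have "Im (CLINT \<omega>|M. indicator B (Z \<omega>) * R \<omega>) = (LINT \<omega>|M. Im (indicator B (Z \<omega>) * R \<omega>))"
    using integral_Im[OF int] by simp
  also have "\<dots> = 0" unfolding Im0[symmetric] by (intro Bochner_Integration.integral_cong) (auto simp: indicator_def)
  finally have "Im (CLINT \<omega>|M. indicator B (Z \<omega>) * R \<omega>) = 0" .
  with 1 show ?thesis by (simp add: complex_eq_iff)
qed

definition natural_filtration :: "(real \<Rightarrow> 'a \<Rightarrow> real) \<Rightarrow> real \<Rightarrow> 'a measure" where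
  "natural_filtration Z t = sigma (space M) {Z r -` B \<inter> space M | r B. 0 \<le> r \<and> r \<le> t \<and> B \<in> sets borel}"

text \<open>Expressed by characteristic functions of finitely many past values: these can be
  computed for Poisson sums, and the identity survives almost sure limits. In terms of the
  characteristic exponent, \<open>\<kappa> = - \<psi>\<close>.\<close>

definition indep_increments :: "(real \<Rightarrow> 'a \<Rightarrow> real) \<Rightarrow> (real \<Rightarrow> complex) \<Rightarrow> bool" where
  "indep_increments Z \<kappa> \<longleftrightarrow> (\<forall>s t \<xi> L \<theta>. 0 \<le> s \<longrightarrow> s \<le> t \<longrightarrow> finite L \<longrightarrow> L \<subseteq> {0..s} \<longrightarrow>
    (CLINT \<omega>|M. iexp (\<Sum>r\<in>L. \<theta> r * Z r \<omega>) * iexp (\<xi> * (Z t \<omega> - Z s \<omega>))) =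
    (CLINT \<omega>|M. iexp (\<Sum>r\<in>L. \<theta> r * Z r \<omega>)) * exp (complex_of_real (t - s) * \<kappa> \<xi>))"

lemma space_natural_filtration [simp]: "space (natural_filtration Z t) = space M"
  by (simp add: natural_filtration_def space_measure_of_conv)

lemma sets_natural_filtration:
  "sets (natural_filtration Z t) = sigma_sets (space M) {Z r -` B \<inter> space M | r B. 0 \<le> r \<and> r \<le> t \<and> B \<in> sets borel}"
  unfolding natural_filtration_def by (rule sets_measure_of) auto

lemma natural_filtration_mono:
  "s \<le> t \<Longrightarrow> sets (natural_filtration Z s) \<subseteq> sets (natural_filtration Z t)"
  unfolding sets_natural_filtration by (intro sigma_sets_mono') (auto intro: order_trans)

lemma subalgebra_natural_filtration:
  assumes "\<And>t. Z t \<in> borel_measurable M"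
  shows "subalgebra M (natural_filtration Z t)"
  unfolding subalgebra_def sets_natural_filtration
proof (intro conjI sets.sigma_sets_subset)
  show "{Z r -` B \<inter> space M | r B. 0 \<le> r \<and> r \<le> t \<and> B \<in> sets borel} \<subseteq> sets M"
    using assms by (auto intro: measurable_sets)
qed simp

lemma natural_filtration_adapted:
  assumes "0 \<le> t"
  shows "Z t \<in> borel_measurable (natural_filtration Z t)"
proof (rule measurableI)
  fix B :: "real set" assume "B \<in> sets borel"
  then show "Z t -` B \<inter> space (natural_filtration Z t) \<in> sets (natural_filtration Z t)"
    unfolding sets_natural_filtration using assms by (auto intro!: sigma_sets.Basic)
qed simp

text \<open>One coordinate at a time: \<open>fourier_zero\<close> turns vanishing against all
  \<open>iexp (u * Z q \<omega>)\<close> into vanishing against the event that \<open>Z q\<close>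
  lies in \<open>B q\<close>. Indicators and exponentials are kept over separate sets
  \<open>L2\<close> and \<open>L\<close>, so that the induction can generalize over \<open>L\<close>
  and \<open>\<theta>\<close>.\<close>

lemma indep_increments_cylinder:
  assumes ii: "indep_increments Z \<kappa>" and Z[measurable]: "\<And>t. Z t \<in> borel_measurable M"
    and st: "0 \<le> s" "s \<le> t"
    and L2: "finite L2" "L2 \<subseteq> {0..s}" and B: "\<And>r. B r \<in> sets borel"
    and L: "finite L" "L \<subseteq> {0..s}"
  shows "(CLINT \<omega>|M. (\<Prod>r\<in>L2. indicator (B r) (Z r \<omega>)) * (iexp (\<Sum>r\<in>L. \<theta> r * Z r \<omega>) *
    (iexp (\<xi> * (Z t \<omega> - Z s \<omega>)) - exp (complex_of_real (t - s) * \<kappa> \<xi>)))) = 0"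
  using L2(1,2) L
proof (induction L2 arbitrary: L \<theta> rule: finite_induct)
  case empty
  let ?c = "exp (complex_of_real (t - s) * \<kappa> \<xi>)"
  have 1: "integrable M (\<lambda>\<omega>. iexp (\<Sum>r\<in>L. \<theta> r * Z r \<omega>) * iexp (\<xi> * (Z t \<omega> - Z s \<omega>)))"
    by (rule integrable_bounded_complex[where C=1]) (measurable, simp add: norm_mult)
  have 2: "integrable M (\<lambda>\<omega>. iexp (\<Sum>r\<in>L. \<theta> r * Z r \<omega>) * ?c)"
    by (rule integrable_bounded_complex[where C="cmod ?c"]) (measurable, simp add: norm_mult)
  have "(CLINT \<omega>|M. iexp (\<Sum>r\<in>L. \<theta> r * Z r \<omega>) * iexp (\<xi> * (Z t \<omega> - Z s \<omega>))) = (CLINT \<omega>|M. iexp (\<Sum>r\<in>L. \<theta> r * Z r \<omega>)) * ?c"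
    using ii st empty by (simp only: indep_increments_def)
  then have "(CLINT \<omega>|M. iexp (\<Sum>r\<in>L. \<theta> r * Z r \<omega>) * iexp (\<xi> * (Z t \<omega> - Z s \<omega>)) - iexp (\<Sum>r\<in>L. \<theta> r * Z r \<omega>) * ?c) = 0"
    by (subst Bochner_Integration.integral_diff[OF 1 2]) simp
  then show ?case by (simp only: right_diff_distrib prod.empty mult_1)
next
  case (insert q L2)
  let ?c = "exp (complex_of_real (t - s) * \<kappa> \<xi>)"
  let ?R = "\<lambda>\<omega>. (\<Prod>r\<in>L2. indicator (B r) (Z r \<omega>)) * (iexp (\<Sum>r\<in>L. \<theta> r * Z r \<omega>) * (iexp (\<xi> * (Z t \<omega> - Z s \<omega>)) - ?c))"
  have [measurable]: "(\<lambda>\<omega>. indicator (B r) (Z r \<omega>) :: complex) \<in> borel_measurable M" for r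
    using B[of r] by measurable
  have "(CLINT \<omega>|M. indicator (B q) (Z q \<omega>) * ?R \<omega>) = 0"
  proof (rule fourier_zero[where C="1 * (1 * (1 + cmod ?c))"])
    show "?R \<in> borel_measurable M" by measurable
    show "cmod (?R \<omega>) \<le> 1 * (1 * (1 + cmod ?c))" for \<omega>
      unfolding norm_mult prod_norm[symmetric]
    proof (intro mult_mono)
      show "(\<Prod>r\<in>L2. cmod (indicator (B r) (Z r \<omega>))) \<le> 1"
        by (intro prod_le_1) (auto simp: indicator_def)
      show "cmod (iexp (\<xi> * (Z t \<omega> - Z s \<omega>)) - ?c) \<le> 1 + cmod ?c"
        using norm_triangle_ineq4[of "iexp (\<xi> * (Z t \<omega> - Z s \<omega>))" ?c] by simp
    qed (auto intro!: mult_nonneg_nonneg)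
    fix u
    \<comment> \<open>Adds the new frequency \<open>u\<close> at time \<open>q\<close>, whether or
      not \<open>q\<close> already occurs in \<open>L\<close>.\<close>
    define \<theta>' where "\<theta>' r = (if r \<in> L then \<theta> r else 0) + (if r = q then u else 0)" for r
    have sum: "(\<Sum>r\<in>insert q L. \<theta>' r * Z r \<omega>) = (\<Sum>r\<in>L. \<theta> r * Z r \<omega>) + u * Z q \<omega>" for \<omega>
    proof -
      have "(\<Sum>r\<in>insert q L. \<theta>' r * Z r \<omega>) = (\<Sum>r\<in>insert q L. (if r \<in> L then \<theta> r * Z r \<omega> else 0) + (if r = q then u * Z r \<omega> else 0))"
        by (intro sum.cong refl) (auto simp: \<theta>'_def algebra_simps)
      also have "\<dots> = (\<Sum>r\<in>insert q L. if r \<in> L then \<theta> r * Z r \<omega> else 0) + (\<Sum>r\<in>insert q L. if r = q then u * Z r \<omega> else 0)"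
        by (rule sum.distrib)
      also have "(\<Sum>r\<in>insert q L. if r \<in> L then \<theta> r * Z r \<omega> else 0) = (\<Sum>r\<in>L. \<theta> r * Z r \<omega>)"
        using insert.prems by (subst sum.inter_restrict[symmetric]) (auto simp: Int_absorb1 subset_insertI)
      also have "(\<Sum>r\<in>insert q L. if r = q then u * Z r \<omega> else 0) = u * Z q \<omega>"
        using insert.prems by (subst sum.delta) auto
      finally show ?thesis .
    qed
    have "(CLINT \<omega>|M. (\<Prod>r\<in>L2. indicator (B r) (Z r \<omega>)) * (iexp (\<Sum>r\<in>insert q L. \<theta>' r * Z r \<omega>) * (iexp (\<xi> * (Z t \<omega> - Z s \<omega>)) - ?c))) = 0"
      by (rule insert.IH) (use insert.prems in auto)
    then show "(CLINT \<omega>|M. iexp (u * Z q \<omega>) * ?R \<omega>) = 0"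
      unfolding sum by (simp only: of_real_add distrib_left exp_add mult_ac)
  qed (use B in auto)
  then show ?case unfolding prod.insert[OF insert.hyps] mult.assoc .
qed

text \<open>Cylinder sets form an intersection-stable generator of the natural filtration at time
  \<open>s\<close>, and the events over which \<open>R\<close> integrates to 0 form a Dynkin
  system.\<close>

lemma indep_increments_natural:
  assumes ii: "indep_increments Z \<kappa>" and Z[measurable]: "\<And>t. Z t \<in> borel_measurable M"
    and st: "0 \<le> s" "s \<le> t" and A: "A \<in> sets (natural_filtration Z s)"
  shows "(CLINT \<omega>|M. indicator A \<omega> * iexp (\<xi> * (Z t \<omega> - Z s \<omega>))) =
    complex_of_real (measure M A) * exp (complex_of_real (t - s) * \<kappa> \<xi>)"
proof -
  let ?c = "exp (complex_of_real (t - s) * \<kappa> \<xi>)"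
  define R where "R \<omega> = iexp (\<xi> * (Z t \<omega> - Z s \<omega>)) - ?c" for \<omega>
  have [measurable]: "R \<in> borel_measurable M" unfolding R_def by measurable
  have Rb: "cmod (R \<omega>) \<le> 1 + cmod ?c" for \<omega>
    using norm_triangle_ineq4[of "iexp (\<xi> * (Z t \<omega> - Z s \<omega>))" ?c] by (simp add: R_def)
  have iR: "integrable M (\<lambda>\<omega>. indicator D \<omega> * R \<omega>)" if "D \<in> sets M" for D
    by (rule integrable_bounded_complex[where C="1 + cmod ?c"])
       (use that Rb in \<open>auto simp: norm_mult indicator_def\<close>)
  \<comment> \<open>Empty \<open>L\<close> is excluded, since an empty intersection would be
    \<open>UNIV\<close> in place of \<open>space M\<close>.\<close>
  define G where "G = {\<Inter>r\<in>L. Z r -` B r \<inter> space M | L B. finite L \<and> L \<noteq> {} \<and> L \<subseteq> {0..s} \<and> (\<forall>r. B r \<in> sets borel)}"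
  let ?E = "{Z r -` B \<inter> space M | r B. 0 \<le> r \<and> r \<le> s \<and> B \<in> sets (borel :: real measure)}"
  have zero: "(CLINT \<omega>|M. indicator A \<omega> * R \<omega>) = 0"
  proof (rule sigma_sets_induct_disjoint[where G=G and \<Omega>="space M" and P="\<lambda>A. (CLINT \<omega>|M. indicator A \<omega> * R \<omega>) = 0"])
    show "Int_stable G"
    proof (rule Int_stableI)
      fix a b assume "a \<in> G" "b \<in> G"
      then obtain L B L' B' where a: "a = (\<Inter>r\<in>L. Z r -` B r \<inter> space M)" "finite L" "L \<noteq> {}" "L \<subseteq> {0..s}" "\<And>r. B r \<in> sets borel"
        and b: "b = (\<Inter>r\<in>L'. Z r -` B' r \<inter> space M)" "finite L'" "L' \<noteq> {}" "L' \<subseteq> {0..s}" "\<And>r. B' r \<in> sets borel"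
        unfolding G_def by blast
      define D where "D r = (if r \<in> L then B r else UNIV) \<inter> (if r \<in> L' then B' r else UNIV)" for r
      have "a \<inter> b = (\<Inter>r\<in>L \<union> L'. Z r -` D r \<inter> space M)"
        using a(3) b(3) unfolding a(1) b(1) D_def by (auto split: if_splits)
      moreover have "\<forall>r. D r \<in> sets borel" using a b by (auto simp: D_def)
      ultimately show "a \<inter> b \<in> G"
        unfolding G_def using a(2-4) b(2-4)
        by (intro CollectI exI[of _ "L \<union> L'"] exI[of _ D] conjI) simp_all
    qed
    show "G \<subseteq> Pow (space M)" unfolding G_def by auto
    show "A \<in> sigma_sets (space M) G"
    proof -
      have "?E \<subseteq> G"
      proof safe
        fix r and B :: "real set" assume "0 \<le> r" "r \<le> s" "B \<in> sets borel"
        then show "Z r -` B \<inter> space M \<in> G"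
          unfolding G_def by (intro CollectI exI[of _ "{r}"] exI[of _ "\<lambda>_. B"]) auto
      qed
      from subsetD[OF sigma_sets_mono'[OF this, of "space M"]] show ?thesis
        using A unfolding sets_natural_filtration by simp
    qed
    have GM: "sigma_sets (space M) G \<subseteq> sets M"
    proof (rule sets.sigma_sets_subset)
      show "G \<subseteq> sets M"
      proof
        fix a assume "a \<in> G"
        then obtain L B where "a = (\<Inter>r\<in>L. Z r -` B r \<inter> space M)" "finite L" "L \<noteq> {}" "\<And>r. B r \<in> sets borel"
          unfolding G_def by blast
        then show "a \<in> sets M" using measurable_sets[OF Z] by (auto intro!: sets.finite_INT)
      qed
    qed
    {
      fix a assume "a \<in> G"
      then obtain L B where a: "a = (\<Inter>r\<in>L. Z r -` B r \<inter> space M)" "finite L" "L \<noteq> {}" "L \<subseteq> {0..s}" "\<And>r. B r \<in> sets borel"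
        unfolding G_def by blast
      have "(CLINT \<omega>|M. indicator a \<omega> * R \<omega>) = (CLINT \<omega>|M. (\<Prod>r\<in>L. indicator (B r) (Z r \<omega>)) * (iexp (\<Sum>r\<in>{}. 0 * Z r \<omega>) * R \<omega>))"
      proof (intro Bochner_Integration.integral_cong refl)
        fix \<omega> assume \<omega>: "\<omega> \<in> space M"
        have "(indicator a \<omega> :: complex) = (\<Prod>r\<in>L. indicator (B r) (Z r \<omega>))"
        proof (cases "\<forall>r\<in>L. Z r \<omega> \<in> B r")
          case True
          then show ?thesis using a \<omega> by (simp add: indicator_def)
        next
          case False
          then have "(\<Prod>r\<in>L. indicator (B r) (Z r \<omega>) :: complex) = 0"
            using a(2) by (auto simp: indicator_def prod_zero_iff)
          moreover have "\<omega> \<notin> a" using False a(1) by auto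
          ultimately show ?thesis by simp
        qed
        then show "indicator a \<omega> * R \<omega> = (\<Prod>r\<in>L. indicator (B r) (Z r \<omega>)) * (iexp (\<Sum>r\<in>{}. 0 * Z r \<omega>) * R \<omega>)" by simp
      qed
      also have "\<dots> = 0"
        unfolding R_def by (rule indep_increments_cylinder[OF ii Z st a(2,4,5)]) auto
      finally show "(CLINT \<omega>|M. indicator a \<omega> * R \<omega>) = 0" .
    }
    show "(CLINT \<omega>|M. indicator {} \<omega> * R \<omega>) = 0" by simp
    have full: "(CLINT \<omega>|M. R \<omega>) = 0"
      using indep_increments_cylinder[OF ii Z st, of "{}" "\<lambda>_. UNIV" "{}"] by (simp add: R_def)
    {
      fix a assume a: "a \<in> sigma_sets (space M) G" "(CLINT \<omega>|M. indicator a \<omega> * R \<omega>) = 0"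
      have "(CLINT \<omega>|M. indicator (space M - a) \<omega> * R \<omega>) = (CLINT \<omega>|M. indicator (space M) \<omega> * R \<omega> - indicator a \<omega> * R \<omega>)"
        by (intro Bochner_Integration.integral_cong) (auto simp: indicator_def)
      also have "\<dots> = (CLINT \<omega>|M. indicator (space M) \<omega> * R \<omega>) - (CLINT \<omega>|M. indicator a \<omega> * R \<omega>)"
        using a GM by (intro Bochner_Integration.integral_diff iR) auto
      also have "(CLINT \<omega>|M. indicator (space M) \<omega> * R \<omega>) = (CLINT \<omega>|M. R \<omega>)"
        by (intro Bochner_Integration.integral_cong) auto
      finally show "(CLINT \<omega>|M. indicator (space M - a) \<omega> * R \<omega>) = 0" using a(2) full by simp
    }
    {
      fix D :: "nat \<Rightarrow> 'a set" assume D: "disjoint_family D" "range D \<subseteq> sigma_sets (space M) G" "\<And>i. (CLINT \<omega>|M. indicator (D i) \<omega> * R \<omega>) = 0"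
      have Dm[measurable]: "D i \<in> sets M" for i using D GM by auto
      have "(\<lambda>n. CLINT \<omega>|M. indicator (\<Union>i<n. D i) \<omega> * R \<omega>) \<longlonglongrightarrow> (CLINT \<omega>|M. indicator (\<Union>i. D i) \<omega> * R \<omega>)"
      proof (rule integral_dominated_convergence[where w="\<lambda>_. 1 + cmod ?c"])
        show "AE \<omega> in M. (\<lambda>n. indicator (\<Union>i<n. D i) \<omega> * R \<omega>) \<longlonglongrightarrow> indicator (\<Union>i. D i) \<omega> * R \<omega>"
          by (intro AE_I2 tendsto_mult tendsto_const LIMSEQ_indicator_UN)
      qed (use Rb in \<open>auto simp: norm_mult indicator_def\<close>)
      moreover have "(CLINT \<omega>|M. indicator (\<Union>i<n. D i) \<omega> * R \<omega>) = 0" for n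
      proof -
        have "(CLINT \<omega>|M. indicator (\<Union>i<n. D i) \<omega> * R \<omega>) = (CLINT \<omega>|M. (\<Sum>i<n. indicator (D i) \<omega> * R \<omega>))"
          using D(1) by (intro Bochner_Integration.integral_cong refl)
            (simp add: sum_distrib_right[symmetric] indicator_UN_disjoint disjoint_family_on_def)
        also have "\<dots> = (\<Sum>i<n. CLINT \<omega>|M. indicator (D i) \<omega> * R \<omega>)"
          by (rule Bochner_Integration.integral_sum) (rule iR, simp)
        finally show ?thesis using D(3) by simp
      qed
      ultimately show "(CLINT \<omega>|M. indicator (\<Union>i. D i) \<omega> * R \<omega>) = 0"
        using LIMSEQ_unique[OF _ tendsto_const] by auto
    }
  qed
  have Am[measurable]: "A \<in> sets M"
    using A subalgebra_natural_filtration[of Z s] Z by (auto simp: subalgebra_def)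
  have 1: "integrable M (\<lambda>\<omega>. indicator A \<omega> * iexp (\<xi> * (Z t \<omega> - Z s \<omega>)))"
    by (rule integrable_bounded_complex[where C=1]) (auto simp: norm_mult indicator_def)
  have 2: "integrable M (\<lambda>\<omega>. indicator A \<omega> * ?c)"
    by (rule integrable_bounded_complex[where C="cmod ?c"]) (auto simp: norm_mult indicator_def)
  have "0 = (CLINT \<omega>|M. indicator A \<omega> * iexp (\<xi> * (Z t \<omega> - Z s \<omega>)) - indicator A \<omega> * ?c)"
    unfolding zero[symmetric] R_def by (simp only: right_diff_distrib)
  also have "\<dots> = (CLINT \<omega>|M. indicator A \<omega> * iexp (\<xi> * (Z t \<omega> - Z s \<omega>))) - (CLINT \<omega>|M. indicator A \<omega> * ?c)"
    by (rule Bochner_Integration.integral_diff[OF 1 2])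
  also have "(CLINT \<omega>|M. indicator A \<omega> * ?c) = complex_of_real (measure M A) * ?c"
  proof -
    have "(CLINT \<omega>|M. indicator A \<omega>) = (CLINT \<omega>|M. complex_of_real (indicator A \<omega>))"
      by (intro Bochner_Integration.integral_cong refl) (simp split: split_indicator)
    also have "\<dots> = complex_of_real (measure M A)" unfolding integral_complex_of_real by simp
    finally show ?thesis by simp
  qed
  finally show ?thesis by simp
qed

text \<open>Averaging the characteristic function over a standard normal frequency, scaled by
  \<open>1 / a\<close>, gives the expectation of \<open>exp (- (D / a)^2 / 2)\<close> on
  \<open>A\<close>. This is close to \<open>measure M A\<close> because
  \<open>exp (h * \<kappa>) - 1\<close> is at most \<open>h * C * \<xi>^2\<close> in modulus and the
  normal law has second moment 1. Large values of \<open>D\<close> would make the expectation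
  visibly smaller.\<close>

lemma increment_tail:
  fixes \<kappa> :: "real \<Rightarrow> complex"
  assumes [measurable]: "D \<in> borel_measurable M" "A \<in> sets M" "\<kappa> \<in> borel_measurable borel"
    and char: "\<And>\<xi>. (CLINT \<omega>|M. indicator A \<omega> * iexp (\<xi> * D \<omega>)) = complex_of_real (measure M A) * exp (complex_of_real h * \<kappa> \<xi>)"
    and \<kappa>: "\<And>\<xi>. Re (\<kappa> \<xi>) \<le> 0" "\<And>\<xi>. cmod (\<kappa> \<xi>) \<le> C * \<xi>\<^sup>2" and h: "0 \<le> h" and a: "0 < a"
  shows "measure M (A \<inter> {\<omega> \<in> space M. a \<le> \<bar>D \<omega>\<bar>}) \<le> 4 * C * h / a\<^sup>2 * measure M A"
proof -
  interpret N: real_distribution std_normal_distribution by (rule real_dist_normal_dist)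
  interpret Q: pair_sigma_finite std_normal_distribution M ..
  let ?e = "\<lambda>\<omega>. exp (- (D \<omega> / a)\<^sup>2 / 2)"
  have e: "0 \<le> ?e \<omega>" "?e \<omega> \<le> 1" for \<omega> by auto
  have ie: "integrable M (\<lambda>\<omega>. indicator A \<omega> * ?e \<omega>)"
    by (rule integrable_const_bound[where B=1]) (auto simp: indicator_def)
  have i1: "integrable M (\<lambda>\<omega>. indicator A \<omega> :: real)"
    by (rule integrable_const_bound[where B=1]) (auto simp: indicator_def)
  have int: "integrable (std_normal_distribution \<Otimes>\<^sub>M M) (\<lambda>(x, \<omega>). indicator A \<omega> * iexp (x / a * D \<omega>))"
  proof -
    interpret QP: pair_prob_space std_normal_distribution M ..
    show ?thesis
      unfolding case_prod_beta'
      by (rule QP.P.integrable_bounded_complex[where C=1]) (auto simp: norm_mult indicator_def)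
  qed
  have "complex_of_real (LINT \<omega>|M. indicator A \<omega> * ?e \<omega>) = (CLINT \<omega>|M. indicator A \<omega> * complex_of_real (?e \<omega>))"
    unfolding integral_complex_of_real[symmetric]
    by (intro Bochner_Integration.integral_cong refl) (simp add: indicator_def)
  also have "\<dots> = (CLINT \<omega>|M. (CLINT x|std_normal_distribution. indicator A \<omega> * iexp (x / a * D \<omega>)))"
  proof (intro Bochner_Integration.integral_cong refl)
    fix \<omega>
    have "complex_of_real (?e \<omega>) = char std_normal_distribution (D \<omega> / a)"
      by (simp add: char_std_normal_distribution)
    also have "\<dots> = (CLINT x|std_normal_distribution. iexp (x / a * D \<omega>))"
      unfolding char_def by (simp add: mult_ac)
    finally show "indicator A \<omega> * complex_of_real (?e \<omega>) = (CLINT x|std_normal_distribution. indicator A \<omega> * iexp (x / a * D \<omega>))"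
      by (simp only: Bochner_Integration.integral_mult_right_zero)
  qed
  also have "\<dots> = (CLINT x|std_normal_distribution. (CLINT \<omega>|M. indicator A \<omega> * iexp (x / a * D \<omega>)))"
    by (rule Q.Fubini_integral[OF int])
  also have "\<dots> = (CLINT x|std_normal_distribution. complex_of_real (measure M A) * exp (complex_of_real h * \<kappa> (x / a)))"
    by (simp only: char)
  finally have E: "complex_of_real (LINT \<omega>|M. indicator A \<omega> * ?e \<omega>) =
    complex_of_real (measure M A) * (CLINT x|std_normal_distribution. exp (complex_of_real h * \<kappa> (x / a)))"
    by simp
  have Re_le: "Re (complex_of_real h * \<kappa> x) \<le> 0" for x using h \<kappa>(1)[of x] by (simp add: mult_nonneg_nonpos)
  have iexp: "integrable std_normal_distribution (\<lambda>x. exp (complex_of_real h * \<kappa> (x / a)))"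
    by (rule N.integrable_bounded_complex[where C=1]) (use Re_le in auto)
  have x2: "(LINT x|std_normal_distribution. x\<^sup>2) = 1" "integrable std_normal_distribution (\<lambda>x. x\<^sup>2)"
    using std_normal_distribution_even_moments[of 1] by auto
  have "complex_of_real (measure M A - (LINT \<omega>|M. indicator A \<omega> * ?e \<omega>)) =
    complex_of_real (measure M A) * (CLINT x|std_normal_distribution. 1 - exp (complex_of_real h * \<kappa> (x / a)))"
  proof -
    have "(CLINT x|std_normal_distribution. 1 - exp (complex_of_real h * \<kappa> (x / a))) = 1 - (CLINT x|std_normal_distribution. exp (complex_of_real h * \<kappa> (x / a)))"
      using iexp N.prob_space by simp
    then show ?thesis unfolding of_real_diff E by (simp add: right_diff_distrib)
  qed
  from arg_cong[OF this, of cmod]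
  have "\<bar>measure M A - (LINT \<omega>|M. indicator A \<omega> * ?e \<omega>)\<bar> =
    measure M A * cmod (CLINT x|std_normal_distribution. 1 - exp (complex_of_real h * \<kappa> (x / a)))"
    by (simp only: norm_of_real norm_mult abs_of_nonneg[OF measure_nonneg])
  also have "cmod (CLINT x|std_normal_distribution. 1 - exp (complex_of_real h * \<kappa> (x / a))) \<le>
    (LINT x|std_normal_distribution. cmod (1 - exp (complex_of_real h * \<kappa> (x / a))))"
    by (rule integral_norm_bound)
  also have "\<dots> \<le> (LINT x|std_normal_distribution. h * C / a\<^sup>2 * x\<^sup>2)"
  proof (rule integral_mono)
    show "integrable std_normal_distribution (\<lambda>x. cmod (1 - exp (complex_of_real h * \<kappa> (x / a))))"
      using iexp by simp
    show "integrable std_normal_distribution (\<lambda>x. h * C / a\<^sup>2 * x\<^sup>2)" using x2 by simp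
    fix x :: real
    have "cmod (1 - exp (complex_of_real h * \<kappa> (x / a))) \<le> cmod (complex_of_real h * \<kappa> (x / a))"
      using norm_exp_minus_one_le[OF Re_le] by (simp add: norm_minus_commute)
    also have "\<dots> \<le> h * (C * (x / a)\<^sup>2)" using h \<kappa>(2) by (simp add: norm_mult mult_left_mono)
    finally show "cmod (1 - exp (complex_of_real h * \<kappa> (x / a))) \<le> h * C / a\<^sup>2 * x\<^sup>2"
      by (simp add: power_divide)
  qed
  also have "\<dots> = h * C / a\<^sup>2" using x2 by simp
  finally have le: "\<bar>measure M A - (LINT \<omega>|M. indicator A \<omega> * ?e \<omega>)\<bar> \<le> measure M A * (h * C / a\<^sup>2)"
    by (simp add: mult_left_mono)
  have "measure M (A \<inter> {\<omega> \<in> space M. a \<le> \<bar>D \<omega>\<bar>}) / 4 = (LINT \<omega>|M. indicator (A \<inter> {\<omega> \<in> space M. a \<le> \<bar>D \<omega>\<bar>}) \<omega> / 4)"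
    by simp
  also have "\<dots> \<le> (LINT \<omega>|M. indicator A \<omega> - indicator A \<omega> * ?e \<omega>)"
  proof (rule integral_mono)
    show "integrable M (\<lambda>\<omega>. indicator (A \<inter> {\<omega> \<in> space M. a \<le> \<bar>D \<omega>\<bar>}) \<omega> / 4 :: real)"
      by (rule integrable_const_bound[where B=1]) (auto simp: indicator_def)
    show "integrable M (\<lambda>\<omega>. indicator A \<omega> - indicator A \<omega> * ?e \<omega>)" using ie i1 by simp
    fix \<omega>
    show "indicator (A \<inter> {\<omega> \<in> space M. a \<le> \<bar>D \<omega>\<bar>}) \<omega> / 4 \<le> indicator A \<omega> - indicator A \<omega> * ?e \<omega>"
    proof (cases "\<omega> \<in> A \<inter> {\<omega> \<in> space M. a \<le> \<bar>D \<omega>\<bar>}")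
      case True
      then have "1 \<le> \<bar>D \<omega> / a\<bar>" using a by (simp add: abs_divide)
      then have "1 \<le> (D \<omega> / a)\<^sup>2"
        using one_le_power[of "\<bar>D \<omega> / a\<bar>" 2] by (simp only: power2_abs)
      then have "?e \<omega> \<le> exp (- (1 / 2))" by simp
      \<comment> \<open>On the event the loss \<open>1 - ?e \<omega>\<close> is therefore at least
        \<open>1 / 4\<close>, the origin of the factor 4.\<close>
      also have "\<dots> \<le> 3 / 4"
      proof -
        have "4 / 3 \<le> exp (1 / 2 :: real)" using exp_ge_add_one_self[of "1/2"] by linarith
        then show ?thesis by (simp add: exp_minus field_simps)
      qed
      finally show ?thesis using True by simp
    next
      case False
      then show ?thesis using e[of \<omega>] by (auto simp: indicator_def)
    qed
  qed
  also have "\<dots> = measure M A - (LINT \<omega>|M. indicator A \<omega> * ?e \<omega>)" using ie i1 by simp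
  also have "\<dots> \<le> measure M A * (h * C / a\<^sup>2)" using le by simp
  finally show ?thesis by (simp add: field_simps)
qed

text \<open>Decompose along the first time in \<open>L\<close> at which \<open>2 * a\<close> is exceeded: from there on the increment stays
  below \<open>a\<close> with probability at least one half, or else the bound is trivial.\<close>
lemma ottaviani_finite:
  fixes Z :: "real \<Rightarrow> 'a \<Rightarrow> real"
  assumes ii: "indep_increments Z \<kappa>" and Z[measurable]: "\<And>t. Z t \<in> borel_measurable M" and Z0: "\<And>\<omega>. Z 0 \<omega> = 0"
    and \<kappa>m: "\<kappa> \<in> borel_measurable borel"
    and \<kappa>: "\<And>\<xi>. Re (\<kappa> \<xi>) \<le> 0" "\<And>\<xi>. cmod (\<kappa> \<xi>) \<le> C * \<xi>\<^sup>2" and C: "0 \<le> C"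
    and a: "0 < a" and T: "0 \<le> T" and L: "finite L" "L \<subseteq> {0..T}"
  shows "measure M {\<omega> \<in> space M. \<exists>t\<in>L. 2 * a \<le> \<bar>Z t \<omega>\<bar>} \<le> 8 * C * T / a\<^sup>2"
proof (cases "4 * C * T / a\<^sup>2 \<le> 1 / 2")
  case False
  then have "1 \<le> 8 * C * T / a\<^sup>2" by simp
  then show ?thesis using prob_le_1 order_trans by blast
next
  case True
  have sub: "subalgebra M (natural_filtration Z t)" for t by (rule subalgebra_natural_filtration[OF Z])
  have tail: "measure M (A \<inter> {\<omega> \<in> space M. a \<le> \<bar>Z T \<omega> - Z s \<omega>\<bar>}) \<le> 4 * C * T / a\<^sup>2 * measure M A"
    if s: "0 \<le> s" "s \<le> T" and A: "A \<in> sets (natural_filtration Z s)" for s A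
  proof -
    have [measurable]: "A \<in> sets M" using A sub[of s] by (auto simp: subalgebra_def)
    have "measure M (A \<inter> {\<omega> \<in> space M. a \<le> \<bar>Z T \<omega> - Z s \<omega>\<bar>}) \<le> 4 * C * (T - s) / a\<^sup>2 * measure M A"
      by (rule increment_tail[where \<kappa>=\<kappa>]) (use s \<kappa> \<kappa>m a indep_increments_natural[OF ii Z s A] in auto)
    also have "\<dots> \<le> 4 * C * T / a\<^sup>2 * measure M A"
      using C s by (intro mult_right_mono divide_right_mono mult_left_mono) auto
    finally show ?thesis .
  qed
  define A where "A t = {\<omega> \<in> space M. 2 * a \<le> \<bar>Z t \<omega>\<bar> \<and> (\<forall>r\<in>L \<inter> {..<t}. \<bar>Z r \<omega>\<bar> < 2 * a)}" for t
  have AF: "A t \<in> sets (natural_filtration Z t)" if t: "t \<in> L" for t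
  proof -
    let ?F = "natural_filtration Z t"
    have Zr[measurable]: "Z r \<in> borel_measurable ?F" if "0 \<le> r" "r \<le> t" for r
      using natural_filtration_adapted[OF that(1), of Z] natural_filtration_mono[OF that(2), of Z]
      by (auto simp: measurable_def)
    have "A t = {\<omega> \<in> space ?F. 2 * a \<le> \<bar>Z t \<omega>\<bar>} \<inter> {\<omega> \<in> space ?F. \<forall>r\<in>L \<inter> {..<t}. \<bar>Z r \<omega>\<bar> < 2 * a}"
      by (auto simp: A_def)
    also have "\<dots> \<in> sets ?F"
    proof (rule sets.Int)
      have "0 \<le> t" using t L by auto
      then have [measurable]: "Z t \<in> borel_measurable ?F" by (intro Zr) auto
      show "{\<omega> \<in> space ?F. 2 * a \<le> \<bar>Z t \<omega>\<bar>} \<in> sets ?F" by measurable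
      show "{\<omega> \<in> space ?F. \<forall>r\<in>L \<inter> {..<t}. \<bar>Z r \<omega>\<bar> < 2 * a} \<in> sets ?F"
      proof (rule sets.sets_Collect_finite_All)
        fix r assume "r \<in> L \<inter> {..<t}"
        then have "0 \<le> r" "r \<le> t" using L by auto
        then have [measurable]: "Z r \<in> borel_measurable ?F" by (rule Zr)
        show "{\<omega> \<in> space ?F. \<bar>Z r \<omega>\<bar> < 2 * a} \<in> sets ?F" by measurable
      qed (use L in auto)
    qed
    finally show ?thesis .
  qed
  have AM[measurable]: "A t \<in> sets M" if "t \<in> L" for t using AF[OF that] sub[of t] by (auto simp: subalgebra_def)
  have disj: "disjoint_family_on A L"
    unfolding disjoint_family_on_def
  proof (intro ballI impI)
    fix s t assume st: "s \<in> L" "t \<in> L" "s \<noteq> t"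
    have *: "\<omega> \<notin> A s" if "s \<in> L" "s < t" "\<omega> \<in> A t" for s t \<omega>
    proof -
      have "\<bar>Z s \<omega>\<bar> < 2 * a" using that by (auto simp: A_def)
      then show ?thesis by (simp add: A_def)
    qed
    from *[of s t] *[of t s] st show "A s \<inter> A t = {}"
      by (cases "s < t") auto
  qed
  have Un: "{\<omega> \<in> space M. \<exists>t\<in>L. 2 * a \<le> \<bar>Z t \<omega>\<bar>} = (\<Union>t\<in>L. A t)"
  proof (intro equalityI subsetI)
    fix \<omega> assume \<omega>: "\<omega> \<in> {\<omega> \<in> space M. \<exists>t\<in>L. 2 * a \<le> \<bar>Z t \<omega>\<bar>}"
    define H where "H = {t \<in> L. 2 * a \<le> \<bar>Z t \<omega>\<bar>}"
    have H: "finite H" "H \<noteq> {}" using \<omega> L by (auto simp: H_def)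
    have "Min H \<in> H" using H by (rule Min_in)
    moreover have "\<forall>r\<in>L \<inter> {..<Min H}. \<bar>Z r \<omega>\<bar> < 2 * a"
    proof
      fix r assume r: "r \<in> L \<inter> {..<Min H}"
      then have "r \<notin> H" using Min_le[OF H(1), of r] by auto
      then show "\<bar>Z r \<omega>\<bar> < 2 * a" using r by (auto simp: H_def)
    qed
    ultimately show "\<omega> \<in> (\<Union>t\<in>L. A t)" using \<omega> by (auto simp: H_def A_def)
  qed (auto simp: A_def)
  have half: "measure M (A t) / 2 \<le> measure M (A t \<inter> {\<omega> \<in> space M. a \<le> \<bar>Z T \<omega>\<bar>})" if t: "t \<in> L" for t
  proof -
    note [measurable] = AM[OF t]
    have "measure M (A t) \<le> measure M ((A t \<inter> {\<omega> \<in> space M. a \<le> \<bar>Z T \<omega>\<bar>}) \<union> (A t \<inter> {\<omega> \<in> space M. a \<le> \<bar>Z T \<omega> - Z t \<omega>\<bar>}))"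
    proof (rule finite_measure_mono)
      show "A t \<subseteq> (A t \<inter> {\<omega> \<in> space M. a \<le> \<bar>Z T \<omega>\<bar>}) \<union> (A t \<inter> {\<omega> \<in> space M. a \<le> \<bar>Z T \<omega> - Z t \<omega>\<bar>})"
      proof
        fix \<omega> assume "\<omega> \<in> A t"
        moreover from this have "\<omega> \<in> space M" "2 * a \<le> \<bar>Z t \<omega>\<bar>" by (auto simp: A_def)
        moreover from this have "a \<le> \<bar>Z T \<omega>\<bar> \<or> a \<le> \<bar>Z T \<omega> - Z t \<omega>\<bar>" by linarith
        ultimately show "\<omega> \<in> (A t \<inter> {\<omega> \<in> space M. a \<le> \<bar>Z T \<omega>\<bar>}) \<union> (A t \<inter> {\<omega> \<in> space M. a \<le> \<bar>Z T \<omega> - Z t \<omega>\<bar>})" by blast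
      qed
    qed measurable
    also have "\<dots> \<le> measure M (A t \<inter> {\<omega> \<in> space M. a \<le> \<bar>Z T \<omega>\<bar>}) + measure M (A t \<inter> {\<omega> \<in> space M. a \<le> \<bar>Z T \<omega> - Z t \<omega>\<bar>})"
      by (rule measure_Un_le) measurable
    also have "measure M (A t \<inter> {\<omega> \<in> space M. a \<le> \<bar>Z T \<omega> - Z t \<omega>\<bar>}) \<le> 4 * C * T / a\<^sup>2 * measure M (A t)"
      using t L by (intro tail AF) auto
    also have "\<dots> \<le> 1 / 2 * measure M (A t)" using True by (intro mult_right_mono) auto
    finally show ?thesis by simp
  qed
  have "measure M {\<omega> \<in> space M. \<exists>t\<in>L. 2 * a \<le> \<bar>Z t \<omega>\<bar>} / 2 = (\<Sum>t\<in>L. measure M (A t) / 2)"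
    unfolding Un sum_divide_distrib[symmetric]
    using L disj AM by (subst finite_measure_finite_Union) auto
  also have "\<dots> \<le> (\<Sum>t\<in>L. measure M (A t \<inter> {\<omega> \<in> space M. a \<le> \<bar>Z T \<omega>\<bar>}))"
    by (intro sum_mono half)
  also have "\<dots> = measure M (\<Union>t\<in>L. A t \<inter> {\<omega> \<in> space M. a \<le> \<bar>Z T \<omega>\<bar>})"
    using L disj by (intro finite_measure_finite_Union[symmetric]) (auto simp: disjoint_family_on_def intro!: sets.Int AM)
  \<comment> \<open>All pieces lie in the single event that \<open>\<bar>Z T\<bar>\<close> is at
    least \<open>a\<close>. As \<open>Z 0 = 0\<close>, this is a tail event of the increment from
    time 0, and the estimate applies once more.\<close>
  also have "\<dots> \<le> measure M (space M \<inter> {\<omega> \<in> space M. a \<le> \<bar>Z T \<omega> - Z 0 \<omega>\<bar>})"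
    by (rule finite_measure_mono) (auto simp: Z0)
  also have "\<dots> \<le> 4 * C * T / a\<^sup>2 * measure M (space M)"
    using T sets.top[of "natural_filtration Z 0"] by (intro tail) auto
  finally show ?thesis by (simp add: prob_space)
qed

lemma ottaviani_countable:
  fixes Z :: "real \<Rightarrow> 'a \<Rightarrow> real"
  assumes ii: "indep_increments Z \<kappa>" and Z[measurable]: "\<And>t. Z t \<in> borel_measurable M" and Z0: "\<And>\<omega>. Z 0 \<omega> = 0"
    and \<kappa>m: "\<kappa> \<in> borel_measurable borel"
    and \<kappa>: "\<And>\<xi>. Re (\<kappa> \<xi>) \<le> 0" "\<And>\<xi>. cmod (\<kappa> \<xi>) \<le> C * \<xi>\<^sup>2" and C: "0 \<le> C"
    and a: "0 < a" and T: "0 \<le> T" and L: "countable L" "L \<subseteq> {0..T}"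
  shows "measure M {\<omega> \<in> space M. \<exists>t\<in>L. 2 * a \<le> \<bar>Z t \<omega>\<bar>} \<le> 8 * C * T / a\<^sup>2"
proof (cases "L = {}")
  case True
  then show ?thesis using C T by simp
next
  case False
  define E where "E n = {\<omega> \<in> space M. \<exists>t\<in>from_nat_into L ` {..n}. 2 * a \<le> \<bar>Z t \<omega>\<bar>}" for n :: nat
  have "range E \<subseteq> sets M" by (auto simp: E_def)
  moreover have "incseq E" unfolding E_def by (intro incseq_SucI) auto
  ultimately have "(\<lambda>n. measure M (E n)) \<longlonglongrightarrow> measure M (\<Union>n. E n)"
    by (rule finite_Lim_measure_incseq)
  moreover have "measure M (E n) \<le> 8 * C * T / a\<^sup>2" for n
    unfolding E_def using from_nat_into[OF False] L
    by (intro ottaviani_finite[OF ii Z Z0 \<kappa>m \<kappa> C a T]) auto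
  ultimately have "measure M (\<Union>n. E n) \<le> 8 * C * T / a\<^sup>2"
    by (intro LIMSEQ_le_const2) auto
  moreover have "(\<Union>n. E n) = {\<omega> \<in> space M. \<exists>t\<in>L. 2 * a \<le> \<bar>Z t \<omega>\<bar>}"
  proof (intro equalityI subsetI)
    fix \<omega> assume "\<omega> \<in> (\<Union>n. E n)"
    then show "\<omega> \<in> {\<omega> \<in> space M. \<exists>t\<in>L. 2 * a \<le> \<bar>Z t \<omega>\<bar>}"
      using from_nat_into[OF False] by (auto simp: E_def)
  next
    fix \<omega> assume "\<omega> \<in> {\<omega> \<in> space M. \<exists>t\<in>L. 2 * a \<le> \<bar>Z t \<omega>\<bar>}"
    then obtain t where t: "\<omega> \<in> space M" "t \<in> L" "2 * a \<le> \<bar>Z t \<omega>\<bar>" by blast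
    obtain n where "from_nat_into L n = t" using from_nat_into_surj[OF L(1) t(2)] by blast
    then have "\<omega> \<in> E n" using t by (auto simp: E_def)
    then show "\<omega> \<in> (\<Union>n. E n)" by blast
  qed
  ultimately show ?thesis by simp
qed

end

section \<open>Poisson sums over cells\<close>

text \<open>The sample space is to be the type \<open>real \<Rightarrow> real \<times> real\<close>
  of the final theorem. So the product runs over all reals: the coordinate at \<open>real i\<close>
  carries \<open>D i\<close>, and the remaining ones hold further copies.\<close>

lemma ex_independent_family:
  fixes D :: "nat \<Rightarrow> (real \<times> real) measure"
  assumes D: "\<And>i. prob_space (D i)" "\<And>i. sets (D i) = sets borel"
  shows "\<exists>(M :: (real \<Rightarrow> real \<times> real) measure) V. prob_space M \<and>
    prob_space.indep_vars M (\<lambda>_. borel) V UNIV \<and> (\<forall>i. distr M borel (V i) = D i)"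
proof -
  define E where "E r = D (nat \<lfloor>r\<rfloor>)" for r :: real
  define M where "M = PiM UNIV E"
  define V where "V i \<omega> = \<omega> (real i)" for i :: nat and \<omega> :: "real \<Rightarrow> real \<times> real"
  have E: "prob_space (E r)" "sets (E r) = sets borel" "E (real i) = D i" for r i
    using D by (auto simp: E_def)
  have prob: "prob_space M" unfolding M_def by (rule prob_space_PiM) (rule E)
  interpret prob_space M by (rule prob)
  have V: "V i \<in> measurable M (D i)" for i
    unfolding V_def M_def E(3)[symmetric] by (rule measurable_component_singleton) simp
  have Vb[measurable]: "V i \<in> borel_measurable M" for i
    using V[of i] by (simp add: measurable_cong_sets[OF refl D(2)])
  have dV: "distr M (D i) (V i) = D i" for i
    unfolding V_def M_def E(3)[symmetric] by (rule distr_PiM_component) (auto intro: E)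
  have dV': "distr M borel (V i) = D i" for i
    using dV[of i] by (subst distr_cong[OF refl _ refl, of _ "D i"]) (auto simp: D)
  have "indep_vars (\<lambda>_. borel) V UNIV"
  proof (subst indep_vars_iff_distr_eq_PiM)
    have eq: "PiM UNIV (\<lambda>i. distr M borel (V i)) = PiM UNIV (\<lambda>i. E (real i))"
      by (simp add: dV' E)
    have "distr M (PiM UNIV (\<lambda>i. E (real i))) (\<lambda>\<omega>. \<lambda>n\<in>UNIV. \<omega> (real n)) = PiM UNIV (\<lambda>i. E (real i))"
      unfolding M_def by (rule distr_PiM_reindex) (auto intro: E inj_onI)
    then show "distr M (PiM UNIV (\<lambda>i. borel)) (\<lambda>x. \<lambda>i\<in>UNIV. V i x) = PiM UNIV (\<lambda>i. distr M borel (V i))"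
      unfolding eq V_def
      by (subst distr_cong[OF refl sets_PiM_cong[OF refl] refl, of _ _ "\<lambda>i. E (real i)"]) (simp_all add: E D)
  qed auto
  with prob dV' show ?thesis by blast
qed

text \<open>For a cell of measure zero the point mass is a placeholder, since the Poisson number of
  points in it is almost surely 0.\<close>

definition cell_law :: "(real \<times> real) measure \<Rightarrow> (real \<times> real) measure" where
  "cell_law \<rho> = (if emeasure \<rho> (space \<rho>) = 0 then return borel (0, 0) else uniform_measure \<rho> (space \<rho>))"

text \<open>The library's Poisson distribution is only specified for positive rates.\<close>
definition poisson0_pmf :: "real \<Rightarrow> nat pmf" where
  "poisson0_pmf l = (if 0 < l then poisson_pmf l else return_pmf 0)"

lemma pmf_poisson0: "0 \<le> l \<Longrightarrow> pmf (poisson0_pmf l) n = l ^ n / fact n * exp (- l)"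
  by (cases n) (auto simp: poisson0_pmf_def)

text \<open>The count is stored in the first component of a pair, so that counts and points are
  members of one independent family with a single value type.\<close>

definition count_law :: "real \<Rightarrow> (real \<times> real) measure" where
  "count_law l = distr (measure_pmf (poisson0_pmf l)) borel (\<lambda>n. (real n, 0))"

locale finite_cell =
  fixes \<rho> :: "(real \<times> real) measure"
  assumes sets_cell: "sets \<rho> = sets borel" and finite_cell: "emeasure \<rho> (space \<rho>) \<noteq> \<infinity>"
begin

sublocale finite_measure \<rho> using finite_cell by (rule finite_measureI)

lemma prob_space_cell_law: "prob_space (cell_law \<rho>)"
  unfolding cell_law_def
  using finite_cell by (auto intro!: prob_space_uniform_measure prob_space_return)

lemma sets_cell_law: "sets (cell_law \<rho>) = sets borel"
  by (simp add: cell_law_def sets_cell)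

text \<open>Multiplied through by the total mass, so that cells of measure zero are included with
  both sides equal to 0.\<close>

lemma integral_cell_law:
  fixes g :: "real \<times> real \<Rightarrow> complex"
  assumes "g \<in> borel_measurable borel"
  shows "complex_of_real (measure \<rho> (space \<rho>)) * (CLINT z|cell_law \<rho>. g z) = (CLINT z|\<rho>. g z)"
proof (cases "emeasure \<rho> (space \<rho>) = 0")
  case True
  then have "measure \<rho> (space \<rho>) = 0" by (simp add: measure_def)
  moreover have "(CLINT z|\<rho>. g z) = 0"
    by (rule integral_eq_zero_AE) (use True in \<open>auto intro!: AE_I[where N="space \<rho>"]\<close>)
  ultimately show ?thesis by simp
next
  case False
  let ?m = "measure \<rho> (space \<rho>)"
  have m: "?m \<noteq> 0" "emeasure \<rho> (space \<rho>) = ennreal ?m" using False by (auto simp: emeasure_eq_measure)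
  have [measurable]: "g \<in> borel_measurable \<rho>" using assms by (simp add: measurable_cong_sets[OF sets_cell refl])
  have "cell_law \<rho> = density \<rho> (\<lambda>z. ennreal (1 / ?m))"
  proof -
    have "0 < ?m" using m(1) measure_nonneg[of \<rho> "space \<rho>"] by linarith
    then have "1 / ennreal ?m = ennreal (1 / ?m)" using divide_ennreal[of 1 ?m] by simp
    then show ?thesis
      unfolding cell_law_def uniform_measure_def using False m(2)
      by (auto intro!: density_cong AE_I2)
  qed
  then have "(CLINT z|cell_law \<rho>. g z) = (CLINT z|\<rho>. (1 / ?m) *\<^sub>R g z)"
    by (simp only:) (subst integral_density, auto)
  also have "\<dots> = complex_of_real (1 / ?m) * (CLINT z|\<rho>. g z)"
    by (simp only: scaleR_conv_of_real Bochner_Integration.integral_mult_right_zero)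
  finally show ?thesis using m by simp
qed

end

context prob_space
begin

text \<open>The compound Poisson formula. On the event that the count is \<open>n\<close>,
  independence gives the Poisson weight times the \<open>n\<close>-th power of the transform
  \<open>ch\<close> of one point, and the exponential series sums to
  \<open>exp (l * ch - l)\<close>.\<close>

lemma poisson_cell_char:
  fixes V :: "nat \<Rightarrow> 'a \<Rightarrow> real \<times> real" and g :: "real \<times> real \<Rightarrow> real"
  assumes ind: "indep_vars (\<lambda>_. borel) V UNIV"
    and cell: "finite_cell \<rho>"
    and count: "distr M borel (V 0) = count_law (measure \<rho> (space \<rho>))"
    and pts: "\<And>k. distr M borel (V (Suc k)) = cell_law \<rho>"
    and g[measurable]: "g \<in> borel_measurable borel"
  shows "(CLINT \<omega>|M. iexp (\<Sum>k<nat \<lfloor>fst (V 0 \<omega>)\<rfloor>. g (V (Suc k) \<omega>))) = exp (CLINT z|\<rho>. iexp (g z) - 1)"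
proof -
  interpret C: finite_cell \<rho> by (rule cell)
  define l where "l = measure \<rho> (space \<rho>)"
  have l: "0 \<le> l" by (simp add: l_def)
  define N where "N \<omega> = nat \<lfloor>fst (V 0 \<omega>)\<rfloor>" for \<omega>
  define ch where "ch = (CLINT z|cell_law \<rho>. iexp (g z))"
  have V[measurable]: "V i \<in> borel_measurable M" for i using ind by (auto simp: indep_vars_def)
  have fm[measurable]: "fst \<in> borel_measurable (borel :: (real \<times> real) measure)"
    by (intro borel_measurable_continuous_onI continuous_intros)
  have nm[measurable]: "(\<lambda>z::real \<times> real. nat \<lfloor>fst z\<rfloor>) \<in> measurable borel (count_space UNIV)" by measurable
  have Nm[measurable]: "N \<in> measurable M (count_space UNIV)"
    unfolding N_def using measurable_compose[OF V[of 0] nm] by simp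
  define U where "U n \<omega> = indicator {n} (N \<omega>) * (\<Prod>k<n. iexp (g (V (Suc k) \<omega>)))" for n \<omega>
  have gV: "(\<lambda>\<omega>. g (V k \<omega>)) \<in> borel_measurable M" for k
    by (rule measurable_compose[OF V g])
  have eg: "(\<lambda>z. iexp (g z)) \<in> borel_measurable borel" by measurable
  have eV: "(\<lambda>\<omega>. iexp (g (V k \<omega>))) \<in> borel_measurable M" for k
    by (rule measurable_compose[OF V eg])
  have "(\<lambda>\<omega>. indicator {n} (N \<omega>) :: complex) \<in> borel_measurable M" for n
    by (rule measurable_compose[OF Nm]) simp
  then have U_meas[measurable]: "U n \<in> borel_measurable M" for n
    unfolding U_def by (intro borel_measurable_times borel_measurable_prod eV)
  have EU: "(CLINT \<omega>|M. U n \<omega>) = complex_of_real (l ^ n / fact n * exp (- l)) * ch ^ n" for n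
  proof -
    \<comment> \<open>The event for the count and the factors of the points become one product over
      \<open>{..n}\<close>, with index 0 for the count, so that independence is invoked only
      once.\<close>
    define Y where "Y i z = (if i = 0 then indicator {n} (nat \<lfloor>fst z\<rfloor>) else iexp (g z))" for i :: nat and z
    have Ym[measurable]: "Y i \<in> borel_measurable borel" for i unfolding Y_def by (cases "i = 0") simp_all
    have "U n \<omega> = (\<Prod>i\<in>{..n}. Y i (V i \<omega>))" for \<omega>
    proof -
      have "(\<Prod>i\<in>{..n}. Y i (V i \<omega>)) = (\<Prod>i<Suc n. Y i (V i \<omega>))" by (simp add: lessThan_Suc_atMost)
      also have "\<dots> = Y 0 (V 0 \<omega>) * (\<Prod>i<n. Y (Suc i) (V (Suc i) \<omega>))" by (rule prod.lessThan_Suc_shift)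
      also have "\<dots> = U n \<omega>" by (simp add: Y_def U_def N_def)
      finally show ?thesis by simp
    qed
    then have "(CLINT \<omega>|M. U n \<omega>) = (CLINT \<omega>|M. (\<Prod>i\<in>{..n}. Y i (V i \<omega>)))" by simp
    also have "\<dots> = (\<Prod>i\<in>{..n}. CLINT \<omega>|M. Y i (V i \<omega>))"
    proof (rule indep_vars_lebesgue_integral)
      show "indep_vars (\<lambda>_. borel) (\<lambda>i \<omega>. Y i (V i \<omega>)) {..n}"
        by (rule indep_vars_compose2[OF indep_vars_subset[OF ind]]) auto
      show "integrable M (\<lambda>\<omega>. Y i (V i \<omega>))" for i
      proof (rule integrable_bounded_complex[where C=1])
        show "(\<lambda>\<omega>. Y i (V i \<omega>)) \<in> borel_measurable M" by (rule measurable_compose[OF V Ym])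
      qed (auto simp: Y_def indicator_def)
    qed simp
    also have "\<dots> = (\<Prod>i<Suc n. CLINT \<omega>|M. Y i (V i \<omega>))" by (simp add: lessThan_Suc_atMost)
    also have "\<dots> = (CLINT \<omega>|M. Y 0 (V 0 \<omega>)) * (\<Prod>i<n. CLINT \<omega>|M. Y (Suc i) (V (Suc i) \<omega>))" by (rule prod.lessThan_Suc_shift)
    also have "\<dots> = (CLINT \<omega>|M. Y 0 (V 0 \<omega>)) * (\<Prod>i<n. ch)"
    proof (intro arg_cong2[where f="(*)"] prod.cong refl)
      fix i
      have "(CLINT \<omega>|M. Y (Suc i) (V (Suc i) \<omega>)) = (CLINT z|distr M borel (V (Suc i)). Y (Suc i) z)"
        by (rule integral_distr[symmetric]) measurable
      then show "(CLINT \<omega>|M. Y (Suc i) (V (Suc i) \<omega>)) = ch" unfolding pts ch_def by (simp add: Y_def)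
    qed
    also have "(CLINT \<omega>|M. Y 0 (V 0 \<omega>)) = complex_of_real (l ^ n / fact n * exp (- l))"
    proof -
      have "(CLINT \<omega>|M. Y 0 (V 0 \<omega>)) = (CLINT z|distr M borel (V 0). Y 0 z)"
        by (rule integral_distr[symmetric]) measurable
      also have "\<dots> = (CLINT k|measure_pmf (poisson0_pmf l). Y 0 (real k, 0))"
        unfolding count l_def[symmetric] count_law_def
        by (rule integral_distr) auto
      also have "\<dots> = (CLINT k|measure_pmf (poisson0_pmf l). complex_of_real (indicator {n} k))"
        by (intro Bochner_Integration.integral_cong refl) (simp add: Y_def split: split_indicator)
      also have "\<dots> = complex_of_real (pmf (poisson0_pmf l) n)"
        unfolding integral_complex_of_real by (simp add: measure_pmf_single)
      finally show ?thesis by (simp only: pmf_poisson0[OF l])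
    qed
    finally show ?thesis by simp
  qed
  have U_sum: "(\<Sum>n<m. U n \<omega>) = (if N \<omega> < m then iexp (\<Sum>k<N \<omega>. g (V (Suc k) \<omega>)) else 0)" for m \<omega>
  proof -
    have "(\<Sum>n<m. U n \<omega>) = (\<Sum>n<m. if n = N \<omega> then iexp (\<Sum>k<N \<omega>. g (V (Suc k) \<omega>)) else 0)"
      by (intro sum.cong refl) (auto simp: U_def indicator_def exp_sum sum_distrib_left of_real_sum)
    then show ?thesis by (simp add: sum.delta)
  qed
  have "(\<lambda>m. CLINT \<omega>|M. (\<Sum>n<m. U n \<omega>)) \<longlonglongrightarrow> (CLINT \<omega>|M. iexp (\<Sum>k<N \<omega>. g (V (Suc k) \<omega>)))"
  proof (rule integral_dominated_convergence[where w="\<lambda>_. 1"])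
    show "AE \<omega> in M. (\<lambda>m. \<Sum>n<m. U n \<omega>) \<longlonglongrightarrow> iexp (\<Sum>k<N \<omega>. g (V (Suc k) \<omega>))"
    proof (rule AE_I2, rule tendsto_eventually)
      fix \<omega> show "\<forall>\<^sub>F m in sequentially. (\<Sum>n<m. U n \<omega>) = iexp (\<Sum>k<N \<omega>. g (V (Suc k) \<omega>))"
        using eventually_gt_at_top[of "N \<omega>"] by eventually_elim (simp add: U_sum)
    qed
    show "AE \<omega> in M. norm (\<Sum>n<m. U n \<omega>) \<le> 1" for m by (auto simp: U_sum)
    show "(\<lambda>\<omega>. iexp (\<Sum>k<N \<omega>. g (V (Suc k) \<omega>))) \<in> borel_measurable M"
      by (rule measurable_compose_countable[OF _ Nm, where f="\<lambda>n \<omega>. iexp (\<Sum>k<n. g (V (Suc k) \<omega>))"]) measurable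
  qed auto
  moreover have "(CLINT \<omega>|M. (\<Sum>n<m. U n \<omega>)) = (\<Sum>n<m. (complex_of_real l * ch) ^ n /\<^sub>R fact n) * complex_of_real (exp (- l))" for m
  proof -
    have "(CLINT \<omega>|M. (\<Sum>n<m. U n \<omega>)) = (\<Sum>n<m. CLINT \<omega>|M. U n \<omega>)"
    proof (rule Bochner_Integration.integral_sum)
      show "integrable M (U n)" for n
        by (rule integrable_bounded_complex[where C=1])
           (auto simp: U_def norm_mult indicator_def prod_norm[symmetric])
    qed
    also have "\<dots> = (\<Sum>n<m. ((complex_of_real l * ch) ^ n /\<^sub>R fact n) * complex_of_real (exp (- l)))"
      by (intro sum.cong refl) (simp add: EU power_mult_distrib scaleR_conv_of_real field_simps)
    finally show ?thesis by (simp only: sum_distrib_right)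
  qed
  moreover have "(\<lambda>m. (\<Sum>n<m. (complex_of_real l * ch) ^ n /\<^sub>R fact n) * complex_of_real (exp (- l))) \<longlonglongrightarrow> exp (complex_of_real l * ch) * complex_of_real (exp (- l))"
    using exp_converges[of "complex_of_real l * ch"] unfolding sums_def by (intro tendsto_intros)
  ultimately have "(CLINT \<omega>|M. iexp (\<Sum>k<N \<omega>. g (V (Suc k) \<omega>))) = exp (complex_of_real l * ch) * complex_of_real (exp (- l))"
    using LIMSEQ_unique by (simp only:)
  also have "\<dots> = exp (complex_of_real l * ch - l)"
    by (simp add: exp_diff exp_minus divide_inverse exp_of_real)
  also have "complex_of_real l * ch - l = (CLINT z|\<rho>. iexp (g z) - 1)"
  proof -
    have "integrable \<rho> (\<lambda>z. iexp (g z))"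
      by (rule C.integrable_const_bound[where B=1]) (auto simp: measurable_cong_sets[OF C.sets_cell refl])
    then have "(CLINT z|\<rho>. iexp (g z) - 1) = (CLINT z|\<rho>. iexp (g z)) - l"
      by (simp add: l_def scaleR_conv_of_real)
    also have "(CLINT z|\<rho>. iexp (g z)) = complex_of_real l * ch"
      unfolding l_def ch_def by (rule C.integral_cell_law[symmetric]) measurable
    finally show ?thesis by simp
  qed
  finally show ?thesis by (simp add: N_def)
qed

end

text \<open>Independence of disjoint blocks, applied to the singleton blocks
  \<open>{f j}\<close>.\<close>

lemma (in prob_space) indep_vars_reindex_inj:
  assumes ind: "indep_vars M' X I" and f: "inj_on f J" "f ` J \<subseteq> I"
  shows "indep_vars (\<lambda>j. M' (f j)) (\<lambda>j. X (f j)) J"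
proof -
  have "indep_vars (\<lambda>j. PiM {f j} M') (\<lambda>j \<omega>. restrict (\<lambda>i. X i \<omega>) {f j}) J"
    by (rule indep_vars_restrict[OF ind]) (use f in \<open>auto simp: disjoint_family_on_def inj_on_def\<close>)
  then have "indep_vars (\<lambda>j. M' (f j)) (\<lambda>j \<omega>. (\<lambda>x. x (f j)) (restrict (\<lambda>i. X i \<omega>) {f j})) J"
    by (rule indep_vars_compose2) (auto intro: measurable_component_singleton)
  then show ?thesis by simp
qed

text \<open>Restricting by a density and not to a subspace keeps \<open>UNIV\<close> as the
  underlying space, so all cells are measures on the whole plane.\<close>

definition time_cell :: "nat \<Rightarrow> real measure" where
  "time_cell j = density lborel (indicator {real j<..real j + 1})"

locale jump_cells =
  fixes \<nu> :: "real measure" and E :: "nat \<Rightarrow> real set"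
  assumes sets_nu: "sets \<nu> = sets borel" and E_sets: "\<And>i. E i \<in> sets borel" and E_fin: "\<And>i. emeasure \<nu> (E i) < \<infinity>"
begin

definition size_cell :: "nat \<Rightarrow> real measure" where
  "size_cell i = density \<nu> (indicator (E i))"

definition cell :: "nat \<times> nat \<Rightarrow> (real \<times> real) measure" where
  "cell c = time_cell (snd c) \<Otimes>\<^sub>M size_cell (fst c)"

lemma sets_cells [measurable_cong]: "sets (time_cell j) = sets borel" "sets (size_cell i) = sets borel"
  by (auto simp: time_cell_def size_cell_def sets_nu)

lemma time_cell_fin: "finite_measure (time_cell j)"
  by (rule finite_measureI) (simp add: time_cell_def emeasure_density)

lemma size_cell_fin: "finite_measure (size_cell i)"
proof (rule finite_measureI)
  have [measurable]: "E i \<in> sets \<nu>" using E_sets sets_nu by simp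
  have U: "UNIV \<in> sets \<nu>" using sets_nu by simp
  have sp: "space (size_cell i) = UNIV" using sets_eq_imp_space_eq[OF sets_nu] by (simp add: size_cell_def)
  have "emeasure (size_cell i) (space (size_cell i)) = (\<integral>\<^sup>+ z. indicator (E i) z * indicator UNIV z \<partial>\<nu>)"
    unfolding sp unfolding size_cell_def by (rule emeasure_density[OF _ U]) measurable
  also have "\<dots> = emeasure \<nu> (E i)" by simp
  finally show "emeasure (size_cell i) (space (size_cell i)) \<noteq> \<infinity>" using E_fin[of i] by simp
qed

lemma finite_cell: "finite_cell (cell c)"
proof
  interpret A: finite_measure "time_cell (snd c)" by (rule time_cell_fin)
  interpret B: finite_measure "size_cell (fst c)" by (rule size_cell_fin)
  show "sets (cell c) = sets borel"
    unfolding cell_def borel_prod[symmetric] by (intro sets_pair_measure_cong sets_cells)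
  have "emeasure (cell c) (space (time_cell (snd c)) \<times> space (size_cell (fst c))) =
    emeasure (time_cell (snd c)) (space (time_cell (snd c))) * emeasure (size_cell (fst c)) (space (size_cell (fst c)))"
    unfolding cell_def by (rule B.emeasure_pair_measure_Times) auto
  then show "emeasure (cell c) (space (cell c)) \<noteq> \<infinity>"
    by (simp add: cell_def space_pair_measure ennreal_mult_eq_top_iff)
qed

end

text \<open>The annulus \<open>i\<close> and the time interval \<open>(j, j + 1]\<close> form the cell \<open>(i, j)\<close>; its points are \<open>W (i, j) (Suc k)\<close>
  for \<open>k\<close> below the Poisson count encoded in \<open>W (i, j) 0\<close>.\<close>

locale poisson_field = prob_space M + jump_cells \<nu> E
  for M :: "'a measure" and \<nu> :: "real measure" and E :: "nat \<Rightarrow> real set" +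
  fixes W :: "nat \<times> nat \<Rightarrow> nat \<Rightarrow> 'a \<Rightarrow> real \<times> real"
  assumes W_indep: "indep_vars (\<lambda>_. borel) (\<lambda>p. W (fst p) (snd p)) UNIV"
    and W_count: "\<And>c. distr M borel (W c 0) = count_law (measure (cell c) (space (cell c)))"
    and W_point: "\<And>c k. distr M borel (W c (Suc k)) = cell_law (cell c)"
begin

definition count :: "nat \<times> nat \<Rightarrow> 'a \<Rightarrow> nat" where
  "count c \<omega> = nat \<lfloor>fst (W c 0 \<omega>)\<rfloor>"

lemma W_measurable: "W c k \<in> borel_measurable M"
proof -
  have "random_variable borel (W (fst (c, k)) (snd (c, k)))"
    using W_indep unfolding indep_vars_def by blast
  then show ?thesis by simp
qed

lemma count_measurable [measurable]: "count c \<in> measurable M (count_space UNIV)"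
proof -
  have [measurable]: "fst \<in> borel_measurable (borel :: (real \<times> real) measure)"
    by (intro borel_measurable_continuous_onI continuous_intros)
  have "(\<lambda>z::real \<times> real. nat \<lfloor>fst z\<rfloor>) \<in> measurable borel (count_space UNIV)" by measurable
  from measurable_compose[OF W_measurable[of c 0] this] show ?thesis by (simp add: count_def[abs_def])
qed

text \<open>The summand \<open>h\<close> sees the time index \<open>snd c\<close> of the cell,
  because the jump process below cuts off at the left end of the cell.\<close>

definition cell_sum :: "(nat \<Rightarrow> real \<times> real \<Rightarrow> real) \<Rightarrow> (nat \<times> nat) set \<Rightarrow> 'a \<Rightarrow> real" where
  "cell_sum h Cs \<omega> = (\<Sum>c\<in>Cs. \<Sum>k<count c \<omega>. h (snd c) (W c (Suc k) \<omega>))"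

lemma cell_sum_measurable [measurable]:
  assumes h: "\<And>j. h j \<in> borel_measurable borel"
  shows "cell_sum h Cs \<in> borel_measurable M"
proof -
  have "(\<lambda>\<omega>. \<Sum>k<count c \<omega>. h (snd c) (W c (Suc k) \<omega>)) \<in> borel_measurable M" for c
  proof (rule measurable_compose_countable[OF _ count_measurable, where f="\<lambda>n \<omega>. \<Sum>k<n. h (snd c) (W c (Suc k) \<omega>)"])
    show "(\<lambda>\<omega>. \<Sum>k<n. h (snd c) (W c (Suc k) \<omega>)) \<in> borel_measurable M" for n
      by (intro borel_measurable_sum measurable_compose[OF W_measurable h])
  qed
  then show ?thesis unfolding cell_sum_def[abs_def] by (intro borel_measurable_sum)
qed

text \<open>The variables of different cells form disjoint blocks \<open>K c\<close> of the family
  \<open>W\<close>. Hence the contributions of the cells are independent, and each is evaluated by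
  \<open>poisson_cell_char\<close>.\<close>

lemma cell_sum_char:
  assumes h: "\<And>j. h j \<in> borel_measurable borel" and Cs: "finite Cs"
  shows "(CLINT \<omega>|M. iexp (cell_sum h Cs \<omega>)) = (\<Prod>c\<in>Cs. exp (CLINT z|cell c. iexp (h (snd c) z) - 1))"
proof -
  define Y where "Y c x = iexp (\<Sum>k<nat \<lfloor>fst (x (c, 0))\<rfloor>. h (snd c) (x (c, Suc k)))"
    for c :: "nat \<times> nat" and x :: "(nat \<times> nat) \<times> nat \<Rightarrow> real \<times> real"
  define K where "K c = {c} \<times> (UNIV :: nat set)" for c :: "nat \<times> nat"
  have [measurable]: "fst \<in> borel_measurable (borel :: (real \<times> real) measure)"
    by (intro borel_measurable_continuous_onI continuous_intros)
  have nm: "(\<lambda>z::real \<times> real. nat \<lfloor>fst z\<rfloor>) \<in> measurable borel (count_space UNIV)" by measurable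
  have Ym: "Y c \<in> borel_measurable (PiM (K c) (\<lambda>_. borel))" for c
  proof -
    have x: "(\<lambda>x. x (c, k)) \<in> borel_measurable (PiM (K c) (\<lambda>_. borel))" for k
      by (rule measurable_component_singleton) (simp add: K_def)
    have n: "(\<lambda>x :: (nat \<times> nat) \<times> nat \<Rightarrow> real \<times> real. nat \<lfloor>fst (x (c, 0))\<rfloor>) \<in> measurable (PiM (K c) (\<lambda>_. borel)) (count_space UNIV)"
      using measurable_compose[OF x[of 0] nm] by simp
    have "(\<lambda>x. \<Sum>k<nat \<lfloor>fst (x (c, 0))\<rfloor>. h (snd c) (x (c, Suc k))) \<in> borel_measurable (PiM (K c) (\<lambda>_. borel))"
    proof (rule measurable_compose_countable[OF _ n, where f="\<lambda>n x. \<Sum>k<n. h (snd c) (x (c, Suc k))"])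
      show "(\<lambda>x. \<Sum>k<n. h (snd c) (x (c, Suc k))) \<in> borel_measurable (PiM (K c) (\<lambda>_. borel))" for n
        by (intro borel_measurable_sum measurable_compose[OF x h])
    qed
    then show ?thesis unfolding Y_def by measurable
  qed
  have "indep_vars (\<lambda>c. PiM (K c) (\<lambda>_. borel)) (\<lambda>c \<omega>. restrict (\<lambda>p. W (fst p) (snd p) \<omega>) (K c)) Cs"
    by (rule indep_vars_restrict[OF W_indep]) (auto simp: K_def disjoint_family_on_def)
  then have ind: "indep_vars (\<lambda>_. borel) (\<lambda>c \<omega>. Y c (restrict (\<lambda>p. W (fst p) (snd p) \<omega>) (K c))) Cs"
    by (rule indep_vars_compose2) (rule Ym)
  have Yeq: "Y c (restrict (\<lambda>p. W (fst p) (snd p) \<omega>) (K c)) = iexp (\<Sum>k<nat \<lfloor>fst (W c 0 \<omega>)\<rfloor>. h (snd c) (W c (Suc k) \<omega>))" for c \<omega>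
    by (simp add: Y_def K_def)
  have "(CLINT \<omega>|M. iexp (cell_sum h Cs \<omega>)) = (CLINT \<omega>|M. (\<Prod>c\<in>Cs. Y c (restrict (\<lambda>p. W (fst p) (snd p) \<omega>) (K c))))"
    unfolding Yeq by (intro Bochner_Integration.integral_cong refl)
      (simp add: cell_sum_def count_def exp_sum[OF Cs, symmetric] sum_distrib_left of_real_sum)
  also have "\<dots> = (\<Prod>c\<in>Cs. CLINT \<omega>|M. Y c (restrict (\<lambda>p. W (fst p) (snd p) \<omega>) (K c)))"
  proof (rule indep_vars_lebesgue_integral[OF Cs ind])
    fix c assume "c \<in> Cs"
    then have "random_variable borel (\<lambda>\<omega>. Y c (restrict (\<lambda>p. W (fst p) (snd p) \<omega>) (K c)))"
      using ind unfolding indep_vars_def by blast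
    then show "integrable M (\<lambda>\<omega>. Y c (restrict (\<lambda>p. W (fst p) (snd p) \<omega>) (K c)))"
      by (rule integrable_bounded_complex[where C=1]) (simp add: Y_def)
  qed
  also have "\<dots> = (\<Prod>c\<in>Cs. exp (CLINT z|cell c. iexp (h (snd c) z) - 1))"
  proof (rule prod.cong[OF refl])
    fix c
    have "indep_vars (\<lambda>_. borel) (\<lambda>k. (\<lambda>p. W (fst p) (snd p)) (c, k)) UNIV"
      using indep_vars_reindex_inj[OF W_indep, of "\<lambda>k. (c, k)" UNIV] by (simp add: inj_on_def)
    then have "indep_vars (\<lambda>_. borel) (W c) UNIV" by simp
    then show "(CLINT \<omega>|M. Y c (restrict (\<lambda>p. W (fst p) (snd p) \<omega>) (K c))) = exp (CLINT z|cell c. iexp (h (snd c) z) - 1)"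
      unfolding Yeq
      by (rule poisson_cell_char[OF _ finite_cell])
         (simp_all add: W_count W_point h)
  qed
  finally show ?thesis .
qed

definition jump_exponent :: "nat \<Rightarrow> real \<Rightarrow> complex" where
  "jump_exponent i \<xi> = (CLINT z|size_cell i. iexp (\<xi> * z) - 1)"

text \<open>Outside the time window the integrand is 0, inside it depends on the jump size alone.
  The integral over the product measure thus factorizes into the length of the overlap of window and
  time cell, and the jump exponent.\<close>

lemma cell_integral_window:
  assumes st: "0 \<le> s" "s \<le> t"
  shows "(CLINT z|cell (i, j). iexp (\<xi> * (snd z * indicator {max (real j) s<..t} (fst z))) - 1) =
    complex_of_real (max 0 (min (real j + 1) t - max (real j) s)) * jump_exponent i \<xi>"
proof -
  interpret A: finite_measure "time_cell j" by (rule time_cell_fin)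
  interpret B: finite_measure "size_cell i" by (rule size_cell_fin)
  interpret Q: pair_sigma_finite "time_cell j" "size_cell i" ..
  interpret C: finite_cell "cell (i, j)" by (rule finite_cell)
  let ?f = "\<lambda>z. iexp (\<xi> * (snd z * indicator {max (real j) s<..t} (fst z))) - 1"
  have int: "integrable (time_cell j \<Otimes>\<^sub>M size_cell i) ?f"
  proof -
    have "?f \<in> borel_measurable (time_cell j \<Otimes>\<^sub>M size_cell i)" by measurable
    moreover have "cmod (?f z) \<le> 2" for z
      using norm_triangle_ineq4[of "iexp (\<xi> * (snd z * indicator {max (real j) s<..t} (fst z)))" 1] by simp
    ultimately show ?thesis
      using C.integrable_const_bound[of ?f 2] by (simp add: cell_def)
  qed
  have "(CLINT z|cell (i, j). ?f z) = (CLINT \<tau>|time_cell j. (CLINT z|size_cell i. ?f (\<tau>, z)))"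
    unfolding cell_def fst_conv snd_conv using Q.integral_fst'[OF int] by (simp only: fst_conv snd_conv)
  also have "\<dots> = (CLINT \<tau>|time_cell j. complex_of_real (indicator {max (real j) s<..t} \<tau>) * jump_exponent i \<xi>)"
    unfolding jump_exponent_def by (intro Bochner_Integration.integral_cong refl) (simp split: split_indicator)
  also have "\<dots> = (CLINT \<tau>|time_cell j. complex_of_real (indicator {max (real j) s<..t} \<tau>)) * jump_exponent i \<xi>"
    by (rule Bochner_Integration.integral_mult_left_zero)
  also have "(CLINT \<tau>|time_cell j. complex_of_real (indicator {max (real j) s<..t} \<tau>)) =
    complex_of_real (max 0 (min (real j + 1) t - max (real j) s))"
  proof -
    have "(LINT \<tau>|time_cell j. indicator {max (real j) s<..t} \<tau>) = measure (time_cell j) {max (real j) s<..t}"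
      by (simp add: sets_eq_imp_space_eq[OF sets_cells(1)])
    also have "\<dots> = max 0 (min (real j + 1) t - max (real j) s)"
    proof -
      have "emeasure (time_cell j) {max (real j) s<..t} = (\<integral>\<^sup>+ \<tau>. indicator {real j<..real j + 1} \<tau> * indicator {max (real j) s<..t} \<tau> \<partial>lborel)"
        unfolding time_cell_def by (rule emeasure_density) auto
      also have "\<dots> = (\<integral>\<^sup>+ \<tau>. indicator {max (real j) s<..min (real j + 1) t} \<tau> \<partial>lborel)"
        by (intro nn_integral_cong) (auto simp: indicator_def)
      also have "\<dots> = emeasure lborel {max (real j) s<..min (real j + 1) t}" by simp
      also have "\<dots> = ennreal (max 0 (min (real j + 1) t - max (real j) s))"
      proof (cases "max (real j) s \<le> min (real j + 1) t")
        case True then show ?thesis by (subst emeasure_lborel_Ioc) (auto simp: max_absorb2)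
      next
        case False
        then have "{max (real j) s<..min (real j + 1) t} = {}" "max 0 (min (real j + 1) t - max (real j) s) = 0" by auto
        then show ?thesis by simp
      qed
      finally show ?thesis unfolding measure_def by (simp only: enn2real_ennreal max.cobounded1)
    qed
    finally show ?thesis unfolding integral_complex_of_real by simp
  qed
  finally show ?thesis .
qed

lemma window_sum:
  assumes "0 \<le> s" "s \<le> t"
  shows "(\<Sum>j<m. max 0 (min (real j + 1) t - max (real j) s)) = max 0 (min (real m) t - s)"
proof (induction m)
  case (Suc m)
  then show ?case using assms by (auto simp: max_def min_def)
qed (use assms in auto)

text \<open>A point lies in the time interval of its cell only almost surely. Writing the cutoff at
  \<open>real j\<close> into the summand makes the cells with \<open>t \<le> real j\<close>
  contribute 0 for every sample point, so the range of summation can be enlarged at will.\<close>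

definition jump_process :: "nat \<Rightarrow> real \<Rightarrow> 'a \<Rightarrow> real" where
  "jump_process i t \<omega> = cell_sum (\<lambda>j z. snd z * indicator {real j<..t} (fst z)) ({i} \<times> {..<nat \<lceil>t\<rceil>}) \<omega>"

lemma jump_fun_measurable [measurable]:
  "(\<lambda>z::real \<times> real. snd z * indicator {a<..b} (fst z)) \<in> borel_measurable borel"
  unfolding borel_prod[symmetric] by measurable

lemma jump_process_measurable [measurable]: "jump_process i t \<in> borel_measurable M"
  unfolding jump_process_def[abs_def] by (rule cell_sum_measurable) measurable

lemma jump_process_extend:
  assumes "t \<le> real m"
  shows "jump_process i t \<omega> = cell_sum (\<lambda>j z. snd z * indicator {real j<..t} (fst z)) ({i} \<times> {..<m}) \<omega>"
  unfolding jump_process_def cell_sum_def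
proof (rule sum.mono_neutral_left)
  show "{i} \<times> {..<nat \<lceil>t\<rceil>} \<subseteq> {i} \<times> {..<m}" using assms by (auto simp: nat_ceiling_le_eq intro: less_le_trans)
  show "\<forall>c\<in>{i} \<times> {..<m} - {i} \<times> {..<nat \<lceil>t\<rceil>}. (\<Sum>k<count c \<omega>. snd (W c (Suc k) \<omega>) * indicator {real (snd c)<..t} (fst (W c (Suc k) \<omega>))) = 0"
  proof (intro ballI sum.neutral)
    fix c k assume "c \<in> {i} \<times> {..<m} - {i} \<times> {..<nat \<lceil>t\<rceil>}"
    then have "\<not> snd c < nat \<lceil>t\<rceil>" by (cases c) auto
    then have "t \<le> real (snd c)" by linarith
    then show "snd (W c (Suc k) \<omega>) * indicator {real (snd c)<..t} (fst (W c (Suc k) \<omega>)) = 0" by auto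
  qed
qed simp

lemma jump_process_nonpos: "t \<le> 0 \<Longrightarrow> jump_process i t \<omega> = 0"
  using jump_process_extend[of t 0 i \<omega>] by (simp add: cell_sum_def)

lemma jump_process_sum:
  assumes "finite I" "t \<le> real m"
  shows "(\<Sum>i\<in>I. jump_process i t \<omega>) = cell_sum (\<lambda>j z. snd z * indicator {real j<..t} (fst z)) (I \<times> {..<m}) \<omega>"
proof -
  have "cell_sum h ({i} \<times> {..<m}) \<omega> = (\<Sum>j<m. \<Sum>k<count (i, j) \<omega>. h j (W (i, j) (Suc k) \<omega>))" for h i
    unfolding cell_sum_def
    by (rule sum.reindex_cong[of "\<lambda>j. (i, j)"]) (auto simp only: inj_on_def fst_conv snd_conv prod.inject)
  moreover have "cell_sum h (I \<times> {..<m}) \<omega> = (\<Sum>i\<in>I. \<Sum>j<m. \<Sum>k<count (i, j) \<omega>. h j (W (i, j) (Suc k) \<omega>))" for h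
    unfolding cell_sum_def sum.cartesian_product by (intro sum.cong refl) (simp add: split_def)
  ultimately show ?thesis unfolding jump_process_extend[OF assms(2)] by simp
qed

text \<open>A point with time at most \<open>s\<close> affects past values only, a later one the
  increment only. So \<open>g1\<close> and \<open>g2\<close> are never nonzero together,
  \<open>iexp (g1 + g2) - 1\<close> is the sum of the two separate terms, and the compound Poisson
  formula factorizes. The window lengths over all time cells add up to \<open>t - s\<close>.\<close>

lemma jump_increments:
  assumes I: "finite I"
  shows "indep_increments (\<lambda>t \<omega>. \<Sum>i\<in>I. jump_process i t \<omega>) (\<lambda>\<xi>. \<Sum>i\<in>I. jump_exponent i \<xi>)"
  unfolding indep_increments_def
proof (intro allI impI)
  fix s t \<xi> :: real and L :: "real set" and \<theta> :: "real \<Rightarrow> real"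
  assume st: "0 \<le> s" "s \<le> t" and L: "finite L" "L \<subseteq> {0..s}"
  define m where "m = nat \<lceil>t\<rceil>"
  have m: "r \<le> real m" if "r \<le> t" for r using that unfolding m_def by linarith
  define Cs where "Cs = I \<times> {..<m}"
  have Cs: "finite Cs" using I by (simp add: Cs_def)
  define g1 where "g1 j z = snd z * (\<Sum>r\<in>L. \<theta> r * indicator {real j<..r} (fst z))" for j :: nat and z :: "real \<times> real"
  define g2 where "g2 j z = \<xi> * (snd z * indicator {max (real j) s<..t} (fst z))" for j :: nat and z :: "real \<times> real"
  have g1m: "g1 j \<in> borel_measurable borel" and g2m: "g2 j \<in> borel_measurable borel" for j
    unfolding g1_def g2_def borel_prod[symmetric] by measurable
  have g1: "(\<Sum>r\<in>L. \<theta> r * (\<Sum>i\<in>I. jump_process i r \<omega>)) = cell_sum g1 Cs \<omega>" for \<omega>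
  proof -
    have "(\<Sum>r\<in>L. \<theta> r * (\<Sum>i\<in>I. jump_process i r \<omega>)) = (\<Sum>r\<in>L. \<theta> r * cell_sum (\<lambda>j z. snd z * indicator {real j<..r} (fst z)) Cs \<omega>)"
      unfolding Cs_def using L st by (intro sum.cong refl arg_cong2[where f="(*)"] jump_process_sum I m) auto
    also have "\<dots> = (\<Sum>r\<in>L. \<Sum>c\<in>Cs. \<Sum>k<count c \<omega>. \<theta> r * (snd (W c (Suc k) \<omega>) * indicator {real (snd c)<..r} (fst (W c (Suc k) \<omega>))))"
      by (simp only: cell_sum_def sum_distrib_left)
    also have "\<dots> = (\<Sum>c\<in>Cs. \<Sum>k<count c \<omega>. \<Sum>r\<in>L. \<theta> r * (snd (W c (Suc k) \<omega>) * indicator {real (snd c)<..r} (fst (W c (Suc k) \<omega>))))"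
      by (subst sum.swap, intro sum.cong refl, rule sum.swap)
    also have "\<dots> = cell_sum g1 Cs \<omega>"
      by (simp only: cell_sum_def g1_def sum_distrib_left mult.left_commute)
    finally show ?thesis .
  qed
  have g2: "\<xi> * ((\<Sum>i\<in>I. jump_process i t \<omega>) - (\<Sum>i\<in>I. jump_process i s \<omega>)) = cell_sum g2 Cs \<omega>" for \<omega>
  proof -
    have "\<xi> * ((\<Sum>i\<in>I. jump_process i t \<omega>) - (\<Sum>i\<in>I. jump_process i s \<omega>)) =
      \<xi> * (cell_sum (\<lambda>j z. snd z * indicator {real j<..t} (fst z)) Cs \<omega> - cell_sum (\<lambda>j z. snd z * indicator {real j<..s} (fst z)) Cs \<omega>)"
      unfolding Cs_def using st by (simp add: jump_process_sum[OF I m])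
    also have "\<dots> = (\<Sum>c\<in>Cs. \<Sum>k<count c \<omega>. \<xi> * (snd (W c (Suc k) \<omega>) * indicator {real (snd c)<..t} (fst (W c (Suc k) \<omega>)) -
       snd (W c (Suc k) \<omega>) * indicator {real (snd c)<..s} (fst (W c (Suc k) \<omega>))))"
      unfolding cell_sum_def sum_subtractf[symmetric] sum_distrib_left ..
    also have "\<dots> = cell_sum g2 Cs \<omega>"
      unfolding cell_sum_def g2_def using st by (intro sum.cong refl) (auto simp: indicator_def)
    finally show ?thesis .
  qed
  have g12: "cell_sum g1 Cs \<omega> + cell_sum g2 Cs \<omega> = cell_sum (\<lambda>j z. g1 j z + g2 j z) Cs \<omega>" for \<omega>
    by (simp add: cell_sum_def sum.distrib)
  have split: "iexp (g1 j z + g2 j z) - 1 = (iexp (g1 j z) - 1) + (iexp (g2 j z) - 1)" for j z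
  proof (cases "fst z \<le> s")
    case True then have "g2 j z = 0" by (simp add: g2_def)
    then show ?thesis by simp
  next
    case False
    then have "indicator {real j<..r} (fst z) = (0::real)" if "r \<in> L" for r using that L by auto
    then have "g1 j z = 0" by (simp add: g1_def)
    then show ?thesis by simp
  qed
  have int: "integrable (cell c) (\<lambda>z. iexp (g z) - 1)" if g: "g \<in> borel_measurable borel" for g :: "real \<times> real \<Rightarrow> real" and c
  proof -
    interpret C: finite_cell "cell c" by (rule finite_cell)
    have "(\<lambda>z. iexp (g z) - 1) \<in> borel_measurable borel" using g by measurable
    then have "(\<lambda>z. iexp (g z) - 1) \<in> borel_measurable (cell c)" by (simp add: measurable_cong_sets[OF C.sets_cell refl])
    moreover have "cmod (iexp (g z) - 1) \<le> 2" for z using norm_triangle_ineq4[of "iexp (g z)" 1] by simp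
    ultimately show ?thesis by (intro C.integrable_const_bound[where B=2]) auto
  qed
  have "(CLINT \<omega>|M. iexp (cell_sum g1 Cs \<omega>) * iexp (cell_sum g2 Cs \<omega>)) = (CLINT \<omega>|M. iexp (cell_sum (\<lambda>j z. g1 j z + g2 j z) Cs \<omega>))"
    unfolding g12[symmetric] by (simp add: distrib_left exp_add)
  also have "\<dots> = (\<Prod>c\<in>Cs. exp (CLINT z|cell c. iexp (g1 (snd c) z + g2 (snd c) z) - 1))"
    by (rule cell_sum_char[OF _ Cs]) (intro borel_measurable_add g1m g2m)
  also have "\<dots> = (\<Prod>c\<in>Cs. exp (CLINT z|cell c. iexp (g1 (snd c) z) - 1) * exp (CLINT z|cell c. iexp (g2 (snd c) z) - 1))"
    unfolding split by (intro prod.cong refl) (simp only: Bochner_Integration.integral_add[OF int[OF g1m] int[OF g2m]] exp_add)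
  also have "\<dots> = (CLINT \<omega>|M. iexp (cell_sum g1 Cs \<omega>)) * (\<Prod>c\<in>Cs. exp (CLINT z|cell c. iexp (g2 (snd c) z) - 1))"
    by (simp only: prod.distrib cell_sum_char[OF g1m Cs])
  also have "(\<Prod>c\<in>Cs. exp (CLINT z|cell c. iexp (g2 (snd c) z) - 1)) = exp (\<Sum>c\<in>Cs. CLINT z|cell c. iexp (g2 (snd c) z) - 1)"
    using Cs by (simp add: exp_sum)
  also have "(\<Sum>c\<in>Cs. CLINT z|cell c. iexp (g2 (snd c) z) - 1) = (\<Sum>i\<in>I. \<Sum>j<m. CLINT z|cell (i, j). iexp (g2 j z) - 1)"
    unfolding Cs_def by (simp add: sum.cartesian_product split_def)
  also have "\<dots> = (\<Sum>i\<in>I. \<Sum>j<m. complex_of_real (max 0 (min (real j + 1) t - max (real j) s)) * jump_exponent i \<xi>)"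
    unfolding g2_def by (intro sum.cong refl cell_integral_window st)
  also have "\<dots> = (\<Sum>i\<in>I. complex_of_real (\<Sum>j<m. max 0 (min (real j + 1) t - max (real j) s)) * jump_exponent i \<xi>)"
    by (simp only: sum_distrib_right of_real_sum)
  also have "\<dots> = complex_of_real (t - s) * (\<Sum>i\<in>I. jump_exponent i \<xi>)"
    unfolding window_sum[OF st] using m[of t] st by (simp add: sum_distrib_left min_absorb2 max_absorb2)
  finally show "(CLINT \<omega>|M. iexp (\<Sum>r\<in>L. \<theta> r * (\<Sum>i\<in>I. jump_process i r \<omega>)) * iexp (\<xi> * ((\<Sum>i\<in>I. jump_process i t \<omega>) - (\<Sum>i\<in>I. jump_process i s \<omega>)))) =
    (CLINT \<omega>|M. iexp (\<Sum>r\<in>L. \<theta> r * (\<Sum>i\<in>I. jump_process i r \<omega>))) * exp (complex_of_real (t - s) * (\<Sum>i\<in>I. jump_exponent i \<xi>))"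
    by (simp only: g1 g2)
qed

text \<open>Up to time \<open>t0 + 1\<close> only finitely many points matter, and each closed upper
  cutoff \<open>{real j<..t}\<close> is constant just after \<open>t0\<close>.\<close>

lemma jump_process_eventually_right: "\<forall>\<^sub>F t in at_right t0. jump_process i t \<omega> = jump_process i t0 \<omega>"
proof -
  define m where "m = nat \<lceil>t0 + 1\<rceil>"
  have m: "t0 + 1 \<le> real m" unfolding m_def by linarith
  have single: "\<forall>\<^sub>F t in at_right t0. snd z * indicator {real j<..t} (fst z) = snd z * indicator {real j<..t0} (fst z)" for z :: "real \<times> real" and j
  proof (cases "fst z \<le> t0")
    case True
    have "\<forall>\<^sub>F t in at_right t0. t0 < t" by (simp add: eventually_at_right_less)
    then show ?thesis by eventually_elim (use True in \<open>auto simp: indicator_def\<close>)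
  next
    case False
    then have "\<forall>\<^sub>F t in at_right t0. t < fst z" by (intro eventually_at_rightI[of t0 "fst z"]) auto
    then show ?thesis by eventually_elim (use False in \<open>auto simp: indicator_def\<close>)
  qed
  have "\<forall>\<^sub>F t in at_right t0. \<forall>c\<in>{i} \<times> {..<m}. \<forall>k\<in>{..<count c \<omega>}.
    snd (W c (Suc k) \<omega>) * indicator {real (snd c)<..t} (fst (W c (Suc k) \<omega>)) = snd (W c (Suc k) \<omega>) * indicator {real (snd c)<..t0} (fst (W c (Suc k) \<omega>))"
    by (intro eventually_ball_finite ballI single) auto
  moreover have "\<forall>\<^sub>F t in at_right t0. t < t0 + 1" by (intro eventually_at_rightI[of t0 "t0 + 1"]) auto
  ultimately show ?thesis
  proof eventually_elim
    case (elim t)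
    have "jump_process i t \<omega> = cell_sum (\<lambda>j z. snd z * indicator {real j<..t} (fst z)) ({i} \<times> {..<m}) \<omega>"
      using elim m by (intro jump_process_extend) auto
    also have "\<dots> = cell_sum (\<lambda>j z. snd z * indicator {real j<..t0} (fst z)) ({i} \<times> {..<m}) \<omega>"
      unfolding cell_sum_def by (intro sum.cong refl elim(1)[rule_format])
    also have "\<dots> = jump_process i t0 \<omega>" using m by (intro jump_process_extend[symmetric]) auto
    finally show ?case .
  qed
qed

lemma jump_process_eventually_left: "\<exists>l. \<forall>\<^sub>F t in at_left t0. jump_process i t \<omega> = l"
proof -
  define m where "m = nat \<lceil>t0\<rceil>"
  have m: "t0 \<le> real m" unfolding m_def by linarith
  let ?l = "\<lambda>j z. snd z * (if real j < fst z \<and> fst z < t0 then 1 else 0)"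
  have less: "\<forall>\<^sub>F t in at_left t0. t < t0" by (simp add: eventually_at_filter)
  have single: "\<forall>\<^sub>F t in at_left t0. snd z * indicator {real j<..t} (fst z) = ?l j z" for z :: "real \<times> real" and j
  proof (cases "fst z < t0")
    case True
    then have "\<forall>\<^sub>F t in at_left t0. fst z < t" by (intro eventually_at_leftI[of "fst z" t0]) auto
    then show ?thesis by eventually_elim (use True in \<open>auto simp: indicator_def\<close>)
  next
    case False
    from less show ?thesis by eventually_elim (use False in \<open>auto simp: indicator_def\<close>)
  qed
  have "\<forall>\<^sub>F t in at_left t0. \<forall>c\<in>{i} \<times> {..<m}. \<forall>k\<in>{..<count c \<omega>}.
    snd (W c (Suc k) \<omega>) * indicator {real (snd c)<..t} (fst (W c (Suc k) \<omega>)) = ?l (snd c) (W c (Suc k) \<omega>)"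
    by (intro eventually_ball_finite ballI single) auto
  with less have "\<forall>\<^sub>F t in at_left t0. jump_process i t \<omega> = cell_sum ?l ({i} \<times> {..<m}) \<omega>"
  proof eventually_elim
    case (elim t)
    have "jump_process i t \<omega> = cell_sum (\<lambda>j z. snd z * indicator {real j<..t} (fst z)) ({i} \<times> {..<m}) \<omega>"
      using elim m by (intro jump_process_extend) auto
    also have "\<dots> = cell_sum ?l ({i} \<times> {..<m}) \<omega>"
      unfolding cell_sum_def by (intro sum.cong refl elim(2)[rule_format])
    finally show ?case .
  qed
  then show ?thesis ..
qed

end

section \<open>Existence of the Levy process\<close>

context prob_space
begin

lemma indep_increments_drift:
  assumes "indep_increments Z \<kappa>"
  shows "indep_increments (\<lambda>t \<omega>. Z t \<omega> + b * max 0 t) (\<lambda>\<xi>. \<kappa> \<xi> + \<i> * complex_of_real (b * \<xi>))"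
  unfolding indep_increments_def
proof (intro allI impI)
  fix s t \<xi> :: real and L :: "real set" and \<theta> :: "real \<Rightarrow> real"
  assume st: "0 \<le> s" "s \<le> t" and L: "finite L" "L \<subseteq> {0..s}"
  define d where "d = (\<Sum>r\<in>L. \<theta> r * (b * max 0 r))"
  have 1: "iexp (\<Sum>r\<in>L. \<theta> r * (Z r \<omega> + b * max 0 r)) = iexp d * iexp (\<Sum>r\<in>L. \<theta> r * Z r \<omega>)" for \<omega>
    by (simp add: d_def distrib_left sum.distrib exp_add[symmetric] add.commute)
  have 2: "iexp (\<xi> * ((Z t \<omega> + b * max 0 t) - (Z s \<omega> + b * max 0 s))) =
    exp (complex_of_real (t - s) * (\<i> * complex_of_real (b * \<xi>))) * iexp (\<xi> * (Z t \<omega> - Z s \<omega>))" for \<omega>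
    using st by (simp add: max_absorb2 exp_add[symmetric] algebra_simps)
  have "(CLINT \<omega>|M. iexp (\<Sum>r\<in>L. \<theta> r * (Z r \<omega> + b * max 0 r)) *
      iexp (\<xi> * ((Z t \<omega> + b * max 0 t) - (Z s \<omega> + b * max 0 s)))) =
    (CLINT \<omega>|M. (iexp d * exp (complex_of_real (t - s) * (\<i> * complex_of_real (b * \<xi>)))) *
      (iexp (\<Sum>r\<in>L. \<theta> r * Z r \<omega>) * iexp (\<xi> * (Z t \<omega> - Z s \<omega>))))"
    unfolding 1 2 by (simp only: mult_ac)
  also have "\<dots> = (iexp d * exp (complex_of_real (t - s) * (\<i> * complex_of_real (b * \<xi>)))) *
      ((CLINT \<omega>|M. iexp (\<Sum>r\<in>L. \<theta> r * Z r \<omega>)) * exp (complex_of_real (t - s) * \<kappa> \<xi>))"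
    using assms[unfolded indep_increments_def, rule_format, OF st L, of \<theta> \<xi>]
    by (simp only: Bochner_Integration.integral_mult_right_zero)
  also have "\<dots> = (iexp d * (CLINT \<omega>|M. iexp (\<Sum>r\<in>L. \<theta> r * Z r \<omega>))) *
      exp (complex_of_real (t - s) * (\<kappa> \<xi> + \<i> * complex_of_real (b * \<xi>)))"
    by (simp only: distrib_left exp_add mult_ac)
  also have "iexp d * (CLINT \<omega>|M. iexp (\<Sum>r\<in>L. \<theta> r * Z r \<omega>)) = (CLINT \<omega>|M. iexp (\<Sum>r\<in>L. \<theta> r * (Z r \<omega> + b * max 0 r)))"
    unfolding 1 by (simp only: Bochner_Integration.integral_mult_right_zero)
  finally show "(CLINT \<omega>|M. iexp (\<Sum>r\<in>L. \<theta> r * (Z r \<omega> + b * max 0 r)) *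
      iexp (\<xi> * ((Z t \<omega> + b * max 0 t) - (Z s \<omega> + b * max 0 s)))) =
    (CLINT \<omega>|M. iexp (\<Sum>r\<in>L. \<theta> r * (Z r \<omega> + b * max 0 r))) *
      exp (complex_of_real (t - s) * (\<kappa> \<xi> + \<i> * complex_of_real (b * \<xi>)))" .
qed

lemma indep_increments_limit:
  assumes ii: "\<And>n. indep_increments (Zn n) (\<kappa>n n)"
    and m: "\<And>n t. Zn n t \<in> borel_measurable M" "\<And>t. Z t \<in> borel_measurable M"
    and lim: "AE \<omega> in M. \<forall>t\<ge>0. (\<lambda>n. Zn n t \<omega>) \<longlonglongrightarrow> Z t \<omega>" "\<And>\<xi>. (\<lambda>n. \<kappa>n n \<xi>) \<longlonglongrightarrow> \<kappa> \<xi>"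
  shows "indep_increments Z \<kappa>"
  unfolding indep_increments_def
proof (intro allI impI)
  fix s t \<xi> :: real and L :: "real set" and \<theta> :: "real \<Rightarrow> real"
  assume st: "0 \<le> s" "s \<le> t" and L: "finite L" "L \<subseteq> {0..s}"
  note [measurable] = m
  have 1: "(\<lambda>n. CLINT \<omega>|M. iexp (\<Sum>r\<in>L. \<theta> r * Zn n r \<omega>)) \<longlonglongrightarrow> (CLINT \<omega>|M. iexp (\<Sum>r\<in>L. \<theta> r * Z r \<omega>))"
  proof (rule integral_dominated_convergence[where w="\<lambda>_. 1"])
    show "AE \<omega> in M. (\<lambda>n. iexp (\<Sum>r\<in>L. \<theta> r * Zn n r \<omega>)) \<longlonglongrightarrow> iexp (\<Sum>r\<in>L. \<theta> r * Z r \<omega>)"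
      using lim(1) by eventually_elim (use L in \<open>auto intro!: tendsto_intros\<close>)
  qed auto
  have 2: "(\<lambda>n. CLINT \<omega>|M. iexp (\<Sum>r\<in>L. \<theta> r * Zn n r \<omega>) * iexp (\<xi> * (Zn n t \<omega> - Zn n s \<omega>))) \<longlonglongrightarrow>
    (CLINT \<omega>|M. iexp (\<Sum>r\<in>L. \<theta> r * Z r \<omega>) * iexp (\<xi> * (Z t \<omega> - Z s \<omega>)))"
  proof (rule integral_dominated_convergence[where w="\<lambda>_. 1"])
    show "AE \<omega> in M. (\<lambda>n. iexp (\<Sum>r\<in>L. \<theta> r * Zn n r \<omega>) * iexp (\<xi> * (Zn n t \<omega> - Zn n s \<omega>))) \<longlonglongrightarrow>
      iexp (\<Sum>r\<in>L. \<theta> r * Z r \<omega>) * iexp (\<xi> * (Z t \<omega> - Z s \<omega>))"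
      using lim(1) by eventually_elim (use L st in \<open>auto intro!: tendsto_intros\<close>)
  qed (auto simp: norm_mult)
  have 3: "(\<lambda>n. (CLINT \<omega>|M. iexp (\<Sum>r\<in>L. \<theta> r * Zn n r \<omega>)) * exp (complex_of_real (t - s) * \<kappa>n n \<xi>)) \<longlonglongrightarrow>
    (CLINT \<omega>|M. iexp (\<Sum>r\<in>L. \<theta> r * Z r \<omega>)) * exp (complex_of_real (t - s) * \<kappa> \<xi>)"
    by (intro tendsto_intros 1 lim(2))
  show "(CLINT \<omega>|M. iexp (\<Sum>r\<in>L. \<theta> r * Z r \<omega>) * iexp (\<xi> * (Z t \<omega> - Z s \<omega>))) =
    (CLINT \<omega>|M. iexp (\<Sum>r\<in>L. \<theta> r * Z r \<omega>)) * exp (complex_of_real (t - s) * \<kappa> \<xi>)"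
    by (rule LIMSEQ_unique[OF 2]) (use 3 ii[unfolded indep_increments_def, rule_format, OF st L] in simp)
qed

end

section \<open>The compensated integrand and the sum over annuli\<close>

text \<open>Minus the integrand of \<open>levy_exponent_nogauss\<close>, the sign in which exponents
  of independent jump processes add up.\<close>

definition levy_fun :: "real \<Rightarrow> real \<Rightarrow> complex" where
  "levy_fun \<xi> z = iexp (\<xi> * z) - 1 - \<i> * complex_of_real (\<xi> * (if \<bar>z\<bar> < 1 then z else 0))"

lemma levy_fun_measurable [measurable]: "(\<lambda>z. levy_fun \<xi> z) \<in> borel_measurable borel"
  unfolding levy_fun_def by measurable

lemma Re_levy_fun: "Re (levy_fun \<xi> z) \<le> 0"
  by (simp add: levy_fun_def Re_exp)

lemma levy_fun_le_quadratic:
  assumes "\<bar>z\<bar> < 1"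
  shows "cmod (levy_fun \<xi> z) \<le> \<xi>\<^sup>2 / 2 * z\<^sup>2"
  using iexp_diff_linear_le[of "\<xi> * z" 0] assms by (simp add: levy_fun_def power_mult_distrib)

text \<open>Second-order Taylor bound for small \<open>z\<close>, the trivial bound 2 for large
  \<open>z\<close>. It gives integrability and a dominating function that is locally uniform in
  \<open>\<xi>\<close>.\<close>

lemma levy_fun_le: "cmod (levy_fun \<xi> z) \<le> (2 + \<xi>\<^sup>2) * min 1 (z\<^sup>2)"
proof (cases "\<bar>z\<bar> < 1")
  case True
  then have "z\<^sup>2 \<le> 1" by (simp add: abs_square_le_1)
  then have m: "min 1 (z\<^sup>2) = z\<^sup>2" by simp
  have "\<xi>\<^sup>2 / 2 * z\<^sup>2 \<le> (2 + \<xi>\<^sup>2) * z\<^sup>2" by (intro mult_right_mono) auto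
  with levy_fun_le_quadratic[OF True, of \<xi>] show ?thesis unfolding m by linarith
next
  case False
  then have "1 \<le> z\<^sup>2" by (simp add: abs_square_less_1 not_less[symmetric] del: not_less)
  then have m: "min 1 (z\<^sup>2) = 1" by simp
  have "cmod (levy_fun \<xi> z) \<le> 2"
    using norm_triangle_ineq4[of "iexp (\<xi> * z)" 1] False by (simp add: levy_fun_def)
  moreover have "0 \<le> \<xi>\<^sup>2" by simp
  ultimately show ?thesis unfolding m mult_1_right by linarith
qed

context
  fixes \<nu> :: "real measure"
  assumes levy: "levy_measure \<nu>"
begin

lemma levy_sets [measurable_cong]: "sets \<nu> = sets borel"
  using levy by (simp add: levy_measure_def)

lemma integrable_min_square: "integrable \<nu> (\<lambda>z. min 1 (z\<^sup>2))"
  using levy by (intro integrableI_nonneg) (auto simp: levy_measure_def)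

lemma integrable_levy_fun: "integrable \<nu> (levy_fun \<xi>)"
  by (rule Bochner_Integration.integrable_bound[OF integrable_mult_right[OF integrable_min_square, of "2 + \<xi>\<^sup>2"]])
     (auto intro!: AE_I2 order_trans[OF levy_fun_le])

lemma levy_exponent_eq:
  "levy_exponent_nogauss c \<nu> \<xi> = \<i> * complex_of_real (c * \<xi>) - (CLINT z|\<nu>. levy_fun \<xi> z)"
proof -
  have "(\<integral> z. (1 - exp (\<i> * complex_of_real (\<xi> * z)) + (if \<bar>z\<bar> < 1 then \<i> * complex_of_real (\<xi> * z) else 0)) \<partial>\<nu>) =
    (CLINT z|\<nu>. - levy_fun \<xi> z)"
    by (intro Bochner_Integration.integral_cong refl) (simp add: levy_fun_def)
  then show ?thesis by (simp add: levy_exponent_nogauss_def)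
qed

lemma continuous_levy_exponent: "continuous_on UNIV (levy_exponent_nogauss c \<nu>)"
proof -
  have "continuous_on UNIV (\<lambda>\<xi>. CLINT z|\<nu>. levy_fun \<xi> z)"
  proof (rule continuous_on_sequentiallyI)
    fix u a assume u: "u \<longlonglongrightarrow> (a :: real)"
    from convergent_imp_Bseq[OF convergentI[OF u]] obtain B where B: "\<And>n. \<bar>u n\<bar> \<le> B"
      unfolding Bseq_def by auto
    show "(\<lambda>n. CLINT z|\<nu>. levy_fun (u n) z) \<longlonglongrightarrow> (CLINT z|\<nu>. levy_fun a z)"
    proof (rule integral_dominated_convergence[where w="\<lambda>z. (2 + B\<^sup>2) * min 1 (z\<^sup>2)"])
      show "integrable \<nu> (\<lambda>z. (2 + B\<^sup>2) * min 1 (z\<^sup>2))" by (intro integrable_mult_right integrable_min_square)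
      show "AE z in \<nu>. (\<lambda>n. levy_fun (u n) z) \<longlonglongrightarrow> levy_fun a z"
        unfolding levy_fun_def by (intro AE_I2 tendsto_intros u)
      show "AE z in \<nu>. cmod (levy_fun (u n) z) \<le> (2 + B\<^sup>2) * min 1 (z\<^sup>2)" for n
      proof (intro AE_I2)
        fix z :: real
        have "(u n)\<^sup>2 \<le> B\<^sup>2" using B[of n] by (metis abs_le_square_iff abs_of_nonneg abs_ge_zero order_trans)
        then have "(2 + (u n)\<^sup>2) * min 1 (z\<^sup>2) \<le> (2 + B\<^sup>2) * min 1 (z\<^sup>2)" by (intro mult_right_mono) auto
        with levy_fun_le show "cmod (levy_fun (u n) z) \<le> (2 + B\<^sup>2) * min 1 (z\<^sup>2)" by (rule order_trans)
      qed
    qed measurable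
  qed
  then show ?thesis unfolding levy_exponent_eq[abs_def] by (intro continuous_intros)
qed

end

text \<open>The rate \<open>(1 / 8) ^ i\<close> is chosen for the maximal inequality at threshold
  \<open>(1 / 2) ^ i\<close>: divided by the squared threshold it leaves \<open>(1 / 2) ^ i\<close>,
  summable even against a time horizon \<open>i\<close>. Jumps of size at least 1 all fall into
  \<open>E 0\<close>, whose single level is not subject to the estimate.\<close>

locale levy_field = poisson_field +
  fixes B :: real
  assumes levy: "levy_measure \<nu>" and E_disj: "disjoint_family E" and E_cover: "(\<Union>i. E i) = - {0}"
    and E_Suc: "\<And>i. E (Suc i) \<subseteq> {z. \<bar>z\<bar> < 1}"
    and E_small: "\<And>i. (LINT z|\<nu>. indicator (E (Suc i)) z * min 1 (z\<^sup>2)) \<le> B * (1 / 8) ^ i"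
begin

definition small_drift :: "nat \<Rightarrow> real" where
  "small_drift i = (LINT z|size_cell i. (if \<bar>z\<bar> < 1 then z else 0))"

definition level_exponent :: "nat \<Rightarrow> real \<Rightarrow> complex" where
  "level_exponent i \<xi> = (CLINT z|\<nu>. indicator (E i) z *\<^sub>R levy_fun \<xi> z)"

definition level :: "nat \<Rightarrow> real \<Rightarrow> 'a \<Rightarrow> real" where
  "level i t \<omega> = jump_process i t \<omega> + (- small_drift i) * max 0 t"

lemma E_nu [measurable]: "E i \<in> sets \<nu>" "E i \<in> sets borel"
  using E_sets sets_nu by auto

lemma jump_exponent_compensated:
  "jump_exponent i \<xi> + \<i> * complex_of_real ((- small_drift i) * \<xi>) = level_exponent i \<xi>"
proof -
  interpret B: finite_measure "size_cell i" by (rule size_cell_fin)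
  have 1: "integrable (size_cell i) (\<lambda>z. iexp (\<xi> * z) - 1)"
  proof (rule B.integrable_const_bound[where B=2])
    show "AE z in size_cell i. cmod (iexp (\<xi> * z) - 1) \<le> 2"
      using norm_triangle_ineq4[of "iexp (\<xi> * z)" 1 for z] by (intro AE_I2) (metis norm_exp_i_times norm_one one_add_one)
    show "(\<lambda>z. iexp (\<xi> * z) - 1) \<in> borel_measurable (size_cell i)"
      unfolding measurable_cong_sets[OF sets_cells(2) refl] by measurable
  qed
  have 2: "integrable (size_cell i) (\<lambda>z::real. if \<bar>z\<bar> < 1 then z else 0)"
  proof (rule B.integrable_const_bound[where B=1])
    show "(\<lambda>z::real. if \<bar>z\<bar> < 1 then z else 0) \<in> borel_measurable (size_cell i)"
      unfolding measurable_cong_sets[OF sets_cells(2) refl] by measurable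
  qed auto
  have "(CLINT z|size_cell i. levy_fun \<xi> z) =
    (CLINT z|size_cell i. (iexp (\<xi> * z) - 1) + (\<i> * complex_of_real (- \<xi>)) * complex_of_real (if \<bar>z\<bar> < 1 then z else 0))"
    by (intro Bochner_Integration.integral_cong refl) (simp add: levy_fun_def)
  also have "\<dots> = jump_exponent i \<xi> + (\<i> * complex_of_real (- \<xi>)) * complex_of_real (small_drift i)"
    unfolding jump_exponent_def small_drift_def
    by (subst Bochner_Integration.integral_add[OF 1])
       (use 2 in \<open>auto simp only: integral_mult_right_zero integral_complex_of_real integrable_mult_right integrable_of_real\<close>)
  finally have "jump_exponent i \<xi> + \<i> * complex_of_real ((- small_drift i) * \<xi>) = (CLINT z|size_cell i. levy_fun \<xi> z)"
    by (simp add: mult_ac)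
  also have "\<dots> = (CLINT z|density \<nu> (\<lambda>z. ennreal (indicator (E i) z)). levy_fun \<xi> z)"
    by (simp add: size_cell_def ennreal_indicator)
  also have "\<dots> = level_exponent i \<xi>"
    unfolding level_exponent_def by (rule integral_density) (auto simp: measurable_cong_sets[OF sets_nu refl])
  finally show ?thesis .
qed

lemma level_measurable [measurable]: "level i t \<in> borel_measurable M"
  unfolding level_def[abs_def] by measurable

lemma level_nonpos: "t \<le> 0 \<Longrightarrow> level i t \<omega> = 0"
  by (simp add: level_def jump_process_nonpos)

text \<open>Stated for finite sets of levels because two kinds are used: a single level in the
  maximal inequality, and initial segments for the limit process.\<close>

lemma level_increments:
  assumes "finite I"
  shows "indep_increments (\<lambda>t \<omega>. \<Sum>i\<in>I. level i t \<omega>) (\<lambda>\<xi>. \<Sum>i\<in>I. level_exponent i \<xi>)"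
proof -
  have "(\<lambda>t \<omega>. (\<Sum>i\<in>I. jump_process i t \<omega>) + (\<Sum>i\<in>I. - small_drift i) * max 0 t) = (\<lambda>t \<omega>. \<Sum>i\<in>I. level i t \<omega>)"
    by (simp only: level_def sum.distrib sum_distrib_right)
  moreover have "(\<lambda>\<xi>. (\<Sum>i\<in>I. jump_exponent i \<xi>) + \<i> * complex_of_real ((\<Sum>i\<in>I. - small_drift i) * \<xi>)) = (\<lambda>\<xi>. \<Sum>i\<in>I. level_exponent i \<xi>)"
    by (simp only: jump_exponent_compensated[symmetric] sum.distrib sum_distrib_right sum_distrib_left of_real_sum)
  ultimately show ?thesis using indep_increments_drift[OF jump_increments[OF assms], of "\<Sum>i\<in>I. - small_drift i"] by simp
qed

lemma level_exponent_measurable: "level_exponent i \<in> borel_measurable borel"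
proof -
  interpret B: finite_measure "size_cell i" by (rule size_cell_fin)
  have "(\<lambda>\<xi>. jump_exponent i \<xi>) \<in> borel_measurable borel"
    unfolding jump_exponent_def
  proof (rule B.borel_measurable_lebesgue_integral)
    show "(\<lambda>(\<xi>, z). iexp (\<xi> * z) - 1) \<in> borel_measurable (borel \<Otimes>\<^sub>M size_cell i)"
      unfolding measurable_cong_sets[OF sets_pair_measure_cong[OF refl sets_cells(2)] refl] by measurable
  qed
  then show ?thesis unfolding jump_exponent_compensated[symmetric, abs_def] by measurable
qed

lemma integrable_level: "integrable \<nu> (\<lambda>z. indicator (E i) z *\<^sub>R levy_fun \<xi> z)"
  by (intro integrable_mult_indicator integrable_levy_fun levy E_nu)

lemma Re_level_exponent: "Re (level_exponent i \<xi>) \<le> 0"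
proof -
  have "Re (level_exponent i \<xi>) = (LINT z|\<nu>. Re (indicator (E i) z *\<^sub>R levy_fun \<xi> z))"
    unfolding level_exponent_def by (rule integral_Re[OF integrable_level, symmetric])
  also have "\<dots> = - (LINT z|\<nu>. - Re (indicator (E i) z *\<^sub>R levy_fun \<xi> z))" by simp
  also have "\<dots> \<le> 0"
    unfolding neg_le_0_iff_le by (rule Bochner_Integration.integral_nonneg) (auto simp: indicator_def Re_levy_fun)
  finally show ?thesis .
qed

lemma level_exponent_le: "cmod (level_exponent (Suc i) \<xi>) \<le> B * (1 / 8) ^ i * \<xi>\<^sup>2"
proof -
  have I: "integrable \<nu> (\<lambda>z. indicator (E (Suc i)) z * min 1 (z\<^sup>2))"
    using integrable_mult_indicator[OF E_nu(1) integrable_min_square[OF levy], of "Suc i"] by simp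
  have "cmod (level_exponent (Suc i) \<xi>) \<le> (LINT z|\<nu>. \<xi>\<^sup>2 * (indicator (E (Suc i)) z * min 1 (z\<^sup>2)))"
    unfolding level_exponent_def
  proof (rule Bochner_Integration.integral_norm_bound_integral[OF integrable_level])
    show "integrable \<nu> (\<lambda>z. \<xi>\<^sup>2 * (indicator (E (Suc i)) z * min 1 (z\<^sup>2)))" using I by simp
    fix z
    show "cmod (indicator (E (Suc i)) z *\<^sub>R levy_fun \<xi> z) \<le> \<xi>\<^sup>2 * (indicator (E (Suc i)) z * min 1 (z\<^sup>2))"
    proof (cases "z \<in> E (Suc i)")
      case True
      then have z: "\<bar>z\<bar> < 1" using E_Suc by auto
      then have "min 1 (z\<^sup>2) = z\<^sup>2" by (simp add: abs_square_le_1 min_absorb2)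
      moreover have "\<xi>\<^sup>2 / 2 * z\<^sup>2 \<le> \<xi>\<^sup>2 * z\<^sup>2" by (intro mult_right_mono) auto
      with levy_fun_le_quadratic[OF z, of \<xi>] have "cmod (levy_fun \<xi> z) \<le> \<xi>\<^sup>2 * z\<^sup>2" by (rule order_trans)
      ultimately show ?thesis using True by simp
    qed simp
  qed
  also have "\<dots> = \<xi>\<^sup>2 * (LINT z|\<nu>. indicator (E (Suc i)) z * min 1 (z\<^sup>2))" by (rule integral_mult_right_zero)
  also have "\<dots> \<le> \<xi>\<^sup>2 * (B * (1 / 8) ^ i)" by (intro mult_left_mono E_small) auto
  finally show ?thesis by (simp add: mult_ac)
qed

lemma B_nonneg: "0 \<le> B"
proof -
  have "0 \<le> (LINT z|\<nu>. indicator (E (Suc 0)) z * min 1 (z\<^sup>2))" by (intro Bochner_Integration.integral_nonneg) auto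
  also note E_small[of 0]
  finally show ?thesis by simp
qed

text \<open>By disjointness the partial sums are integrals over finite unions of annuli. These
  exhaust everything except 0, where \<open>levy_fun\<close> vanishes, and
  \<open>levy_fun_le\<close> dominates.\<close>

lemma level_exponent_sums: "(\<lambda>n. \<Sum>i<n. level_exponent i \<xi>) \<longlonglongrightarrow> (CLINT z|\<nu>. levy_fun \<xi> z)"
proof -
  have eq: "(\<Sum>i<n. indicator (E i) z *\<^sub>R levy_fun \<xi> z) = indicator (\<Union>i<n. E i) z *\<^sub>R levy_fun \<xi> z" for n z
  proof -
    have "disjoint_family_on E {..<n}" using E_disj by (auto simp: disjoint_family_on_def)
    then have "indicat_real (\<Union>i<n. E i) z = (\<Sum>i<n. indicator (E i) z)" by (intro indicator_UN_disjoint) auto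
    then show ?thesis by (simp only: scaleR_sum_left)
  qed
  have "(\<lambda>n. CLINT z|\<nu>. (\<Sum>i<n. indicator (E i) z *\<^sub>R levy_fun \<xi> z)) \<longlonglongrightarrow> (CLINT z|\<nu>. levy_fun \<xi> z)"
  proof (rule integral_dominated_convergence[where w="\<lambda>z. (2 + \<xi>\<^sup>2) * min 1 (z\<^sup>2)"])
    show "integrable \<nu> (\<lambda>z. (2 + \<xi>\<^sup>2) * min 1 (z\<^sup>2))" by (intro integrable_mult_right integrable_min_square levy)
    show "AE z in \<nu>. (\<lambda>n. \<Sum>i<n. indicator (E i) z *\<^sub>R levy_fun \<xi> z) \<longlonglongrightarrow> levy_fun \<xi> z"
    proof (intro AE_I2)
      fix z
      show "(\<lambda>n. \<Sum>i<n. indicator (E i) z *\<^sub>R levy_fun \<xi> z) \<longlonglongrightarrow> levy_fun \<xi> z"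
      proof (cases "z = 0")
        case True then show ?thesis by (simp add: levy_fun_def)
      next
        case False
        then obtain i where i: "z \<in> E i" using E_cover by auto
        then have "\<forall>\<^sub>F n in sequentially. (\<Sum>i<n. indicator (E i) z *\<^sub>R levy_fun \<xi> z) = levy_fun \<xi> z"
          unfolding eq by (intro eventually_sequentiallyI[of "Suc i"]) (auto simp: indicator_def)
        then show ?thesis by (rule tendsto_eventually)
      qed
    qed
    show "AE z in \<nu>. cmod (\<Sum>i<n. indicator (E i) z *\<^sub>R levy_fun \<xi> z) \<le> (2 + \<xi>\<^sup>2) * min 1 (z\<^sup>2)" for n
      unfolding eq using levy_fun_le[of \<xi>] by (intro AE_I2) (auto simp: indicator_def)
  qed (auto simp: measurable_cong_sets[OF sets_nu refl])
  then show ?thesis unfolding level_exponent_def by (subst (asm) Bochner_Integration.integral_sum) (auto intro: integrable_level)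
qed

text \<open>Rational times keep the event a countable union; right continuity recovers the remaining
  times. The horizon \<open>real i\<close> grows with the level, so one Borel-Cantelli argument
  settles every bounded interval.\<close>

definition bad :: "nat \<Rightarrow> 'a set" where
  "bad i = {\<omega> \<in> space M. \<exists>t\<in>\<rat> \<inter> {0..real i}. 2 * (1 / 2) ^ i \<le> \<bar>level (Suc i) t \<omega>\<bar>}"

definition good :: "'a set" where
  "good = {\<omega> \<in> space M. \<forall>\<^sub>F i in sequentially. \<omega> \<notin> bad i}"

lemma bad_sets [measurable]: "bad i \<in> sets M"
proof -
  have "countable (\<rat> \<inter> {0..real i})" by (intro countable_Int1 countable_rat)
  then have "bad i = (\<Union>t\<in>\<rat> \<inter> {0..real i}. {\<omega> \<in> space M. 2 * (1 / 2) ^ i \<le> \<bar>level (Suc i) t \<omega>\<bar>})"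
    by (auto simp: bad_def)
  also have "\<dots> \<in> sets M"
    using \<open>countable (\<rat> \<inter> {0..real i})\<close> by (intro sets.countable_UN') auto
  finally show ?thesis .
qed

lemma good_sets [measurable]: "good \<in> sets M"
  unfolding good_def eventually_sequentially by measurable

lemma AE_good: "AE \<omega> in M. \<omega> \<in> good"
proof -
  have le: "measure M (bad i) \<le> 8 * B * (real (Suc i) * (1 / 2) ^ i)" for i
  proof -
    have "measure M (bad i) \<le> 8 * (B * (1 / 8) ^ i) * real i / ((1 / 2) ^ i)\<^sup>2"
      unfolding bad_def
    proof (rule ottaviani_countable)
      show "indep_increments (level (Suc i)) (level_exponent (Suc i))"
        using level_increments[of "{Suc i}"] by simp
      show "level (Suc i) 0 \<omega> = 0" for \<omega> by (rule level_nonpos) simp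
      show "countable (\<rat> \<inter> {0..real i})" by (intro countable_Int1 countable_rat)
      show "0 \<le> B * (1 / 8) ^ i" using B_nonneg by simp
    qed (auto intro: level_exponent_measurable Re_level_exponent level_exponent_le)
    also have "\<dots> = 8 * B * (real i * (1 / 2) ^ i)"
    proof -
      have "((1 / 8) ^ i :: real) = (1 / 2) ^ i * ((1 / 2) ^ i)\<^sup>2"
      proof -
        have "(1 / 8 :: real) ^ i = ((1 / 2) ^ 3) ^ i" by (simp add: power3_eq_cube)
        also have "\<dots> = ((1 / 2) ^ i) ^ 3" by (simp only: power_mult[symmetric] mult.commute)
        finally show ?thesis by (simp only: power3_eq_cube power2_eq_square mult.assoc)
      qed
      then show ?thesis by (simp add: field_simps)
    qed
    \<comment> \<open>\<open>real i\<close> is raised to \<open>real (Suc i)\<close> to meet the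
      term of the differentiated geometric series.\<close>
    also have "\<dots> \<le> 8 * B * (real (Suc i) * (1 / 2) ^ i)" using B_nonneg by (intro mult_left_mono mult_right_mono) auto
    finally show ?thesis .
  qed
  have "summable (\<lambda>i. 8 * B * (real (Suc i) * (1 / 2) ^ i))"
    using geometric_deriv_sums[of "1 / 2 :: real"] by (intro summable_mult) (auto simp: sums_iff)
  then have "summable (\<lambda>i. measure M (bad i))"
    by (rule summable_comparison_test[rotated]) (use le in auto)
  then have "AE \<omega> in M. \<forall>\<^sub>F i in sequentially. \<omega> \<in> space M - bad i"
    by (intro borel_cantelli_AE1) (auto simp: emeasure_eq_measure)
  then show ?thesis using AE_space by eventually_elim (simp add: good_def)
qed

lemma level_right: "((\<lambda>t. level i t \<omega>) \<longlongrightarrow> level i t0 \<omega>) (at_right t0)"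
proof -
  have "((\<lambda>t. jump_process i t \<omega>) \<longlongrightarrow> jump_process i t0 \<omega>) (at_right t0)"
    by (rule tendsto_eventually[OF jump_process_eventually_right])
  then show ?thesis unfolding level_def by (intro tendsto_intros)
qed

lemma level_left: "\<exists>l. ((\<lambda>t. level i t \<omega>) \<longlongrightarrow> l) (at_left t0)"
proof -
  obtain l where "\<forall>\<^sub>F t in at_left t0. jump_process i t \<omega> = l" using jump_process_eventually_left by blast
  then have "((\<lambda>t. jump_process i t \<omega>) \<longlongrightarrow> l) (at_left t0)" by (rule tendsto_eventually)
  then have "((\<lambda>t. level i t \<omega>) \<longlongrightarrow> l + (- small_drift i) * max 0 t0) (at_left t0)"
    unfolding level_def by (intro tendsto_intros)
  then show ?thesis ..
qed

text \<open>A strict excess at \<open>t\<close> persists just to the right of \<open>t\<close> by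
  right continuity, hence occurs at a rational time. The assumption \<open>t < real i\<close> leaves
  room for that time within the horizon.\<close>

lemma level_bound_not_bad:
  assumes \<omega>: "\<omega> \<in> space M" "\<omega> \<notin> bad i" and t: "0 \<le> t" "t < real i"
  shows "\<bar>level (Suc i) t \<omega>\<bar> \<le> 2 * (1 / 2) ^ i"
proof (rule ccontr)
  assume "\<not> ?thesis"
  then have "2 * (1 / 2) ^ i < \<bar>level (Suc i) t \<omega>\<bar>" by simp
  then have "\<forall>\<^sub>F r in at_right t. 2 * (1 / 2) ^ i < \<bar>level (Suc i) r \<omega>\<bar>"
    by (rule order_tendstoD(1)[OF tendsto_rabs[OF level_right]])
  then obtain b where b: "t < b" "\<And>r. t < r \<Longrightarrow> r < b \<Longrightarrow> 2 * (1 / 2) ^ i < \<bar>level (Suc i) r \<omega>\<bar>"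
    unfolding eventually_at_right_field by auto
  obtain q where q: "q \<in> \<rat>" "t < q" "q < min b (real i)"
    using Rats_dense_in_real[of t "min b (real i)"] b(1) t by auto
  then have "\<omega> \<in> bad i" using b(2)[of q] \<omega>(1) t unfolding bad_def by (auto intro!: bexI[of _ q])
  with \<omega> show False by simp
qed

lemma level_bound:
  assumes "\<omega> \<in> good"
  shows "\<forall>\<^sub>F i in sequentially. \<forall>t\<le>T. \<bar>level i t \<omega>\<bar> \<le> 4 * (1 / 2) ^ i"
proof -
  have \<omega>: "\<omega> \<in> space M" and ev: "\<forall>\<^sub>F i in sequentially. \<omega> \<notin> bad i" using assms by (auto simp: good_def)
  have "\<forall>\<^sub>F i in sequentially. T < real i" using filterlim_real_sequentially by (simp add: filterlim_at_top_dense)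
  with ev have "\<forall>\<^sub>F i in sequentially. \<forall>t\<le>T. \<bar>level (Suc i) t \<omega>\<bar> \<le> 4 * (1 / 2) ^ (Suc i)"
  proof eventually_elim
    case (elim i)
    show ?case
    proof (intro allI impI)
      fix t assume "t \<le> T"
      show "\<bar>level (Suc i) t \<omega>\<bar> \<le> 4 * (1 / 2) ^ (Suc i)"
      proof (cases "0 \<le> t")
        case True
        then have "\<bar>level (Suc i) t \<omega>\<bar> \<le> 2 * (1 / 2) ^ i"
          using elim \<open>t \<le> T\<close> by (intro level_bound_not_bad[OF \<omega>]) auto
        then show ?thesis by simp
      qed (simp add: level_nonpos)
    qed
  qed
  then show ?thesis by (rule eventually_sequentially_Suc[THEN iffD1])
qed

lemma summable_bound: "summable (\<lambda>i. 4 * (1 / 2) ^ i :: real)"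
  by (intro summable_mult summable_geometric) simp

lemma level_summable: "\<omega> \<in> good \<Longrightarrow> summable (\<lambda>i. level i t \<omega>)"
  using level_bound[of \<omega> t]
  by (intro summable_comparison_test_ev[OF _ summable_bound]) (auto elim: eventually_mono)

text \<open>Tannery's theorem: on the good event all but finitely many levels obey one summable
  bound for all \<open>t \<le> T\<close>, so limit and sum may be exchanged. The filter is left
  general to serve both one-sided limits.\<close>

lemma level_sum_tendsto:
  assumes \<omega>: "\<omega> \<in> good" and lim: "\<And>i. ((\<lambda>t. level i t \<omega>) \<longlongrightarrow> l i) F"
    and F: "\<forall>\<^sub>F t in F. t \<le> T" "F \<noteq> bot"
  shows "((\<lambda>t. \<Sum>i. level i t \<omega>) \<longlongrightarrow> suminf l) F"
proof -
  have "\<forall>\<^sub>F (i, t) in sequentially \<times>\<^sub>F F. norm (level i t \<omega>) \<le> 4 * (1 / 2) ^ i"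
    unfolding eventually_prod_filter using level_bound[OF \<omega>, of T] F(1) by (intro exI conjI) auto
  from tannerys_theorem[OF lim this summable_bound F(2)] show ?thesis by simp
qed

text \<open>Set to 0 off the event \<open>good\<close> of full measure, so that every path, and not
  merely almost every one, is cadlag. The drift is \<open>- c\<close> because the exponent enters as
  \<open>exp (- t * \<psi> \<xi>)\<close> and contains the term \<open>\<i> * c * \<xi>\<close> with
  a plus sign.\<close>

definition levy_path :: "real \<Rightarrow> real \<Rightarrow> 'a \<Rightarrow> real" where
  "levy_path c t \<omega> = (if \<omega> \<in> good then (\<Sum>i. level i t \<omega>) + (- c) * max 0 t else 0)"

lemma levy_path_nonpos: "t \<le> 0 \<Longrightarrow> levy_path c t \<omega> = 0"
  by (simp add: levy_path_def level_nonpos)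

lemma levy_path_measurable [measurable]: "levy_path c t \<in> borel_measurable M"
  unfolding levy_path_def[abs_def] by measurable

lemma levy_path_right: "((\<lambda>t. levy_path c t \<omega>) \<longlongrightarrow> levy_path c t0 \<omega>) (at_right t0)"
proof (cases "\<omega> \<in> good")
  case True
  have "((\<lambda>t. \<Sum>i. level i t \<omega>) \<longlongrightarrow> (\<Sum>i. level i t0 \<omega>)) (at_right t0)"
    by (rule level_sum_tendsto[OF True level_right, where T="t0 + 1"])
       (auto intro!: eventually_at_rightI[of t0 "t0 + 1"])
  then show ?thesis unfolding levy_path_def using True by (auto intro!: tendsto_intros)
qed (simp add: levy_path_def)

lemma levy_path_left: "\<exists>l. ((\<lambda>t. levy_path c t \<omega>) \<longlongrightarrow> l) (at_left t0)"
proof (cases "\<omega> \<in> good")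
  case True
  have "\<forall>i. \<exists>l. ((\<lambda>t. level i t \<omega>) \<longlongrightarrow> l) (at_left t0)" by (intro allI level_left)
  from choice[OF this] obtain l where l: "\<And>i. ((\<lambda>t. level i t \<omega>) \<longlongrightarrow> l i) (at_left t0)" by auto
  have "((\<lambda>t. \<Sum>i. level i t \<omega>) \<longlongrightarrow> suminf l) (at_left t0)"
    by (rule level_sum_tendsto[OF True l, where T=t0])
       (auto simp: eventually_at_filter)
  then have "((\<lambda>t. levy_path c t \<omega>) \<longlongrightarrow> suminf l + (- c) * max 0 t0) (at_left t0)"
    unfolding levy_path_def using True by (auto intro!: tendsto_intros)
  then show ?thesis ..
qed (auto simp: levy_path_def)

lemma levy_path_increments: "indep_increments (levy_path c) (\<lambda>\<xi>. - levy_exponent_nogauss c \<nu> \<xi>)"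
proof (rule indep_increments_limit)
  show "indep_increments (\<lambda>t \<omega>. (\<Sum>i<n. level i t \<omega>) + (- c) * max 0 t)
    (\<lambda>\<xi>. (\<Sum>i<n. level_exponent i \<xi>) + \<i> * complex_of_real ((- c) * \<xi>))" for n
    by (intro indep_increments_drift level_increments) simp
  show "AE \<omega> in M. \<forall>t\<ge>0. (\<lambda>n. (\<Sum>i<n. level i t \<omega>) + (- c) * max 0 t) \<longlonglongrightarrow> levy_path c t \<omega>"
    using AE_good
  proof eventually_elim
    case (elim \<omega>)
    then show ?case unfolding levy_path_def using summable_LIMSEQ[OF level_summable[OF elim]] by (auto intro!: tendsto_intros)
  qed
  show "(\<lambda>n. (\<Sum>i<n. level_exponent i \<xi>) + \<i> * complex_of_real ((- c) * \<xi>)) \<longlonglongrightarrow> - levy_exponent_nogauss c \<nu> \<xi>" for \<xi>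
    using tendsto_add[OF level_exponent_sums[of \<xi>] tendsto_const[of "\<i> * complex_of_real ((- c) * \<xi>)"]]
    by (simp add: levy_exponent_eq[OF levy])
qed measurable

end

section \<open>Choice of the annuli\<close>

lemma levy_measure_away_from_zero:
  assumes \<nu>: "levy_measure \<nu>" and A: "A \<in> sets borel" "A \<subseteq> {z. r \<le> \<bar>z\<bar>}" and r: "0 < r"
  shows "emeasure \<nu> A < \<infinity>"
proof -
  note [measurable_cong] = levy_sets[OF \<nu>]
  have [measurable]: "A \<in> sets \<nu>" using A levy_sets[OF \<nu>] by simp
  define e where "e = min 1 (r\<^sup>2)"
  have e: "0 < e" using r by (simp add: e_def)
  have "ennreal e * emeasure \<nu> A = (\<integral>\<^sup>+ z. ennreal e * indicator A z \<partial>\<nu>)"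
    by (simp add: nn_integral_cmult)
  also have "\<dots> \<le> (\<integral>\<^sup>+ z. ennreal (min 1 (z\<^sup>2)) \<partial>\<nu>)"
  proof (rule nn_integral_mono)
    fix z
    show "ennreal e * indicator A z \<le> ennreal (min 1 (z\<^sup>2))"
    proof (cases "z \<in> A")
      case True
      then have "r \<le> \<bar>z\<bar>" using A by auto
      then have "r\<^sup>2 \<le> z\<^sup>2" using r by (intro abs_le_square_iff[THEN iffD1]) auto
      then show ?thesis using True by (auto simp: e_def intro!: ennreal_leI)
    qed simp
  qed
  also have "\<dots> < \<infinity>" using \<nu> by (simp add: levy_measure_def)
  finally show ?thesis using e by (auto simp: ennreal_mult_less_top)
qed

lemma levy_measure_near_zero:
  assumes \<nu>: "levy_measure \<nu>"
  shows "(\<lambda>n. LINT z|\<nu>. indicator {- (1 / (1 + real n))<..<1 / (1 + real n)} z * min 1 (z\<^sup>2)) \<longlonglongrightarrow> 0"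
proof -
  note [measurable_cong] = levy_sets[OF \<nu>]
  have "(\<lambda>n. LINT z|\<nu>. indicator {- (1 / (1 + real n))<..<1 / (1 + real n)} z * min 1 (z\<^sup>2)) \<longlonglongrightarrow> (LINT z|\<nu>. 0)"
  proof (rule integral_dominated_convergence[OF _ _ integrable_min_square[OF \<nu>]])
    show "AE z in \<nu>. (\<lambda>n. indicator {- (1 / (1 + real n))<..<1 / (1 + real n)} z * min 1 (z\<^sup>2)) \<longlonglongrightarrow> 0"
    proof (intro AE_I2)
      fix z
      show "(\<lambda>n. indicator {- (1 / (1 + real n))<..<1 / (1 + real n)} z * min 1 (z\<^sup>2)) \<longlonglongrightarrow> 0"
      proof (cases "z = 0")
        case False
        have "(\<lambda>n. 1 / (1 + real n)) \<longlonglongrightarrow> 0" by real_asymp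
        then have "\<forall>\<^sub>F n in sequentially. 1 / (1 + real n) < \<bar>z\<bar>" using False by (intro order_tendstoD) auto
        then have "\<forall>\<^sub>F n in sequentially. indicator {- (1 / (1 + real n))<..<1 / (1 + real n)} z * min 1 (z\<^sup>2) = 0"
          by eventually_elim (auto simp: indicator_def)
        then show ?thesis by (rule tendsto_eventually)
      qed simp
    qed
    show "AE z in \<nu>. norm (indicator {- (1 / (1 + real n))<..<1 / (1 + real n)} z * min 1 (z\<^sup>2)) \<le> min 1 (z\<^sup>2)" for n
      by (auto simp: indicator_def)
  qed (auto simp: measurable_cong_sets[OF levy_sets[OF \<nu>] refl])
  then show ?thesis by simp
qed

lemma levy_annuli:
  assumes \<nu>: "levy_measure \<nu>"
  shows "\<exists>(E :: nat \<Rightarrow> real set) B. jump_cells \<nu> E \<and> disjoint_family E \<and> (\<Union>i. E i) = - {0} \<and>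
    (\<forall>i. E (Suc i) \<subseteq> {z. \<bar>z\<bar> < 1}) \<and> (\<forall>i. (LINT z|\<nu>. indicator (E (Suc i)) z * min 1 (z\<^sup>2)) \<le> B * (1 / 8) ^ i)"
proof -
  note [measurable_cong] = levy_sets[OF \<nu>]
  define T where "T n = (LINT z|\<nu>. indicator {- (1 / (1 + real n))<..<1 / (1 + real n)} z * min 1 (z\<^sup>2))" for n
  have "\<exists>N. \<forall>n\<ge>N. T n \<le> (1 / 8) ^ i" for i :: nat
    using order_tendstoD(2)[OF levy_measure_near_zero[OF \<nu>], of "(1 / 8) ^ i"]
    unfolding T_def eventually_sequentially by (auto intro: less_imp_le)
  then obtain N where N: "\<And>i n. N i \<le> n \<Longrightarrow> T n \<le> (1 / 8) ^ i" using choice[of "\<lambda>i N. \<forall>n\<ge>N. T n \<le> (1 / 8) ^ i"] by auto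
  \<comment> \<open>The sum makes \<open>m\<close> monotone with \<open>N k \<le> m i\<close> for
    all \<open>k < i\<close>; the summand \<open>i\<close> forces the radii \<open>\<rho> i\<close>
    to tend to 0.\<close>
  define m where "m i = i + (\<Sum>k<i. N k)" for i
  define \<rho> where "\<rho> i = 1 / (1 + real (m i))" for i
  have \<rho>: "0 < \<rho> i" "\<rho> i \<le> 1" "\<rho> 0 = 1" for i by (simp_all add: \<rho>_def) (simp add: m_def)
  have mono: "\<rho> j \<le> \<rho> i" if "i \<le> j" for i j
  proof -
    have "m i \<le> m j" unfolding m_def using that by (intro add_mono sum_mono2) auto
    then show ?thesis unfolding \<rho>_def by (intro divide_left_mono) auto
  qed
  define E where "E i = (case i of 0 \<Rightarrow> {z. 1 \<le> \<bar>z\<bar>} | Suc j \<Rightarrow> {z. \<rho> (Suc j) \<le> \<bar>z\<bar> \<and> \<bar>z\<bar> < \<rho> j})" for i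
  have E0: "E 0 = {z. 1 \<le> \<bar>z\<bar>}" and ES: "E (Suc j) = {z. \<rho> (Suc j) \<le> \<bar>z\<bar> \<and> \<bar>z\<bar> < \<rho> j}" for j
    by (auto simp: E_def)
  have lower: "E i \<subseteq> {z. \<rho> i \<le> \<bar>z\<bar>}" for i by (cases i) (auto simp: E0 ES \<rho>)
  have Em: "E i \<in> sets borel" for i by (cases i) (simp_all add: E0 ES)
  have cells: "jump_cells \<nu> E"
    by standard (auto simp: levy_sets[OF \<nu>] Em intro: levy_measure_away_from_zero[OF \<nu> Em lower \<rho>(1), unfolded infinity_ennreal_def])
  have sep: "E i \<inter> E j = {}" if "i < j" for i j
  proof -
    from that obtain k where k: "j = Suc k" "i \<le> k" by (cases j) auto
    show ?thesis using lower[of i] mono[OF k(2)] by (auto simp: k(1) ES)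
  qed
  have disj: "disjoint_family E"
    unfolding disjoint_family_on_def using sep by (metis inf_commute nat_neq_iff)
  have cover: "(\<Union>i. E i) = - {0}"
  proof (intro equalityI subsetI)
    fix z :: real assume "z \<in> - {0}"
    then have z: "0 < \<bar>z\<bar>" by simp
    show "z \<in> (\<Union>i. E i)"
    proof (cases "1 \<le> \<bar>z\<bar>")
      case True then show ?thesis by (auto simp: E0 intro!: exI[of _ 0])
    next
      case False
      obtain n where n: "1 / \<bar>z\<bar> < real n" using reals_Archimedean2 by blast
      have "n \<le> m n" by (simp add: m_def)
      then have "\<rho> n \<le> 1 / (1 + real n)" unfolding \<rho>_def by (intro divide_left_mono) auto
      also have "\<dots> \<le> \<bar>z\<bar>" using n z by (simp add: field_simps)
      finally have ex: "\<rho> n \<le> \<bar>z\<bar>" .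
      define l where "l = (LEAST n. \<rho> n \<le> \<bar>z\<bar>)"
      have l: "\<rho> l \<le> \<bar>z\<bar>" unfolding l_def using ex by (rule LeastI)
      then obtain k where k: "l = Suc k" using False \<rho>(3) by (cases l) auto
      then have "\<not> \<rho> k \<le> \<bar>z\<bar>" using not_less_Least[of k "\<lambda>n. \<rho> n \<le> \<bar>z\<bar>"] l_def by simp
      then have "z \<in> E l" using l by (simp add: k ES)
      then show ?thesis by blast
    qed
  next
    fix z assume "z \<in> (\<Union>i. E i)"
    then obtain i where "\<rho> i \<le> \<bar>z\<bar>" using lower by blast
    then show "z \<in> - {0}" using \<rho>(1)[of i] by auto
  qed
  have sub1: "E (Suc i) \<subseteq> {z. \<bar>z\<bar> < 1}" for i using \<rho>(2)[of i] by (auto simp: ES)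
  have T0: "0 \<le> T 0" unfolding T_def by (intro Bochner_Integration.integral_nonneg) auto
  \<comment> \<open>\<open>m i\<close> dominates \<open>N j\<close> only for \<open>j < i\<close>,
    so the decay is that of the previous index, and the constant 8 makes up for the shift. The case
    \<open>i = 0\<close>, where \<open>m 0 = 0\<close>, is covered by the summand
    \<open>T 0\<close>.\<close>
  have small: "(LINT z|\<nu>. indicator (E (Suc i)) z * min 1 (z\<^sup>2)) \<le> (8 + T 0) * (1 / 8) ^ i" for i
  proof -
    have I: "integrable \<nu> (\<lambda>z. indicator A z * min 1 (z\<^sup>2))" if "A \<in> sets borel" for A
      using integrable_mult_indicator[of A \<nu>, OF _ integrable_min_square[OF \<nu>]] that levy_sets[OF \<nu>] by simp
    have "(LINT z|\<nu>. indicator (E (Suc i)) z * min 1 (z\<^sup>2)) \<le> T (m i)"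
      unfolding T_def by (intro integral_mono I Em) (auto simp: indicator_def ES \<rho>_def)
    also have "\<dots> \<le> (8 + T 0) * (1 / 8) ^ i"
    proof (cases i)
      case 0 then show ?thesis by (simp add: m_def)
    next
      case (Suc j)
      have "T (m i) \<le> (1 / 8) ^ j" by (rule N) (simp add: Suc m_def)
      also have "\<dots> = 8 * (1 / 8) ^ i" by (simp add: Suc)
      also have "\<dots> \<le> (8 + T 0) * (1 / 8) ^ i" using T0 by (intro mult_right_mono) auto
      finally show ?thesis .
    qed
    finally show ?thesis .
  qed
  show ?thesis using cells disj cover sub1 small by blast
qed

section \<open>Assembly of the driving process and of the solution\<close>

lemma (in jump_cells) ex_poisson_field:
  "\<exists>(M :: (real \<Rightarrow> real \<times> real) measure) W. poisson_field M \<nu> E W"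
proof -
  define law where "law p = (case snd p of 0 \<Rightarrow> count_law (measure (cell (fst p)) (space (cell (fst p)))) | Suc k \<Rightarrow> cell_law (cell (fst p)))"
    for p :: "(nat \<times> nat) \<times> nat"
  \<comment> \<open>Pairing functions flatten the index of a cell together with the number of the
    variable in it, since \<open>ex_independent_family\<close> is indexed by natural
    numbers.\<close>
  define dec where "dec n = (prod_decode (fst (prod_decode n)), snd (prod_decode n))" for n
  define enc where "enc p = prod_encode (prod_encode (fst p), snd p)" for p :: "(nat \<times> nat) \<times> nat"
  have dec_enc: "dec (enc p) = p" for p by (simp add: dec_def enc_def)
  have "prob_space (law p)" for p
  proof (cases "snd p")
    case 0
    then show ?thesis by (auto simp: law_def count_law_def intro!: measure_pmf.prob_space_distr)
  qed (simp add: law_def finite_cell.prob_space_cell_law[OF finite_cell])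
  moreover have "sets (law p) = sets borel" for p
    by (cases "snd p") (simp_all add: law_def count_law_def finite_cell.sets_cell_law[OF finite_cell])
  ultimately obtain M :: "(real \<Rightarrow> real \<times> real) measure" and V where M: "prob_space M"
    and ind: "prob_space.indep_vars M (\<lambda>_. borel) V UNIV" and dist: "\<And>i. distr M borel (V i) = law (dec i)"
    using ex_independent_family[of "\<lambda>i. law (dec i)"] by auto
  define W where "W c k = V (enc (c, k))" for c k
  interpret M: prob_space M by (rule M)
  have "inj enc" by (rule inj_on_inverseI[where g=dec]) (rule dec_enc)
  then have "M.indep_vars (\<lambda>_. borel) (\<lambda>p. V (enc p)) UNIV"
    using M.indep_vars_reindex_inj[OF ind, of enc UNIV] by simp
  then have "M.indep_vars (\<lambda>_. borel) (\<lambda>p. W (fst p) (snd p)) UNIV" by (simp add: W_def)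
  then have "poisson_field M \<nu> E W"
    by unfold_locales (auto simp: W_def dist dec_enc law_def)
  then show ?thesis by blast
qed

lemma ex_levy_path:
  assumes \<nu>: "levy_measure \<nu>"
  shows "\<exists>(M :: (real \<Rightarrow> real \<times> real) measure) S. prob_space M \<and> (\<forall>t. S t \<in> borel_measurable M) \<and>
    (\<forall>t \<omega>. t \<le> 0 \<longrightarrow> S t \<omega> = 0) \<and> (\<forall>\<omega> t. ((\<lambda>t. S t \<omega>) \<longlongrightarrow> S t \<omega>) (at_right t)) \<and>
    (\<forall>\<omega> t. \<exists>l. ((\<lambda>t. S t \<omega>) \<longlongrightarrow> l) (at_left t)) \<and>
    prob_space.indep_increments M S (\<lambda>\<xi>. - levy_exponent_nogauss c \<nu> \<xi>)"
proof -
  obtain E B where E: "jump_cells \<nu> E" "disjoint_family E" "(\<Union>i. E i) = - {0}" "\<And>i. E (Suc i) \<subseteq> {z. \<bar>z\<bar> < 1}"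
    "\<And>i. (LINT z|\<nu>. indicator (E (Suc i)) z * min 1 (z\<^sup>2)) \<le> B * (1 / 8) ^ i"
    using levy_annuli[OF \<nu>] by auto
  obtain M :: "(real \<Rightarrow> real \<times> real) measure" and W where W: "poisson_field M \<nu> E W"
    using jump_cells.ex_poisson_field[OF E(1)] by blast
  interpret W: poisson_field M \<nu> E W by (rule W)
  interpret L: levy_field M \<nu> E W B by unfold_locales (use \<nu> E in auto)
  show ?thesis
    by (intro exI[of _ M] exI[of _ "L.levy_path c"] conjI allI impI W.prob_space_axioms L.levy_path_measurable
      L.levy_path_nonpos L.levy_path_right L.levy_path_left L.levy_path_increments)
qed

theorem theorem3p1:
  fixes c :: real and \<nu> :: "real measure" and \<psi> :: "real \<Rightarrow> complex"
    and a :: "real \<Rightarrow> real \<Rightarrow> real" and K x0 :: real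
  assumes "levy_measure \<nu>"
    and "\<psi> = levy_exponent_nogauss c \<nu>"
    and "\<forall>\<^sub>F \<xi> in at_infinity. Re (\<psi> \<xi>) > 0"
    and "(\<lambda>\<xi>. 1 / Re (\<psi> \<xi>)) \<in> o[at_infinity](\<lambda>\<xi>. 1 / \<bar>\<xi>\<bar>)"
    and "(\<lambda>(t, x). a t x) \<in> borel_measurable (restrict_space borel ({0..} \<times> UNIV))"
    and "K > 0"
    and "\<forall>t\<ge>0. \<forall>x. \<bar>a t x\<bar> \<le> K"
  shows "\<exists>(M :: (real \<Rightarrow> real \<times> real) measure) F X S. weak_solution M F X S \<psi> a x0"
proof -
  from ex_levy_path[OF assms(1), of c, folded assms(2)]
  obtain P :: "(real \<Rightarrow> real \<times> real) measure" and S where P: "prob_space P" and Sm: "\<forall>t. S t \<in> borel_measurable P"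
    and S0: "\<forall>t \<omega>. t \<le> 0 \<longrightarrow> S t \<omega> = 0" and Sr: "\<forall>\<omega> t. ((\<lambda>t. S t \<omega>) \<longlongrightarrow> S t \<omega>) (at_right t)"
    and Sl: "\<forall>\<omega> t. \<exists>l. ((\<lambda>t. S t \<omega>) \<longlongrightarrow> l) (at_left t)"
    and ii: "prob_space.indep_increments P S (\<lambda>\<xi>. - \<psi> \<xi>)"
    by (elim exE conjE) (rule that; assumption)
  note Sm = Sm[rule_format] and S0 = S0[rule_format] and Sr = Sr[rule_format] and Sl = Sl[rule_format]
  interpret P: prob_space P by (rule P)
  define F where "F = P.natural_filtration S"
  have S_adapted: "S t \<in> borel_measurable (F t)" for t
  proof (cases "0 \<le> t")
    case True then show ?thesis unfolding F_def by (rule P.natural_filtration_adapted)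
  next
    case False
    then have "S t = (\<lambda>_. 0)" by (intro ext S0) auto
    then show ?thesis by simp
  qed
  have growth: "\<exists>\<rho>. \<forall>\<xi>. \<rho> \<le> \<bar>\<xi>\<bar> \<longrightarrow> N * \<bar>\<xi>\<bar> \<le> Re (\<psi> \<xi>)" for N
  proof -
    define N' where "N' = max 1 N"
    have "\<forall>\<^sub>F \<xi> in at_infinity. norm (1 / Re (\<psi> \<xi>)) \<le> (1 / N') * norm (1 / \<bar>\<xi>\<bar>)"
      using landau_o.smallD[OF assms(4), of "1 / N'"] by (simp add: N'_def)
    moreover have "\<forall>\<^sub>F \<xi>::real in at_infinity. 1 \<le> \<bar>\<xi>\<bar>"
      unfolding eventually_at_infinity by (intro exI[of _ 1]) auto
    \<comment> \<open>Positivity of \<open>Re (\<psi> \<xi>)\<close> enters here: with the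
      convention \<open>1 / 0 = 0\<close>, a bound on the reciprocal alone would not exclude zeros
      of \<open>Re (\<psi> \<xi>)\<close>.\<close>
    ultimately have "\<forall>\<^sub>F \<xi> in at_infinity. N * \<bar>\<xi>\<bar> \<le> Re (\<psi> \<xi>)"
      using assms(3)
    proof eventually_elim
      case (elim \<xi>)
      then have "N' * \<bar>\<xi>\<bar> \<le> Re (\<psi> \<xi>)" by (simp add: N'_def field_simps)
      moreover have "N * \<bar>\<xi>\<bar> \<le> N' * \<bar>\<xi>\<bar>" by (intro mult_right_mono) (auto simp: N'_def)
      ultimately show ?case by linarith
    qed
    then show ?thesis by (simp add: eventually_at_infinity)
  qed
  interpret D: smoothing_levy_driver P F S \<psi>
  proof (intro smoothing_levy_driver.intro smoothing_levy_driver_axioms.intro levy_driver.intro levy_driver_axioms.intro P)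
    show "filtration (space P) F"
      unfolding filtration_def F_def by (auto simp: P.natural_filtration_mono subset_eq dest: P.natural_filtration_mono)
    show "subalgebra P (F t)" for t unfolding F_def by (rule P.subalgebra_natural_filtration[OF Sm])
    show "continuous (at_right t) (\<lambda>t. S t \<omega>)" for t \<omega> unfolding continuous_within by (rule Sr)
    show "continuous_on UNIV \<psi>" unfolding assms(2) by (rule continuous_levy_exponent[OF assms(1)])
    show "(CLINT \<omega>|P. indicator A \<omega> * iexp (\<xi> * (S t \<omega> - S s \<omega>))) =
      complex_of_real (measure P A) * exp (- complex_of_real (t - s) * \<psi> \<xi>)"
      if "0 \<le> s" "s < t" "A \<in> sets (F s)" for s t \<xi> A
      using P.indep_increments_natural[OF ii Sm, of s t A \<xi>] that
      unfolding F_def by (simp only: mult_minus_left mult_minus_right less_imp_le)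
    show "\<exists>\<rho>. \<forall>\<xi>. \<rho> \<le> \<bar>\<xi>\<bar> \<longrightarrow> N * \<bar>\<xi>\<bar> \<le> Re (\<psi> \<xi>)" for N by (rule growth)
  qed (use S_adapted S0 in auto)
  \<comment> \<open>\<open>a\<close> is measurable and bounded for nonnegative times only. The
    extension by 0 provides a drift on the whole plane, as \<open>strong_solution\<close>
    expects.\<close>
  define a' where "a' t x = (if 0 \<le> t then a t x else 0)" for t x
  have a'm: "(\<lambda>z. a' (fst z) (snd z)) \<in> borel_measurable borel"
  proof -
    have "{0::real..} \<times> (UNIV :: real set) \<inter> space borel \<in> sets borel"
      by (auto intro!: borel_closed closed_Times)
    then have "(\<lambda>z. indicator ({0..} \<times> UNIV) z *\<^sub>R (\<lambda>(t, x). a t x) z) \<in> borel_measurable borel"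
      using assms(5) by (subst (asm) borel_measurable_restrict_space_iff) auto
    also have "(\<lambda>z. indicator ({0..} \<times> UNIV) z *\<^sub>R (\<lambda>(t, x). a t x) z) = (\<lambda>z. a' (fst z) (snd z))"
      by (auto simp: a'_def indicator_def)
    finally show ?thesis .
  qed
  have a'K: "\<bar>a' t x\<bar> \<le> K" for t x using assms(6,7) by (auto simp: a'_def)
  obtain X where X: "D.lipschitz_drifted K x0 X"
    and sol: "AE \<omega> in P. \<forall>t\<ge>0. X t \<omega> = x0 + S t \<omega> + (LINT s:{0..t}|lborel. a' s (X s \<omega>))"
    using D.strong_solution[OF a'm a'K assms(6), of x0] by blast
  have cadlag_S: "cadlag (\<lambda>t. S t \<omega>)" for \<omega>
    unfolding cadlag_def continuous_within using Sr Sl by auto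
  have cadlag_X: "cadlag (\<lambda>t. X t \<omega>)" if \<omega>: "\<omega> \<in> space P" for \<omega>
    unfolding cadlag_def
  proof (intro conjI allI impI)
    fix t :: real
    show "continuous (at_right t) (\<lambda>t. X t \<omega>)" by (rule D.lipschitz_drifted_right[OF X \<omega>])
    obtain l where "((\<lambda>t. S t \<omega>) \<longlongrightarrow> l) (at_left t)" using Sl by blast
    moreover have "((\<lambda>t. X t \<omega> - S t \<omega>) \<longlongrightarrow> X t \<omega> - S t \<omega>) (at_left t)"
      using continuous_at_imp_continuous_at_within[OF D.lipschitz_drifted_cont[OF X \<omega>]] unfolding continuous_within .
    ultimately have "((\<lambda>t. (X t \<omega> - S t \<omega>) + S t \<omega>) \<longlongrightarrow> (X t \<omega> - S t \<omega>) + l) (at_left t)" by (intro tendsto_add)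
    then show "\<exists>l. ((\<lambda>t. X t \<omega>) \<longlongrightarrow> l) (at_left t)" by auto
  qed
  \<comment> \<open>Only the measure is completed; the filtration remains the natural one. All
    integrands and events concerned are measurable before completion, so their integrals and
    measures do not change.\<close>
  have levy: "levy_process (completion P) F S \<psi>"
    unfolding levy_process_def
  proof (intro conjI allI impI ballI)
    show "prob_space (completion P)" by (rule P.prob_space_completion)
    show "complete_measure (completion P)" ..
    show "filtration (space (completion P)) F" using D.filt by simp
    show "subalgebra (completion P) (F t)" for t
      using D.subalg[of t] by (auto simp: subalgebra_def)
    show "continuous_on UNIV \<psi>" by (rule D.psi_cont)
    fix s t \<xi> A assume st: "0 \<le> s" "s < t" and A: "A \<in> sets (F s)"
    have AP[measurable]: "A \<in> sets P" using A D.subalg[of s] by (auto simp: subalgebra_def)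
    note [measurable] = Sm
    show "(\<integral>\<omega>. indicator A \<omega> * exp (\<i> * complex_of_real (\<xi> * (S t \<omega> - S s \<omega>))) \<partial>completion P) =
      complex_of_real (measure (completion P) A) * exp (- complex_of_real (t - s) * \<psi> \<xi>)"
      using D.S_incr[OF st A, of \<xi>] by (subst integral_completion) (simp_all add: AP)
  qed (use S_adapted S0 cadlag_S in auto)
  have "weak_solution (completion P) F X S \<psi> a x0"
    unfolding weak_solution_def
  proof (intro conjI allI impI ballI levy)
    show "X t \<in> borel_measurable (F t)" for t using X by (simp add: D.lipschitz_drifted_def)
    show "cadlag (\<lambda>t. X t \<omega>)" if "\<omega> \<in> space (completion P)" for \<omega> using that by (intro cadlag_X) simp
    show "AE \<omega> in completion P. \<forall>t\<ge>0. X t \<omega> = x0 + S t \<omega> + (LBINT s=0..t. a s (X s \<omega>))"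
    proof (rule AE_completion)
      \<comment> \<open>For \<open>t \<ge> 0\<close> the interval integral is the integral over
        \<open>{0..t}\<close>, and on that set \<open>a'\<close> agrees with
        \<open>a\<close>.\<close>
      have eq: "(LBINT s=0..t. a s (X s \<omega>)) = (LINT s:{0..t}|lborel. a' s (X s \<omega>))" if "0 \<le> t" for t \<omega>
        unfolding zero_ereal_def interval_integral_Icc[OF that]
        by (intro set_lebesgue_integral_cong) (auto simp: a'_def)
      show "AE \<omega> in P. \<forall>t\<ge>0. X t \<omega> = x0 + S t \<omega> + (LBINT s=0..t. a s (X s \<omega>))"
        using sol
      proof eventually_elim
        case (elim \<omega>)
        then show ?case by (intro allI impI) (simp only: eq)
      qed
    qed
  qed
  then show ?thesis by blast
qed

end
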